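(* Let $k=d\ge1$, $\alpha\in(0,1)$, and let $\pi:\Omega^d_{\alpha,0}\to C^{\alpha-1}(\mathbb R^d)$ be the bounded injective linear map given by $$\langle\pi A,\psi\rangle:=(-1)^d\int_{\mathbb R^d}A(\llbracket0,v\rrbracket)\,\partial_1\cdots\partial_d\psi(v)\,dv,\qquad\psi\in C_c^\infty(\mathbb R^d).$$ Then $\pi$ is surjective with bounded inverse.
   Context: Distances are Euclidean; $\mathrm{Vol}^{j}$ is $j$-dimensional Hausdorff measure. A $d$-simplex is the convex hull of affinely independent $v_0,\dots,v_d\in\mathbb R^d$; its boundary faces are the $(d-1)$-simplices spanned by $d$ of its vertices. An oriented $d$-simplex carries an ordering of its vertices modulo even permutations; $-\sigma$ has the opposite orientation. $\mathfrak X^d$ is the set of oriented $d$-simplices in $\mathbb R^d$, $\mathfrak X^d_{\le1}$ those with diameter $\le1$. A subdivision of $\sigma$ is a finite set of $d$-simplices oriented as $\sigma$, with pairwise intersections of measure zero, with union $\sigma$. Mass: $h_\sigma:=\min_F\max_{x\in\sigma}d(x,\langle F\rangle)$ (min over boundary faces $F$, $\langle F\rangle$ the affine hull), $\mathbf m^d_\alpha(\sigma):=\max_F\mathrm{Vol}^{d-1}(F)h_\sigma^\alpha$. $\Omega^d$: maps $A:\mathfrak X^d\to\mathbb R$ with $A(-\sigma)=-A(\sigma)$, additive under subdivisions, Borel measurable in the vertices. $\|A\|_\alpha:=\sup_{\sigma\in\mathfrak X^d_{\le1}}|A(\sigma)|/\mathbf m^d_\alpha(\sigma)$ and $\Omega^d_{\alpha,0}:=\{A\in\Omega^d:\|A\|_\alpha<\infty\}$,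 normed by $\|\cdot\|_\alpha$. $\llbracket0,v\rrbracket$ is the box $\{\sum_jt_jv_je_j:t_j\in[0,1]\}$ with the standard orientation of $\mathbb R^d$, counted with sign $\prod_j\mathrm{sign}(v_j)$; $A$ is evaluated on it by additivity after subdividing into simplices (value $0$ if degenerate). $C^{\alpha-1}(\mathbb R^d)$: distributions $F$ with finite norm $\sup_{x\in\mathbb R^d,\lambda\in(0,1],\varphi}\lambda^{1-\alpha}|\langle F,\varphi_x^\lambda\rangle|$, where $\varphi$ ranges over smooth functions supported in the unit ball with $\|\varphi\|_{C^1}\le1$ and $\varphi_x^\lambda=\lambda^{-d}\varphi((\cdot-x)/\lambda)$. *)

theory Defs
  imports "HOL-Analysis.Analysis" "HOL-Combinatorics.Combinatorics"
begin

subsection \<open>Hausdorff measure\<close>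

text \<open>Normalised so that \<^term>\<open>hausdorff_measure s\<close> agrees with Lebesgue measure on
  \<open>s\<close>-dimensional Euclidean space, and with counting measure for \<open>s = 0\<close>. The empty set is
  treated separately because \<open>0 ^ 0 = 1\<close>.\<close>

definition hausdorff_premeasure :: "nat \<Rightarrow> real \<Rightarrow> 'a::metric_space set \<Rightarrow> ennreal" where
  "hausdorff_premeasure s \<delta> S =
     (INF U \<in> {U :: nat \<Rightarrow> 'a set. (\<forall>i. bounded (U i) \<and> diameter (U i) \<le> \<delta>) \<and> S \<subseteq> (\<Union>i. U i)}.
        \<Sum>i. if U i = {} then 0
             else ennreal (unit_ball_vol (real s) / 2 ^ s * diameter (U i) ^ s))"

definition hausdorff_measure :: "nat \<Rightarrow> 'a::metric_space set \<Rightarrow> ennreal" where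
  "hausdorff_measure s S = (SUP \<delta>\<in>{0<..}. hausdorff_premeasure s \<delta> S)"


subsection \<open>Oriented simplices\<close>

text \<open>Space dimension is \<open>d = CARD('n)\<close>. An ordered \<open>(d+1)\<close>-tuple of points is indexed by
  \<^typ>\<open>'n option\<close>: \<^term>\<open>None\<close> is the index \<open>0\<close> and \<^term>\<open>Some j\<close> is the index of the
  coordinate \<open>j\<close>. An oriented simplex is the class of an affinely independent tuple
  under even permutations of the indices.\<close>

type_synonym 'n vertex_tuple = "(real, 'n) vec ^ ('n option)"
type_synonym 'n osimplex = "'n vertex_tuple set"

definition aff_indep_tuple :: "'n::finite vertex_tuple \<Rightarrow> bool" where
  "aff_indep_tuple v \<longleftrightarrow> inj (($) v) \<and> \<not> affine_dependent (range (($) v))"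

definition osimplex_of :: "'n::finite vertex_tuple \<Rightarrow> 'n osimplex" where
  "osimplex_of v = {\<chi> i. v $ p i | p. p permutes UNIV \<and> evenperm p}"

definition osimplices :: "'n::finite osimplex set" where
  "osimplices = osimplex_of ` {v. aff_indep_tuple v}"

definition opposite :: "'n::finite osimplex \<Rightarrow> 'n osimplex" where
  "opposite \<sigma> = {\<chi> i. v $ p i | v p. v \<in> \<sigma> \<and> p permutes UNIV \<and> \<not> evenperm p}"

definition vertices :: "'n::finite osimplex \<Rightarrow> (real^'n) set" where
  "vertices \<sigma> = (\<Union>v\<in>\<sigma>. range (($) v))"

definition body :: "'n::finite osimplex \<Rightarrow> (real^'n) set" where
  "body \<sigma> = convex hull (vertices \<sigma>)"

definition boundary_faces :: "'n::finite osimplex \<Rightarrow> (real^'n) set set" where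
  "boundary_faces \<sigma> = {convex hull (vertices \<sigma> - {a}) | a. a \<in> vertices \<sigma>}"

definition small_osimplices :: "'n::finite osimplex set" where
  "small_osimplices = {\<sigma> \<in> osimplices. diameter (body \<sigma>) \<le> 1}"

text \<open>The sign is \<open>1\<close> if \<open>(v\<^sub>1 - v\<^sub>0, \<dots>, v\<^sub>d - v\<^sub>0)\<close> is a positive basis for the
  standard orientation and \<open>-1\<close> if it is negative; the chosen representative is irrelevant, as even
  permutations of the vertices preserve the sign.\<close>

definition orientation_sign :: "'n::finite osimplex \<Rightarrow> real" where
  "orientation_sign \<sigma> =
     (let v = (SOME v. v \<in> \<sigma>) in sgn (det (\<chi> i. v $ Some i - v $ None)))"

text \<open>\<^term>\<open>subdivides T P s\<close>: the simplices in \<open>T\<close>, all of orientation \<open>s\<close>, subdivide the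
  region \<open>P\<close>.\<close>

definition subdivides :: "'n::finite osimplex set \<Rightarrow> (real^'n) set \<Rightarrow> real \<Rightarrow> bool" where
  "subdivides T P s \<longleftrightarrow>
     finite T \<and> T \<subseteq> osimplices \<and> (\<forall>\<tau>\<in>T. orientation_sign \<tau> = s) \<and>
     (\<forall>\<tau>\<in>T. \<forall>\<tau>'\<in>T. \<tau> \<noteq> \<tau>' \<longrightarrow> negligible (body \<tau> \<inter> body \<tau>')) \<and>
     (\<Union>\<tau>\<in>T. body \<tau>) = P"

definition subdivision :: "'n::finite osimplex set \<Rightarrow> 'n osimplex \<Rightarrow> bool" where
  "subdivision T \<sigma> \<longleftrightarrow> subdivides T (body \<sigma>) (orientation_sign \<sigma>)"


subsection \<open>Mass and the space of simplex functions\<close>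

definition height :: "'n::finite osimplex \<Rightarrow> real" where
  "height \<sigma> = Min ((\<lambda>F. SUP x\<in>body \<sigma>. infdist x (affine hull F)) ` boundary_faces \<sigma>)"

definition mass :: "real \<Rightarrow> 'n::finite osimplex \<Rightarrow> real" where
  "mass \<alpha> \<sigma> =
     Max ((\<lambda>F. enn2real (hausdorff_measure (CARD('n) - 1) F) * height \<sigma> powr \<alpha>) ` boundary_faces \<sigma>)"

text \<open>Functions on oriented simplices are total functions vanishing off \<^const>\<open>osimplices\<close>, so
  that equality of functions is equality on oriented simplices.\<close>

definition Omega :: "('n::finite osimplex \<Rightarrow> real) set" where
  "Omega = {A.
     (\<forall>\<sigma>. \<sigma> \<notin> osimplices \<longrightarrow> A \<sigma> = 0) \<and>
     (\<forall>\<sigma>\<in>osimplices. A (opposite \<sigma>) = - A \<sigma>) \<and>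
     (\<forall>\<sigma>\<in>osimplices. \<forall>T. subdivision T \<sigma> \<longrightarrow> A \<sigma> = (\<Sum>\<tau>\<in>T. A \<tau>)) \<and>
     (\<lambda>v. A (osimplex_of v)) \<in> borel_measurable (restrict_space borel {v. aff_indep_tuple v})}"

definition Omega_norm :: "real \<Rightarrow> ('n::finite osimplex \<Rightarrow> real) \<Rightarrow> ennreal" where
  "Omega_norm \<alpha> A = (SUP \<sigma>\<in>small_osimplices. ennreal (\<bar>A \<sigma>\<bar> / mass \<alpha> \<sigma>))"

definition Omega_alpha :: "real \<Rightarrow> ('n::finite osimplex \<Rightarrow> real) set" where
  "Omega_alpha \<alpha> = {A \<in> Omega. Omega_norm \<alpha> A < \<infinity>}"

definition origin_box :: "real^'n::finite \<Rightarrow> (real^'n) set" where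
  "origin_box v = {\<Sum>j\<in>UNIV. (t j * v $ j) *\<^sub>R axis j 1 | t. \<forall>j. t j \<in> {0..1}}"

text \<open>For \<open>A\<close> in \<^const>\<open>Omega\<close> the value does not depend on the chosen subdivision.\<close>

definition box_value :: "('n::finite osimplex \<Rightarrow> real) \<Rightarrow> real^'n \<Rightarrow> real" where
  "box_value A v =
     (if \<exists>j. v $ j = 0 then 0
      else (\<Prod>j\<in>UNIV. sgn (v $ j)) * (\<Sum>\<sigma>\<in>(SOME T. subdivides T (origin_box v) 1). A \<sigma>))"


subsection \<open>Test functions and distributions\<close>

definition partial_deriv :: "'n::finite \<Rightarrow> (real^'n \<Rightarrow> real) \<Rightarrow> real^'n \<Rightarrow> real" where
  "partial_deriv i f x = deriv (\<lambda>t. f (x + t *\<^sub>R axis i 1)) 0"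

primrec partial_derivs :: "'n::finite list \<Rightarrow> (real^'n \<Rightarrow> real) \<Rightarrow> real^'n \<Rightarrow> real" where
  "partial_derivs [] f = f"
| "partial_derivs (i # is) f = partial_deriv i (partial_derivs is f)"

text \<open>Differentiability of all iterated partial derivatives includes their continuity.\<close>

definition smooth :: "(real^'n::finite \<Rightarrow> real) \<Rightarrow> bool" where
  "smooth f \<longleftrightarrow> (\<forall>is x. partial_derivs is f differentiable (at x))"

text \<open>One derivative in each coordinate. For smooth functions the order is irrelevant.\<close>

definition mixed_deriv :: "(real^'n::finite \<Rightarrow> real) \<Rightarrow> real^'n \<Rightarrow> real" where
  "mixed_deriv = partial_derivs (SOME is. distinct is \<and> set is = UNIV)"

definition test_functions :: "(real^'n::finite \<Rightarrow> real) set" where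
  "test_functions = {\<psi>. smooth \<psi> \<and> compact (closure {x. \<psi> x \<noteq> 0})}"

text \<open>\<^term>\<open>Ck_norm N f\<close> is the sum of the sup norms of all partial derivatives of order at most
  \<open>N\<close>; for \<open>N = 1\<close> it is \<open>sup \<bar>f\<bar> + (\<Sum>j. sup \<bar>\<partial>\<^sub>j f\<bar>)\<close>. It is only used for test functions,
  where all suprema are finite.\<close>

definition Ck_norm :: "nat \<Rightarrow> (real^'n::finite \<Rightarrow> real) \<Rightarrow> real" where
  "Ck_norm N f = (\<Sum>is\<in>{is. length is \<le> N}. SUP x. \<bar>partial_derivs is f x\<bar>)"

text \<open>Distributions are continuous linear functionals on \<^const>\<open>test_functions\<close>, extended by zero
  to all functions. Continuity is expressed through the usual seminorm estimates.\<close>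

definition distributions :: "((real^'n::finite \<Rightarrow> real) \<Rightarrow> real) set" where
  "distributions = {F.
     (\<forall>\<psi>. \<psi> \<notin> test_functions \<longrightarrow> F \<psi> = 0) \<and>
     (\<forall>\<psi>\<in>test_functions. \<forall>\<phi>\<in>test_functions. \<forall>a b.
        F (\<lambda>x. a * \<psi> x + b * \<phi> x) = a * F \<psi> + b * F \<phi>) \<and>
     (\<forall>K. compact K \<longrightarrow> (\<exists>C N. \<forall>\<psi>\<in>test_functions.
        {x. \<psi> x \<noteq> 0} \<subseteq> K \<longrightarrow> \<bar>F \<psi>\<bar> \<le> C * Ck_norm N \<psi>))}"

definition unit_test_functions :: "(real^'n::finite \<Rightarrow> real) set" where
  "unit_test_functions =
     {\<phi>. smooth \<phi> \<and> closure {x. \<phi> x \<noteq> 0} \<subseteq> cball 0 1 \<and> Ck_norm 1 \<phi> \<le> 1}"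

definition rescale :: "real \<Rightarrow> real^'n \<Rightarrow> (real^'n::finite \<Rightarrow> real) \<Rightarrow> real^'n \<Rightarrow> real" where
  "rescale \<rho> x \<phi> = (\<lambda>y. \<phi> ((y - x) /\<^sub>R \<rho>) / \<rho> ^ CARD('n))"

text \<open>\<^term>\<open>holder_norm \<beta>\<close> is the norm of \<open>C\<^sup>\<beta>\<close>, with \<open>\<beta> = \<alpha> - 1\<close> negative.\<close>

definition holder_norm :: "real \<Rightarrow> ((real^'n::finite \<Rightarrow> real) \<Rightarrow> real) \<Rightarrow> ennreal" where
  "holder_norm \<beta> F =
     (SUP (x, \<rho>, \<phi>) \<in> UNIV \<times> {0<..1} \<times> unit_test_functions.
        ennreal (\<rho> powr (- \<beta>) * \<bar>F (rescale \<rho> x \<phi>)\<bar>))"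

definition holder_space :: "real \<Rightarrow> ((real^'n::finite \<Rightarrow> real) \<Rightarrow> real) set" where
  "holder_space \<beta> = {F \<in> distributions. holder_norm \<beta> F < \<infinity>}"

definition pi_map :: "('n::finite osimplex \<Rightarrow> real) \<Rightarrow> (real^'n \<Rightarrow> real) \<Rightarrow> real" where
  "pi_map A \<psi> =
     (if \<psi> \<in> test_functions
      then (-1) ^ CARD('n) * (LINT v|lborel. box_value A v * mixed_deriv \<psi> v)
      else 0)"

end

theory Submission
  imports Defs "HOL-Computational_Algebra.Polynomial"
begin

text \<open>
An element \<open>A\<close> of \<open>\<Omega>\<close> is the same thing as a finitely additive charge \<open>B\<close> on simplices, and
finiteness of its norm bounds \<open>B\<close> on cubes of side \<open>r\<close> by a multiple of
\<open>r\<^sup>d\<^sup>-\<^sup>1 r\<^sup>\<alpha>\<close>. Summation by parts shows that \<open>\<pi> A\<close> is the limit of the averages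
\<open>r\<^sup>-\<^sup>d \<integral> B (x + [0, r]\<^sup>d) \<psi> x dx\<close>. Halving \<open>r\<close> replaces a cube by its \<open>2\<^sup>d\<close>
subcubes and moves the argument of \<open>\<psi>\<close> by \<open>O(r)\<close>, so on Lipschitz test functions the averages converge at rate
\<open>r\<^sup>\<alpha>\<close>. Testing at scale \<open>\<rho>\<close> with \<open>r \<approx> \<rho>\<close> gives boundedness of \<open>\<pi>\<close>. Testing with the
indicator function of a simplex \<open>S\<close> smoothed at scale \<open>r\<close> gives \<open>B S + O(r\<^sup>\<alpha>)\<close>, which yields
injectivity.

Conversely, replace a distribution \<open>F\<close> by the density that is constant on the cells of the grid of side
\<open>r\<close>, equal to \<open>F\<close> tested against the normalised members of a smooth partition of unity. Its integral over a
simplex \<open>S\<close> is \<open>F\<close> tested against a smoothed indicator function of \<open>S\<close>, and passing from \<open>r\<close> to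
\<open>r / 2\<close> changes this function only within distance \<open>O(r)\<close> of the boundary. If \<open>h\<close> is the height of \<open>S\<close>,
that region has volume at most a multiple of \<open>(r / h) vol S\<close>, so the change is of order \<open>r\<^sup>\<alpha> vol S / h\<close>, which is summable
over dyadic \<open>r \<le> h\<close>. The limit charge is of order \<open>h\<^sup>\<alpha>\<^sup>-\<^sup>1 vol S\<close>, which is bounded by the mass,
because \<open>vol S\<close> is at most a constant times \<open>h\<close> times the largest facet volume. Its image under \<open>\<pi>\<close> is \<open>F\<close>.
\<close>

section \<open>Simplices, barycentric coordinates and tilings\<close>

subsection \<open>Determinants of vertex tuples\<close>

text \<open>The mass of a simplex mixes facet area and height, and its two directions of use need
  different geometry. Boundedness and injectivity only require an upper bound of the mass: a cube of
  side r is cut into a number of simplices bounded in terms of d, possibly very thin, and c D ^ (d -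
  1 + \<alpha>) with D the diameter dominates the mass of each. The inverse requires a lower bound
  that survives for thin simplices, vol S \<le> c h H(F), which has to be extracted from covers
  because Hausdorff measure is defined by them. Thinness also dictates the treatment of scales: the
  volume of a boundary layer of width r is controlled by (r / h) vol S only for r up to about h.
  Above the height no cancellation between scales is used and the density bound r ^ (\<alpha> - 1)
  is enough, since \<alpha> < 1 makes it largest at the smallest such r; below the height the
  increments form a geometric series of ratio 2 ^ (-\<alpha>), which is where \<alpha> > 0 enters.
  Additivity is handled up to null sets throughout, so that closed cubes, half-open cells and pieces
  cut off by hyperplanes can be exchanged freely.\<close>

definition orient_det :: "'n::finite vertex_tuple \<Rightarrow> real" where
  "orient_det v = det (\<chi> i. v $ Some i - v $ None)"

text \<open>Homogeneous coordinates. The matrix \<open>hmat\<close> with these rows treats all d + 1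
  vertices alike, so that permuting vertices is permuting rows.\<close>

definition homog :: "real^'n::finite \<Rightarrow> real^('n option)" where
  "homog x = (\<chi> k. case k of None \<Rightarrow> 1 | Some j \<Rightarrow> x $ j)"

definition hmat :: "'n::finite vertex_tuple \<Rightarrow> real^('n option)^('n option)" where
  "hmat v = (\<chi> i. homog (v $ i))"

lemma homog_nth [simp]: "homog x $ None = 1" "homog x $ Some j = x $ j"
  by (simp_all add: homog_def)

lemma UNIV_option_eq: "(UNIV :: 'n option set) = insert None (range Some)"
  by (auto intro: option.exhaust)

lemma sum_option:
  fixes f :: "'n::finite option \<Rightarrow> 'b::comm_monoid_add"
  shows "(\<Sum>i\<in>UNIV. f i) = f None + (\<Sum>j\<in>UNIV. f (Some j))"
  unfolding UNIV_option_eq by (subst sum.insert) (auto simp: sum.reindex)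

text \<open>In the Leibniz sum a permutation that moves \<open>None\<close> takes some row
  \<open>Some i\<close> to the column \<open>None\<close>, where the entry vanishes. The remaining
  permutations act on \<open>range Some\<close> and are transported to the index type without change
  of sign.\<close>

lemma det_option_block:
  fixes M :: "real^('n::finite option)^('n option)"
  assumes "\<And>i. M $ Some i $ None = 0"
  shows "det M = M $ None $ None * det (\<chi> i j. M $ Some i $ Some j)"
proof -
  let ?f = "\<lambda>p. of_int (sign p) * (\<Prod>i\<in>UNIV. M $ i $ p i)"
  have "det M = sum ?f {p. p permutes (insert None (range (Some :: 'n \<Rightarrow> _)))}"
    unfolding det_def UNIV_option_eq ..
  also have "\<dots> = (\<Sum>b\<in>insert None (range Some). \<Sum>q | q permutes range Some. ?f (Transposition.transpose None b \<circ> q))"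
    by (rule sum_over_permutations_insert) auto
  also have "\<dots> = (\<Sum>q | q permutes range Some. ?f q)
      + (\<Sum>b\<in>range Some. \<Sum>q | q permutes range Some. ?f (Transposition.transpose None b \<circ> q))"
    by (subst sum.insert) auto
  also have "(\<Sum>b\<in>range Some. \<Sum>q | q permutes range (Some :: 'n \<Rightarrow> _). ?f (Transposition.transpose None b \<circ> q)) = 0"
  proof (intro sum.neutral ballI)
    fix b :: "'n option" and q :: "'n option \<Rightarrow> 'n option"
    assume b: "b \<in> range Some" and "q \<in> {q. q permutes range Some}"
    then have q: "q permutes range Some" by simp
    obtain i where i: "q (Some i) = b"
      using b permutes_image[OF q] by (metis (no_types, lifting) imageE)
    have "(Transposition.transpose None b \<circ> q) (Some i) = None"
      using i by simp
    then have "M $ Some i $ (Transposition.transpose None b \<circ> q) (Some i) = 0"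
      using assms by simp
    then have "(\<Prod>i\<in>UNIV. M $ i $ (Transposition.transpose None b \<circ> q) i) = 0"
      by (intro prod_zero) auto
    then show "?f (Transposition.transpose None b \<circ> q) = 0" by simp
  qed
  also have "(\<Sum>q | q permutes range (Some :: 'n \<Rightarrow> _). ?f q)
     = (\<Sum>p | p permutes UNIV. ?f (map_permutation UNIV Some p))"
  proof (rule sum.reindex_bij_witness[of _ "map_permutation UNIV Some" "map_permutation (range Some) (inv Some)"])
    have b: "bij_betw (Some :: 'n \<Rightarrow> _) UNIV (range Some)" by (simp add: bij_betw_def)
    have b': "bij_betw (inv Some) (range (Some :: 'n \<Rightarrow> _)) UNIV"
      by (metis b bij_betw_inv_into)
    fix q :: "'n option \<Rightarrow> 'n option" assume "q \<in> {q. q permutes range Some}"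
    then have q: "q permutes range Some" by simp
    show "map_permutation UNIV Some (map_permutation (range Some) (inv Some) q) = q"
      by (rule map_permutation_compose_inv[OF b' q]) (auto simp: f_inv_into_f)
    show "map_permutation (range Some) (inv Some) q \<in> {p. p permutes (UNIV :: 'n set)}"
      using map_permutation_permutes[OF b' q] by simp
    have e: "map_permutation UNIV Some (map_permutation (range Some) (inv Some) q) = q"
      by (rule map_permutation_compose_inv[OF b' q]) (auto simp: f_inv_into_f)
    show "?f (map_permutation UNIV Some (map_permutation (range Some) (inv Some) q)) = ?f q"
      by (simp only: e)
  next
    have b: "bij_betw (Some :: 'n \<Rightarrow> _) UNIV (range Some)" by (simp add: bij_betw_def)
    fix p :: "'n \<Rightarrow> 'n" assume "p \<in> {p. p permutes UNIV}"
    then have p: "p permutes UNIV" by simp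
    show "map_permutation (range Some) (inv Some) (map_permutation UNIV Some p) = p"
      by (rule map_permutation_compose_inv[OF b p]) auto
    show "map_permutation UNIV Some p \<in> {q. q permutes range Some}"
      using map_permutation_permutes[OF b p] by simp
  qed
  also have "\<dots> = (\<Sum>p | p permutes UNIV. M $ None $ None * (of_int (sign p) * (\<Prod>i\<in>UNIV. M $ Some i $ Some (p i))))"
  proof (intro sum.cong refl)
    fix p :: "'n \<Rightarrow> 'n" assume "p \<in> {p. p permutes UNIV}"
    then have p: "p permutes UNIV" by simp
    let ?q = "map_permutation UNIV Some p"
    have s: "sign ?q = sign p"
      using sign_map_permutation[of Some UNIV p] p by (simp add: inj_on_def)
    have N: "?q None = None" by (simp add: map_permutation_def restrict_id_def)
    have S: "?q (Some i) = Some (p i)" for i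
      by (rule map_permutation_apply) auto
    have "(\<Prod>i\<in>UNIV. M $ i $ ?q i) = M $ None $ None * (\<Prod>i\<in>UNIV. M $ Some i $ Some (p i))"
      unfolding UNIV_option_eq by (subst prod.insert) (auto simp: N S prod.reindex)
    then show "?f ?q = M $ None $ None * (of_int (sign p) * (\<Prod>i\<in>UNIV. M $ Some i $ Some (p i)))"
      by (simp add: s)
  qed
  finally show ?thesis by (simp add: det_def sum_distrib_left)
qed

lemma det_subtract_row:
  fixes M :: "real^'m::finite^'m"
  assumes "finite J" "k \<notin> J"
  shows "det (\<chi> i. if i \<in> J then M $ i - M $ k else M $ i) = det M"
  using assms
proof (induction J rule: finite_induct)
  case (insert j J)
  let ?M = "\<chi> i. if i \<in> J then M $ i - M $ k else M $ i"
  have "(\<chi> i. if i = j then row j ?M + (-1) *s row k ?M else row i ?M)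
      = (\<chi> i. if i \<in> insert j J then M $ i - M $ k else M $ i)"
    using insert by (auto simp: vec_eq_iff row_def)
  then show ?case
    using det_row_operation[of j k ?M "-1"] insert by auto
qed (simp add: vec_lambda_eta)

text \<open>Subtracting the row of vertex 0 from all others leaves a first column with the single
  nonzero entry 1, so the block formula applies.\<close>

lemma orient_det_eq: "orient_det v = det (hmat v)"
proof -
  let ?N = "\<chi> i. if i \<in> range Some then hmat v $ i - hmat v $ None else hmat v $ i"
  have "det (hmat v) = det ?N"
    by (rule det_subtract_row[symmetric]) auto
  also have "\<dots> = det (\<chi> i j. ?N $ Some i $ Some j)"
    by (subst det_option_block) (auto simp: hmat_def)
  also have "(\<chi> i j. ?N $ Some i $ Some j) = (\<chi> i. v $ Some i - v $ None)"
    by (auto simp: vec_eq_iff hmat_def)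
  finally show ?thesis unfolding orient_det_def by simp
qed

lemma orient_det_permute:
  assumes "p permutes UNIV"
  shows "orient_det (\<chi> i. v $ p i) = of_int (sign p) * orient_det v"
proof -
  have "hmat (\<chi> i. v $ p i) = (\<chi> i. hmat v $ p i)"
    by (simp add: hmat_def)
  then show ?thesis
    unfolding orient_det_eq using det_permute_rows[OF assms, of "hmat v"] by simp
qed

lemma
  fixes A :: "real^'m::finite^'m"
  assumes "invertible A"
  shows matrix_inv_right': "A ** matrix_inv A = mat 1"
    and matrix_inv_left': "matrix_inv A ** A = mat 1"
  using someI_ex[OF assms[unfolded invertible_def]] unfolding matrix_inv_def by blast+

lemma sum_vector_matrix_homog:
  "(u v* hmat v) $ None = (\<Sum>i\<in>UNIV. u $ i)"
  "(u v* hmat v) $ Some j = (\<Sum>i\<in>UNIV. u $ i *\<^sub>R v $ i) $ j"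
  by (simp_all add: vector_matrix_mult_def hmat_def mult.commute)

text \<open>A vector u in the left kernel of \<open>hmat v\<close> is an affine relation among the
  vertices: the column \<open>None\<close> says that the coefficients sum to 0, the other columns
  that the weighted sum of the vertices vanishes.\<close>

lemma orient_det_nz_iff: "orient_det v \<noteq> 0 \<longleftrightarrow> aff_indep_tuple v"
proof
  assume nz: "orient_det v \<noteq> 0"
  then have inv: "invertible (hmat v)" by (simp add: orient_det_eq invertible_det_nz)
  have ker: "u = 0" if "(\<Sum>i\<in>UNIV. u $ i) = 0" "(\<Sum>i\<in>UNIV. u $ i *\<^sub>R v $ i) = 0" for u
  proof -
    have "u v* hmat v = 0"
    proof (simp add: vec_eq_iff, intro allI)
      fix k show "(u v* hmat v) $ k = 0"
        by (cases k) (simp_all only: sum_vector_matrix_homog that zero_index)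
    qed
    then have "u v* (hmat v ** matrix_inv (hmat v)) = 0"
      by (simp flip: vector_matrix_mul_assoc)
    then show ?thesis using matrix_inv_right'[OF inv] by simp
  qed
  have inj: "inj (($) v)"
  proof (rule injI, rule ccontr)
    fix i j assume "v $ i = v $ j" "i \<noteq> j"
    then have "row i (hmat v) = row j (hmat v)" by (simp add: row_def hmat_def)
    then show False using det_identical_rows[OF \<open>i \<noteq> j\<close>, of "hmat v"] nz by (simp add: orient_det_eq)
  qed
  have "\<not> affine_dependent (range (($) v))"
  proof
    assume "affine_dependent (range (($) v))"
    then obtain U where U: "sum U (range (($) v)) = 0" "\<exists>x\<in>range (($) v). U x \<noteq> 0"
        "(\<Sum>x\<in>range (($) v). U x *\<^sub>R x) = 0"
      using affine_dependent_explicit_finite[of "range (($) v)"] by auto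
    have "(\<chi> i. U (v $ i)) = 0"
      using U inj by (intro ker) (simp_all add: sum.reindex)
    then show False using U(2) by (auto simp: vec_eq_iff)
  qed
  with inj show "aff_indep_tuple v" by (simp add: aff_indep_tuple_def)
next
  assume ai: "aff_indep_tuple v"
  show "orient_det v \<noteq> 0"
  proof
    assume "orient_det v = 0"
    then have "\<not> invertible (transpose (hmat v))"
      by (simp add: orient_det_eq invertible_det_nz)
    then have "\<not> inj ((*v) (transpose (hmat v)))"
      by (metis invertible_left_inverse matrix_left_invertible_injective)
    then obtain u where u: "transpose (hmat v) *v u = 0" "u \<noteq> 0"
      by (metis matrix_left_invertible_injective matrix_left_invertible_ker)
    then have "u v* hmat v = 0" by simp
    then have s: "(\<Sum>i\<in>UNIV. u $ i) = 0" "(\<Sum>i\<in>UNIV. u $ i *\<^sub>R v $ i) = 0"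
      using sum_vector_matrix_homog[of u v] by (auto simp: vec_eq_iff)
    obtain k where k: "u $ k \<noteq> 0" using u by (auto simp: vec_eq_iff)
    have inj: "inj (($) v)" using ai by (simp add: aff_indep_tuple_def)
    have "affine_dependent (range (($) v))"
      unfolding affine_dependent_explicit_finite[OF finite_imageI[OF finite]]
      by (rule exI[of _ "\<lambda>x. u $ inv (($) v) x"])
         (use s k inj in \<open>auto simp: sum.reindex inv_f_f\<close>)
    with ai show False by (simp add: aff_indep_tuple_def)
  qed
qed

subsection \<open>Barycentric coordinates\<close>

text \<open>The solution u of \<open>u v* hmat v = homog x\<close>. Written with the inverse matrix,
  the coordinates are affine functions on the whole space, which is what estimates outside the
  simplex need.\<close>

definition bary :: "'n::finite vertex_tuple \<Rightarrow> real^'n \<Rightarrow> real^('n option)" where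
  "bary v x = homog x v* matrix_inv (hmat v)"

lemma bary_unique:
  assumes "aff_indep_tuple v" "(\<Sum>i\<in>UNIV. u $ i) = 1" "(\<Sum>i\<in>UNIV. u $ i *\<^sub>R v $ i) = x"
  shows "bary v x = u"
proof -
  have inv: "invertible (hmat v)"
    using assms(1) by (simp add: orient_det_nz_iff[symmetric] orient_det_eq invertible_det_nz)
  have "u v* hmat v = homog x"
  proof (simp add: vec_eq_iff, intro allI)
    fix k show "(u v* hmat v) $ k = homog x $ k"
      by (cases k) (simp_all only: sum_vector_matrix_homog assms homog_nth)
  qed
  then have "bary v x = u v* (hmat v ** matrix_inv (hmat v))"
    by (simp add: bary_def flip: vector_matrix_mul_assoc)
  then show ?thesis using matrix_inv_right'[OF inv] by simp
qed

lemma bary_sum: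
  assumes "aff_indep_tuple v"
  shows "(\<Sum>i\<in>UNIV. bary v x $ i) = 1" "(\<Sum>i\<in>UNIV. bary v x $ i *\<^sub>R v $ i) = x"
proof -
  have inv: "invertible (hmat v)"
    using assms(1) by (simp add: orient_det_nz_iff[symmetric] orient_det_eq invertible_det_nz)
  have "bary v x v* hmat v = homog x"
    by (simp add: bary_def vector_matrix_mul_assoc matrix_inv_left'[OF inv])
  then show "(\<Sum>i\<in>UNIV. bary v x $ i) = 1" "(\<Sum>i\<in>UNIV. bary v x $ i *\<^sub>R v $ i) = x"
    using sum_vector_matrix_homog[of "bary v x" v] by (auto simp: vec_eq_iff)
qed

lemma bary_vertex:
  assumes "aff_indep_tuple v"
  shows "bary v (v $ k) $ i = (if i = k then 1 else 0)"
proof -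
  have "bary v (v $ k) = (\<chi> i. if i = k then 1 else 0)"
    by (rule bary_unique[OF assms]) (simp_all add: if_distrib[of "\<lambda>r. r *\<^sub>R _"] cong: if_cong)
  then show ?thesis by simp
qed

lemma bary_affine:
  assumes ai: "aff_indep_tuple v" and "s + t = 1"
  shows "bary v (s *\<^sub>R x + t *\<^sub>R y) = s *\<^sub>R bary v x + t *\<^sub>R bary v y"
proof (rule bary_unique[OF ai])
  show "(\<Sum>i\<in>UNIV. (s *\<^sub>R bary v x + t *\<^sub>R bary v y) $ i) = 1"
    using bary_sum[OF ai] assms by (simp add: sum.distrib flip: sum_distrib_left)
  show "(\<Sum>i\<in>UNIV. (s *\<^sub>R bary v x + t *\<^sub>R bary v y) $ i *\<^sub>R v $ i) = s *\<^sub>R x + t *\<^sub>R y"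
    using bary_sum(2)[OF ai] by (simp add: sum.distrib scaleR_add_left flip: scaleR_scaleR scaleR_right.sum)
qed

text \<open>The gradient of the affine function \<open>bary v x $ i\<close>. The reciprocal of its
  norm turns out to be the altitude of vertex i over the opposite facet.\<close>

definition bary_grad :: "'n::finite vertex_tuple \<Rightarrow> 'n option \<Rightarrow> real^'n" where
  "bary_grad v i = (\<chi> j. matrix_inv (hmat v) $ Some j $ i)"

lemma bary_eq: "bary v x $ i = bary v 0 $ i + bary_grad v i \<bullet> x"
  by (simp add: bary_def vector_matrix_mult_def sum_option bary_grad_def inner_vec_def mult.commute)

lemma bary_diff: "bary v x $ i - bary v y $ i = bary_grad v i \<bullet> (x - y)"
  using bary_eq[of v x i] bary_eq[of v y i] by (simp add: inner_diff_right)

lemma bary_grad_nz: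
  assumes "aff_indep_tuple v" shows "bary_grad v i \<noteq> 0"
proof
  assume "bary_grad v i = 0"
  obtain k where "k \<noteq> i" by (metis option.distinct(1) not_Some_eq)
  with bary_diff[of v "v $ i" i "v $ k"] bary_vertex[OF assms] \<open>bary_grad v i = 0\<close>
  show False by auto
qed

lemma convex_hull_range:
  fixes v :: "'n::finite vertex_tuple"
  shows "convex hull (range (($) v)) = {\<Sum>i\<in>UNIV. u i *\<^sub>R v $ i | u. (\<forall>i. 0 \<le> u i) \<and> sum u UNIV = 1}"
    (is "_ = ?R")
proof
  show "convex hull (range (($) v)) \<subseteq> ?R"
  proof (rule hull_minimal)
    show "range (($) v) \<subseteq> ?R"
    proof clarify
      fix k show "\<exists>u. v $ k = (\<Sum>i\<in>UNIV. u i *\<^sub>R v $ i) \<and> (\<forall>i. 0 \<le> u i) \<and> sum u UNIV = 1"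
        by (rule exI[of _ "\<lambda>i. if i = k then 1 else 0"])
           (simp add: if_distrib[of "\<lambda>r. r *\<^sub>R _"] cong: if_cong)
    qed
    show "convex ?R"
    proof (rule convexI, clarify)
      fix s t :: real and u w :: "'n option \<Rightarrow> real"
      assume *: "0 \<le> s" "0 \<le> t" "s + t = 1" "\<forall>i. 0 \<le> u i" "sum u UNIV = 1" "\<forall>i. 0 \<le> w i" "sum w UNIV = 1"
      show "\<exists>z. s *\<^sub>R (\<Sum>i\<in>UNIV. u i *\<^sub>R v $ i) + t *\<^sub>R (\<Sum>i\<in>UNIV. w i *\<^sub>R v $ i) = (\<Sum>i\<in>UNIV. z i *\<^sub>R v $ i)
         \<and> (\<forall>i. 0 \<le> z i) \<and> sum z UNIV = 1"
        using * by (intro exI[of _ "\<lambda>i. s * u i + t * w i"])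
          (auto simp: scaleR_sum_right sum.distrib scaleR_add_left simp flip: sum_distrib_left)
    qed
  qed
  show "?R \<subseteq> convex hull (range (($) v))"
    by clarify (intro convex_sum convex_convex_hull, auto intro: hull_inc)
qed

lemma mem_simplex_iff:
  assumes "aff_indep_tuple v"
  shows "x \<in> convex hull (range (($) v)) \<longleftrightarrow> (\<forall>i. 0 \<le> bary v x $ i)"
proof
  assume "x \<in> convex hull (range (($) v))"
  then obtain u where u: "x = (\<Sum>i\<in>UNIV. u i *\<^sub>R v $ i)" "\<forall>i. 0 \<le> u i" "sum u UNIV = 1"
    unfolding convex_hull_range by auto
  have "bary v x = (\<chi> i. u i)" by (rule bary_unique[OF assms]) (use u in auto)
  then show "\<forall>i. 0 \<le> bary v x $ i" using u by simp
next
  assume "\<forall>i. 0 \<le> bary v x $ i"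
  then show "x \<in> convex hull (range (($) v))"
    unfolding convex_hull_range using bary_sum[OF assms, of x]
    by (auto intro!: exI[of _ "\<lambda>i. bary v x $ i"])
qed

subsection \<open>Tilings by simplices\<close>

definition full_simplices :: "(real^'n::finite) set set" where
  "full_simplices = {convex hull (range (($) v)) | v. aff_indep_tuple v}"

lemma full_simplicesI: "aff_indep_tuple v \<Longrightarrow> convex hull (range (($) v)) \<in> full_simplices"
  by (auto simp: full_simplices_def)

lemma full_simplex_compact: "S \<in> full_simplices \<Longrightarrow> compact S"
  by (auto simp: full_simplices_def intro!: finite_imp_compact_convex_hull)

lemma full_simplex_convex: "S \<in> full_simplices \<Longrightarrow> convex S"
  by (auto simp: full_simplices_def)

lemma full_simplex_closed: "S \<in> full_simplices \<Longrightarrow> closed S"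
  by (simp add: compact_imp_closed full_simplex_compact)

lemma full_simplex_bounded: "S \<in> full_simplices \<Longrightarrow> bounded S"
  by (simp add: compact_imp_bounded full_simplex_compact)

lemma bary_continuous: "continuous_on A (\<lambda>x. bary v x $ i)"
  by (subst bary_eq) (intro continuous_intros)

lemma full_simplex_interior:
  fixes S :: "(real^'n::finite) set"
  assumes "S \<in> full_simplices" shows "interior S \<noteq> {}"
proof -
  obtain v where v: "aff_indep_tuple v" "S = convex hull (range (($) v))"
    using assms by (auto simp: full_simplices_def)
  define U where "U = (\<Inter>i. {x. 0 < bary v x $ i})"
  define c where "c = (\<Sum>i\<in>UNIV. (1 / real CARD('n option)) *\<^sub>R v $ i)"
  have "bary v c = (\<chi> i. 1 / real CARD('n option))"
    by (rule bary_unique[OF v(1)]) (auto simp: c_def)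
  then have "c \<in> U" by (auto simp: U_def)
  moreover have "open U"
    unfolding U_def by (intro open_INT finite ballI open_Collect_less continuous_intros bary_continuous)
  moreover have "U \<subseteq> S"
    unfolding v(2) U_def using mem_simplex_iff[OF v(1)] by (auto simp: less_imp_le)
  ultimately show ?thesis by (metis interior_maximal empty_iff subsetD)
qed

text \<open>A full simplex is the closure of its interior, and the open set
  \<open>interior S - T\<close> is negligible, hence empty.\<close>

lemma full_simplex_subset_closed:
  assumes "S \<in> full_simplices" "negligible (S - T)" "closed T"
  shows "S \<subseteq> T"
proof -
  have "negligible (interior S - T)"
    by (rule negligible_subset[OF assms(2)]) (use interior_subset in auto)
  then have "interior S - T = {}"
    using open_not_negligible[of "interior S - T"] assms(3) by (auto intro: open_Diff)
  then have "closure (interior S) \<subseteq> T"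
    using assms(3) by (intro closure_minimal) auto
  moreover have "closure (interior S) = S"
    using convex_closure_interior[of S] full_simplex_interior full_simplex_convex
      full_simplex_closed assms(1) closure_closed by metis
  ultimately show ?thesis by simp
qed

lemma full_simplex_not_negligible: "S \<in> full_simplices \<Longrightarrow> \<not> negligible S"
  using full_simplex_subset_closed[of S "{}"] full_simplex_interior[of S] by auto

text \<open>The union is compared with P only up to null sets. This makes the notion stable under
  intersections and applicable to half-open cells; when P is itself a full simplex, the union is
  nevertheless exactly P (\<open>tiles_simplex_eq\<close>).\<close>

definition tiles :: "(real^'n::finite) set set \<Rightarrow> (real^'n) set \<Rightarrow> bool" where
  "tiles \<T> P \<longleftrightarrow> finite \<T> \<and> \<T> \<subseteq> full_simplices \<and> pairwise (\<lambda>S T. negligible (S \<inter> T)) \<T>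
     \<and> negligible (\<Union>\<T> - P) \<and> negligible (P - \<Union>\<T>)"

lemma tiles_simplex_eq:
  assumes "tiles \<T> S" "S \<in> full_simplices" shows "\<Union>\<T> = S"
proof
  show "\<Union>\<T> \<subseteq> S"
  proof (rule Union_least)
    fix T assume "T \<in> \<T>"
    with assms(1) have "negligible (T - S)" "T \<in> full_simplices"
      by (auto simp: tiles_def elim!: negligible_subset)
    then show "T \<subseteq> S" using full_simplex_subset_closed full_simplex_closed assms(2) by blast
  qed
  show "S \<subseteq> \<Union>\<T>"
  proof (rule full_simplex_subset_closed[OF assms(2)])
    show "closed (\<Union>\<T>)"
      using assms(1) by (intro closed_Union) (auto simp: tiles_def full_simplex_closed)
  qed (use assms in \<open>auto simp: tiles_def\<close>)
qed

lemma tiles_finite: "tiles \<T> P \<Longrightarrow> finite \<T>"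
  and tiles_full: "tiles \<T> P \<Longrightarrow> S \<in> \<T> \<Longrightarrow> S \<in> full_simplices"
  and tiles_disjoint: "tiles \<T> P \<Longrightarrow> S \<in> \<T> \<Longrightarrow> T \<in> \<T> \<Longrightarrow> S \<noteq> T \<Longrightarrow> negligible (S \<inter> T)"
  and tiles_negligible: "tiles \<T> P \<Longrightarrow> negligible (\<Union>\<T> - P)" "tiles \<T> P \<Longrightarrow> negligible (P - \<Union>\<T>)"
  by (auto simp: tiles_def pairwise_def)

lemma tiles_singleton: "S \<in> full_simplices \<Longrightarrow> tiles {S} S"
  by (simp add: tiles_def)

lemma tiles_cong:
  assumes "tiles \<T> P" "negligible (P - Q)" "negligible (Q - P)"
  shows "tiles \<T> Q"
proof -
  have n: "negligible ((\<Union>\<T> - P) \<union> (P - Q))" "negligible ((Q - P) \<union> (P - \<Union>\<T>))"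
    using assms by (auto simp: tiles_def intro: negligible_Un)
  have "negligible (\<Union>\<T> - Q)" by (rule negligible_subset[OF n(1)]) blast
  moreover have "negligible (Q - \<Union>\<T>)" by (rule negligible_subset[OF n(2)]) blast
  ultimately
  show ?thesis using assms by (simp add: tiles_def)
qed

lemma tiles_UN:
  assumes I: "finite I" and t: "\<And>i. i \<in> I \<Longrightarrow> tiles (f i) (P i)"
    and neg: "\<And>i j. i \<in> I \<Longrightarrow> j \<in> I \<Longrightarrow> i \<noteq> j \<Longrightarrow> negligible (P i \<inter> P j)"
  shows "tiles (\<Union>i\<in>I. f i) (\<Union>i\<in>I. P i)"
    and "sum B (\<Union>i\<in>I. f i) = (\<Sum>i\<in>I. sum B (f i))"
proof -
  have neg': "negligible (S \<inter> T)" if "i \<in> I" "j \<in> I" "i \<noteq> j" "S \<in> f i" "T \<in> f j" for i j S T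
  proof (rule negligible_subset)
    show "negligible ((\<Union>(f i) - P i) \<union> (\<Union>(f j) - P j) \<union> (P i \<inter> P j))"
      using t[OF that(1)] t[OF that(2)] neg[OF that(1-3)] by (auto simp: tiles_def intro!: negligible_Un)
  qed (use that in auto)
  show "tiles (\<Union>i\<in>I. f i) (\<Union>i\<in>I. P i)"
    unfolding tiles_def
  proof (intro conjI)
    show "finite (\<Union>i\<in>I. f i)" "(\<Union>i\<in>I. f i) \<subseteq> full_simplices"
      using I t by (auto simp: tiles_def)
    show "pairwise (\<lambda>S T. negligible (S \<inter> T)) (\<Union>i\<in>I. f i)"
    proof (rule pairwiseI)
      fix S T assume "S \<in> (\<Union>i\<in>I. f i)" "T \<in> (\<Union>i\<in>I. f i)" "S \<noteq> T"
      then obtain i j where ij: "i \<in> I" "j \<in> I" "S \<in> f i" "T \<in> f j" by auto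
      show "negligible (S \<inter> T)"
      proof (cases "i = j")
        case True
        then show ?thesis using t[OF ij(1)] ij \<open>S \<noteq> T\<close> by (auto simp: tiles_def pairwise_def)
      qed (use neg' ij in auto)
    qed
    have n: "negligible (\<Union>i\<in>I. \<Union>(f i) - P i)" "negligible (\<Union>i\<in>I. P i - \<Union>(f i))"
      using I t by (auto simp: tiles_def intro!: negligible_Union)
    show "negligible (\<Union>(\<Union>i\<in>I. f i) - (\<Union>i\<in>I. P i))" by (rule negligible_subset[OF n(1)]) blast
    show "negligible ((\<Union>i\<in>I. P i) - \<Union>(\<Union>i\<in>I. f i))" by (rule negligible_subset[OF n(2)]) blast
  qed
  \<comment> \<open>A simplex common to two families would be counted once in the union and twice in
    the double sum. It would be negligible, which a full simplex is not.\<close>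
  have disj: "f i \<inter> f j = {}" if "i \<in> I" "j \<in> I" "i \<noteq> j" for i j
  proof (rule ccontr)
    assume "f i \<inter> f j \<noteq> {}"
    then obtain S where "S \<in> f i" "S \<in> f j" by auto
    with neg'[OF that this] t[OF that(1)] show False
      using full_simplex_not_negligible[of S] by (auto simp: tiles_def)
  qed
  show "sum B (\<Union>i\<in>I. f i) = (\<Sum>i\<in>I. sum B (f i))"
    using I t disj by (intro sum.UNION_disjoint) (auto simp: tiles_def)
qed

lemma tiles_refine:
  assumes t: "tiles \<T> P" and f: "\<And>S. S \<in> \<T> \<Longrightarrow> tiles (f S) S"
  shows "tiles (\<Union>S\<in>\<T>. f S) P" "sum B (\<Union>S\<in>\<T>. f S) = (\<Sum>S\<in>\<T>. sum B (f S))"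
proof -
  have *: "finite \<T>" "\<And>S T. S \<in> \<T> \<Longrightarrow> T \<in> \<T> \<Longrightarrow> S \<noteq> T \<Longrightarrow> negligible (S \<inter> T)"
    using t by (auto simp: tiles_def pairwise_def)
  show "sum B (\<Union>S\<in>\<T>. f S) = (\<Sum>S\<in>\<T>. sum B (f S))"
    by (rule tiles_UN(2)[where P = "\<lambda>S. S"]) (use * f in auto)
  have "tiles (\<Union>S\<in>\<T>. f S) (\<Union>S\<in>\<T>. S)"
    by (rule tiles_UN(1)[where P = "\<lambda>S. S"]) (use * f in auto)
  then show "tiles (\<Union>S\<in>\<T>. f S) P"
    by (rule tiles_cong) (use t in \<open>auto simp: tiles_def\<close>)
qed

subsection \<open>Cutting simplices by hyperplanes\<close>

definition replace_vertex :: "'n::finite vertex_tuple \<Rightarrow> 'n option \<Rightarrow> real^'n \<Rightarrow> 'n vertex_tuple" where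
  "replace_vertex v i p = (\<chi> k. if k = i then p else v $ k)"

lemma replace_vertex_nth: "replace_vertex v i p $ k = (if k = i then p else v $ k)"
  by (simp add: replace_vertex_def)

lemma homog_affine: "s + t = 1 \<Longrightarrow> homog (s *\<^sub>R x + t *\<^sub>R y) = s *\<^sub>R homog x + t *\<^sub>R homog y"
  by (auto simp: vec_eq_iff homog_def split: option.splits)

text \<open>Moving vertex i to p multiplies the determinant by 1 - t. If m denotes the new
  coordinates, the old ones are (1 - t) m_i at i and m_j + t m_i at j, the others being unchanged;
  nonnegativity of m_j is the additional inequality.\<close>

lemma edge_point:
  fixes v :: "'n::finite vertex_tuple"
  assumes ai: "aff_indep_tuple v" and ij: "i \<noteq> j" and t: "0 < t" "t < 1"
    and p: "p = (1 - t) *\<^sub>R v $ i + t *\<^sub>R v $ j"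
  shows "aff_indep_tuple (replace_vertex v i p)"
    and "x \<in> convex hull (range (($) (replace_vertex v i p))) \<longleftrightarrow>
      (\<forall>k. 0 \<le> bary v x $ k) \<and> t * bary v x $ i \<le> (1 - t) * bary v x $ j"
proof -
  let ?v = "replace_vertex v i p"
  have "hmat ?v = (\<chi> k. if k = i then (1 - t) *s (row i (hmat v) + (t / (1 - t)) *s row j (hmat v)) else row k (hmat v))"
  proof -
    have "homog p = (1 - t) *\<^sub>R homog (v $ i) + t *\<^sub>R homog (v $ j)"
      unfolding p by (rule homog_affine) simp
    then have "homog p $ l = (1 - t) * homog (v $ i) $ l + t * homog (v $ j) $ l" for l
      by (simp add: vec_eq_iff)
    moreover have "(1 - t) * (a + t / (1 - t) * b) = (1 - t) * a + t * b" for a b :: real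
      using t by (simp add: distrib_left)
    ultimately have "homog p $ l = (1 - t) * (homog (v $ i) $ l + t / (1 - t) * homog (v $ j) $ l)" for l
      by simp
    then show ?thesis
      unfolding vec_eq_iff by (auto simp only: hmat_def replace_vertex_def row_def vec_lambda_beta vec_lambda_eta
        vector_smult_component vector_add_component if_distrib[of homog] if_distrib[of "\<lambda>x. x $ _"] split: if_splits)
  qed
  then have "det (hmat ?v) = (1 - t) * det (hmat v)"
    using det_row_mul[of i "1 - t" "\<lambda>_. row i (hmat v) + (t / (1 - t)) *s row j (hmat v)" "\<lambda>k. row k (hmat v)"]
      det_row_operation[OF ij, of "hmat v" "t / (1 - t)"] by simp
  then show ai': "aff_indep_tuple ?v"
    using ai t by (simp flip: orient_det_nz_iff add: orient_det_eq)
  define m where "m = bary ?v x"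
  have S: "(\<Sum>k\<in>UNIV. m $ k) = 1" "(\<Sum>k\<in>UNIV. m $ k *\<^sub>R ?v $ k) = x"
    unfolding m_def using bary_sum[OF ai'] by blast+
  let ?u = "\<chi> k. m $ k - (if k = i then t * m $ i else 0) + (if k = j then t * m $ i else 0)"
  have "bary v x = ?u"
  proof (rule bary_unique[OF ai])
    show "(\<Sum>k\<in>UNIV. ?u $ k) = 1" using S(1) by (simp add: sum.distrib sum_subtractf)
    have "x = (\<Sum>k\<in>UNIV. m $ k *\<^sub>R v $ k + (if k = i then m $ i *\<^sub>R (p - v $ i) else 0))"
      unfolding S(2)[symmetric] by (intro sum.cong) (auto simp: replace_vertex_nth algebra_simps)
    also have "\<dots> = (\<Sum>k\<in>UNIV. m $ k *\<^sub>R v $ k) + (t * m $ i) *\<^sub>R (v $ j - v $ i)"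
      by (simp add: sum.distrib p algebra_simps)
    finally have x: "x = \<dots>" .
    have "(\<Sum>k\<in>UNIV. ?u $ k *\<^sub>R v $ k) = (\<Sum>k\<in>UNIV. m $ k *\<^sub>R v $ k
       - (if k = i then (t * m $ i) *\<^sub>R v $ i else 0) + (if k = j then (t * m $ i) *\<^sub>R v $ j else 0))"
      by (intro sum.cong refl) (auto simp: algebra_simps)
    also have "\<dots> = x"
      unfolding x by (simp add: sum.distrib sum_subtractf scaleR_diff_right)
    finally show "(\<Sum>k\<in>UNIV. ?u $ k *\<^sub>R v $ k) = x" .
  qed
  then have b: "bary v x $ k = m $ k - (if k = i then t * m $ i else 0) + (if k = j then t * m $ i else 0)" for k
    by simp
  have bi: "bary v x $ i = (1 - t) * m $ i" and bj: "bary v x $ j = m $ j + t * m $ i"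
    using b[of i] b[of j] ij by (auto simp: algebra_simps)
  have bk: "bary v x $ k = m $ k" if "k \<noteq> i" "k \<noteq> j" for k using b[of k] that by simp
  have mi: "0 \<le> bary v x $ i \<longleftrightarrow> 0 \<le> m $ i" using bi t by (simp add: zero_le_mult_iff)
  have mj: "t * bary v x $ i \<le> (1 - t) * bary v x $ j \<longleftrightarrow> 0 \<le> m $ j"
  proof -
    have "(1 - t) * bary v x $ j - t * bary v x $ i = (1 - t) * m $ j"
      unfolding bi bj by (simp add: algebra_simps)
    then show ?thesis using t by (smt (verit, best) zero_le_mult_iff)
  qed
  have "(\<forall>k. 0 \<le> m $ k) \<longleftrightarrow> (\<forall>k. 0 \<le> bary v x $ k) \<and> t * bary v x $ i \<le> (1 - t) * bary v x $ j"
  proof safe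
    fix k assume m: "\<forall>k. 0 \<le> m $ k"
    show "0 \<le> bary v x $ k"
      using m[rule_format, of k] m[rule_format, of i] t b[of k] mi
      by (cases "k = i") auto
  next
    assume "\<forall>k. 0 \<le> m $ k"
    then show "t * bary v x $ i \<le> (1 - t) * bary v x $ j" using mj by simp
  next
    fix k assume *: "\<forall>k. 0 \<le> bary v x $ k" "t * bary v x $ i \<le> (1 - t) * bary v x $ j"
    then show "0 \<le> m $ k"
      using mi mj bk[of k] by (cases "k = i"; cases "k = j") (auto, metis)
  qed
  then show "x \<in> convex hull (range (($) ?v)) \<longleftrightarrow>
      (\<forall>k. 0 \<le> bary v x $ k) \<and> t * bary v x $ i \<le> (1 - t) * bary v x $ j"
    using mem_simplex_iff[OF ai'] by (simp add: m_def)
qed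

text \<open>The edge-point description, used from both ends of the edge, produces opposite
  inequalities, so the halves meet inside one hyperplane. It is a genuine hyperplane because its
  normal has inner product -1 with the edge vector.\<close>

lemma bisect_simplex:
  fixes v :: "'n::finite vertex_tuple"
  assumes ai: "aff_indep_tuple v" and ij: "i \<noteq> j" and t: "0 < t" "t < 1"
    and p: "p = (1 - t) *\<^sub>R v $ i + t *\<^sub>R v $ j"
  shows "aff_indep_tuple (replace_vertex v i p)" "aff_indep_tuple (replace_vertex v j p)"
    and "convex hull (range (($) (replace_vertex v i p))) \<union> convex hull (range (($) (replace_vertex v j p)))
        = convex hull (range (($) v))"
    and "negligible (convex hull (range (($) (replace_vertex v i p))) \<inter> convex hull (range (($) (replace_vertex v j p))))"
proof -
  have p': "p = (1 - (1 - t)) *\<^sub>R v $ j + (1 - t) *\<^sub>R v $ i" using p by (simp add: add.commute)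
  note 1 = edge_point[OF ai ij t p]
  note 2 = edge_point[OF ai ij[symmetric] _ _ p', simplified, OF t(2) t(1)]
  show "aff_indep_tuple (replace_vertex v i p)" "aff_indep_tuple (replace_vertex v j p)"
    using 1(1) 2(1) by auto
  show "convex hull (range (($) (replace_vertex v i p))) \<union> convex hull (range (($) (replace_vertex v j p)))
        = convex hull (range (($) v))"
    unfolding set_eq_iff Un_iff 1(2) 2(2) mem_simplex_iff[OF ai] by auto
  let ?a = "(1 - t) *\<^sub>R bary_grad v j - t *\<^sub>R bary_grad v i"
  let ?b = "t * bary v 0 $ i - (1 - t) * bary v 0 $ j"
  have "bary_grad v j \<bullet> (v $ i - v $ j) = -1" "bary_grad v i \<bullet> (v $ i - v $ j) = 1"
    using bary_diff[of v "v $ i" j "v $ j"] bary_diff[of v "v $ i" i "v $ j"] bary_vertex[OF ai] ij by auto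
  then have "?a \<bullet> (v $ i - v $ j) = -1"
    by (simp add: inner_diff_left)
  then have "?a \<noteq> 0" by auto
  then have "negligible {x. ?a \<bullet> x = ?b}" by (intro negligible_hyperplane) auto
  then show "negligible (convex hull (range (($) (replace_vertex v i p))) \<inter> convex hull (range (($) (replace_vertex v j p))))"
  proof (rule negligible_subset, intro subsetI CollectI)
    fix x assume "x \<in> convex hull (range (($) (replace_vertex v i p))) \<inter> convex hull (range (($) (replace_vertex v j p)))"
    then have "t * bary v x $ i = (1 - t) * bary v x $ j" using 1(2) 2(2) by force
    then show "?a \<bullet> x = ?b"
      unfolding bary_eq[of v x i] bary_eq[of v x j] by (simp add: inner_diff_left algebra_simps)
  qed
qed

text \<open>Induction on the number of vertices off the hyperplane. If some edge crosses it,
  bisecting at the crossing point replaces, in each half, one vertex off the hyperplane by a point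
  on it; each step at most doubles the number of pieces.\<close>

lemma simplex_cut_aux:
  fixes v :: "'n::finite vertex_tuple"
  assumes "aff_indep_tuple v" "card {i. a \<bullet> v $ i \<noteq> b} = k"
  shows "\<exists>\<T>. tiles \<T> (convex hull (range (($) v))) \<and> card \<T> \<le> 2 ^ k \<and>
    (\<forall>T\<in>\<T>. T \<subseteq> {x. a \<bullet> x \<le> b} \<or> T \<subseteq> {x. b \<le> a \<bullet> x})"
  using assms
proof (induction k arbitrary: v rule: less_induct)
  case (less k v)
  let ?S = "convex hull (range (($) v))"
  show ?case
  proof (cases "(\<forall>i. a \<bullet> v $ i \<le> b) \<or> (\<forall>i. b \<le> a \<bullet> v $ i)")
    case True
    then have "?S \<subseteq> {x. a \<bullet> x \<le> b} \<or> ?S \<subseteq> {x. b \<le> a \<bullet> x}"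
    proof
      assume "\<forall>i. a \<bullet> v $ i \<le> b"
      then have "?S \<subseteq> {x. a \<bullet> x \<le> b}" by (intro hull_minimal convex_halfspace_le) auto
      then show ?thesis ..
    next
      assume "\<forall>i. b \<le> a \<bullet> v $ i"
      then have "?S \<subseteq> {x. a \<bullet> x \<ge> b}" by (intro hull_minimal convex_halfspace_ge) auto
      then show ?thesis by simp
    qed
    then show ?thesis
      using less.prems by (intro exI[of _ "{?S}"]) (auto simp: tiles_singleton full_simplicesI)
  next
    case False
    then obtain i j where i: "a \<bullet> v $ i < b" and j: "b < a \<bullet> v $ j" by (auto simp: not_le)
    define t where "t = (b - a \<bullet> v $ i) / (a \<bullet> v $ j - a \<bullet> v $ i)"
    define p where "p = (1 - t) *\<^sub>R v $ i + t *\<^sub>R v $ j"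
    have t: "0 < t" "t < 1" using i j by (auto simp: t_def field_simps)
    have ij: "i \<noteq> j" using i j by auto
    have "a \<bullet> p = a \<bullet> v $ i + t * (a \<bullet> v $ j - a \<bullet> v $ i)"
      by (simp add: p_def inner_right_distrib algebra_simps)
    also have "\<dots> = b" using i j by (simp add: t_def)
    finally have ap: "a \<bullet> p = b" .
    note bi = bisect_simplex[OF less.prems(1) ij t p_def]
    have sub: "\<exists>\<T>. tiles \<T> (convex hull (range (($) (replace_vertex v l p)))) \<and> card \<T> \<le> 2 ^ (k - 1) \<and>
       (\<forall>T\<in>\<T>. T \<subseteq> {x. a \<bullet> x \<le> b} \<or> T \<subseteq> {x. b \<le> a \<bullet> x})" if "l \<in> {i, j}" for l
    proof -
      have eq: "{m. a \<bullet> replace_vertex v l p $ m \<noteq> b} = {m. a \<bullet> v $ m \<noteq> b} - {l}"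
        by (auto simp: replace_vertex_nth ap)
      have "l \<in> {m. a \<bullet> v $ m \<noteq> b}" using that i j by auto
      then have "card {m. a \<bullet> replace_vertex v l p $ m \<noteq> b} = k - 1" "k - 1 < k"
        unfolding eq using less.prems(2) by (auto simp: card_gt_0_iff simp del: diff_less intro!: diff_less)
      then show ?thesis using that bi(1,2) by (intro less.IH) auto
    qed
    obtain \<T>1 where T1: "tiles \<T>1 (convex hull (range (($) (replace_vertex v i p))))" "card \<T>1 \<le> 2 ^ (k - 1)"
       "\<forall>T\<in>\<T>1. T \<subseteq> {x. a \<bullet> x \<le> b} \<or> T \<subseteq> {x. b \<le> a \<bullet> x}" using sub[of i] by auto
    obtain \<T>2 where T2: "tiles \<T>2 (convex hull (range (($) (replace_vertex v j p))))" "card \<T>2 \<le> 2 ^ (k - 1)"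
       "\<forall>T\<in>\<T>2. T \<subseteq> {x. a \<bullet> x \<le> b} \<or> T \<subseteq> {x. b \<le> a \<bullet> x}" using sub[of j] by auto
    have "tiles (\<Union>l\<in>{i, j}. if l = i then \<T>1 else \<T>2)
        (\<Union>l\<in>{i, j}. convex hull (range (($) (replace_vertex v l p))))"
      by (rule tiles_UN) (use T1 T2 bi(4) ij in \<open>auto simp: Int_commute\<close>)
    then have "tiles (\<T>1 \<union> \<T>2) ?S" using ij bi(3) by (auto simp: Un_commute)
    moreover have "card (\<T>1 \<union> \<T>2) \<le> 2 ^ k"
    proof -
      have "k \<noteq> 0" using less.prems(2) i by (metis (mono_tags, lifting) card_0_eq empty_iff finite mem_Collect_eq order_less_irrefl)
      then have "(2::nat) ^ k = 2 ^ (k - 1) + 2 ^ (k - 1)" by (cases k) auto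
      then show ?thesis using card_Un_le[of \<T>1 \<T>2] T1(2) T2(2) by linarith
    qed
    ultimately show ?thesis using T1(3) T2(3) by blast
  qed
qed

definition halfspaces :: "((real^'n::finite) \<times> real) set \<Rightarrow> (real^'n) set" where
  "halfspaces H = {x. \<forall>(a, b)\<in>H. a \<bullet> x \<le> b}"

text \<open>All d + 1 vertices may lie off the cutting hyperplane. The count has to be independent
  of the simplex because it enters the constants of the norm estimates.\<close>

abbreviation cut_bound :: "'n::finite itself \<Rightarrow> nat" where
  "cut_bound _ \<equiv> 2 ^ CARD('n option)"

lemma simplex_cut:
  fixes S :: "(real^'n::finite) set"
  assumes "finite H" "S \<in> full_simplices"
  shows "\<exists>\<T>. tiles \<T> S \<and> card \<T> \<le> cut_bound TYPE('n) ^ card H \<and>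
    (\<forall>T\<in>\<T>. \<forall>(a, b)\<in>H. T \<subseteq> {x. a \<bullet> x \<le> b} \<or> T \<subseteq> {x. b \<le> a \<bullet> x})"
  using assms(1)
proof (induction H rule: finite_induct)
  case empty
  show ?case using assms(2) by (intro exI[of _ "{S}"]) (auto simp: tiles_singleton)
next
  case (insert h H)
  obtain a b where h: "h = (a, b)" by force
  obtain \<T> where T: "tiles \<T> S" "card \<T> \<le> cut_bound TYPE('n) ^ card H"
    "\<forall>T\<in>\<T>. \<forall>(a, b)\<in>H. T \<subseteq> {x. a \<bullet> x \<le> b} \<or> T \<subseteq> {x. b \<le> a \<bullet> x}" using insert.IH by auto
  have fin: "finite \<T>" using T(1) by (simp add: tiles_def)
  have "\<exists>\<U>. tiles \<U> T \<and> card \<U> \<le> cut_bound TYPE('n) \<and> (\<forall>U\<in>\<U>. U \<subseteq> {x. a \<bullet> x \<le> b} \<or> U \<subseteq> {x. b \<le> a \<bullet> x})"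
    if "T \<in> \<T>" for T
  proof -
    obtain v where v: "aff_indep_tuple v" "T = convex hull (range (($) v))"
      using tiles_full[OF T(1) \<open>T \<in> \<T>\<close>] by (auto simp: full_simplices_def)
    have "card {i. a \<bullet> v $ i \<noteq> b} \<le> CARD('n option)" by (rule card_mono) auto
    then have "(2::nat) ^ card {i. a \<bullet> v $ i \<noteq> b} \<le> cut_bound TYPE('n)" by (intro power_increasing) auto
    then show ?thesis using simplex_cut_aux[OF v(1) refl, of a b] v(2) le_trans by blast
  qed
  then obtain f where f: "\<And>T. T \<in> \<T> \<Longrightarrow> tiles (f T) T" "\<And>T. T \<in> \<T> \<Longrightarrow> card (f T) \<le> cut_bound TYPE('n)"
    "\<And>T U. T \<in> \<T> \<Longrightarrow> U \<in> f T \<Longrightarrow> U \<subseteq> {x. a \<bullet> x \<le> b} \<or> U \<subseteq> {x. b \<le> a \<bullet> x}" by metis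
  have sub: "U \<subseteq> T" if "T \<in> \<T>" "U \<in> f T" for T U
    using tiles_simplex_eq[OF f(1)[OF that(1)]] that T(1) by (auto simp: tiles_def)
  have "card (\<Union>T\<in>\<T>. f T) \<le> (\<Sum>T\<in>\<T>. card (f T))" by (rule card_UN_le[OF fin])
  also have "\<dots> \<le> card \<T> * cut_bound TYPE('n)" using f(2) sum_bounded_above[of \<T> "\<lambda>T. card (f T)"] by simp
  also have "\<dots> \<le> cut_bound TYPE('n) ^ card (insert h H)"
    using T(2) insert.hyps by (simp add: mult.commute)
  finally have "card (\<Union>T\<in>\<T>. f T) \<le> cut_bound TYPE('n) ^ card (insert h H)" .
  moreover have "tiles (\<Union>T\<in>\<T>. f T) S" by (rule tiles_refine[OF T(1) f(1)])
  moreover have "U \<subseteq> {x. c \<bullet> x \<le> e} \<or> U \<subseteq> {x. e \<le> c \<bullet> x}"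
    if U: "U \<in> f T" "T \<in> \<T>" and ce: "(c, e) \<in> insert h H" for U T c e
  proof -
    from ce h consider "c = a" "e = b" | "(c, e) \<in> H" by auto
    then show ?thesis
    proof cases
      case 1
      then show ?thesis using f(3)[OF U(2,1)] by simp
    next
      case 2
      then have "T \<subseteq> {x. c \<bullet> x \<le> e} \<or> T \<subseteq> {x. e \<le> c \<bullet> x}" using T(3) U(2) by blast
      then show ?thesis using sub[OF U(2,1)] by blast
    qed
  qed
  then have "\<forall>U\<in>(\<Union>T\<in>\<T>. f T). \<forall>(a, b)\<in>insert h H. U \<subseteq> {x. a \<bullet> x \<le> b} \<or> U \<subseteq> {x. b \<le> a \<bullet> x}"
    by blast
  ultimately show ?case by blast
qed

text \<open>After cutting along every bounding hyperplane, each piece lies on one side of each.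
  Keeping the pieces inside all halfspaces loses only points on the hyperplanes themselves.\<close>

lemma tiles_Int_halfspaces:
  fixes S :: "(real^'n::finite) set"
  assumes H: "finite H" "\<forall>(a, b)\<in>H. a \<noteq> 0" and S: "S \<in> full_simplices"
  shows "\<exists>\<T>. tiles \<T> (S \<inter> halfspaces H) \<and> card \<T> \<le> cut_bound TYPE('n) ^ card H \<and>
    (\<forall>T\<in>\<T>. T \<subseteq> S \<inter> halfspaces H)"
proof -
  obtain \<T> where T: "tiles \<T> S" "card \<T> \<le> cut_bound TYPE('n) ^ card H"
    "\<And>T a b. T \<in> \<T> \<Longrightarrow> (a, b) \<in> H \<Longrightarrow> T \<subseteq> {x. a \<bullet> x \<le> b} \<or> T \<subseteq> {x. b \<le> a \<bullet> x}"
    using simplex_cut[OF H(1) S] by force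
  have fin: "finite \<T>" using T(1) by (simp add: tiles_def)
  have TS: "\<Union>\<T> = S" by (rule tiles_simplex_eq[OF T(1) S])
  let ?T = "{T \<in> \<T>. T \<subseteq> halfspaces H}"
  have "negligible (S \<inter> halfspaces H - \<Union>?T)"
  proof (rule negligible_subset)
    show "negligible (\<Union>(a, b)\<in>H. {x. a \<bullet> x = b})"
      using H by (intro negligible_Union) (auto intro!: negligible_hyperplane)
    show "S \<inter> halfspaces H - \<Union>?T \<subseteq> (\<Union>(a, b)\<in>H. {x. a \<bullet> x = b})"
    proof clarify
      fix x assume x: "x \<in> S" "x \<in> halfspaces H" "x \<notin> \<Union>?T"
      then obtain T where T': "T \<in> \<T>" "x \<in> T" using TS by blast
      with x(3) have "\<not> T \<subseteq> halfspaces H" by blast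
      then obtain a b where ab: "(a, b) \<in> H" "\<not> T \<subseteq> {x. a \<bullet> x \<le> b}"
        unfolding halfspaces_def by blast
      then have "T \<subseteq> {x. b \<le> a \<bullet> x}" using T(3)[OF T'(1) ab(1)] by simp
      then have "a \<bullet> x = b" using T'(2) x(2) ab(1) by (fastforce simp: halfspaces_def)
      then show "x \<in> (\<Union>(a, b)\<in>H. {x. a \<bullet> x = b})" using ab(1) by auto
    qed
  qed
  moreover have "\<Union>?T - S \<inter> halfspaces H = {}" using TS by auto
  ultimately have "tiles ?T (S \<inter> halfspaces H)"
    using T(1) fin by (auto simp: tiles_def pairwise_def)
  moreover have "card ?T \<le> card \<T>" using fin by (intro card_mono) auto
  ultimately show ?thesis using T(2) TS by (intro exI[of _ ?T]) auto
qed

lemma full_simplex_halfspaces: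
  fixes S :: "(real^'n::finite) set"
  assumes "S \<in> full_simplices"
  shows "\<exists>H. finite H \<and> (\<forall>(a, b)\<in>H. a \<noteq> 0) \<and> S = halfspaces H"
proof -
  obtain v where v: "aff_indep_tuple v" "S = convex hull (range (($) v))"
    using assms by (auto simp: full_simplices_def)
  have "S = halfspaces (range (\<lambda>i. (- bary_grad v i, bary v 0 $ i)))"
  proof -
    have "0 \<le> bary v x $ i \<longleftrightarrow> - bary_grad v i \<bullet> x \<le> bary v 0 $ i" for x i
      using bary_eq[of v x i] by auto
    then show ?thesis
      unfolding v(2) set_eq_iff mem_simplex_iff[OF v(1)] halfspaces_def by auto
  qed
  then show ?thesis using bary_grad_nz[OF v(1)]
    by (intro exI[of _ "range (\<lambda>i. (- bary_grad v i, bary v 0 $ i))"]) auto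
qed

section \<open>Finitely additive charges on simplices and boxes\<close>

subsection \<open>Finitely additive extension to polyhedral sets\<close>

definition polyhedral :: "(real^'n::finite) set \<Rightarrow> bool" where
  "polyhedral P \<longleftrightarrow> (\<exists>\<T>. tiles \<T> P)"

definition simplex_additive :: "((real^'n::finite) set \<Rightarrow> real) \<Rightarrow> bool" where
  "simplex_additive B \<longleftrightarrow> (\<forall>S\<in>full_simplices. \<forall>\<T>. tiles \<T> S \<longrightarrow> B S = sum B \<T>)"

text \<open>An arbitrary tiling is chosen. For additive \<open>B\<close> the value does not depend
  on it; for sets without a tiling the value is unspecified.\<close>

definition extend :: "((real^'n::finite) set \<Rightarrow> real) \<Rightarrow> (real^'n) set \<Rightarrow> real" where
  "extend B P = sum B (SOME \<T>. tiles \<T> P)"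

lemma polyhedral_simplex_Int:
  assumes "S \<in> full_simplices" "T \<in> full_simplices" shows "polyhedral (S \<inter> T)"
  using full_simplex_halfspaces[OF assms(2)] tiles_Int_halfspaces[OF _ _ assms(1)]
  unfolding polyhedral_def by metis

lemma tiles_Int:
  assumes "tiles \<T> P" "tiles \<U> Q" "\<And>S T. S \<in> \<T> \<Longrightarrow> T \<in> \<U> \<Longrightarrow> tiles (f S T) (S \<inter> T)"
  shows "tiles (\<Union>(S, T)\<in>\<T> \<times> \<U>. f S T) (P \<inter> Q)"
proof -
  have fin: "finite (\<T> \<times> \<U>)" using assms by (auto simp: tiles_def)
  have "tiles (\<Union>X\<in>\<T> \<times> \<U>. (\<lambda>(S, T). f S T) X) (\<Union>X\<in>\<T> \<times> \<U>. (\<lambda>(S, T). S \<inter> T) X)"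
  proof (rule tiles_UN(1)[OF fin])
    fix X Y assume *: "X \<in> \<T> \<times> \<U>" "Y \<in> \<T> \<times> \<U>" "X \<noteq> Y"
    then have "negligible (fst X \<inter> fst Y) \<or> negligible (snd X \<inter> snd Y)"
      using tiles_disjoint[OF assms(1)] tiles_disjoint[OF assms(2)]
      by (metis mem_Times_iff prod_eq_iff)
    then show "negligible ((\<lambda>(S, T). S \<inter> T) X \<inter> (\<lambda>(S, T). S \<inter> T) Y)"
      by (elim disjE; elim negligible_subset) (auto simp: case_prod_beta)
  qed (use assms(3) in auto)
  then have "tiles (\<Union>(S, T)\<in>\<T> \<times> \<U>. f S T) (\<Union>X\<in>\<T> \<times> \<U>. (\<lambda>(S, T). S \<inter> T) X)" by simp
  moreover have n: "negligible ((\<Union>\<T> - P) \<union> (\<Union>\<U> - Q))" "negligible ((P - \<Union>\<T>) \<union> (Q - \<Union>\<U>))"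
    using assms by (auto simp: tiles_def)
  have "negligible ((\<Union>X\<in>\<T> \<times> \<U>. (\<lambda>(S, T). S \<inter> T) X) - P \<inter> Q)"
    by (rule negligible_subset[OF n(1)]) auto
  moreover have "negligible (P \<inter> Q - (\<Union>X\<in>\<T> \<times> \<U>. (\<lambda>(S, T). S \<inter> T) X))"
    by (rule negligible_subset[OF n(2)]) fastforce
  ultimately show ?thesis by (rule tiles_cong)
qed

lemma polyhedral_Int: assumes "polyhedral P" "polyhedral Q" shows "polyhedral (P \<inter> Q)"
proof -
  obtain \<T> \<U> where TU: "tiles \<T> P" "tiles \<U> Q" using assms by (auto simp: polyhedral_def)
  then have "\<forall>S\<in>\<T>. \<forall>T\<in>\<U>. \<exists>\<V>. tiles \<V> (S \<inter> T)"
    using polyhedral_simplex_Int unfolding tiles_def polyhedral_def by blast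
  then obtain f where "\<And>S T. S \<in> \<T> \<Longrightarrow> T \<in> \<U> \<Longrightarrow> tiles (f S T) (S \<inter> T)" by metis
  from tiles_Int[OF TU this] show ?thesis by (auto simp: polyhedral_def)
qed

text \<open>Two tilings have a common refinement: their pairwise intersections are again polyhedral
  by the cutting lemmas, and summing over the refinement in either order gives the two
  sides.\<close>

lemma simplex_additive_tiles:
  assumes B: "simplex_additive B" and T: "tiles \<T> P" and U: "tiles \<U> P"
  shows "sum B \<T> = sum B \<U>"
proof -
  have "\<forall>S\<in>\<T>. \<forall>T\<in>\<U>. \<exists>\<V>. tiles \<V> (S \<inter> T)"
    using polyhedral_simplex_Int T U unfolding tiles_def polyhedral_def by blast
  then obtain f where f: "\<And>S T. S \<in> \<T> \<Longrightarrow> T \<in> \<U> \<Longrightarrow> tiles (f S T) (S \<inter> T)" by metis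
  have fin: "finite \<T>" "finite \<U>" using T U by (auto simp: tiles_def)
  have 1: "B S = (\<Sum>T\<in>\<U>. sum B (f S T))" if "S \<in> \<T>" for S
  proof -
    have "negligible (S \<inter> T \<inter> (S \<inter> T'))" if "T \<in> \<U>" "T' \<in> \<U>" "T \<noteq> T'" for T T'
      by (rule negligible_subset[OF tiles_disjoint[OF U that]]) auto
    note tU = tiles_UN[where P = "\<lambda>T. S \<inter> T" and f = "f S", OF fin(2) f[OF that] this, simplified]
    have t: "tiles (\<Union>T\<in>\<U>. f S T) (\<Union>T\<in>\<U>. S \<inter> T)" and s: "sum B (\<Union>T\<in>\<U>. f S T) = (\<Sum>T\<in>\<U>. sum B (f S T))"
      using tU by auto
    have "negligible ((\<Union>\<T> - P) \<union> (P - \<Union>\<U>))" using T U by (auto simp: tiles_def)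
    then have "negligible (S - (\<Union>T\<in>\<U>. S \<inter> T))" by (rule negligible_subset) (use that in auto)
    moreover have "(\<Union>T\<in>\<U>. S \<inter> T) - S = {}" by auto
    ultimately have "tiles (\<Union>T\<in>\<U>. f S T) S" using tiles_cong[OF t] by simp
    then show ?thesis using B s that T by (auto simp: simplex_additive_def tiles_def)
  qed
  have 2: "B T = (\<Sum>S\<in>\<T>. sum B (f S T))" if "T \<in> \<U>" for T
  proof -
    have "negligible (S \<inter> T \<inter> (S' \<inter> T))" if "S \<in> \<T>" "S' \<in> \<T>" "S \<noteq> S'" for S S'
      by (rule negligible_subset[OF tiles_disjoint[OF T that]]) auto
    note tU = tiles_UN[where P = "\<lambda>S. S \<inter> T" and f = "\<lambda>S. f S T", OF fin(1) f[OF _ that] this, simplified]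
    have t: "tiles (\<Union>S\<in>\<T>. f S T) (\<Union>S\<in>\<T>. S \<inter> T)" and s: "sum B (\<Union>S\<in>\<T>. f S T) = (\<Sum>S\<in>\<T>. sum B (f S T))"
      using tU by auto
    have "negligible ((\<Union>\<U> - P) \<union> (P - \<Union>\<T>))" using T U by (auto simp: tiles_def)
    then have "negligible (T - (\<Union>S\<in>\<T>. S \<inter> T))" by (rule negligible_subset) (use that in auto)
    moreover have "(\<Union>S\<in>\<T>. S \<inter> T) - T = {}" by auto
    ultimately have "tiles (\<Union>S\<in>\<T>. f S T) T" using tiles_cong[OF t] by simp
    then show ?thesis using B s that U by (auto simp: simplex_additive_def tiles_def)
  qed
  have "sum B \<T> = (\<Sum>S\<in>\<T>. \<Sum>T\<in>\<U>. sum B (f S T))" using 1 by simp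
  also have "\<dots> = (\<Sum>T\<in>\<U>. \<Sum>S\<in>\<T>. sum B (f S T))" by (rule sum.swap)
  also have "\<dots> = sum B \<U>" using 2 by simp
  finally show ?thesis .
qed

lemma extend_eq:
  assumes "simplex_additive B" "tiles \<T> P" shows "extend B P = sum B \<T>"
  unfolding extend_def
  by (rule simplex_additive_tiles[OF assms(1) someI[of "\<lambda>\<T>. tiles \<T> P", OF assms(2)] assms(2)])

lemma extend_simplex: "simplex_additive B \<Longrightarrow> S \<in> full_simplices \<Longrightarrow> extend B S = B S"
  using extend_eq[OF _ tiles_singleton] by fastforce

lemma polyhedral_cong:
  "polyhedral P \<Longrightarrow> negligible (P - Q) \<Longrightarrow> negligible (Q - P) \<Longrightarrow> polyhedral Q"
  unfolding polyhedral_def using tiles_cong by blast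

lemma extend_cong:
  assumes "simplex_additive B" "polyhedral P" "negligible (P - Q)" "negligible (Q - P)"
  shows "extend B P = extend B Q"
proof -
  obtain \<T> where "tiles \<T> P" using assms by (auto simp: polyhedral_def)
  with tiles_cong[OF this assms(3,4)] show ?thesis using extend_eq[OF assms(1)] by metis
qed

lemma extend_negligible:
  assumes "simplex_additive B" "negligible P" shows "extend B P = 0"
  using extend_eq[OF assms(1), of "{}" P] assms(2) by (simp add: tiles_def)

lemma polyhedral_UN_extend:
  assumes "finite I" "\<And>i. i \<in> I \<Longrightarrow> polyhedral (P i)"
    and "\<And>i j. i \<in> I \<Longrightarrow> j \<in> I \<Longrightarrow> i \<noteq> j \<Longrightarrow> negligible (P i \<inter> P j)"
  shows "polyhedral (\<Union>i\<in>I. P i)"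
    and "simplex_additive B \<Longrightarrow> extend B (\<Union>i\<in>I. P i) = (\<Sum>i\<in>I. extend B (P i))"
proof -
  obtain f where f: "\<And>i. i \<in> I \<Longrightarrow> tiles (f i) (P i)" using assms(2) unfolding polyhedral_def by metis
  have t: "tiles (\<Union>i\<in>I. f i) (\<Union>i\<in>I. P i)"
      "sum B (\<Union>i\<in>I. f i) = (\<Sum>i\<in>I. sum B (f i))"
    by (rule tiles_UN[OF assms(1), where P = P]; use f assms(3) in blast)+
  show "polyhedral (\<Union>i\<in>I. P i)" using t(1) by (auto simp: polyhedral_def)
  show "extend B (\<Union>i\<in>I. P i) = (\<Sum>i\<in>I. extend B (P i))" if B: "simplex_additive B"
    using extend_eq[OF B t(1)] extend_eq[OF B f] t(2) by simp
qed

lemma simplex_contains_bounded: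
  fixes A :: "(real^'n::finite) set"
  assumes "bounded A"
  obtains S where "S \<in> full_simplices" "A \<subseteq> S"
proof -
  obtain R where R: "R > 0" "\<And>x. x \<in> A \<Longrightarrow> norm x \<le> R" using assms bounded_pos by blast
  \<comment> \<open>On the cube [-R, R]^d each coordinate (x_j + R) / L is at most 1 / d, so the d
    of them sum to at most 1 and the coordinate of the corner vertex stays nonnegative.\<close>
  define L where "L = 2 * R * real CARD('n)"
  have L: "L > 0" using R by (simp add: L_def)
  define v :: "'n vertex_tuple" where
    "v = (\<chi> k. case k of None \<Rightarrow> (\<chi> j. - R) | Some i \<Rightarrow> (\<chi> j. - R) + L *\<^sub>R axis i 1)"
  have "(\<chi> i. v $ Some i - v $ None) = (\<chi> i. L *\<^sub>R axis i 1)" by (simp add: v_def vec_eq_iff)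
  then have "orient_det v = (\<Prod>i\<in>(UNIV::'n set). L)"
    unfolding orient_det_def by (simp, subst det_diagonal) (auto simp: axis_def)
  then have ai: "aff_indep_tuple v" using L by (simp flip: orient_det_nz_iff)
  have "A \<subseteq> convex hull (range (($) v))"
  proof
    fix x assume "x \<in> A"
    then have "\<bar>x $ j\<bar> \<le> R" for j using R(2) component_le_norm_cart[of x j] order_trans by blast
    then have xj: "- R \<le> x $ j" "x $ j \<le> R" for j by (auto simp: abs_le_iff minus_le_iff)
    let ?u = "\<lambda>k. case k of None \<Rightarrow> 1 - (\<Sum>j\<in>UNIV. (x $ j + R) / L) | Some j \<Rightarrow> (x $ j + R) / L"
    have "(\<Sum>j\<in>UNIV. (x $ j + R) / L) \<le> (\<Sum>j\<in>(UNIV::'n set). 2 * R / L)"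
      using L xj by (intro sum_mono divide_right_mono) auto
    also have "\<dots> = 1" using R by (simp add: L_def)
    finally have "0 \<le> ?u k" for k using xj L by (auto split: option.splits simp: add_increasing2 add_nonneg_nonneg)
      (smt (verit) divide_nonneg_pos)
    moreover have "sum ?u UNIV = 1" by (simp add: sum_option)
    moreover have "x = (\<Sum>k\<in>UNIV. ?u k *\<^sub>R v $ k)"
    proof -
      have "(\<Sum>k\<in>UNIV. ?u k *\<^sub>R v $ k) = (\<Sum>k\<in>UNIV. ?u k *\<^sub>R (\<chi> j. - R)) + (\<Sum>i\<in>UNIV. (x $ i + R) *\<^sub>R axis i 1)"
        using L by (simp add: sum_option v_def sum.distrib scaleR_add_right)
      also have "(\<Sum>k\<in>UNIV. ?u k *\<^sub>R (\<chi> j. - R)) = (\<chi> j. - R)"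
        by (simp flip: scaleR_sum_left add: \<open>sum ?u UNIV = 1\<close>)
      finally show ?thesis
        by (simp add: vec_eq_iff axis_def if_distrib cong: if_cong)
    qed
    ultimately show "x \<in> convex hull (range (($) v))" unfolding convex_hull_range by (auto intro!: exI[of _ ?u])
  qed
  then show ?thesis using that full_simplicesI[OF ai] by blast
qed

subsection \<open>Oriented simplices and their bodies\<close>

lemma range_permuted_tuple:
  fixes v :: "'n::finite vertex_tuple"
  assumes "p permutes UNIV" shows "range (($) (\<chi> i. v $ p i)) = range (($) v)"
proof -
  have "range (($) (\<chi> i. v $ p i)) = ($) v ` (p ` UNIV)" by auto
  then show ?thesis using permutes_image[OF assms] by simp
qed

lemma aff_indep_permuted:
  fixes v :: "'n::finite vertex_tuple"
  assumes "p permutes UNIV" "aff_indep_tuple v" shows "aff_indep_tuple (\<chi> i. v $ p i)"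
  using assms orient_det_permute[OF assms(1), of v] by (simp flip: orient_det_nz_iff)

lemma self_in_osimplex_of: "v \<in> osimplex_of v"
proof -
  have "\<exists>p. v = (\<chi> i. v $ p i) \<and> p permutes UNIV \<and> evenperm p"
    by (rule exI[of _ id]) (simp add: permutes_id)
  then show ?thesis unfolding osimplex_of_def by blast
qed

lemma vertices_osimplex_of: "vertices (osimplex_of v) = range (($) v)"
  using self_in_osimplex_of[of v] range_permuted_tuple
  unfolding vertices_def osimplex_of_def by (intro equalityI UN_least UN_upper) auto

lemma body_osimplex_of: "body (osimplex_of v) = convex hull (range (($) v))"
  by (simp add: body_def vertices_osimplex_of)

lemma orientation_sign_osimplex_of: "orientation_sign (osimplex_of v) = sgn (orient_det v)"
proof -
  have "(SOME w. w \<in> osimplex_of v) \<in> osimplex_of v" using self_in_osimplex_of by (rule someI)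
  then obtain p where p: "(SOME w. w \<in> osimplex_of v) = (\<chi> i. v $ p i)" "p permutes UNIV" "evenperm p"
    by (auto simp: osimplex_of_def)
  have "orient_det (SOME w. w \<in> osimplex_of v) = orient_det v"
    unfolding p(1) by (simp add: orient_det_permute[OF p(2)] sign_def p(3))
  then show ?thesis by (simp add: orientation_sign_def orient_det_def)
qed

lemma osimplex_of_permuted_subset:
  fixes v :: "'n::finite vertex_tuple"
  assumes p: "p permutes UNIV" "evenperm p"
  shows "osimplex_of (\<chi> i. v $ p i) \<subseteq> osimplex_of v"
proof
  fix w assume "w \<in> osimplex_of (\<chi> i. v $ p i)"
  then obtain q where q: "w = (\<chi> i. v $ p (q i))" "q permutes UNIV" "evenperm q"
    by (auto simp: osimplex_of_def)
  have "evenperm (p \<circ> q)"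
    using evenperm_comp[of p q] p q by (auto simp: permutation_permutes intro: exI[of _ UNIV])
  with q p show "w \<in> osimplex_of v"
    unfolding osimplex_of_def by (intro CollectI exI[of _ "p \<circ> q"]) (auto intro: permutes_compose)
qed

lemma osimplex_of_permuted:
  fixes v :: "'n::finite vertex_tuple"
  assumes p: "p permutes UNIV" "evenperm p"
  shows "osimplex_of (\<chi> i. v $ p i) = osimplex_of v"
proof
  have i: "inv p permutes UNIV" using p by (rule_tac permutes_inv)
  have e: "evenperm (inv p)" using p by (subst evenperm_inv) (auto simp: permutation_permutes intro: exI[of _ UNIV])
  have "(\<chi> i. (\<chi> i. v $ p i) $ inv p i) = v" using permutes_inverses(1)[OF p(1)] by (simp add: vec_eq_iff)
  then show "osimplex_of v \<subseteq> osimplex_of (\<chi> i. v $ p i)"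
    using osimplex_of_permuted_subset[OF i e, of "\<chi> i. v $ p i"] by simp
qed (rule osimplex_of_permuted_subset[OF p])

lemma ex_odd_permutation:
  obtains q :: "'n::finite option \<Rightarrow> 'n option" where "q permutes UNIV" "\<not> evenperm q"
proof
  let ?q = "Transposition.transpose None (Some (undefined :: 'n))"
  show "?q permutes UNIV" by (rule permutes_swap_id) auto
  show "\<not> evenperm ?q" by (simp add: evenperm_swap)
qed

text \<open>The odd permutations form a single coset of the even ones, so one odd \<open>q\<close>
  already represents the opposite orientation.\<close>

lemma opposite_osimplex_of:
  fixes v :: "'n::finite vertex_tuple"
  assumes q: "q permutes UNIV" "\<not> evenperm q"
  shows "opposite (osimplex_of v) = osimplex_of (\<chi> i. v $ q i)"
proof
  have perm: "permutation p" if "p permutes UNIV" for p :: "'n option \<Rightarrow> 'n option"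
    using that by (auto simp: permutation_permutes)
  show "opposite (osimplex_of v) \<subseteq> osimplex_of (\<chi> i. v $ q i)"
  proof
    fix w assume "w \<in> opposite (osimplex_of v)"
    then obtain p r where pr: "w = (\<chi> i. v $ p (r i))" "p permutes UNIV" "evenperm p" "r permutes UNIV" "\<not> evenperm r"
      by (auto simp: opposite_def osimplex_of_def)
    let ?s = "inv q \<circ> (p \<circ> r)"
    have "evenperm ?s"
      using evenperm_comp[of p r] evenperm_comp[of "inv q" "p \<circ> r"] evenperm_inv[of q] pr q
      by (simp add: perm permutes_inv permutation_compose)
    moreover have "?s permutes UNIV" using pr q by (intro permutes_compose permutes_inv)
    moreover have "w = (\<chi> i. (\<chi> i. v $ q i) $ ?s i)"
      using permutes_inverses(1)[OF q(1)] by (simp add: pr(1) vec_eq_iff)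
    ultimately show "w \<in> osimplex_of (\<chi> i. v $ q i)" unfolding osimplex_of_def by blast
  qed
  show "osimplex_of (\<chi> i. v $ q i) \<subseteq> opposite (osimplex_of v)"
  proof
    fix w assume "w \<in> osimplex_of (\<chi> i. v $ q i)"
    then obtain p where p: "w = (\<chi> i. v $ q (p i))" "p permutes UNIV" "evenperm p"
      by (auto simp: osimplex_of_def)
    have "\<not> evenperm (q \<circ> p)" using evenperm_comp[of q p] p q by (simp add: perm)
    moreover have "q \<circ> p permutes UNIV" using p q by (intro permutes_compose)
    moreover have "w = (\<chi> i. v $ (q \<circ> p) i)" using p by simp
    ultimately show "w \<in> opposite (osimplex_of v)"
      using self_in_osimplex_of[of v] unfolding opposite_def by blast
  qed
qed

lemma osimplicesE:
  assumes "\<sigma> \<in> osimplices" obtains v where "aff_indep_tuple v" "\<sigma> = osimplex_of v"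
  using assms by (auto simp: osimplices_def)

lemma osimplex_of_in: "aff_indep_tuple v \<Longrightarrow> osimplex_of v \<in> osimplices"
  by (auto simp: osimplices_def)

lemma osimplex_opposite:
  assumes "\<sigma> \<in> osimplices"
  shows "opposite \<sigma> \<in> osimplices" "body (opposite \<sigma>) = body \<sigma>"
    "orientation_sign (opposite \<sigma>) = - orientation_sign \<sigma>"
proof -
  obtain v where v: "aff_indep_tuple v" "\<sigma> = osimplex_of v" using assms by (rule osimplicesE)
  obtain q :: "'a option \<Rightarrow> 'a option" where q: "q permutes UNIV" "\<not> evenperm q" by (rule ex_odd_permutation)
  show "opposite \<sigma> \<in> osimplices" "body (opposite \<sigma>) = body \<sigma>"
    "orientation_sign (opposite \<sigma>) = - orientation_sign \<sigma>"
    unfolding v(2) opposite_osimplex_of[OF q] body_osimplex_of orientation_sign_osimplex_of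
      range_permuted_tuple[OF q(1)]
    using aff_indep_permuted[OF q(1) v(1)] orient_det_permute[OF q(1), of v] q(2)
    by (auto simp: osimplex_of_in sign_def sgn_minus)
qed

lemma body_full_simplex: "\<sigma> \<in> osimplices \<Longrightarrow> body \<sigma> \<in> full_simplices"
  by (elim osimplicesE) (simp add: body_osimplex_of full_simplicesI)

lemma orientation_sign_cases: "\<sigma> \<in> osimplices \<Longrightarrow> orientation_sign \<sigma> = 1 \<or> orientation_sign \<sigma> = -1"
  by (elim osimplicesE) (auto simp: orientation_sign_osimplex_of sgn_if simp flip: orient_det_nz_iff)

text \<open>The vertices are the extreme points of the hull, so tuples with equal hulls have the
  same set of entries.\<close>

lemma same_hull_permuted:
  fixes v w :: "'n::finite vertex_tuple"
  assumes v: "aff_indep_tuple v" and w: "aff_indep_tuple w"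
    and eq: "convex hull (range (($) v)) = convex hull (range (($) w))"
  obtains p where "p permutes UNIV" "w = (\<chi> i. v $ p i)"
proof -
  have "x \<in> range (($) v) \<longleftrightarrow> x \<in> range (($) w)" for x
    using extreme_point_of_convex_hull_affine_independent[of "range (($) v)" x]
      extreme_point_of_convex_hull_affine_independent[of "range (($) w)" x] v w eq
    by (simp add: aff_indep_tuple_def)
  then have r: "range (($) v) = range (($) w)" by blast
  define p where "p i = inv (($) v) (w $ i)" for i
  have pw: "v $ p i = w $ i" for i
    unfolding p_def using r by (intro f_inv_into_f) auto
  have "inj p"
    using w pw unfolding inj_def aff_indep_tuple_def by metis
  then have "bij p" by (simp add: bij_def finite_UNIV_inj_surj)
  then have "p permutes UNIV" by (simp add: permutes_def bij_pointE) (metis bij_pointE)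
  then show ?thesis using that pw by (simp add: vec_eq_iff)
qed

text \<open>Tuples with the same hull differ by a permutation, and an odd one would reverse the sign
  of the determinant. This is what allows orientations to be dropped in favour of point
  sets.\<close>

lemma osimplex_eqI:
  assumes "\<sigma> \<in> osimplices" "\<tau> \<in> osimplices" "body \<sigma> = body \<tau>" "orientation_sign \<sigma> = orientation_sign \<tau>"
  shows "\<sigma> = \<tau>"
proof -
  obtain v w where v: "aff_indep_tuple v" "\<sigma> = osimplex_of v" and w: "aff_indep_tuple w" "\<tau> = osimplex_of w"
    using assms(1,2) by (auto elim!: osimplicesE)
  obtain p where p: "p permutes UNIV" "w = (\<chi> i. v $ p i)"
    using same_hull_permuted[OF v(1) w(1)] assms(3) by (auto simp: v w body_osimplex_of)
  have "sgn (orient_det v) = sgn (orient_det w)"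
    using assms(4) by (simp add: v w orientation_sign_osimplex_of)
  moreover have "orient_det v \<noteq> 0" using v(1) by (simp add: orient_det_nz_iff)
  ultimately have "evenperm p"
    unfolding p(2) orient_det_permute[OF p(1)] by (auto simp: sign_def sgn_minus sgn_0_0 split: if_splits)
  then show ?thesis unfolding v w p(2) by (rule osimplex_of_permuted[OF p(1), symmetric])
qed

lemma ex_oriented:
  fixes S :: "(real^'n::finite) set"
  assumes "S \<in> full_simplices" "s = 1 \<or> s = -1"
  shows "\<exists>\<sigma>\<in>osimplices. body \<sigma> = S \<and> orientation_sign \<sigma> = s"
proof -
  obtain v where v: "aff_indep_tuple v" "S = convex hull (range (($) v))"
    using assms by (auto simp: full_simplices_def)
  have o: "osimplex_of v \<in> osimplices" "body (osimplex_of v) = S"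
    using v by (auto simp: osimplex_of_in body_osimplex_of)
  show ?thesis
  proof (cases "orientation_sign (osimplex_of v) = s")
    case False
    then have "orientation_sign (opposite (osimplex_of v)) = s"
      using orientation_sign_cases[OF o(1)] osimplex_opposite(3)[OF o(1)] assms(2) by auto
    then show ?thesis using osimplex_opposite[OF o(1)] o(2) by blast
  qed (use o in blast)
qed

definition oriented :: "real \<Rightarrow> (real^'n::finite) set \<Rightarrow> 'n osimplex" where
  "oriented s S = (SOME \<sigma>. \<sigma> \<in> osimplices \<and> body \<sigma> = S \<and> orientation_sign \<sigma> = s)"

lemma oriented:
  assumes "S \<in> full_simplices" "s = 1 \<or> s = -1"
  shows "oriented s S \<in> osimplices" "body (oriented s S) = S" "orientation_sign (oriented s S) = s"
  using someI_ex[OF ex_oriented[OF assms, unfolded Bex_def]] unfolding oriented_def by blast+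

lemma oriented_eqI: "\<sigma> \<in> osimplices \<Longrightarrow> oriented (orientation_sign \<sigma>) (body \<sigma>) = \<sigma>"
  by (intro osimplex_eqI oriented body_full_simplex orientation_sign_cases)

lemma subdivides_tiles:
  assumes "subdivides T P s"
  shows "tiles (body ` T) P" "inj_on body T"
proof -
  have T: "T \<subseteq> osimplices" "finite T" using assms by (auto simp: subdivides_def)
  show inj: "inj_on body T"
    using assms by (intro inj_onI osimplex_eqI) (auto simp: subdivides_def)
  show "tiles (body ` T) P"
    unfolding tiles_def
    using assms body_full_simplex by (auto simp: subdivides_def pairwise_def)
qed

lemma tiles_subdivides:
  assumes "tiles \<T> P" "\<Union>\<T> = P" "s = 1 \<or> s = -1"
  shows "subdivides (oriented s ` \<T>) P s" "inj_on (oriented s) \<T>"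
proof -
  note o = oriented[OF tiles_full[OF assms(1)] assms(3)]
  show "inj_on (oriented s) \<T>" by (rule inj_onI) (metis o(2))
  show "subdivides (oriented s ` \<T>) P s"
    unfolding subdivides_def
  proof (intro conjI ballI impI)
    fix \<tau> \<tau>' assume *: "\<tau> \<in> oriented s ` \<T>" "\<tau>' \<in> oriented s ` \<T>" "\<tau> \<noteq> \<tau>'"
    then obtain S S' where "S \<in> \<T>" "S' \<in> \<T>" "\<tau> = oriented s S" "\<tau>' = oriented s S'" by auto
    with * o tiles_disjoint[OF assms(1)] show "negligible (body \<tau> \<inter> body \<tau>')" by metis
  qed (use assms o tiles_finite[OF assms(1)] in auto)
qed

definition charge :: "('n::finite osimplex \<Rightarrow> real) \<Rightarrow> (real^'n) set \<Rightarrow> real" where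
  "charge A S = A (oriented 1 S)"

lemma charge_body:
  assumes A: "A \<in> Omega" and \<sigma>: "\<sigma> \<in> osimplices"
  shows "A \<sigma> = orientation_sign \<sigma> * charge A (body \<sigma>)"
proof (cases "orientation_sign \<sigma> = 1")
  case True
  then show ?thesis using oriented_eqI[OF \<sigma>] by (simp add: charge_def)
next
  case False
  then have s: "orientation_sign \<sigma> = -1" using orientation_sign_cases[OF \<sigma>] by simp
  note o = osimplex_opposite[OF \<sigma>]
  have "oriented 1 (body \<sigma>) = opposite \<sigma>" using oriented_eqI[OF o(1)] o s by simp
  moreover have "A (opposite \<sigma>) = - A \<sigma>" using A \<sigma> by (auto simp: Omega_def)
  ultimately show ?thesis using s by (simp add: charge_def)
qed

lemma sum_charge:
  assumes "A \<in> Omega" "subdivides T P s" "s = 1 \<or> s = -1"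
  shows "sum A T = s * sum (charge A) (body ` T)"
proof -
  have "sum A T = (\<Sum>\<tau>\<in>T. s * charge A (body \<tau>))"
    using assms(2) charge_body[OF assms(1)] by (intro sum.cong) (auto simp: subdivides_def)
  then show ?thesis
    using subdivides_tiles(2)[OF assms(2)] by (simp add: sum.reindex sum_distrib_left)
qed

text \<open>Subdivisions require the union to be exactly the simplex, whereas tilings ignore null
  sets. For full simplices the two agree by \<open>tiles_simplex_eq\<close>.\<close>

lemma charge_additive:
  assumes A: "A \<in> Omega" shows "simplex_additive (charge A)"
  unfolding simplex_additive_def
proof (intro ballI allI impI)
  fix S :: "(real^'a) set" and \<T> assume S: "S \<in> full_simplices" and T: "tiles \<T> S"
  note o = oriented[OF S, of 1, simplified]
  note s = tiles_subdivides[OF T tiles_simplex_eq[OF T S], of 1, simplified]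
  have "subdivision (oriented 1 ` \<T>) (oriented 1 S)" using s(1) o by (simp add: subdivision_def)
  then have "A (oriented 1 S) = sum A (oriented 1 ` \<T>)" using A o by (auto simp: Omega_def)
  then show "charge A S = sum (charge A) \<T>"
    using s(2) by (simp add: charge_def sum.reindex)
qed

lemma orient_det_measurable [measurable]: "orient_det \<in> borel_measurable borel"
  unfolding orient_det_def[abs_def] det_def
  by (intro borel_measurable_continuous_onI continuous_intros)

definition measurable_charge :: "((real^'n::finite) set \<Rightarrow> real) \<Rightarrow> bool" where
  "measurable_charge B \<longleftrightarrow>
     (\<lambda>v. B (convex hull (range (($) v)))) \<in> borel_measurable (restrict_space borel {v. aff_indep_tuple v})"

lemma charge_measurable:
  assumes A: "A \<in> Omega" shows "measurable_charge (charge A)"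
proof -
  have [measurable]: "(\<lambda>v. A (osimplex_of v)) \<in> borel_measurable (restrict_space borel {v. aff_indep_tuple v})"
    "orient_det \<in> borel_measurable (restrict_space borel {v::'a vertex_tuple. aff_indep_tuple v})"
    using A by (auto simp: Omega_def intro: measurable_restrict_space1)
  have "(\<lambda>v. sgn (orient_det v) * A (osimplex_of v)) \<in> borel_measurable (restrict_space borel {v. aff_indep_tuple v})"
    by measurable
  moreover have "sgn (orient_det v) * A (osimplex_of v) = charge A (convex hull (range (($) v)))"
    if "aff_indep_tuple v" for v
    using charge_body[OF A osimplex_of_in[OF that]] that
    by (auto simp: body_osimplex_of orientation_sign_osimplex_of sgn_if simp flip: orient_det_nz_iff)
  ultimately show ?thesis
    unfolding measurable_charge_def
    using measurable_cong[of "restrict_space borel {v. aff_indep_tuple v}"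
      "\<lambda>v. sgn (orient_det v) * A (osimplex_of v)" "\<lambda>v. charge A (convex hull (range (($) v)))" borel]
    by (auto simp: space_restrict_space)
qed

definition of_charge :: "((real^'n::finite) set \<Rightarrow> real) \<Rightarrow> 'n osimplex \<Rightarrow> real" where
  "of_charge B \<sigma> = (if \<sigma> \<in> osimplices then orientation_sign \<sigma> * B (body \<sigma>) else 0)"

lemma of_charge_Omega:
  fixes B :: "(real^'n::finite) set \<Rightarrow> real"
  assumes add: "simplex_additive B" and meas: "measurable_charge B"
  shows "of_charge B \<in> Omega"
  unfolding Omega_def
proof (intro CollectI conjI allI ballI impI)
  show "of_charge B \<sigma> = 0" if "\<sigma> \<notin> osimplices" for \<sigma> using that by (simp add: of_charge_def)
  show "of_charge B (opposite \<sigma>) = - of_charge B \<sigma>" if "\<sigma> \<in> osimplices" for \<sigma>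
    using osimplex_opposite[OF that] that by (simp add: of_charge_def)
next
  fix \<sigma> :: "'n osimplex" and T assume \<sigma>: "\<sigma> \<in> osimplices" and "subdivision T \<sigma>"
  then have sub: "subdivides T (body \<sigma>) (orientation_sign \<sigma>)" by (simp add: subdivision_def)
  have "B (body \<sigma>) = sum B (body ` T)"
    using add subdivides_tiles(1)[OF sub] body_full_simplex[OF \<sigma>] by (auto simp: simplex_additive_def)
  also have "\<dots> = (\<Sum>\<tau>\<in>T. B (body \<tau>))" using subdivides_tiles(2)[OF sub] by (simp add: sum.reindex)
  finally have "of_charge B \<sigma> = (\<Sum>\<tau>\<in>T. orientation_sign \<sigma> * B (body \<tau>))"
    using \<sigma> by (simp add: of_charge_def sum_distrib_left)
  also have "\<dots> = (\<Sum>\<tau>\<in>T. of_charge B \<tau>)"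
    using sub by (intro sum.cong) (auto simp: of_charge_def subdivides_def)
  finally show "of_charge B \<sigma> = (\<Sum>\<tau>\<in>T. of_charge B \<tau>)" .
next
  have [measurable]: "orient_det \<in> borel_measurable (restrict_space borel {v::'n vertex_tuple. aff_indep_tuple v})"
    by (rule measurable_restrict_space1) measurable
  have "(\<lambda>v. sgn (orient_det v) * B (convex hull (range (($) v)))) \<in> borel_measurable (restrict_space borel {v. aff_indep_tuple v})"
    using meas unfolding measurable_charge_def by measurable
  then show "(\<lambda>v. of_charge B (osimplex_of v)) \<in> borel_measurable (restrict_space borel {v. aff_indep_tuple v})"
    by (subst measurable_cong[of _ _ "\<lambda>v. sgn (orient_det v) * B (convex hull (range (($) v)))"])
      (auto simp: space_restrict_space of_charge_def osimplex_of_in body_osimplex_of orientation_sign_osimplex_of)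
qed

lemma charge_of_charge: "S \<in> full_simplices \<Longrightarrow> charge (of_charge B) S = B S"
  using oriented[of S 1] by (simp add: charge_def of_charge_def)

subsection \<open>Boxes\<close>

definition box_halfspaces :: "real^'n::finite \<Rightarrow> real^'n \<Rightarrow> ((real^'n) \<times> real) set" where
  "box_halfspaces a b = range (\<lambda>j. (axis j 1, b $ j)) \<union> range (\<lambda>j. (- axis j 1, - a $ j))"

lemma box_halfspaces:
  fixes a b :: "real^'n::finite"
  shows "finite (box_halfspaces a b)" "\<forall>(c, e)\<in>box_halfspaces a b. c \<noteq> 0"
    "card (box_halfspaces a b) \<le> 2 * CARD('n)" "halfspaces (box_halfspaces a b) = cbox a b"
proof -
  show "finite (box_halfspaces a b)" "\<forall>(c, e)\<in>box_halfspaces a b. c \<noteq> 0"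
    by (auto simp: box_halfspaces_def)
  show "card (box_halfspaces a b) \<le> 2 * CARD('n)"
    unfolding box_halfspaces_def mult_2
    by (rule order.trans[OF card_Un_le]) (intro add_mono card_image_le finite)
  show "halfspaces (box_halfspaces a b) = cbox a b"
    unfolding halfspaces_def box_halfspaces_def ball_Un mem_box_cart set_eq_iff
    by (auto simp: inner_axis')
qed

text \<open>A box is the intersection of 2 d halfspaces, and each cut multiplies the number of
  pieces by at most \<open>cut_bound\<close>.\<close>

abbreviation box_bound :: "'n::finite itself \<Rightarrow> nat" where
  "box_bound _ \<equiv> cut_bound TYPE('n) ^ (2 * CARD('n))"

lemma tiles_simplex_cbox:
  fixes S :: "(real^'n::finite) set"
  assumes "S \<in> full_simplices"
  obtains \<T> where "tiles \<T> (S \<inter> cbox a b)" "card \<T> \<le> box_bound TYPE('n)" "\<forall>T\<in>\<T>. T \<subseteq> S \<inter> cbox a b"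
proof -
  note H = box_halfspaces[of a b]
  obtain \<T> where T: "tiles \<T> (S \<inter> cbox a b)" "card \<T> \<le> cut_bound TYPE('n) ^ card (box_halfspaces a b)"
    "\<forall>T\<in>\<T>. T \<subseteq> S \<inter> cbox a b"
    using tiles_Int_halfspaces[OF H(1,2) assms] unfolding H(4) by blast
  have "cut_bound TYPE('n) ^ card (box_halfspaces a b) \<le> box_bound TYPE('n)"
    using H(3) by (intro power_increasing) auto
  then have "card \<T> \<le> box_bound TYPE('n)" using T(2) by (rule order.trans[rotated])
  with T show ?thesis by (intro that) auto
qed

lemma tiles_cbox:
  fixes a b :: "real^'n::finite"
  obtains \<T> where "tiles \<T> (cbox a b)" "card \<T> \<le> box_bound TYPE('n)" "\<forall>T\<in>\<T>. T \<subseteq> cbox a b"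
proof -
  obtain S where S: "S \<in> full_simplices" "cbox a b \<subseteq> S" by (rule simplex_contains_bounded[OF bounded_cbox])
  then have "S \<inter> cbox a b = cbox a b" by auto
  then show ?thesis using tiles_simplex_cbox[OF S(1), of a b thesis] that by simp
qed

lemma polyhedral_cbox: "polyhedral (cbox a b)"
  unfolding polyhedral_def by (rule tiles_cbox[of a b]) blast

lemma polyhedral_full_simplex: "S \<in> full_simplices \<Longrightarrow> polyhedral S"
  unfolding polyhedral_def using tiles_singleton by blast

lemma extend_bound:
  fixes P :: "(real^'n::finite) set"
  assumes B: "simplex_additive B" and t: "tiles \<T> P" "card \<T> \<le> box_bound TYPE('n)"
    and M: "\<And>T. T \<in> \<T> \<Longrightarrow> \<bar>B T\<bar> \<le> M" "0 \<le> (M::real)"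
  shows "\<bar>extend B P\<bar> \<le> real (box_bound TYPE('n)) * M"
proof -
  have "\<bar>extend B P\<bar> \<le> (\<Sum>T\<in>\<T>. \<bar>B T\<bar>)" unfolding extend_eq[OF B t(1)] by (rule sum_abs)
  also have "\<dots> \<le> real (card \<T>) * M" using M(1) by (intro sum_bounded_above)
  also have "\<dots> \<le> real (box_bound TYPE('n)) * M"
    using t(2) M(2) by (intro mult_right_mono) (simp_all only: of_nat_le_iff)
  finally show ?thesis .
qed

lemma extend_cbox_bound:
  fixes a b :: "real^'n::finite"
  assumes B: "simplex_additive B" and M: "\<And>T. T \<in> full_simplices \<Longrightarrow> T \<subseteq> cbox a b \<Longrightarrow> \<bar>B T\<bar> \<le> M" "0 \<le> (M::real)"
  shows "\<bar>extend B (cbox a b)\<bar> \<le> real (box_bound TYPE('n)) * M"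
proof -
  obtain \<T> where T: "tiles \<T> (cbox a b)" "card \<T> \<le> box_bound TYPE('n)" "\<forall>T\<in>\<T>. T \<subseteq> cbox a b"
    by (rule tiles_cbox[of a b])
  show ?thesis by (rule extend_bound[OF B T(1,2) _ M(2)]) (use M(1)[OF tiles_full[OF T(1)]] T(3) in auto)
qed

lemma extend_simplex_cbox_bound:
  fixes a b :: "real^'n::finite"
  assumes B: "simplex_additive B" and S: "S \<in> full_simplices"
    and M: "\<And>T. T \<in> full_simplices \<Longrightarrow> T \<subseteq> cbox a b \<Longrightarrow> \<bar>B T\<bar> \<le> M" "0 \<le> (M::real)"
  shows "\<bar>extend B (S \<inter> cbox a b)\<bar> \<le> real (box_bound TYPE('n)) * M"
proof -
  obtain \<T> where T: "tiles \<T> (S \<inter> cbox a b)" "card \<T> \<le> box_bound TYPE('n)" "\<forall>T\<in>\<T>. T \<subseteq> S \<inter> cbox a b"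
    by (rule tiles_simplex_cbox[OF S, of a b])
  show ?thesis
    by (rule extend_bound[OF B T(1,2) _ M(2)]) (use M(1)[OF tiles_full[OF T(1)]] T(3) in auto)
qed

definition vmin :: "real^'n::finite \<Rightarrow> real^'n \<Rightarrow> real^'n" where "vmin x y = (\<chi> j. min (x $ j) (y $ j))"
definition vmax :: "real^'n::finite \<Rightarrow> real^'n \<Rightarrow> real^'n" where "vmax x y = (\<chi> j. max (x $ j) (y $ j))"

lemma vmin_nth [simp]: "vmin x y $ j = min (x $ j) (y $ j)" by (simp add: vmin_def)
lemma vmax_nth [simp]: "vmax x y $ j = max (x $ j) (y $ j)" by (simp add: vmax_def)

lemma origin_box_eq: "origin_box v = cbox (vmin 0 v) (vmax 0 v)"
proof (intro equalityI subsetI)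
  fix x assume "x \<in> origin_box v"
  then obtain t where t: "x = (\<Sum>j\<in>UNIV. (t j * v $ j) *\<^sub>R axis j 1)" "\<forall>j. t j \<in> {0..1}"
    by (auto simp: origin_box_def)
  have "x $ j = t j * v $ j" for j
    by (simp add: t(1) axis_def if_distrib cong: if_cong)
  moreover have "min 0 (v $ j) \<le> t j * v $ j \<and> t j * v $ j \<le> max 0 (v $ j)" for j
  proof (cases "0 \<le> v $ j")
    case True
    then show ?thesis using t(2) by (auto simp: min_def max_def mult_left_le_one_le)
  next
    case False
    then have "t j * v $ j \<le> 0" "1 * v $ j \<le> t j * v $ j"
      using t(2) by (auto intro!: mult_nonneg_nonpos mult_right_mono_neg simp del: mult_1)
    then show ?thesis using False by (auto simp: min_def max_def)
  qed
  ultimately show "x \<in> cbox (vmin 0 v) (vmax 0 v)" by (simp add: mem_box_cart)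
next
  fix x assume x: "x \<in> cbox (vmin 0 v) (vmax 0 v)"
  let ?t = "\<lambda>j. x $ j / v $ j"
  have xj: "min 0 (v $ j) \<le> x $ j \<and> x $ j \<le> max 0 (v $ j)" for j
    using x by (auto simp: mem_box_cart)
  have tj: "?t j \<in> {0..1}" for j
    using xj[of j] by (auto simp: divide_simps min_def max_def split: if_splits)
  have "?t j * v $ j = x $ j" for j using xj[of j] by (cases "v $ j = 0") auto
  then have "(\<Sum>j\<in>UNIV. (?t j * v $ j) *\<^sub>R axis j 1) = (\<Sum>j\<in>UNIV. (x $ j) *\<^sub>R axis j 1)"
    by (simp only:)
  moreover have "(\<Sum>j\<in>UNIV. (x $ j) *\<^sub>R axis j 1) = x" by (simp add: vec_eq_iff axis_def if_distrib cong: if_cong)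
  ultimately have xe: "x = (\<Sum>j\<in>UNIV. (?t j * v $ j) *\<^sub>R axis j 1)" by (rule trans[symmetric])
  show "x \<in> origin_box v"
    unfolding origin_box_def by (intro CollectI exI[of _ ?t] conjI allI) (rule xe, rule tj)
qed

text \<open>The part of the open box missed by a tiling is open and negligible, hence empty, and
  taking closures gives an exact cover. Since \<open>box_value\<close> selects a subdivision whose
  union is exactly the box, existence is needed for the selection to be meaningful.\<close>

lemma ex_subdivides_cbox:
  fixes a b :: "real^'n::finite"
  assumes "\<And>j. a $ j < b $ j"
  shows "\<exists>T. subdivides T (cbox a b) 1"
proof -
  obtain \<T> where T: "tiles \<T> (cbox a b)" "card \<T> \<le> box_bound TYPE('n)" "\<forall>T\<in>\<T>. T \<subseteq> cbox a b"
    by (rule tiles_cbox[of a b])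
  have cl: "closed (\<Union>\<T>)"
    using tiles_finite[OF T(1)] tiles_full[OF T(1)] full_simplex_closed by (intro closed_Union) auto
  have "negligible (box a b - \<Union>\<T>)"
    by (rule negligible_subset[OF tiles_negligible(2)[OF T(1)]]) (use box_subset_cbox in blast)
  then have "box a b \<subseteq> \<Union>\<T>"
    using open_not_negligible[of "box a b - \<Union>\<T>"] cl by (auto intro: open_Diff open_box)
  then have "closure (box a b) \<subseteq> \<Union>\<T>" by (rule closure_minimal[OF _ cl])
  moreover have "closure (box a b) = cbox a b"
  proof (rule closure_box)
    show "box a b \<noteq> {}" using assms by (auto simp: interval_ne_empty_cart)
  qed
  ultimately have "\<Union>\<T> = cbox a b" using T(3) by blast
  then show ?thesis using tiles_subdivides(1)[OF T(1)] by blast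
qed

text \<open>The d-fold increment between two corners in arbitrary position. The sign product
  vanishes for degenerate boxes, in agreement with the value 0 prescribed for them.\<close>

definition signed_box :: "((real^'n::finite) set \<Rightarrow> real) \<Rightarrow> real^'n \<Rightarrow> real^'n \<Rightarrow> real" where
  "signed_box B a b = (\<Prod>j\<in>UNIV. sgn (b $ j - a $ j)) * extend B (cbox (vmin a b) (vmax a b))"

lemma box_value_eq:
  fixes v :: "real^'n::finite"
  assumes A: "A \<in> Omega" shows "box_value A v = signed_box (charge A) 0 v"
proof (cases "\<exists>j. v $ j = 0")
  case True
  then have "(\<Prod>j\<in>UNIV. sgn (v $ j)) = 0" by (intro prod_zero) (auto simp: sgn_0_0)
  then show ?thesis using True by (simp add: box_value_def signed_box_def)
next
  case False
  let ?T = "SOME T. subdivides T (origin_box v) 1"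
  have "\<exists>T. subdivides T (origin_box v) 1"
    unfolding origin_box_eq using False by (intro ex_subdivides_cbox) (auto simp: min_def max_def less_le)
  then have s: "subdivides ?T (origin_box v) 1" by (rule someI_ex)
  have "sum A ?T = extend (charge A) (origin_box v)"
    using sum_charge[OF A s] extend_eq[OF charge_additive[OF A] subdivides_tiles(1)[OF s]] by simp
  then show ?thesis using False by (simp add: box_value_def signed_box_def origin_box_eq)
qed

lemma negligible_affine_stretch:
  fixes a c :: "real^'n::finite"
  assumes "negligible N" shows "negligible ((\<lambda>x. \<chi> j. a $ j + c $ j * x $ j) ` N)"
proof (rule negligible_differentiable_image_negligible[OF order_refl assms])
  have "bounded_linear (\<lambda>x::real^'n. \<chi> j. c $ j * x $ j)"
    unfolding linear_conv_bounded_linear[symmetric] by (rule linearI) (auto simp: vec_eq_iff algebra_simps)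
  then have "(\<lambda>x. a + (\<chi> j. c $ j * x $ j)) differentiable_on N"
    by (intro differentiable_on_add differentiable_on_const linear_imp_differentiable_on) (simp add: linear_conv_bounded_linear)
  moreover have "(\<lambda>x. a + (\<chi> j. c $ j * x $ j)) = (\<lambda>x. \<chi> j. a $ j + c $ j * x $ j)"
    by (auto simp: vec_eq_iff)
  ultimately show "(\<lambda>x. \<chi> j. a $ j + c $ j * x $ j) differentiable_on N" by simp
qed

lemma aff_indep_stretch:
  fixes v :: "'n::finite vertex_tuple" and a c :: "real^'n"
  assumes "aff_indep_tuple v" "\<And>j. c $ j \<noteq> 0"
  shows "aff_indep_tuple (\<chi> k. \<chi> j. a $ j + c $ j * v $ k $ j)"
proof -
  let ?M = "\<chi> i. v $ Some i - v $ None"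
  have "orient_det (\<chi> k. \<chi> j. a $ j + c $ j * v $ k $ j) = det (\<chi> i j. c $ j * ?M $ i $ j)"
    unfolding orient_det_def by (rule arg_cong[where f = det]) (simp add: vec_eq_iff algebra_simps)
  also have "\<dots> = det (\<chi> i. c $ i *s (transpose ?M $ i))"
    by (subst det_transpose[symmetric]) (rule arg_cong[where f = det], simp add: vec_eq_iff transpose_def)
  also have "\<dots> = (\<Prod>i\<in>UNIV. c $ i) * det (transpose ?M)"
    by (simp add: det_rows_mul vec_lambda_eta)
  finally show ?thesis using assms by (simp add: orient_det_def flip: orient_det_nz_iff)
qed

lemma hull_stretch:
  fixes v :: "'n::finite vertex_tuple" and a c :: "real^'n"
  shows "convex hull (range (($) (\<chi> k. \<chi> j. a $ j + c $ j * v $ k $ j)))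
     = (\<lambda>x. \<chi> j. a $ j + c $ j * x $ j) ` (convex hull (range (($) v)))"
proof -
  let ?L = "\<lambda>x. \<chi> j. a $ j + c $ j * x $ j"
  have "linear (\<lambda>x::real^'n. \<chi> j. c $ j * x $ j)"
    by (rule linearI) (auto simp: vec_eq_iff algebra_simps)
  then have "convex hull ((\<lambda>x. \<chi> j. c $ j * x $ j) ` range (($) v)) = (\<lambda>x. \<chi> j. c $ j * x $ j) ` (convex hull (range (($) v)))"
    by (rule convex_hull_linear_image[symmetric])
  then have "convex hull ((+) a ` ((\<lambda>x. \<chi> j. c $ j * x $ j) ` range (($) v)))
    = (+) a ` (\<lambda>x. \<chi> j. c $ j * x $ j) ` (convex hull (range (($) v)))"
    by (simp only: convex_hull_translation)
  moreover have "range (($) (\<chi> k. \<chi> j. a $ j + c $ j * v $ k $ j)) = (+) a ` (\<lambda>x. \<chi> j. c $ j * x $ j) ` range (($) v)"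
    unfolding image_image by (rule image_cong) (auto simp: vec_eq_iff)
  moreover have "?L ` T = (+) a ` (\<lambda>x. \<chi> j. c $ j * x $ j) ` T" for T
    unfolding image_image by (rule image_cong) (auto simp: vec_eq_iff)
  ultimately show ?thesis by simp
qed

lemma tiles_stretch:
  fixes a c :: "real^'n::finite"
  assumes t: "tiles \<T> P" and c: "\<And>j. c $ j \<noteq> 0"
  defines "L \<equiv> \<lambda>x. \<chi> j. a $ j + c $ j * x $ j"
  shows "tiles ((`) L ` \<T>) (L ` P)" "inj L"
proof -
  show inj: "inj L" using c by (auto simp: inj_def L_def vec_eq_iff)
  have neg: "negligible (L ` N)" if "negligible N" for N
    unfolding L_def by (rule negligible_affine_stretch[OF that])
  have "L ` S \<in> full_simplices" if S: "S \<in> \<T>" for S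
  proof -
    obtain v where v: "aff_indep_tuple v" "S = convex hull (range (($) v))"
      using tiles_full[OF t S] by (auto simp: full_simplices_def)
    then show ?thesis
      using full_simplicesI[OF aff_indep_stretch[OF v(1) c, of a]] unfolding hull_stretch L_def by simp
  qed
  moreover have "negligible (L ` S \<inter> L ` T)" if "S \<in> \<T>" "T \<in> \<T>" "L ` S \<noteq> L ` T" for S T
    using neg[OF tiles_disjoint[OF t that(1,2)]] that(3) by (auto simp: image_Int[OF inj])
  moreover have "\<Union>((`) L ` \<T>) = L ` (\<Union>\<T>)" by auto
  then have "\<Union>((`) L ` \<T>) - L ` P = L ` (\<Union>\<T> - P)" "L ` P - \<Union>((`) L ` \<T>) = L ` (P - \<Union>\<T>)"
    by (simp_all add: image_set_diff[OF inj])
  ultimately show "tiles ((`) L ` \<T>) (L ` P)"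
    using neg[OF tiles_negligible(1)[OF t]] neg[OF tiles_negligible(2)[OF t]] tiles_finite[OF t]
    by (auto simp: tiles_def pairwise_def)
qed

text \<open>Measurability of \<open>B\<close> is given only in terms of vertices. One tiling of the
  unit cube is therefore fixed and carried to every box by a coordinatewise affine map, so that the
  vertices of all pieces depend continuously on the two corners. Nondegeneracy keeps the map
  injective.\<close>

lemma extend_cbox_measurable:
  fixes a b :: "'x \<Rightarrow> real^'n::finite"
  assumes B: "simplex_additive B" and mB: "measurable_charge B"
    and a: "a \<in> borel_measurable M" and b: "b \<in> borel_measurable M"
    and ab: "\<And>x j. x \<in> space M \<Longrightarrow> a x $ j < b x $ j"
  shows "(\<lambda>x. extend B (cbox (a x) (b x))) \<in> borel_measurable M"
proof -
  obtain \<T> where T: "tiles \<T> (cbox 0 1 :: (real^'n) set)" by (rule tiles_cbox[of 0 1])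
  have "\<forall>S\<in>\<T>. \<exists>v. aff_indep_tuple v \<and> S = convex hull (range (($) v))"
    using tiles_full[OF T] by (auto simp: full_simplices_def)
  then obtain v where v: "\<And>S. S \<in> \<T> \<Longrightarrow> aff_indep_tuple (v S)" "\<And>S. S \<in> \<T> \<Longrightarrow> S = convex hull (range (($) (v S)))"
    by metis
  let ?L = "\<lambda>x y. \<chi> j. a x $ j + (b x - a x) $ j * y $ j"
  let ?V = "\<lambda>x w. \<chi> k. \<chi> j. a x $ j + (b x - a x) $ j * w $ k $ j"
  have eq: "extend B (cbox (a x) (b x)) = (\<Sum>S\<in>\<T>. B (convex hull (range (($) (?V x (v S))))))" if x: "x \<in> space M" for x
  proof -
    have c: "(b x - a x) $ j \<noteq> 0" for j using ab[OF x, of j] by simp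
    note t = tiles_stretch[OF T c, of "a x"]
    have "?L x ` cbox 0 1 = cbox (a x) (b x)"
    proof (intro equalityI subsetI)
      fix y assume "y \<in> ?L x ` cbox 0 1"
      then obtain z where z: "y = ?L x z" "\<And>j. 0 \<le> z $ j" "\<And>j. z $ j \<le> 1" by (auto simp: mem_box_cart)
      have "0 \<le> (b x $ j - a x $ j) * z $ j" "(b x $ j - a x $ j) * z $ j \<le> b x $ j - a x $ j" for j
        using ab[OF x, of j] z(2,3)[of j] by (auto intro!: mult_left_le)
      then show "y \<in> cbox (a x) (b x)" by (simp add: mem_box_cart z(1)) (metis add.commute le_diff_eq)
    next
      fix y assume y: "y \<in> cbox (a x) (b x)"
      let ?z = "\<chi> j. (y $ j - a x $ j) / (b x - a x) $ j"
      have "?L x ?z = y" using c by (simp add: vec_eq_iff)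
      moreover have "?z \<in> cbox 0 1" using y ab[OF x] by (auto simp: mem_box_cart divide_simps)
      ultimately show "y \<in> ?L x ` cbox 0 1" by (rule image_eqI[OF sym])
    qed
    then have "extend B (cbox (a x) (b x)) = sum B ((`) (?L x) ` \<T>)"
      using extend_eq[OF B t(1)] by simp
    also have "\<dots> = (\<Sum>S\<in>\<T>. B (?L x ` S))"
      using t(2) by (subst sum.reindex) (auto simp: inj_on_def inj_image_eq_iff)
    also have "\<dots> = (\<Sum>S\<in>\<T>. B (convex hull (range (($) (?V x (v S))))))"
    proof (intro sum.cong refl arg_cong[where f = B])
      fix S assume "S \<in> \<T>"
      from v(2)[OF this] show "?L x ` S = convex hull (range (($) (?V x (v S))))"
        using hull_stretch[of "a x" "b x - a x" "v S"] by simp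
    qed
    finally show ?thesis .
  qed
  have "(\<lambda>x. B (convex hull (range (($) (?V x (v S)))))) \<in> borel_measurable M" if S: "S \<in> \<T>" for S
  proof -
    have "(\<lambda>x. (\<lambda>p q. \<chi> k. \<chi> j. p $ j + (q - p) $ j * v S $ k $ j) (a x) (b x)) \<in> borel_measurable M"
      by (rule borel_measurable_continuous_Pair[OF a b]) (intro continuous_intros)
    moreover have "(\<lambda>x. ?V x (v S)) \<in> space M \<rightarrow> {v. aff_indep_tuple v}"
    proof (intro Pi_I CollectI)
      fix x assume x: "x \<in> space M"
      have c: "(b x - a x) $ j \<noteq> 0" for j using ab[OF x, of j] by simp
      show "aff_indep_tuple (?V x (v S))" by (rule aff_indep_stretch[OF v(1)[OF S] c])
    qed
    ultimately have "(\<lambda>x. ?V x (v S)) \<in> measurable M (restrict_space borel {v. aff_indep_tuple v})"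
      by (intro measurable_restrict_space2)
    from measurable_compose[OF this mB[unfolded measurable_charge_def]] show ?thesis by simp
  qed
  then have "(\<lambda>x. \<Sum>S\<in>\<T>. B (convex hull (range (($) (?V x (v S)))))) \<in> borel_measurable M"
    by (rule borel_measurable_sum)
  then show ?thesis by (subst measurable_cong[OF eq]) auto
qed

section \<open>Comparison of the mass with volume, height and diameter\<close>

subsection \<open>Heights\<close>

lemma power_CARD: "x ^ CARD('n::finite) = x ^ (CARD('n) - 1) * (x::real)"
  by (rule power_minus_mult[symmetric]) simp

definition facet :: "'n::finite vertex_tuple \<Rightarrow> 'n option \<Rightarrow> (real^'n) set" where
  "facet v i = convex hull (range (($) v) - {v $ i})"

lemma boundary_faces_osimplex_of: "boundary_faces (osimplex_of v) = range (facet v)"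
  by (auto simp: boundary_faces_def vertices_osimplex_of facet_def)

lemma bary_affine_hull_facet:
  assumes "aff_indep_tuple v" "x \<in> affine hull (facet v i)"
  shows "bary v x $ i = 0"
proof -
  have "range (($) v) - {v $ i} \<subseteq> {x. bary_grad v i \<bullet> x = - bary v 0 $ i}"
  proof clarify
    fix k assume "v $ k \<noteq> v $ i"
    then have "bary v (v $ k) $ i = 0" using bary_vertex[OF assms(1), of k i] by auto
    then show "bary_grad v i \<bullet> v $ k = - bary v 0 $ i" using bary_eq[of v "v $ k" i] by simp
  qed
  then have "affine hull (range (($) v) - {v $ i}) \<subseteq> {x. bary_grad v i \<bullet> x = - bary v 0 $ i}"
    by (rule hull_minimal) (rule affine_hyperplane)
  then have "bary_grad v i \<bullet> x = - bary v 0 $ i"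
    using assms(2) by (auto simp: facet_def affine_hull_convex_hull)
  then show ?thesis using bary_eq[of v x i] by simp
qed

lemma sum_except:
  fixes v :: "'n::finite vertex_tuple"
  assumes "c i = (0::real)"
  shows "(\<Sum>k\<in>UNIV. c k *\<^sub>R v $ k) = (\<Sum>k\<in>UNIV - {i}. c k *\<^sub>R v $ k)" "sum c UNIV = sum c (UNIV - {i})"
  using assms by (subst sum.remove[of UNIV i]; simp)+

lemma range_minus_vertex:
  assumes "aff_indep_tuple v" shows "range (($) v) - {v $ i} = ($) v ` (UNIV - {i})"
  using assms by (auto simp: aff_indep_tuple_def inj_def)

lemma affine_hull_facetI:
  assumes ai: "aff_indep_tuple v" and "bary v x $ i = 0"
  shows "x \<in> affine hull (facet v i)"
proof -
  have inj: "inj_on (($) v) (UNIV - {i})" using ai by (auto simp: aff_indep_tuple_def inj_def inj_on_def)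
  note s = bary_sum[OF ai, of x]
  have 1: "(\<Sum>k\<in>UNIV - {i}. bary v x $ k *\<^sub>R v $ k) = x" "(\<Sum>k\<in>UNIV - {i}. bary v x $ k) = 1"
    using sum_except(1)[of "\<lambda>k. bary v x $ k" i v] sum_except(2)[of "\<lambda>k. bary v x $ k" i] s assms(2) by auto
  have "x \<in> affine hull (($) v ` (UNIV - {i}))"
    unfolding affine_hull_finite[OF finite_imageI[OF finite]]
    using 1 ai by (intro CollectI exI[of _ "\<lambda>y. bary v x $ inv (($) v) y"])
      (simp add: sum.reindex[OF inj] aff_indep_tuple_def inv_f_f)
  then show ?thesis by (simp add: facet_def affine_hull_convex_hull range_minus_vertex[OF ai])
qed

lemma facetI:
  assumes ai: "aff_indep_tuple v" and "bary v x $ i = 0" "\<And>k. 0 \<le> bary v x $ k"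
  shows "x \<in> facet v i"
proof -
  have inj: "inj_on (($) v) (UNIV - {i})" using ai by (auto simp: aff_indep_tuple_def inj_def inj_on_def)
  note s = bary_sum[OF ai, of x]
  have 1: "(\<Sum>k\<in>UNIV - {i}. bary v x $ k *\<^sub>R v $ k) = x" "(\<Sum>k\<in>UNIV - {i}. bary v x $ k) = 1"
    using sum_except(1)[of "\<lambda>k. bary v x $ k" i v] sum_except(2)[of "\<lambda>k. bary v x $ k" i] s assms(2) by auto
  have "x \<in> convex hull (($) v ` (UNIV - {i}))"
    unfolding convex_hull_finite[OF finite_imageI[OF finite]]
    using 1 ai assms(3) by (intro CollectI exI[of _ "\<lambda>y. bary v x $ inv (($) v) y"])
      (simp add: sum.reindex[OF inj] aff_indep_tuple_def inv_f_f)
  then show ?thesis by (simp add: facet_def range_minus_vertex[OF ai])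
qed

text \<open>The coordinate is affine with gradient g and vanishes on the hyperplane of the facet.
  Subtracting (b / |g|^2) g leads to the foot of the perpendicular, and the Cauchy-Schwarz
  inequality shows that no point of the hyperplane is closer.\<close>

lemma infdist_facet:
  assumes ai: "aff_indep_tuple v"
  shows "infdist x (affine hull (facet v i)) = \<bar>bary v x $ i\<bar> / norm (bary_grad v i)"
proof (rule antisym)
  let ?g = "bary_grad v i" and ?H = "affine hull (facet v i)"
  have g: "?g \<noteq> 0" by (rule bary_grad_nz[OF ai])
  define y where "y = x - (bary v x $ i / (norm ?g)\<^sup>2) *\<^sub>R ?g"
  have "bary v y $ i = bary v x $ i - (bary v x $ i / (norm ?g)\<^sup>2) * (?g \<bullet> ?g)"
    using bary_diff[of v y i x] by (simp add: y_def)
  also have "\<dots> = 0" using g by (simp add: power2_norm_eq_inner)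
  finally have y: "y \<in> ?H" by (rule affine_hull_facetI[OF ai])
  have "dist x y = \<bar>bary v x $ i\<bar> / norm ?g"
    using g by (simp add: y_def dist_norm power2_eq_square abs_mult)
  with infdist_le[OF y, of x] show "infdist x ?H \<le> \<bar>bary v x $ i\<bar> / norm ?g" by simp
  have "\<bar>bary v x $ i\<bar> / norm ?g \<le> dist x z" if "z \<in> ?H" for z
  proof -
    have "\<bar>bary v x $ i\<bar> = \<bar>?g \<bullet> (x - z)\<bar>"
      using bary_diff[of v x i z] bary_affine_hull_facet[OF ai that] by simp
    also have "\<dots> \<le> norm ?g * norm (x - z)" by (rule Cauchy_Schwarz_ineq2)
    finally show ?thesis using g by (simp add: dist_norm field_simps)
  qed
  then show "\<bar>bary v x $ i\<bar> / norm ?g \<le> infdist x ?H"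
    using y unfolding infdist_def by (auto intro!: cINF_greatest)
qed

lemma bary_le_one:
  assumes "aff_indep_tuple v" "x \<in> convex hull (range (($) v))"
  shows "bary v x $ i \<le> 1"
proof -
  have "bary v x $ i \<le> (\<Sum>k\<in>UNIV. bary v x $ k)"
    using assms mem_simplex_iff[OF assms(1)] by (intro member_le_sum) auto
  then show ?thesis using bary_sum(1)[OF assms(1)] by simp
qed

text \<open>On the simplex the coordinate lies between 0 and 1, and the value 1 is attained at
  vertex i.\<close>

lemma facet_height:
  assumes ai: "aff_indep_tuple v"
  shows "(SUP x\<in>convex hull (range (($) v)). infdist x (affine hull (facet v i))) = 1 / norm (bary_grad v i)"
proof (rule cSup_eq_maximum)
  have "v $ i \<in> convex hull (range (($) v))" by (simp add: hull_inc)
  moreover have "infdist (v $ i) (affine hull (facet v i)) = 1 / norm (bary_grad v i)"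
    unfolding infdist_facet[OF ai] by (simp add: bary_vertex[OF ai])
  ultimately show "1 / norm (bary_grad v i) \<in> (\<lambda>x. infdist x (affine hull (facet v i))) ` (convex hull (range (($) v)))"
    by (rule image_eqI[OF sym, rotated])
next
  fix y assume "y \<in> (\<lambda>x. infdist x (affine hull (facet v i))) ` (convex hull (range (($) v)))"
  then obtain x where y: "y = infdist x (affine hull (facet v i))" and x: "x \<in> convex hull (range (($) v))" by auto
  then show "y \<le> 1 / norm (bary_grad v i)"
    unfolding y infdist_facet[OF ai] using bary_le_one[OF ai x, of i] mem_simplex_iff[OF ai, of x]
    by (intro divide_right_mono) auto
qed

lemma height_osimplex_of:
  assumes ai: "aff_indep_tuple v"
  shows "height (osimplex_of v) = Min (range (\<lambda>i. 1 / norm (bary_grad v i)))"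
  unfolding height_def boundary_faces_osimplex_of body_osimplex_of image_image facet_height[OF ai] ..

lemma height_pos: "aff_indep_tuple v \<Longrightarrow> 0 < height (osimplex_of v)"
  by (simp add: height_osimplex_of bary_grad_nz)

lemma height_le: "aff_indep_tuple v \<Longrightarrow> height (osimplex_of v) \<le> 1 / norm (bary_grad v i)"
  by (simp add: height_osimplex_of)

lemma height_attained:
  assumes "aff_indep_tuple v" obtains i where "height (osimplex_of v) = 1 / norm (bary_grad v i)"
proof -
  have "Min (range (\<lambda>i. 1 / norm (bary_grad v i))) \<in> range (\<lambda>i. 1 / norm (bary_grad v i))"
    by (rule Min_in) auto
  then obtain i where "Min (range (\<lambda>i. 1 / norm (bary_grad v i))) = 1 / norm (bary_grad v i)" by (rule rangeE)
  then show ?thesis by (intro that[of i]) (simp only: height_osimplex_of[OF assms])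
qed

text \<open>The height is the reciprocal of the largest gradient norm, hence a Lipschitz scale
  common to all coordinates. Every statement that a point is close to the boundary is translated
  into coordinates by this bound.\<close>

lemma bary_Lipschitz:
  assumes ai: "aff_indep_tuple v"
  shows "\<bar>bary v x $ i - bary v y $ i\<bar> \<le> norm (x - y) / height (osimplex_of v)"
proof -
  have g: "norm (bary_grad v i) > 0" using bary_grad_nz[OF ai] by simp
  have "\<bar>bary v x $ i - bary v y $ i\<bar> \<le> norm (bary_grad v i) * norm (x - y)"
    unfolding bary_diff by (rule Cauchy_Schwarz_ineq2)
  also have "norm (bary_grad v i) \<le> 1 / height (osimplex_of v)"
    using height_le[OF ai, of i] height_pos[OF ai] g by (simp add: field_simps)
  finally show ?thesis by (simp add: mult_right_mono)
qed

lemma ex_other_vertex: obtains k :: "'n::finite option" where "k \<noteq> i"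
proof (cases i)
  case None
  show ?thesis by (rule that[of "Some undefined"]) (simp add: None)
next
  case (Some j)
  show ?thesis by (rule that[of None]) (simp add: Some)
qed

text \<open>A coordinate drops from 1 to 0 along an edge, so the Lipschitz bound forces the edge to
  be at least as long as the height.\<close>

lemma height_le_diameter:
  assumes ai: "aff_indep_tuple v"
  shows "height (osimplex_of v) \<le> diameter (convex hull (range (($) v)))"
proof -
  define i :: "'a option" where "i = None"
  obtain k where k: "k \<noteq> i" by (rule ex_other_vertex)
  have "1 = \<bar>bary v (v $ i) $ i - bary v (v $ k) $ i\<bar>" using k by (simp add: bary_vertex[OF ai])
  also have "\<dots> \<le> norm (v $ i - v $ k) / height (osimplex_of v)" by (rule bary_Lipschitz[OF ai])
  finally have "height (osimplex_of v) \<le> dist (v $ i) (v $ k)"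
    using height_pos[OF ai] by (simp add: dist_norm field_simps)
  also have "\<dots> \<le> diameter (convex hull (range (($) v)))"
    by (intro diameter_bounded_bound full_simplex_bounded full_simplicesI ai) (simp_all add: hull_inc)
  finally show ?thesis .
qed

subsection \<open>Hausdorff measure of facets\<close>

text \<open>The finite cover is padded with empty sets, which cost nothing even for
  \<open>s = 0\<close>.\<close>

lemma hausdorff_premeasure_le:
  assumes "finite \<C>" "F \<subseteq> \<Union>\<C>" "\<And>U. U \<in> \<C> \<Longrightarrow> bounded U \<and> diameter U \<le> r" "0 \<le> r" "r \<le> \<delta>"
  shows "hausdorff_premeasure s \<delta> F \<le> ennreal (real (card \<C>) * (unit_ball_vol (real s) / 2 ^ s * r ^ s))"
proof -
  obtain e where e: "bij_betw e {..<card \<C>} \<C>" using ex_bij_betw_nat_finite[OF assms(1)] by (auto simp: atLeast0LessThan)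
  define U where "U i = (if i < card \<C> then e i else {})" for i
  have UC: "U i \<in> \<C>" if "i < card \<C>" for i using e that by (auto simp: U_def bij_betw_def)
  have "(\<forall>i. bounded (U i) \<and> diameter (U i) \<le> \<delta>) \<and> F \<subseteq> (\<Union>i. U i)"
  proof (intro conjI allI)
    fix i show "bounded (U i)" using assms(3)[OF UC] by (cases "i < card \<C>") (auto simp: U_def)
    show "diameter (U i) \<le> \<delta>" using assms(3)[OF UC, of i] assms(4,5) by (cases "i < card \<C>") (auto simp: U_def)
    show "F \<subseteq> (\<Union>i. U i)"
    proof
      fix x assume "x \<in> F"
      then obtain C where C: "C \<in> \<C>" "x \<in> C" using assms(2) by auto
      have "C \<in> e ` {..<card \<C>}" using bij_betw_imp_surj_on[OF e] C(1) by simp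
      then obtain i where "i < card \<C>" "e i = C" by auto
      then show "x \<in> (\<Union>i. U i)" using C(2) by (auto simp: U_def)
    qed
  qed
  then have "hausdorff_premeasure s \<delta> F \<le> (\<Sum>i. if U i = {} then 0 else ennreal (unit_ball_vol (real s) / 2 ^ s * diameter (U i) ^ s))"
    unfolding hausdorff_premeasure_def by (intro INF_lower) simp
  also have "\<dots> = (\<Sum>i<card \<C>. if U i = {} then 0 else ennreal (unit_ball_vol (real s) / 2 ^ s * diameter (U i) ^ s))"
    by (rule suminf_finite) (auto simp: U_def)
  also have "\<dots> \<le> (\<Sum>i<card \<C>. ennreal (unit_ball_vol (real s) / 2 ^ s * r ^ s))"
  proof (rule sum_mono)
    fix i assume "i \<in> {..<card \<C>}"
    then have d: "diameter (U i) \<le> r" "0 \<le> diameter (U i)" using assms(3)[OF UC] by (auto intro: diameter_ge_0)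
    have "unit_ball_vol (real s) / 2 ^ s * diameter (U i) ^ s \<le> unit_ball_vol (real s) / 2 ^ s * r ^ s"
      using power_mono[OF d, of s] by (intro mult_left_mono) auto
    then show "(if U i = {} then 0 else ennreal (unit_ball_vol (real s) / 2 ^ s * diameter (U i) ^ s)) \<le> ennreal (unit_ball_vol (real s) / 2 ^ s * r ^ s)"
      by (simp add: ennreal_leI)
  qed
  also have "\<dots> = ennreal (real (card \<C>) * (unit_ball_vol (real s) / 2 ^ s * r ^ s))"
  proof -
    have "0 \<le> unit_ball_vol (real s) / 2 ^ s * r ^ s" using assms(4) by simp
    then show ?thesis
      by (subst ennreal_mult) (simp_all only: of_nat_0_le_iff sum_constant card_lessThan ennreal_of_nat_eq_real_of_nat)
  qed
  finally show ?thesis .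
qed

text \<open>Origin of the factors: at most (2 m)^(d - 1) sets of diameter d D / m are used, each at
  the cost of \<open>unit_ball_vol\<close> times the (d - 1)-st power of half its diameter; m
  cancels, and so do the powers of 2.\<close>

definition facet_constant :: "'n::finite itself \<Rightarrow> real" where
  "facet_constant _ = unit_ball_vol (real (CARD('n) - 1)) * real CARD('n) ^ (CARD('n) - 1)"

lemma facet_constant_pos: "0 < facet_constant TYPE('n::finite)"
  by (simp add: facet_constant_def)

text \<open>On the facet the coordinate i is 0 and the coordinate k is determined by the rest, so a
  grid of mesh 1 / m in the remaining d - 1 coordinates covers it. Points in the same grid cell are
  within d D / m, and m is taken so large that this is below the prescribed mesh.\<close>

lemma facet_Hausdorff_le:
  fixes v :: "'n::finite vertex_tuple"
  assumes ai: "aff_indep_tuple v"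
  defines "D \<equiv> diameter (convex hull (range (($) v)))"
  shows "hausdorff_measure (CARD('n) - 1) (facet v i) \<le> ennreal (facet_constant TYPE('n) * D ^ (CARD('n) - 1))"
proof -
  obtain k where k: "k \<noteq> i" by (rule ex_other_vertex)
  define K where "K = UNIV - {i, k}"
  have cK: "card K = CARD('n) - 1" using k by (simp add: K_def card_Diff_subset card_option)
  have bdd: "bounded (convex hull (range (($) v)))" by (intro full_simplex_bounded full_simplicesI ai)
  have D0: "0 \<le> D" unfolding D_def by (rule diameter_ge_0[OF bdd])
  have Dv: "norm (v $ j - v $ l) \<le> D" for j l
    unfolding D_def dist_norm[symmetric] by (intro diameter_bounded_bound bdd) (simp_all add: hull_inc)
  have fs: "facet v i = {x. bary v x $ i = 0 \<and> (\<forall>j. 0 \<le> bary v x $ j)}"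
  proof (intro equalityI subsetI CollectI conjI)
    fix x assume x: "x \<in> facet v i"
    show "bary v x $ i = 0" by (rule bary_affine_hull_facet[OF ai hull_inc[OF x]])
    have "x \<in> convex hull (range (($) v))" using x hull_mono[of "range (($) v) - {v $ i}" "range (($) v)"]
      by (auto simp: facet_def)
    then show "\<forall>j. 0 \<le> bary v x $ j" using mem_simplex_iff[OF ai] by simp
  qed (use facetI[OF ai] in auto)
  show ?thesis
    unfolding hausdorff_measure_def
  proof (rule SUP_least)
    fix \<delta> :: real assume "\<delta> \<in> {0<..}"
    then have \<delta>: "0 < \<delta>" by simp
    obtain m :: nat where m: "m > 0" "real CARD('n) * D / real m \<le> \<delta>"
    proof -
      obtain m :: nat where "real CARD('n) * D / \<delta> < real m" using reals_Archimedean2 by blast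
      moreover have "0 \<le> real CARD('n) * D / \<delta>" using D0 \<delta> by simp
      ultimately have "m > 0" by (metis of_nat_0_less_iff order.strict_trans1)
      with \<open>real CARD('n) * D / \<delta> < real m\<close> \<delta> show ?thesis by (intro that[of m]) (auto simp: field_simps)
    qed
    define r where "r = real CARD('n) * D / real m"
    define U where "U e = {x. bary v x $ i = 0 \<and> (\<forall>j\<in>K. real (e j) \<le> m * bary v x $ j \<and> m * bary v x $ j \<le> real (e j) + 1)}" for e :: "'n option \<Rightarrow> nat"
    let ?E = "PiE K (\<lambda>_. {..m})"
    have finE: "finite ?E" by (intro finite_PiE) (auto simp: K_def)
    have cov: "facet v i \<subseteq> \<Union>(U ` ?E)"
    proof
      fix x assume "x \<in> facet v i"
      then have x: "bary v x $ i = 0" "\<And>j. 0 \<le> bary v x $ j" unfolding fs by auto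
      then have x1: "bary v x $ j \<le> 1" for j by (intro bary_le_one[OF ai]) (simp add: mem_simplex_iff[OF ai])
      let ?e = "restrict (\<lambda>j. nat \<lfloor>m * bary v x $ j\<rfloor>) K"
      have "?e \<in> ?E"
      proof (rule restrict_PiE_iff[THEN iffD2], intro ballI)
        fix j
        have "m * bary v x $ j \<le> real m" using x1[of j] by (simp add: mult_left_le)
        then show "nat \<lfloor>m * bary v x $ j\<rfloor> \<in> {..m}" by (simp add: floor_le_iff nat_le_iff)
      qed
      moreover have "x \<in> U ?e"
        unfolding U_def using x by (auto simp: of_nat_nat)
      ultimately show "x \<in> \<Union>(U ` ?E)" by blast
    qed
    have diam: "norm (x - y) \<le> r" if "x \<in> U e" "y \<in> U e" for x y e
    proof -
      let ?d = "\<lambda>j. bary v x $ j - bary v y $ j"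
      have "x - y = (\<Sum>j\<in>UNIV. ?d j *\<^sub>R v $ j)"
        using bary_sum(2)[OF ai, of x] bary_sum(2)[OF ai, of y] by (simp add: scaleR_diff_left sum_subtractf)
      \<comment> \<open>The coordinate differences sum to 0, so v_k may be subtracted from every
        vertex. This removes the index k, and the index i drops out because both points have
        coordinate 0 there.\<close>
      also have "\<dots> = (\<Sum>j\<in>UNIV. ?d j *\<^sub>R (v $ j - v $ k))"
        using bary_sum(1)[OF ai, of x] bary_sum(1)[OF ai, of y]
        by (simp add: scaleR_diff_right sum_subtractf flip: scaleR_sum_left)
      also have "\<dots> = (\<Sum>j\<in>K. ?d j *\<^sub>R (v $ j - v $ k))"
        using that by (intro sum.mono_neutral_right) (auto simp: K_def U_def)
      finally have "norm (x - y) \<le> (\<Sum>j\<in>K. \<bar>?d j\<bar> * norm (v $ j - v $ k))"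
        by (simp add: sum_norm_le)
      also have "\<dots> \<le> (\<Sum>j\<in>K. (1 / m) * D)"
      proof (intro sum_mono mult_mono Dv)
        fix j assume "j \<in> K"
        then have "real (e j) \<le> m * bary v x $ j" "m * bary v x $ j \<le> real (e j) + 1"
          "real (e j) \<le> m * bary v y $ j" "m * bary v y $ j \<le> real (e j) + 1" using that by (auto simp: U_def)
        then have "\<bar>m * bary v x $ j - m * bary v y $ j\<bar> \<le> 1" by linarith
        then have "m * \<bar>?d j\<bar> \<le> 1" by (simp add: abs_mult flip: right_diff_distrib)
        then show "\<bar>?d j\<bar> \<le> 1 / m" using m by (simp add: field_simps)
      qed auto
      also have "\<dots> \<le> r" using cK D0 m by (simp add: r_def divide_right_mono mult_right_mono)
      finally show ?thesis .
    qed
    have r0: "0 \<le> r" using D0 by (simp add: r_def)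
    have "bounded (U e) \<and> diameter (U e) \<le> r" for e
    proof
      show "diameter (U e) \<le> r" using diam r0 by (intro diameter_le) auto
      show "bounded (U e)"
      proof (cases "U e = {}")
        case False
        then obtain x where "x \<in> U e" by auto
        then have "U e \<subseteq> cball x r" using diam by (auto simp: dist_norm)
        then show ?thesis using bounded_cball bounded_subset by blast
      qed auto
    qed
    then have "hausdorff_premeasure (CARD('n) - 1) \<delta> (facet v i) \<le>
       ennreal (real (card (U ` ?E)) * (unit_ball_vol (real (CARD('n) - 1)) / 2 ^ (CARD('n) - 1) * r ^ (CARD('n) - 1)))"
      using finE cov r0 m(2) by (intro hausdorff_premeasure_le) (auto simp: r_def)
    also have "\<dots> \<le> ennreal (facet_constant TYPE('n) * D ^ (CARD('n) - 1))"
    proof (rule ennreal_leI)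
      have "card (U ` ?E) \<le> card ?E" by (rule card_image_le[OF finE])
      also have "\<dots> = (m + 1) ^ (CARD('n) - 1)" using cK by (simp add: card_PiE K_def)
      also have "\<dots> \<le> (2 * m) ^ (CARD('n) - 1)" using m by (intro power_mono) auto
      finally have "real (card (U ` ?E)) \<le> (2 * real m) ^ (CARD('n) - 1)"
        by (metis of_nat_le_iff of_nat_mult of_nat_numeral of_nat_power)
      then have "real (card (U ` ?E)) * (unit_ball_vol (real (CARD('n) - 1)) / 2 ^ (CARD('n) - 1) * r ^ (CARD('n) - 1))
        \<le> (2 * real m) ^ (CARD('n) - 1) * (unit_ball_vol (real (CARD('n) - 1)) / 2 ^ (CARD('n) - 1) * r ^ (CARD('n) - 1))"
        using r0 by (intro mult_right_mono) auto
      also have "\<dots> = facet_constant TYPE('n) * D ^ (CARD('n) - 1)"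
        using m by (simp add: r_def facet_constant_def power_mult_distrib power_divide)
      finally show "real (card (U ` ?E)) * (unit_ball_vol (real (CARD('n) - 1)) / 2 ^ (CARD('n) - 1) * r ^ (CARD('n) - 1))
        \<le> facet_constant TYPE('n) * D ^ (CARD('n) - 1)" .
    qed
    finally show "hausdorff_premeasure (CARD('n) - 1) \<delta> (facet v i) \<le> ennreal (facet_constant TYPE('n) * D ^ (CARD('n) - 1))" .
  qed
qed

lemma facet_bary:
  assumes ai: "aff_indep_tuple v" and x: "x \<in> facet v i"
  shows "bary v x $ i = 0" "0 \<le> bary v x $ j"
proof -
  show "bary v x $ i = 0" by (rule bary_affine_hull_facet[OF ai hull_inc[OF x]])
  have "x \<in> convex hull (range (($) v))" using x hull_mono[of "range (($) v) - {v $ i}" "range (($) v)"]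
    by (auto simp: facet_def)
  then show "0 \<le> bary v x $ j" using mem_simplex_iff[OF ai] by simp
qed

subsection \<open>Volume and facets\<close>

lemma measure_cball_le:
  fixes c :: "real^'n::finite"
  assumes "0 \<le> r" shows "measure lebesgue (cball c r) \<le> (2 * r) ^ CARD('n)"
proof -
  have "cball c r \<subseteq> cbox (c - (\<chi> j. r)) (c + (\<chi> j. r))"
  proof
    fix x assume "x \<in> cball c r"
    then have "\<bar>(c - x) $ j\<bar> \<le> r" for j
      using component_le_norm_cart[of "c - x" j] by (simp add: dist_norm)
    then show "x \<in> cbox (c - (\<chi> j. r)) (c + (\<chi> j. r))"
      by (simp add: mem_box_cart abs_le_iff algebra_simps)
  qed
  then have "measure lebesgue (cball c r) \<le> measure lebesgue (cbox (c - (\<chi> j. r)) (c + (\<chi> j. r)))"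
    by (intro measure_mono_fmeasurable) auto
  also have "\<dots> = (2 * r) ^ CARD('n)"
  proof -
    have ne: "cbox (c - (\<chi> j. r)) (c + (\<chi> j. r)) \<noteq> {}" using assms by (auto simp: interval_ne_empty_cart)
    have "measure lebesgue (cbox (c - (\<chi> j. r)) (c + (\<chi> j. r))) = measure lborel (cbox (c - (\<chi> j. r)) (c + (\<chi> j. r)))"
      by simp
    then show ?thesis using content_cbox_cart[OF ne] by simp
  qed
  finally show ?thesis .
qed

text \<open>A ball is cut by the hyperplane of facet i and the resulting disc is swept along
  \<open>w\<close>. Every set of a cover of the facet generates such a prism, and the prisms
  together cover the simplex.\<close>

definition prism :: "'n::finite vertex_tuple \<Rightarrow> 'n option \<Rightarrow> real^'n \<Rightarrow> real^'n \<Rightarrow> real \<Rightarrow> real \<Rightarrow> (real^'n) set" where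
  "prism v i w p r s = {x + t *\<^sub>R w | x t. x \<in> cball p r \<and> bary v x $ i = 0 \<and> t \<in> {0..s}}"

lemma compact_prism: "compact (prism v i w p r s)"
proof -
  have "closed {x. bary v x $ i = 0}" by (intro closed_Collect_eq bary_continuous continuous_on_const)
  then have "compact (cball p r \<inter> {x. bary v x $ i = 0})" by (intro compact_Int_closed compact_cball)
  then have "compact ((cball p r \<inter> {x. bary v x $ i = 0}) \<times> {0..s})" by (intro compact_Times compact_Icc)
  then have "compact ((\<lambda>(x, t). x + t *\<^sub>R w) ` ((cball p r \<inter> {x. bary v x $ i = 0}) \<times> {0..s}))"
    by (intro compact_continuous_image) (auto intro!: continuous_intros simp: case_prod_beta)
  also have "(\<lambda>(x, t). x + t *\<^sub>R w) ` ((cball p r \<inter> {x. bary v x $ i = 0}) \<times> {0..s}) = prism v i w p r s"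
    by (fastforce simp: prism_def image_iff)
  finally show ?thesis .
qed

text \<open>This replaces slicing parallel to the facet. The thin slab is translated about r |g| /
  (2 s) times in the normal direction; each translation raises the coordinate by 2 s while the slab
  occupies only [0, s], so the translates are disjoint, and they stay in the ball of radius 3 r,
  whose volume is at most (6 r)^d.\<close>

lemma slab_measure:
  fixes v :: "'n::finite vertex_tuple"
  assumes ai: "aff_indep_tuple v" and r: "0 < r" and s: "0 < s" and Y: "Y \<in> lmeasurable"
    "Y \<subseteq> cball p (2 * r)" "\<And>y. y \<in> Y \<Longrightarrow> 0 \<le> bary v y $ i \<and> bary v y $ i \<le> s"
  shows "r * norm (bary_grad v i) * measure lebesgue Y \<le> 2 * s * (6 * r) ^ CARD('n)"
proof -
  define g where "g = bary_grad v i"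
  have g: "norm g > 0" using bary_grad_nz[OF ai] by (simp add: g_def)
  define M where "M = nat \<lceil>r * norm g / (2 * s)\<rceil>"
  have M: "r * norm g / (2 * s) \<le> real M" "real M - 1 < r * norm g / (2 * s)"
    using r g s by (auto simp: M_def) linarith+
  define e where "e = (2 * s / (norm g)\<^sup>2) *\<^sub>R g"
  have be: "bary v (real j *\<^sub>R e + y) $ i = bary v y $ i + 2 * s * real j" for j y
  proof -
    have "g \<bullet> (real j *\<^sub>R e) = 2 * s * real j"
      using g by (simp add: e_def power2_norm_eq_inner)
    moreover have "bary v (real j *\<^sub>R e + y) $ i - bary v y $ i = g \<bullet> (real j *\<^sub>R e)"
      using bary_diff[of v "real j *\<^sub>R e + y" i y] by (simp add: g_def)
    ultimately show ?thesis by linarith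
  qed
  let ?Y = "\<lambda>j. (+) (real j *\<^sub>R e) ` Y"
  have sub: "?Y j \<subseteq> cball p (3 * r)" if "j < M" for j
  proof clarify
    fix y assume "y \<in> Y"
    then have "dist p y \<le> 2 * r" using Y(2) by auto
    have "real j \<le> real M - 1" using that by simp
    with M(2) have "real j \<le> r * norm g / (2 * s)" by linarith
    then have "real j * (2 * s) \<le> r * norm g" using s by (simp add: pos_le_divide_eq)
    then have "norm (real j *\<^sub>R e) \<le> r"
      using g s by (simp add: e_def power2_eq_square field_simps)
    moreover have "dist p (real j *\<^sub>R e + y) \<le> dist p y + norm (real j *\<^sub>R e)"
      using dist_triangle[of p "real j *\<^sub>R e + y" y] by (simp add: dist_norm)
    ultimately show "real j *\<^sub>R e + y \<in> cball p (3 * r)" using \<open>dist p y \<le> 2 * r\<close> by simp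
  qed
  have meas: "?Y j \<in> lmeasurable" for j by (rule measurable_translation[OF Y(1)])
  have "disjoint_family_on ?Y {..<M}"
    unfolding disjoint_family_on_def
  proof (intro ballI impI)
    fix j l :: nat assume "j \<noteq> l"
    show "?Y j \<inter> ?Y l = {}"
    proof (rule ccontr)
      assume "?Y j \<inter> ?Y l \<noteq> {}"
      then obtain y z where yz: "y \<in> Y" "z \<in> Y" "real j *\<^sub>R e + y = real l *\<^sub>R e + z" by auto
      then have "bary v y $ i + 2 * s * real j = bary v z $ i + 2 * s * real l" using be by metis
      moreover have "\<bar>bary v y $ i - bary v z $ i\<bar> \<le> s" using Y(3)[OF yz(1)] Y(3)[OF yz(2)] by linarith
      ultimately have "\<bar>2 * s * real l - 2 * s * real j\<bar> \<le> s" by linarith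
      moreover have "2 * s * real l - 2 * s * real j = s * (2 * (real l - real j))" by (simp add: algebra_simps)
      then have "\<bar>2 * s * real l - 2 * s * real j\<bar> = s * \<bar>2 * (real l - real j)\<bar>" using s by (simp add: abs_mult)
      ultimately have "s * \<bar>2 * (real l - real j)\<bar> \<le> s * 1" by simp
      then have "\<bar>2 * (real l - real j)\<bar> \<le> 1" using s by (simp only: mult_le_cancel_left_pos)
      moreover have "real l + 1 \<le> real j \<or> real j + 1 \<le> real l"
        using \<open>j \<noteq> l\<close> by (cases "j < l") (simp_all add: not_less)
      ultimately show False by (auto simp: abs_le_iff)
    qed
  qed
  then have "measure lebesgue (\<Union>j<M. ?Y j) = (\<Sum>j<M. measure lebesgue (?Y j))"
    using fmeasurableD[OF meas] fmeasurableD2[OF meas] by (intro measure_finite_Union) (auto simp: infinity_ennreal_def)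
  also have "\<dots> = real M * measure lebesgue Y" by (simp add: measure_translation)
  finally have "real M * measure lebesgue Y = measure lebesgue (\<Union>j<M. ?Y j)" ..
  also have "\<dots> \<le> measure lebesgue (cball p (3 * r))"
    using sub meas by (intro measure_mono_fmeasurable) (auto simp: fmeasurableD)
  also have "\<dots> \<le> (6 * r) ^ CARD('n)" using measure_cball_le[of "3 * r" p] r by simp
  finally have "real M * measure lebesgue Y \<le> (6 * r) ^ CARD('n)" .
  moreover have "r * norm g / (2 * s) * measure lebesgue Y \<le> real M * measure lebesgue Y"
    by (intro mult_right_mono M) simp
  ultimately have "r * norm g / (2 * s) * measure lebesgue Y \<le> (6 * r) ^ CARD('n)" by linarith
  then show ?thesis using s by (simp add: g_def field_simps)
qed

text \<open>The vector \<open>w\<close> may be long and oblique, so the whole prism need not lie in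
  a ball of radius comparable to r. It is cut into K slices with |w| / K \<le> r; each is contained
  in a translate of the bottom slice, to which the slab estimate applies.\<close>

lemma prism_measure_pos:
  fixes v :: "'n::finite vertex_tuple"
  assumes ai: "aff_indep_tuple v" and w: "bary_grad v i \<bullet> w = 1" and r: "0 < r"
  shows "measure lebesgue (prism v i w p r 1) \<le> 2 * 6 ^ CARD('n) * r ^ (CARD('n) - 1) / norm (bary_grad v i)"
proof -
  define g where "g = bary_grad v i"
  have g: "norm g > 0" using bary_grad_nz[OF ai] by (simp add: g_def)
  obtain K0 :: nat where K0: "norm w / r < real K0" using reals_Archimedean2 by blast
  define K where "K = Suc K0"
  have K: "K > 0" "norm w / real K \<le> r"
    using K0 r by (auto simp: K_def field_simps)
  define Y where "Y = prism v i w p r (1 / real K)"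
  have Ym: "Y \<in> lmeasurable" unfolding Y_def by (rule lmeasurable_compact[OF compact_prism])
  have bw: "bary v (x + t *\<^sub>R w) $ i = bary v x $ i + t" for x t
    using bary_diff[of v "x + t *\<^sub>R w" i x] w by simp
  have "Y \<subseteq> cball p (2 * r)"
  proof
    fix y assume "y \<in> Y"
    then obtain x t where y: "y = x + t *\<^sub>R w" "dist p x \<le> r" "0 \<le> t" "t \<le> 1 / real K"
      by (auto simp: Y_def prism_def)
    have "norm (t *\<^sub>R w) = t * norm w" using y by simp
    also have "\<dots> \<le> (1 / real K) * norm w" using y(4) by (rule mult_right_mono) simp
    also have "\<dots> \<le> r" using K by simp
    finally have "norm (t *\<^sub>R w) \<le> r" .
    moreover have "dist p y \<le> dist p x + norm (t *\<^sub>R w)"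
      using dist_triangle[of p y x] by (simp add: y(1) dist_norm)
    ultimately show "y \<in> cball p (2 * r)" using y by simp
  qed
  note Ysub = this
  have "r * norm (bary_grad v i) * measure lebesgue Y \<le> 2 * (1 / real K) * (6 * r) ^ CARD('n)"
  proof (rule slab_measure[OF ai r _ Ym Ysub])
    show "0 < 1 / real K" using K by simp
    show "0 \<le> bary v y $ i \<and> bary v y $ i \<le> 1 / real K" if "y \<in> Y" for y
      using that by (auto simp: Y_def prism_def bw)
  qed
  then have mY: "real K * measure lebesgue Y \<le> 2 * (6 * r) ^ CARD('n) / (r * norm g)"
    using K r g by (simp add: g_def field_simps)
  have "prism v i w p r 1 \<subseteq> (\<Union>m<K. (+) ((real m / real K) *\<^sub>R w) ` Y)"
  proof
    fix y assume "y \<in> prism v i w p r 1"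
    then obtain x t where y: "y = x + t *\<^sub>R w" "dist p x \<le> r" "bary v x $ i = 0" "0 \<le> t" "t \<le> 1"
      by (auto simp: prism_def)
    \<comment> \<open>The top t = 1 is assigned to the last slice; rounding down would produce the
      index K, which is out of range.\<close>
    define m where "m = (if t = 1 then K - 1 else nat \<lfloor>t * real K\<rfloor>)"
    have tm: "real m / real K \<le> t" "t - real m / real K \<le> 1 / real K" "m < K"
    proof -
      have *: "real m \<le> t * real K \<and> t * real K \<le> real m + 1 \<and> m < K"
      proof (cases "t = 1")
        case True then show ?thesis using K by (auto simp: m_def of_nat_diff)
      next
        case False
        then have "t * real K < 1 * real K" using y K by (intro mult_strict_right_mono) auto
        moreover have "0 \<le> t * real K" using y by simp
        ultimately have "\<lfloor>t * real K\<rfloor> < int K" "0 \<le> \<lfloor>t * real K\<rfloor>" by (auto simp: floor_less_iff)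
        then show ?thesis using False by (auto simp: m_def nat_less_iff)
      qed
      then show "real m / real K \<le> t" "t - real m / real K \<le> 1 / real K" "m < K"
      proof -
        have "t - real m / real K = (t * real K - real m) / real K" using K by (simp add: diff_divide_distrib)
        also have "\<dots> \<le> 1 / real K" using * K by (intro divide_right_mono) auto
        finally show "t - real m / real K \<le> 1 / real K" .
      qed (use * K in \<open>auto simp: field_simps\<close>)
    qed
    have "x + (t - real m / real K) *\<^sub>R w \<in> Y"
      unfolding Y_def prism_def using y tm by (intro CollectI exI[of _ x] exI[of _ "t - real m / real K"]) auto
    moreover have "y = (real m / real K) *\<^sub>R w + (x + (t - real m / real K) *\<^sub>R w)"
      by (simp add: y(1) algebra_simps)
    ultimately show "y \<in> (\<Union>m<K. (+) ((real m / real K) *\<^sub>R w) ` Y)" using tm(3) by blast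
  qed
  then have "measure lebesgue (prism v i w p r 1) \<le> measure lebesgue (\<Union>m<K. (+) ((real m / real K) *\<^sub>R w) ` Y)"
    by (rule measure_mono_fmeasurable[OF _ fmeasurableD[OF lmeasurable_compact[OF compact_prism]]])
       (intro fmeasurable.finite_UN measurable_translation Ym finite_lessThan)
  also have "\<dots> \<le> (\<Sum>m<K. measure lebesgue ((+) ((real m / real K) *\<^sub>R w) ` Y))"
    using Ym by (intro measure_UNION_le) (auto intro: measurable_translation fmeasurableD)
  also have "\<dots> = real K * measure lebesgue Y" by (simp add: measure_translation)
  also have "\<dots> \<le> 2 * (6 * r) ^ CARD('n) / (r * norm g)" by (rule mY)
  also have "(6 * r) ^ CARD('n) = 6 ^ CARD('n) * r ^ (CARD('n) - 1) * r"
    by (simp add: power_mult_distrib power_CARD[of r])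
  finally show ?thesis using r by (simp add: g_def)
qed

text \<open>A set of a cover may be a single point, of diameter 0. That case is reached by letting
  the radius decrease to r, the bound being continuous in the radius also for d = 1, where it is
  constant.\<close>

lemma prism_measure:
  fixes v :: "'n::finite vertex_tuple"
  assumes ai: "aff_indep_tuple v" and w: "bary_grad v i \<bullet> w = 1" and r: "0 \<le> r"
  shows "measure lebesgue (prism v i w p r 1) \<le> 2 * 6 ^ CARD('n) * r ^ (CARD('n) - 1) / norm (bary_grad v i)"
proof (rule tendsto_le)
  let ?f = "\<lambda>\<epsilon>. 2 * 6 ^ CARD('n) * (r + \<epsilon>) ^ (CARD('n) - 1) / norm (bary_grad v i)"
  have "(?f \<longlongrightarrow> ?f 0) (at_right 0)" using bary_grad_nz[OF ai] by (intro tendsto_intros) auto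
  then show "(?f \<longlongrightarrow> 2 * 6 ^ CARD('n) * r ^ (CARD('n) - 1) / norm (bary_grad v i)) (at_right 0)" by simp
  show "((\<lambda>_. measure lebesgue (prism v i w p r 1)) \<longlongrightarrow> measure lebesgue (prism v i w p r 1)) (at_right 0)"
    by (rule tendsto_const)
  show "\<forall>\<^sub>F \<epsilon> in at_right 0. measure lebesgue (prism v i w p r 1) \<le> ?f \<epsilon>"
  proof (rule eventually_at_rightI[of 0 1])
    fix \<epsilon> :: real assume "\<epsilon> \<in> {0<..<1}"
    then have \<epsilon>: "0 < \<epsilon>" by simp
    have "measure lebesgue (prism v i w p r 1) \<le> measure lebesgue (prism v i w p (r + \<epsilon>) 1)"
    proof (rule measure_mono_fmeasurable[OF _ fmeasurableD])
      show "prism v i w p r 1 \<subseteq> prism v i w p (r + \<epsilon>) 1" using \<epsilon> by (fastforce simp: prism_def)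
    qed (rule lmeasurable_compact[OF compact_prism])+
    also have "\<dots> \<le> ?f \<epsilon>" using \<epsilon> r by (intro prism_measure_pos ai w) simp
    finally show "measure lebesgue (prism v i w p r 1) \<le> ?f \<epsilon>" .
  qed simp
qed simp

text \<open>The power 12^d = 6^d 2^d absorbs the volume of a prism together with the normalising
  factor 2^(d - 1) of Hausdorff measure, with a factor 2 to spare.\<close>

definition prism_constant :: "'n::finite itself \<Rightarrow> real" where
  "prism_constant _ = 2 * 12 ^ CARD('n) / unit_ball_vol (real (CARD('n) - 1))"

lemma prism_constant_pos: "0 < prism_constant TYPE('n::finite)"
  by (simp add: prism_constant_def)

text \<open>Every point of the simplex is a point of the facet moved by t w with t in [0, 1] and w
  an edge vector ending at vertex i. A countable cover of the facet thus yields a cover of the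
  simplex by prisms, and countable subadditivity bounds the volume by a multiple of the cost of the
  cover.\<close>

lemma volume_le_Hausdorff_facet:
  fixes v :: "'n::finite vertex_tuple"
  assumes ai: "aff_indep_tuple v"
  defines "S \<equiv> convex hull (range (($) v))"
  shows "ennreal (measure lebesgue S / (prism_constant TYPE('n) / norm (bary_grad v i))) \<le> hausdorff_measure (CARD('n) - 1) (facet v i)"
proof -
  define g where "g = norm (bary_grad v i)"
  have g: "g > 0" using bary_grad_nz[OF ai] by (simp add: g_def)
  define u where "u = unit_ball_vol (real (CARD('n) - 1))"
  have u: "u > 0" by (simp add: u_def)
  have pc: "prism_constant TYPE('n) = 2 * 12 ^ CARD('n) / u" by (simp only: prism_constant_def u_def)
  define c where "c = prism_constant TYPE('n) / g"
  have c: "c > 0" using g prism_constant_pos[where 'n='n] by (simp add: c_def)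
  obtain k where k: "k \<noteq> i" by (rule ex_other_vertex)
  define w where "w = v $ i - v $ k"
  have w: "bary_grad v i \<bullet> w = 1" using bary_diff[of v "v $ i" i "v $ k"] k by (simp add: w_def bary_vertex[OF ai])
  have Sm: "S \<in> lmeasurable" unfolding S_def by (intro lmeasurable_compact full_simplex_compact full_simplicesI ai)
  have cover: "\<exists>f\<in>facet v i. \<exists>t\<in>{0..1}. x = f + t *\<^sub>R w" if "x \<in> S" for x
  proof -
    have b: "0 \<le> bary v x $ j" for j using that mem_simplex_iff[OF ai] by (simp add: S_def)
    let ?t = "bary v x $ i"
    have t1: "?t \<le> 1" using bary_le_one[OF ai] that by (simp add: S_def)
    \<comment> \<open>Sliding back along the edge transfers the coordinate i to the coordinate k,
      which stays nonnegative, so the foot lies in the facet.\<close>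
    let ?f = "x - ?t *\<^sub>R w"
    have "bary v ?f = (\<chi> j. bary v x $ j - (if j = i then ?t else 0) + (if j = k then ?t else 0))"
    proof (rule bary_unique[OF ai])
      show "(\<Sum>j\<in>UNIV. (\<chi> j. bary v x $ j - (if j = i then ?t else 0) + (if j = k then ?t else 0)) $ j) = 1"
        using bary_sum(1)[OF ai, of x] by (simp add: sum.distrib sum_subtractf)
      have "(\<Sum>j\<in>UNIV. (\<chi> j. bary v x $ j - (if j = i then ?t else 0) + (if j = k then ?t else 0)) $ j *\<^sub>R v $ j)
        = (\<Sum>j\<in>UNIV. bary v x $ j *\<^sub>R v $ j - (if j = i then ?t *\<^sub>R v $ i else 0) + (if j = k then ?t *\<^sub>R v $ k else 0))"
        by (intro sum.cong refl) (auto simp: algebra_simps)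
      also have "\<dots> = ?f"
        using bary_sum(2)[OF ai, of x] by (simp add: sum.distrib sum_subtractf w_def scaleR_diff_right)
      finally show "(\<Sum>j\<in>UNIV. (\<chi> j. bary v x $ j - (if j = i then ?t else 0) + (if j = k then ?t else 0)) $ j *\<^sub>R v $ j) = ?f" .
    qed
    then have "?f \<in> facet v i" using b k by (intro facetI[OF ai]) auto
    then show ?thesis using b[of i] t1 by (intro bexI[of _ ?f] bexI[of _ ?t]) auto
  qed
  \<comment> \<open>Mesh 1 suffices for a lower bound, because Hausdorff measure is the supremum
    over all meshes.\<close>
  have "hausdorff_premeasure (CARD('n) - 1) 1 (facet v i) \<ge> ennreal (measure lebesgue S / c)"
    unfolding hausdorff_premeasure_def
  proof (rule INF_greatest)
    fix U :: "nat \<Rightarrow> (real^'n) set" assume "U \<in> {U. (\<forall>i. bounded (U i) \<and> diameter (U i) \<le> 1) \<and> facet v i \<subseteq> (\<Union>i. U i)}"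
    then have U: "\<And>m. bounded (U m)" "facet v i \<subseteq> (\<Union>m. U m)" by auto
    let ?s = "CARD('n) - 1"
    let ?h = "\<lambda>m. if U m = {} then 0 else ennreal (u / 2 ^ ?s * diameter (U m) ^ ?s)"
    define Z where "Z m = (if U m = {} then {} else prism v i w (SOME p. p \<in> U m \<inter> facet v i) (diameter (U m)) 1)" for m
    have Zm: "Z m \<in> sets lebesgue" for m
      by (simp add: Z_def fmeasurableD[OF lmeasurable_compact[OF compact_prism]])
    have "S \<subseteq> (\<Union>m. Z m)"
    proof
      fix x assume "x \<in> S"
      then obtain f t where ft: "f \<in> facet v i" "t \<in> {0..1}" "x = f + t *\<^sub>R w" using cover by blast
      then obtain m where m: "f \<in> U m" using U by blast
      let ?p = "SOME p. p \<in> U m \<inter> facet v i"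
      have p: "?p \<in> U m \<inter> facet v i" by (rule someI[of _ f]) (use m ft in auto)
      have "dist ?p f \<le> diameter (U m)" using p m by (intro diameter_bounded_bound U) auto
      then have "x \<in> Z m"
        using m ft facet_bary(1)[OF ai ft(1)] by (auto simp: Z_def prism_def)
      then show "x \<in> (\<Union>m. Z m)" by auto
    qed
    then have "emeasure lebesgue S \<le> emeasure lebesgue (\<Union>m. Z m)" using Zm by (intro emeasure_mono) auto
    also have "\<dots> \<le> (\<Sum>m. emeasure lebesgue (Z m))" using Zm by (intro emeasure_subadditive_countably) auto
    also have "\<dots> \<le> (\<Sum>m. ennreal c * ?h m)"
    proof (rule suminf_le)
      fix m show "emeasure lebesgue (Z m) \<le> ennreal c * ?h m"
      proof (cases "U m = {}")
        case False
        let ?p = "SOME p. p \<in> U m \<inter> facet v i"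
        have d0: "0 \<le> diameter (U m)" by (rule diameter_ge_0[OF U(1)])
        have "emeasure lebesgue (Z m) = ennreal (measure lebesgue (prism v i w ?p (diameter (U m)) 1))"
          using False by (simp add: Z_def emeasure_eq_measure2[OF lmeasurable_compact[OF compact_prism]])
        also have "\<dots> \<le> ennreal (2 * 6 ^ CARD('n) * diameter (U m) ^ ?s / g)"
          unfolding g_def by (intro ennreal_leI prism_measure ai w d0)
        also have "\<dots> \<le> ennreal (c * (u / 2 ^ ?s * diameter (U m) ^ ?s))"
        proof (rule ennreal_leI)
          have "(12::real) ^ CARD('n) = 6 ^ CARD('n) * 2 ^ CARD('n)" by (simp flip: power_mult_distrib)
          moreover have "(2::real) ^ CARD('n) = 2 * 2 ^ ?s" by (simp add: power_CARD)
          ultimately have "c * (u / 2 ^ ?s * diameter (U m) ^ ?s) = 2 * (2 * 6 ^ CARD('n) * diameter (U m) ^ ?s / g)"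
            using u by (simp add: c_def pc)
          moreover have "0 \<le> 2 * 6 ^ CARD('n) * diameter (U m) ^ ?s / g" using d0 g by simp
          ultimately show "2 * 6 ^ CARD('n) * diameter (U m) ^ ?s / g \<le> c * (u / 2 ^ ?s * diameter (U m) ^ ?s)"
            by linarith
        qed
        also have "\<dots> = ennreal c * ?h m"
        proof -
          have "0 \<le> u / 2 ^ ?s * diameter (U m) ^ ?s" using u d0 by simp
          then show ?thesis using False c by (subst ennreal_mult) (simp_all only: if_False less_imp_le)
        qed
        finally show ?thesis .
      qed (simp add: Z_def)
    qed auto
    also have "\<dots> = ennreal c * (\<Sum>m. ?h m)" by (rule ennreal_suminf_cmult)
    finally have *: "ennreal (measure lebesgue S) \<le> ennreal c * (\<Sum>m. ?h m)"
      using Sm by (simp add: emeasure_eq_measure2)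
    have "ennreal (measure lebesgue S / c) = ennreal (1 / c) * ennreal (measure lebesgue S)"
      using c by (simp flip: ennreal_mult)
    also have "\<dots> \<le> ennreal (1 / c) * (ennreal c * (\<Sum>m. ?h m))" using * by (rule mult_left_mono) simp
    also have "\<dots> = (\<Sum>m. ?h m)" using c by (simp add: mult.assoc[symmetric] flip: ennreal_mult)
    finally show "ennreal (measure lebesgue S / c) \<le> (\<Sum>m. if U m = {} then 0 else ennreal (unit_ball_vol (real ?s) / 2 ^ ?s * diameter (U m) ^ ?s))"
      unfolding u_def .
  qed
  also have "hausdorff_premeasure (CARD('n) - 1) 1 (facet v i) \<le> hausdorff_measure (CARD('n) - 1) (facet v i)"
    unfolding hausdorff_measure_def by (intro SUP_upper) simp
  finally show ?thesis by (simp add: c_def g_def)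
qed

text \<open>A facet has measure at most a multiple of D^(d - 1), and the height is at most D.
  Splitting D^\<alpha> as D D^(\<alpha> - 1) presents the bound as a volume D^d times a density
  D^(\<alpha> - 1), the form in which all charges are estimated later.\<close>

lemma mass_le:
  fixes v :: "'n::finite vertex_tuple"
  assumes ai: "aff_indep_tuple v" and \<alpha>: "0 < \<alpha>"
  defines "D \<equiv> diameter (convex hull (range (($) v)))"
  shows "mass \<alpha> (osimplex_of v) \<le> facet_constant TYPE('n) * D ^ CARD('n) * D powr (\<alpha> - 1)"
proof -
  let ?h = "height (osimplex_of v)"
  have h: "0 < ?h" "?h \<le> D" using height_pos[OF ai] height_le_diameter[OF ai] by (auto simp: D_def)
  have "enn2real (hausdorff_measure (CARD('n) - 1) (facet v i)) * ?h powr \<alpha> \<le> facet_constant TYPE('n) * D ^ CARD('n) * D powr (\<alpha> - 1)" for i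
  proof -
    have "enn2real (hausdorff_measure (CARD('n) - 1) (facet v i)) \<le> facet_constant TYPE('n) * D ^ (CARD('n) - 1)"
      using facet_Hausdorff_le[OF ai, of i] h facet_constant_pos[where 'n='n] unfolding D_def[symmetric]
      by (intro enn2real_leI) auto
    then have "enn2real (hausdorff_measure (CARD('n) - 1) (facet v i)) * ?h powr \<alpha> \<le> (facet_constant TYPE('n) * D ^ (CARD('n) - 1)) * D powr \<alpha>"
      using h \<alpha> facet_constant_pos[where 'n='n] by (intro mult_mono powr_mono2) auto
    also have "D powr \<alpha> = D * D powr (\<alpha> - 1)" using h by (simp add: powr_mult_base)
    also have "(facet_constant TYPE('n) * D ^ (CARD('n) - 1)) * (D * D powr (\<alpha> - 1)) = facet_constant TYPE('n) * D ^ CARD('n) * D powr (\<alpha> - 1)"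
      by (simp add: power_CARD)
    finally show ?thesis .
  qed
  then show ?thesis unfolding mass_def boundary_faces_osimplex_of image_image by (intro Max.boundedI) auto
qed

text \<open>The facet realising the height h satisfies vol S \<le> c h H(F); multiplying by
  h^(\<alpha> - 1) turns the right-hand side into one of the terms of the maximum.\<close>

lemma mass_ge:
  fixes v :: "'n::finite vertex_tuple"
  assumes ai: "aff_indep_tuple v"
  shows "measure lebesgue (convex hull (range (($) v))) * height (osimplex_of v) powr (\<alpha> - 1)
     \<le> prism_constant TYPE('n) * mass \<alpha> (osimplex_of v)"
proof -
  let ?h = "height (osimplex_of v)" and ?S = "convex hull (range (($) v))" and ?p = "prism_constant TYPE('n)"
  have h: "0 < ?h" by (rule height_pos[OF ai])
  have p: "0 < ?p" by (rule prism_constant_pos)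
  obtain i where i: "?h = 1 / norm (bary_grad v i)" by (rule height_attained[OF ai])
  let ?H = "hausdorff_measure (CARD('n) - 1) (facet v i)"
  \<comment> \<open>Infinity is sent to 0 by \<open>enn2real\<close>, so finiteness has to be known
    before the lower bound can be transferred.\<close>
  have "?H < \<infinity>" using facet_Hausdorff_le[OF ai, of i] by (simp add: order.strict_trans1 ennreal_less_top)
  then have H: "ennreal (enn2real ?H) = ?H" by simp
  have "ennreal (measure lebesgue ?S / (?p * ?h)) \<le> ennreal (enn2real ?H)"
    using volume_le_Hausdorff_facet[OF ai, of i] unfolding H by (simp add: i)
  then have "measure lebesgue ?S / (?p * ?h) \<le> enn2real ?H" by (simp add: ennreal_le_iff)
  then have "measure lebesgue ?S \<le> enn2real ?H * (?p * ?h)" using p h by (simp add: pos_divide_le_eq)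
  then have "measure lebesgue ?S * ?h powr (\<alpha> - 1) \<le> enn2real ?H * (?p * ?h) * ?h powr (\<alpha> - 1)"
    by (intro mult_right_mono) auto
  also have "\<dots> = ?p * (enn2real ?H * (?h * ?h powr (\<alpha> - 1)))" by (simp add: ac_simps)
  also have "?h * ?h powr (\<alpha> - 1) = ?h powr \<alpha>" using h by (simp add: powr_mult_base)
  also have "?p * (enn2real ?H * ?h powr \<alpha>) \<le> ?p * mass \<alpha> (osimplex_of v)"
    unfolding mass_def boundary_faces_osimplex_of image_image using p by (intro mult_left_mono Max_ge) auto
  finally show ?thesis .
qed

lemma full_simplex_measure_pos:
  assumes "S \<in> full_simplices" shows "0 < measure lebesgue S"
proof -
  have "S \<in> lmeasurable" by (rule lmeasurable_compact[OF full_simplex_compact[OF assms]])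
  then have "measure lebesgue S \<noteq> 0"
    using full_simplex_not_negligible[OF assms] by (simp add: negligible_iff_measure0)
  then show ?thesis by (simp add: less_le)
qed

text \<open>Division by a vanishing mass would give 0 in \<open>Omega_norm\<close> and hide the
  value of the function on that simplex.\<close>

lemma mass_pos:
  assumes ai: "aff_indep_tuple v" shows "0 < mass \<alpha> (osimplex_of v)"
proof -
  have "0 < measure lebesgue (convex hull (range (($) v))) * height (osimplex_of v) powr (\<alpha> - 1)"
    using full_simplex_measure_pos[OF full_simplicesI[OF ai]] height_pos[OF ai] by simp
  also note mass_ge[OF ai]
  finally show ?thesis using prism_constant_pos[where 'n='a] by (simp add: zero_less_mult_iff)
qed

section \<open>Smooth partitions of unity on the lattice\<close>

subsection \<open>Smooth functions\<close>

lemma partial_derivs_append: "partial_derivs (is @ js) f = partial_derivs is (partial_derivs js f)"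
  by (induction "is") auto

lemma smooth_differentiable: "smooth f \<Longrightarrow> f differentiable (at x)"
  unfolding smooth_def by (metis partial_derivs.simps(1))

lemma smooth_partial_derivs: "smooth f \<Longrightarrow> smooth (partial_derivs is f)"
  unfolding smooth_def partial_derivs_append[symmetric] by blast

lemma smooth_partial_deriv: "smooth f \<Longrightarrow> smooth (partial_deriv i f)"
  using smooth_partial_derivs[of f "[i]"] by simp

text \<open>Iterated partial derivatives never leave a class invariant under differentiation.
  Closure properties of smooth functions are proved by exhibiting such a class.\<close>

lemma smooth_coinduct:
  assumes "f \<in> S" and S: "\<And>g. g \<in> S \<Longrightarrow> (\<forall>x. g differentiable (at x)) \<and> (\<forall>i. partial_deriv i g \<in> S)"
  shows "smooth f"
proof -
  have "partial_derivs is f \<in> S" for "is" by (induction "is") (use assms in auto)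
  then show ?thesis using S unfolding smooth_def by blast
qed

lemma has_derivative_partial:
  assumes "(f has_derivative f') (at (x + t *\<^sub>R axis i 1))"
  shows "((\<lambda>s. f (x + s *\<^sub>R axis i 1)) has_real_derivative f' (axis i 1)) (at t)"
proof -
  have l: "linear f'" using assms by (rule has_derivative_linear)
  have "((\<lambda>s. x + s *\<^sub>R axis i 1) has_derivative (\<lambda>s. s *\<^sub>R axis i 1)) (at t)"
    by (auto intro!: derivative_eq_intros)
  from diff_chain_at[OF this] assms
  have "((\<lambda>s. f (x + s *\<^sub>R axis i 1)) has_derivative (\<lambda>s. f' (s *\<^sub>R axis i 1))) (at t)"
    by (simp add: o_def)
  moreover have "(\<lambda>s. f' (s *\<^sub>R axis i 1)) = (*) (f' (axis i 1))"
    using l by (auto simp: linear_cmul mult.commute)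
  ultimately show ?thesis by (simp add: has_field_derivative_def)
qed

lemma partial_deriv_eqI:
  assumes "(f has_derivative f') (at x)" shows "partial_deriv i f x = f' (axis i 1)"
  unfolding partial_deriv_def
  by (rule DERIV_imp_deriv) (rule has_derivative_partial, use assms in simp)

lemma differentiable_has_partial:
  assumes "\<And>x. f differentiable (at x)"
  shows "((\<lambda>s. f (x + s *\<^sub>R axis i 1)) has_real_derivative partial_deriv i f (x + t *\<^sub>R axis i 1)) (at t)"
proof -
  obtain f' where f': "(f has_derivative f') (at (x + t *\<^sub>R axis i 1))"
    using assms by (auto simp: differentiable_def)
  show ?thesis using has_derivative_partial[OF f'] partial_deriv_eqI[OF f'] by simp
qed

lemma partial_deriv_const: "partial_deriv i (\<lambda>x. c) = (\<lambda>x. 0)"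
  by (simp add: partial_deriv_def fun_eq_iff)

lemma smooth_const: "smooth (\<lambda>x. c)"
  by (rule smooth_coinduct[of _ "range (\<lambda>c x. c)"]) (auto simp: partial_deriv_const)

lemma partial_deriv_add:
  assumes "f differentiable (at x)" "g differentiable (at x)"
  shows "partial_deriv i (\<lambda>x. f x + g x) x = partial_deriv i f x + partial_deriv i g x"
proof -
  obtain f' g' where "(f has_derivative f') (at x)" "(g has_derivative g') (at x)" using assms by (auto simp: differentiable_def)
  then show ?thesis by (simp add: partial_deriv_eqI has_derivative_add[of f f' "at x" g g', THEN partial_deriv_eqI])
qed

lemma partial_deriv_mult:
  assumes "f differentiable (at x)" "g differentiable (at x)"
  shows "partial_deriv i (\<lambda>x. f x * g x) x = f x * partial_deriv i g x + partial_deriv i f x * g x"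
proof -
  obtain f' g' where *: "(f has_derivative f') (at x)" "(g has_derivative g') (at x)" using assms by (auto simp: differentiable_def)
  show ?thesis using partial_deriv_eqI[OF has_derivative_mult[OF *]] partial_deriv_eqI[OF *(1)] partial_deriv_eqI[OF *(2)]
    by simp
qed

lemma partial_deriv_inverse:
  assumes "f differentiable (at x)" "f x \<noteq> 0"
  shows "partial_deriv i (\<lambda>x. inverse (f x)) x = - (inverse (f x) * partial_deriv i f x * inverse (f x))"
proof -
  obtain f' where *: "(f has_derivative f') (at x)" using assms by (auto simp: differentiable_def)
  show ?thesis using partial_deriv_eqI[OF Deriv.has_derivative_inverse[OF assms(2) *]] partial_deriv_eqI[OF *] by simp
qed

text \<open>The closure below is invariant under differentiation, so that coinduction applies to it.\<close>

inductive_set smooth_closure :: "(real^'n::finite \<Rightarrow> real) set" where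
  base: "smooth f \<Longrightarrow> f \<in> smooth_closure"
| inv: "smooth f \<Longrightarrow> (\<And>x. f x \<noteq> 0) \<Longrightarrow> (\<lambda>x. inverse (f x)) \<in> smooth_closure"
| add: "f \<in> smooth_closure \<Longrightarrow> g \<in> smooth_closure \<Longrightarrow> (\<lambda>x. f x + g x) \<in> smooth_closure"
| mult: "f \<in> smooth_closure \<Longrightarrow> g \<in> smooth_closure \<Longrightarrow> (\<lambda>x. f x * g x) \<in> smooth_closure"

lemma smooth_closure_smooth:
  assumes "f \<in> smooth_closure" shows "smooth f"
proof (rule smooth_coinduct[OF assms])
  fix g :: "real^'a \<Rightarrow> real" assume "g \<in> smooth_closure"
  then show "(\<forall>x. g differentiable (at x)) \<and> (\<forall>i. partial_deriv i g \<in> smooth_closure)"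
  proof induction
    case (base f)
    then show ?case using smooth_differentiable smooth_partial_deriv smooth_closure.base by blast
  next
    case (inv f)
    have d: "f differentiable (at x)" for x using inv smooth_differentiable by blast
    have "partial_deriv i (\<lambda>x. inverse (f x)) = (\<lambda>x. (\<lambda>x. -1) x * (inverse (f x) * (partial_deriv i f x * inverse (f x))))" for i
      using partial_deriv_inverse[OF d inv(2)] by (auto simp: fun_eq_iff)
    moreover have "(\<lambda>x. (\<lambda>x. -1) x * (inverse (f x) * (partial_deriv i f x * inverse (f x)))) \<in> smooth_closure" for i
      using inv by (intro smooth_closure.mult smooth_closure.inv smooth_closure.base smooth_const smooth_partial_deriv) auto
    ultimately show ?case using d inv(2) by (auto intro!: differentiable_inverse)
  next
    case (add f g)
    then have "partial_deriv i (\<lambda>x. f x + g x) = (\<lambda>x. partial_deriv i f x + partial_deriv i g x)" for i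
      by (auto simp: fun_eq_iff partial_deriv_add)
    then show ?case using add by (auto intro: smooth_closure.add differentiable_add)
  next
    case (mult f g)
    then have "partial_deriv i (\<lambda>x. f x * g x) = (\<lambda>x. f x * partial_deriv i g x + partial_deriv i f x * g x)" for i
      by (auto simp: fun_eq_iff partial_deriv_mult)
    moreover have "(\<lambda>x. f x * partial_deriv i g x + partial_deriv i f x * g x) \<in> smooth_closure" for i
      using mult by (intro smooth_closure.add smooth_closure.mult) auto
    ultimately show ?case using mult by (auto intro: differentiable_mult)
  qed
qed

lemma smooth_add: "smooth f \<Longrightarrow> smooth g \<Longrightarrow> smooth (\<lambda>x. f x + g x)"
  by (rule smooth_closure_smooth[OF smooth_closure.add[OF smooth_closure.base smooth_closure.base]])

lemma smooth_mult: "smooth f \<Longrightarrow> smooth g \<Longrightarrow> smooth (\<lambda>x. f x * g x)"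
  by (rule smooth_closure_smooth[OF smooth_closure.mult[OF smooth_closure.base smooth_closure.base]])

lemma smooth_inverse: "smooth f \<Longrightarrow> (\<And>x. f x \<noteq> 0) \<Longrightarrow> smooth (\<lambda>x. inverse (f x))"
  by (rule smooth_closure_smooth[OF smooth_closure.inv])

lemma smooth_diff: "smooth f \<Longrightarrow> smooth g \<Longrightarrow> smooth (\<lambda>x. f x - g x)"
  using smooth_add[of f "\<lambda>x. -1 * g x"] smooth_mult[OF smooth_const, of g "-1"] by simp

lemma smooth_sum: "(\<And>i. i \<in> I \<Longrightarrow> smooth (f i)) \<Longrightarrow> smooth (\<lambda>x. \<Sum>i\<in>I. f i x)"
  by (induction I rule: infinite_finite_induct) (auto intro: smooth_const smooth_add)

lemma smooth_prod: "(\<And>i. i \<in> I \<Longrightarrow> smooth (f i)) \<Longrightarrow> smooth (\<lambda>x. \<Prod>i\<in>I. f i x)"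
  by (induction I rule: infinite_finite_induct) (auto intro: smooth_const smooth_mult)

lemma differentiable_compose_affine:
  fixes f :: "real^'n::finite \<Rightarrow> real"
  assumes "\<And>x. f differentiable (at x)"
  shows "(\<lambda>x. f (c *\<^sub>R x + b)) differentiable (at x)"
    "partial_deriv i (\<lambda>x. f (c *\<^sub>R x + b)) x = c * partial_deriv i f (c *\<^sub>R x + b)"
proof -
  obtain f' where f': "(f has_derivative f') (at (c *\<^sub>R x + b))" using assms by (auto simp: differentiable_def)
  have "((\<lambda>x. c *\<^sub>R x + b) has_derivative (\<lambda>x. c *\<^sub>R x)) (at x)" by (auto intro!: derivative_eq_intros)
  from diff_chain_at[OF this f'] have d: "((\<lambda>x. f (c *\<^sub>R x + b)) has_derivative (\<lambda>h. f' (c *\<^sub>R h))) (at x)"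
    by (simp add: o_def)
  then show "(\<lambda>x. f (c *\<^sub>R x + b)) differentiable (at x)" by (auto simp: differentiable_def)
  show "partial_deriv i (\<lambda>x. f (c *\<^sub>R x + b)) x = c * partial_deriv i f (c *\<^sub>R x + b)"
    using partial_deriv_eqI[OF d] partial_deriv_eqI[OF f'] has_derivative_linear[OF f']
    by (simp add: linear_cmul)
qed

lemma smooth_compose_affine:
  fixes f :: "real^'n::finite \<Rightarrow> real"
  assumes "smooth f" shows "smooth (\<lambda>x. f (c *\<^sub>R x + b))"
proof (rule smooth_coinduct)
  let ?S = "{\<lambda>x. k * g (c *\<^sub>R x + b) | k g. smooth (g :: real^'n \<Rightarrow> real)}"
  show "(\<lambda>x. f (c *\<^sub>R x + b)) \<in> ?S" using assms by (intro CollectI exI[of _ 1] exI[of _ f]) auto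
  fix h assume "h \<in> ?S"
  then obtain k g where h: "h = (\<lambda>x. k * g (c *\<^sub>R x + b))" "smooth g" by auto
  have d: "g differentiable (at x)" for x using h smooth_differentiable by blast
  note a = differentiable_compose_affine[OF d, where c = c and b = b]
  have "partial_deriv i h = (\<lambda>x. (k * c) * partial_deriv i g (c *\<^sub>R x + b))" for i
    unfolding h(1) using partial_deriv_mult[of "\<lambda>x. k", OF _ a(1)] by (auto simp: fun_eq_iff partial_deriv_const a(2))
  moreover have "h differentiable (at x)" for x unfolding h(1) using a(1) by (intro differentiable_mult) auto
  ultimately show "(\<forall>x. h differentiable (at x)) \<and> (\<forall>i. partial_deriv i h \<in> ?S)"
    using smooth_partial_deriv[OF h(2)] by blast
qed

lemma partial_deriv_coordinate:
  assumes "\<And>x. (g has_real_derivative g' x) (at x)"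
  shows "(\<lambda>x::real^'n::finite. g (x $ j)) differentiable (at x)"
    "partial_deriv i (\<lambda>x::real^'n. g (x $ j)) x = (if i = j then g' (x $ j) else 0)"
proof -
  have "((\<lambda>x::real^'n. x $ j) has_derivative (\<lambda>x. x $ j)) (at x)"
    by (rule bounded_linear_imp_has_derivative[OF bounded_linear_vec_nth])
  from diff_chain_at[OF this assms[unfolded has_field_derivative_def]]
  have d: "((\<lambda>x::real^'n. g (x $ j)) has_derivative (\<lambda>h. g' (x $ j) * h $ j)) (at x)" by (simp add: o_def)
  then show "(\<lambda>x::real^'n. g (x $ j)) differentiable (at x)" by (auto simp: differentiable_def)
  show "partial_deriv i (\<lambda>x::real^'n. g (x $ j)) x = (if i = j then g' (x $ j) else 0)"
    using partial_deriv_eqI[OF d] by (simp add: axis_def)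
qed

text \<open>The index set carries the differentiation: \<open>D\<close> acts on parameters, so the
  multiples of family members form an invariant class. The instance needed is the family of flat
  functions indexed by polynomials.\<close>

lemma smooth_coordinate:
  fixes g :: "'p \<Rightarrow> real \<Rightarrow> real"
  assumes "\<And>p x. (g p has_real_derivative g (D p) x) (at x)"
  shows "smooth (\<lambda>x::real^'n::finite. g p (x $ j))"
proof (rule smooth_coinduct)
  let ?S = "{\<lambda>x. c * g p (x $ j) | c p. True}"
  show "(\<lambda>x. g p (x $ j)) \<in> ?S" by (intro CollectI exI[of _ 1] exI[of _ p]) auto
  fix h :: "real^'n \<Rightarrow> real" assume "h \<in> ?S"
  then obtain c p where h: "h = (\<lambda>x. c * g p (x $ j))" by auto
  have "((\<lambda>x. c * g p x) has_real_derivative c * g (D p) x) (at x)" for x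
    by (intro DERIV_cmult assms)
  note d = partial_deriv_coordinate[of "\<lambda>x. c * g p x", OF this]
  have "partial_deriv i h = (\<lambda>x. (if i = j then c else 0) * g (D p) (x $ j))" for i
    unfolding h by (rule ext) (simp add: d(2))
  then show "(\<forall>x. h differentiable (at x)) \<and> (\<forall>i. partial_deriv i h \<in> ?S)"
    unfolding h using d(1) by blast
qed

subsection \<open>A smooth partition of unity\<close>

text \<open>A polynomial in 1 / x times the function exp (-1 / x), extended by 0. The polynomial is
  a parameter because differentiation stays in the family and sends p to X^2 (p - p').\<close>

definition flat :: "real poly \<Rightarrow> real \<Rightarrow> real" where
  "flat p x = (if 0 < x then poly p (1 / x) * exp (- 1 / x) else 0)"

lemma poly_exp_tendsto_0: "((\<lambda>y. y ^ k * poly p y * exp (- y)) \<longlongrightarrow> 0) at_top" for p :: "real poly"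
proof (induction p arbitrary: k)
  case 0
  then show ?case by simp
next
  case (pCons a p)
  have "((\<lambda>y. a * (y ^ k / exp y) + y ^ Suc k * poly p y * exp (- y)) \<longlongrightarrow> a * 0 + 0) at_top"
    by (intro tendsto_intros tendsto_power_div_exp_0 pCons.IH)
  then show ?case by (simp add: algebra_simps exp_minus divide_inverse)
qed

lemma flat_tendsto_0: "((\<lambda>x. flat p x / x) \<longlongrightarrow> 0) (at 0)"
proof (rule filterlim_split_at_real)
  show "((\<lambda>x. flat p x / x) \<longlongrightarrow> 0) (at_left 0)"
    by (rule tendsto_eventually) (auto simp: eventually_at_left_field flat_def intro!: exI[of _ "-1"])
  have "((\<lambda>x. inverse x ^ 1 * poly p (inverse x) * exp (- inverse x)) \<longlongrightarrow> 0) (at_right 0)"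
    by (rule filterlim_compose[OF poly_exp_tendsto_0 filterlim_inverse_at_top_right])
  then show "((\<lambda>x. flat p x / x) \<longlongrightarrow> 0) (at_right 0)"
    by (rule Lim_transform_eventually)
      (auto simp: eventually_at_right_field flat_def divide_inverse intro!: exI[of _ 1])
qed

lemma flat_derivative:
  "(flat p has_real_derivative flat ([:0, 0, 1:] * (p - pderiv p)) x) (at x)"
proof -
  consider "x < 0" | "x > 0" | "x = 0" by linarith
  then show ?thesis
  proof cases
    case 1
    have "((\<lambda>_. 0) has_real_derivative 0) (at x)" by simp
    then have "(flat p has_real_derivative 0) (at x)"
      by (rule has_field_derivative_transform_within_open[of _ _ _ "{..<0}"]) (use 1 in \<open>auto simp: flat_def\<close>)
    then show ?thesis using 1 by (simp add: flat_def)
  next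
    case 2
    have "((\<lambda>x. poly p (1 / x) * exp (- 1 / x)) has_real_derivative
       (poly (pderiv p) (1 / x) * (- 1 / x\<^sup>2)) * exp (- 1 / x) + poly p (1 / x) * (exp (- 1 / x) * (1 / x\<^sup>2))) (at x)"
      using 2 by (auto intro!: derivative_eq_intros poly_DERIV[THEN DERIV_chain2] simp: power2_eq_square field_simps)
    moreover have "(poly (pderiv p) (1 / x) * (- 1 / x\<^sup>2)) * exp (- 1 / x) + poly p (1 / x) * (exp (- 1 / x) * (1 / x\<^sup>2))
       = flat ([:0, 0, 1:] * (p - pderiv p)) x"
      using 2 by (simp add: flat_def power2_eq_square field_simps)
    ultimately have "((\<lambda>x. poly p (1 / x) * exp (- 1 / x)) has_real_derivative flat ([:0, 0, 1:] * (p - pderiv p)) x) (at x)"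
      by simp
    then show ?thesis
      by (rule has_field_derivative_transform_within_open[of _ _ _ "{0<..}"]) (use 2 in \<open>auto simp: flat_def\<close>)
  next
    case 3
    then show ?thesis using flat_tendsto_0[of p] by (simp add: has_field_derivative_iff flat_def)
  qed
qed

text \<open>The standard smooth transition from 0 to 1. The denominator is positive since x and 1 -
  x are never both nonpositive.\<close>

definition step :: "real \<Rightarrow> real" where
  "step x = flat 1 x * inverse (flat 1 x + flat 1 (1 - x))"

lemma step_denominator: "flat 1 x + flat 1 (1 - x) > 0"
  by (auto simp: flat_def add_pos_pos)

lemma step_eq: "x \<le> 0 \<Longrightarrow> step x = 0" "1 \<le> x \<Longrightarrow> step x = 1"
  by (auto simp: step_def flat_def)

lemma step_bounds: "0 \<le> step x" "step x \<le> 1"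
proof -
  have "0 \<le> flat 1 x" "0 \<le> flat 1 (1 - x)" by (auto simp: flat_def)
  then show "0 \<le> step x" "step x \<le> 1"
    using step_denominator[of x] by (auto simp: step_def divide_inverse[symmetric] divide_le_eq_1)
qed

lemma smooth_step: "smooth (\<lambda>x::real^'n::finite. step (x $ j))"
proof -
  have f: "smooth (\<lambda>x::real^'n. flat 1 (x $ j))" by (rule smooth_coordinate) (rule flat_derivative)
  have "smooth (\<lambda>x::real^'n. flat 1 (((-1) *\<^sub>R x + (\<chi> j. 1)) $ j))" by (rule smooth_compose_affine[OF f])
  then have g: "smooth (\<lambda>x::real^'n. flat 1 (1 - x $ j))" by simp
  have "flat 1 (x $ j) + flat 1 (1 - x $ j) \<noteq> 0" for x :: "real^'n"
    using step_denominator[of "x $ j"] by simp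
  then show ?thesis
    unfolding step_def by (intro smooth_mult smooth_inverse smooth_add f g)
qed

text \<open>A difference of consecutive translates of the transition function, so that sums over
  integer translates telescope to 1.\<close>

definition tooth :: "real \<Rightarrow> real" where "tooth x = step (x + 1) - step x"

lemma tooth_eq_0: "1 \<le> \<bar>x\<bar> \<Longrightarrow> tooth x = 0"
  by (auto simp: tooth_def abs_if step_eq split: if_splits)

lemma abs_tooth_le: "\<bar>tooth x\<bar> \<le> 1"
  using step_bounds[of x] step_bounds[of "x + 1"] by (auto simp: tooth_def abs_le_iff)

lemma sum_tooth:
  assumes "real_of_int a \<le> x" "x \<le> real_of_int b"
  shows "(\<Sum>k\<in>{a..b}. tooth (x - real_of_int k)) = 1"
proof -
  have ab: "a \<le> b" using assms by linarith
  have "(\<Sum>k\<in>{a..b}. tooth (x - real_of_int k)) = step (x - a + 1) - step (x - b)" using ab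
  proof (induction b rule: int_ge_induct)
    case base
    then show ?case by (simp add: tooth_def)
  next
    case (step b)
    have "{a..b + 1} = insert (b + 1) {a..b}" using step.hyps by auto
    then show ?case using step.IH by (simp add: tooth_def algebra_simps)
  qed
  then show ?thesis using assms by (simp add: step_eq)
qed

definition hat :: "real \<Rightarrow> ('n::finite \<Rightarrow> int) \<Rightarrow> real^'n \<Rightarrow> real" where
  "hat r z x = (\<Prod>j\<in>UNIV. tooth (x $ j / r - real_of_int (z j)))"

lemma hat_scale: "hat r z x = hat 1 (\<lambda>_. 0) ((1 / r) *\<^sub>R x + (\<chi> j. - real_of_int (z j)))"
  by (simp add: hat_def)

lemma smooth_hat:
  fixes z :: "'n::finite \<Rightarrow> int"
  shows "smooth (hat r z)"
proof -
  have t: "smooth (\<lambda>x::real^'n. tooth (x $ j))" for j :: 'n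
  proof -
    have "smooth (\<lambda>x::real^'n. step ((1 *\<^sub>R x + (\<chi> j. 1)) $ j))" by (rule smooth_compose_affine[OF smooth_step])
    then have "smooth (\<lambda>x::real^'n. step (x $ j + 1))" by simp
    then show ?thesis unfolding tooth_def by (intro smooth_diff smooth_step)
  qed
  have "smooth (\<lambda>x::real^'n. \<Prod>j\<in>UNIV. tooth (x $ j))" by (intro smooth_prod t)
  then have "smooth (hat 1 (\<lambda>_. 0) :: real^'n \<Rightarrow> real)" by (simp add: hat_def[abs_def])
  then have "smooth (\<lambda>x. hat 1 (\<lambda>_. 0) ((1 / r) *\<^sub>R x + (\<chi> j. - real_of_int (z j))) :: real)"
    by (rule smooth_compose_affine)
  then show ?thesis by (simp flip: hat_scale)
qed

lemma abs_hat_le: "\<bar>hat r z x\<bar> \<le> 1"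
  unfolding hat_def abs_prod by (intro prod_le_1) (simp add: abs_tooth_le)

lemma hat_nonzero:
  assumes "hat r z x \<noteq> 0" shows "\<bar>x $ j / r - real_of_int (z j)\<bar> < 1"
  using assms tooth_eq_0[of "x $ j / r - real_of_int (z j)"] by (force simp: hat_def)

text \<open>The index set is any finite set containing the hats active at x, since it will depend on
  a simplex or a test function. The sum is transferred to a box with three indices per axis, where
  it factorises into one-dimensional sums.\<close>

lemma sum_hat:
  fixes x :: "real^'n::finite"
  assumes "finite Z" "\<And>z. hat r z x \<noteq> 0 \<Longrightarrow> z \<in> Z"
  shows "(\<Sum>z\<in>Z. hat r z x) = 1"
proof -
  let ?I = "\<lambda>j. {\<lfloor>x $ j / r\<rfloor> - 1..\<lfloor>x $ j / r\<rfloor> + 1}"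
  let ?B = "PiE UNIV ?I"
  have B: "z \<in> ?B" if "hat r z x \<noteq> 0" for z
  proof (rule PiE_I)
    fix j show "z j \<in> ?I j"
      using hat_nonzero[OF that, of j] by simp linarith
  qed simp
  have fin: "finite ?B" by (intro finite_PiE) auto
  have "(\<Sum>z\<in>Z. hat r z x) = (\<Sum>z\<in>Z \<union> ?B. hat r z x)"
    using assms fin by (intro sum.mono_neutral_left) auto
  also have "\<dots> = (\<Sum>z\<in>?B. hat r z x)"
    using assms(1) fin B by (intro sum.mono_neutral_right) auto
  also have "\<dots> = (\<Prod>j\<in>UNIV. \<Sum>k\<in>?I j. tooth (x $ j / r - real_of_int k))"
    unfolding hat_def by (subst prod_sum_PiE) auto
  also have "\<dots> = 1" by (intro prod.neutral ballI sum_tooth) linarith+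
  finally show ?thesis .
qed

subsection \<open>Test functions\<close>

lemma partial_deriv_zero_outside:
  assumes "open U" "\<And>x. x \<in> U \<Longrightarrow> f x = 0" "x \<in> U" shows "partial_derivs is f x = 0"
  using assms(3)
proof (induction "is" arbitrary: x)
  case (Cons i "is")
  have "((\<lambda>x. 0) has_derivative (\<lambda>x. 0)) (at x)" by simp
  then have "(partial_derivs is f has_derivative (\<lambda>x. 0)) (at x)"
    by (rule has_derivative_transform_within_open[OF _ assms(1) Cons.prems]) (simp add: Cons.IH)
  then show ?case by (simp add: partial_deriv_eqI)
qed (use assms in auto)

lemma support_partial_derivs:
  "{x. partial_derivs is f x \<noteq> 0} \<subseteq> closure {x. f x \<noteq> 0}"
proof
  fix x assume x: "x \<in> {x. partial_derivs is f x \<noteq> 0}"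
  show "x \<in> closure {x. f x \<noteq> 0}"
  proof (rule ccontr)
    assume "x \<notin> closure {x. f x \<noteq> 0}"
    then have "partial_derivs is f x = 0"
      using closure_subset[of "{x. f x \<noteq> 0}"]
      by (intro partial_deriv_zero_outside[of "- closure {x. f x \<noteq> 0}"]) auto
    with x show False by simp
  qed
qed

lemma test_function_smooth: "\<psi> \<in> test_functions \<Longrightarrow> smooth \<psi>"
  by (simp add: test_functions_def)

lemma smooth_continuous: "smooth f \<Longrightarrow> continuous_on A f"
  by (simp add: continuous_on_eq_continuous_within smooth_differentiable differentiable_imp_continuous_within differentiable_at_withinI)

lemma test_functionI:
  assumes "smooth \<psi>" "bounded B" "\<And>x. \<psi> x \<noteq> 0 \<Longrightarrow> x \<in> B" shows "\<psi> \<in> test_functions"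
proof -
  have "bounded {x. \<psi> x \<noteq> 0}" by (rule bounded_subset[OF assms(2)]) (use assms(3) in auto)
  then show ?thesis using assms(1) by (simp add: test_functions_def compact_closure)
qed

lemma test_function_bounded_support: "\<psi> \<in> test_functions \<Longrightarrow> bounded {x. \<psi> x \<noteq> 0}"
  by (simp add: test_functions_def compact_closure)

lemma test_function_partial_derivs:
  assumes "\<psi> \<in> test_functions" shows "partial_derivs is \<psi> \<in> test_functions"
proof (rule test_functionI)
  show "smooth (partial_derivs is \<psi>)" using assms by (intro smooth_partial_derivs test_function_smooth)
  show "bounded (closure {x. \<psi> x \<noteq> 0})" by (rule bounded_closure[OF test_function_bounded_support[OF assms]])
  show "x \<in> closure {x. \<psi> x \<noteq> 0}" if "partial_derivs is \<psi> x \<noteq> 0" for x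
    using support_partial_derivs that by blast
qed

lemma test_function_bounded:
  assumes "\<psi> \<in> test_functions" shows "\<exists>M>0. \<forall>x. \<bar>\<psi> x\<bar> \<le> M"
proof -
  have c: "compact (closure {x. \<psi> x \<noteq> 0})" using assms by (simp add: test_functions_def)
  have "compact (\<psi> ` closure {x. \<psi> x \<noteq> 0})"
    by (rule compact_continuous_image[OF smooth_continuous[OF test_function_smooth[OF assms]] c])
  then obtain M where M: "M > 0" "\<And>x. x \<in> closure {x. \<psi> x \<noteq> 0} \<Longrightarrow> norm (\<psi> x) \<le> M"
    using compact_imp_bounded bounded_pos by (metis imageI)
  have "\<bar>\<psi> x\<bar> \<le> M" for x
    using M closure_subset[of "{x. \<psi> x \<noteq> 0}"] by (cases "\<psi> x = 0") auto
  then show ?thesis using M(1) by blast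
qed

lemma test_function_mult:
  assumes "smooth f" "\<psi> \<in> test_functions" shows "(\<lambda>x. f x * \<psi> x) \<in> test_functions"
  by (rule test_functionI[OF smooth_mult[OF assms(1) test_function_smooth[OF assms(2)]]
      test_function_bounded_support[OF assms(2)]]) simp

lemma test_function_lincomb:
  assumes "\<psi> \<in> test_functions" "\<phi> \<in> test_functions" shows "(\<lambda>x. a * \<psi> x + b * \<phi> x) \<in> test_functions"
proof (rule test_functionI)
  show "smooth (\<lambda>x. a * \<psi> x + b * \<phi> x)"
    by (rule smooth_add; rule smooth_mult[OF smooth_const]; rule test_function_smooth[OF assms(1)] test_function_smooth[OF assms(2)])
  show "bounded ({x. \<psi> x \<noteq> 0} \<union> {x. \<phi> x \<noteq> 0})"
    using assms by (simp add: test_function_bounded_support)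
qed auto

lemma test_function_zero: "(\<lambda>x. 0) \<in> test_functions"
  by (rule test_functionI[of _ "{}"]) (auto simp: smooth_const)

lemma test_function_sum:
  assumes "finite I" "\<And>i. i \<in> I \<Longrightarrow> \<psi> i \<in> test_functions"
  shows "(\<lambda>x. \<Sum>i\<in>I. c i * \<psi> i x) \<in> test_functions"
  using assms
proof (induction I rule: finite_induct)
  case (insert i I)
  then show ?case using test_function_lincomb[of "\<psi> i" "\<lambda>x. \<Sum>i\<in>I. c i * \<psi> i x" "c i" 1] by simp
qed (simp add: test_function_zero)

lemma partial_derivs_lincomb:
  assumes "smooth f" "smooth g"
  shows "partial_derivs ks (\<lambda>x. a * f x + b * g x) = (\<lambda>x. a * partial_derivs ks f x + b * partial_derivs ks g x)"
proof (induction ks)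
  case (Cons k ks)
  have d: "partial_derivs ks f differentiable (at x)" "partial_derivs ks g differentiable (at x)" for x
    using smooth_differentiable[OF smooth_partial_derivs] assms by blast+
  have m: "partial_deriv k (\<lambda>x. c * h x) x = c * partial_deriv k h x" if "h differentiable (at x)" for c h and x :: "real^'a"
    using partial_deriv_mult[of "\<lambda>_. c" x h k] that by (simp add: partial_deriv_const)
  have "partial_deriv k (\<lambda>x. a * partial_derivs ks f x + b * partial_derivs ks g x) x
      = a * partial_deriv k (partial_derivs ks f) x + b * partial_deriv k (partial_derivs ks g) x" for x
  proof (subst partial_deriv_add)
    show "(\<lambda>x. a * partial_derivs ks f x) differentiable (at x)" "(\<lambda>x. b * partial_derivs ks g x) differentiable (at x)"
      by (intro differentiable_mult differentiable_const d)+
  qed (simp add: m d)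
  then show ?case using Cons by simp
qed simp

lemma distribution_lincomb:
  "F \<in> distributions \<Longrightarrow> \<psi> \<in> test_functions \<Longrightarrow> \<phi> \<in> test_functions \<Longrightarrow>
    F (\<lambda>x. a * \<psi> x + b * \<phi> x) = a * F \<psi> + b * F \<phi>"
  by (simp add: distributions_def)

lemma distribution_zero: "F \<in> distributions \<Longrightarrow> F (\<lambda>x. 0) = 0"
  using distribution_lincomb[OF _ test_function_zero test_function_zero, of F 0 0] by simp

lemma distribution_sum:
  assumes F: "F \<in> distributions" and "finite I" "\<And>i. i \<in> I \<Longrightarrow> \<psi> i \<in> test_functions"
  shows "F (\<lambda>x. \<Sum>i\<in>I. c i * \<psi> i x) = (\<Sum>i\<in>I. c i * F (\<psi> i))"
  using assms(2,3)
proof (induction I rule: finite_induct)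
  case (insert i I)
  then show ?case
    using distribution_lincomb[OF F, of "\<psi> i" "\<lambda>x. \<Sum>i\<in>I. c i * \<psi> i x" "c i" 1] test_function_sum[of I \<psi> c] by simp
qed (simp add: distribution_zero F)

lemma sum_abs_nth_le: "norm x \<le> (\<Sum>j\<in>UNIV. \<bar>x $ j\<bar>)"
  for x :: "real^'n::finite" by (rule norm_le_l1_cart)

lemma smooth_Lipschitz:
  fixes f :: "real^'n::finite \<Rightarrow> real"
  assumes f: "smooth f" and M: "\<And>j x. \<bar>partial_deriv j f x\<bar> \<le> M j"
  shows "\<bar>f x - f y\<bar> \<le> (\<Sum>j\<in>UNIV. M j) * norm (x - y)"
proof -
  have "\<forall>x. \<exists>f'. (f has_derivative f') (at x)"
    using smooth_differentiable[OF f] by (auto simp: differentiable_def)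
  then obtain f' where f': "\<And>x. (f has_derivative f' x) (at x)" by metis
  have "onorm (f' x) \<le> (\<Sum>j\<in>UNIV. M j)" for x
  proof (rule onorm_le)
    fix h
    have l: "linear (f' x)" using f' by (rule has_derivative_linear)
    have "f' x h = f' x (\<Sum>j\<in>UNIV. h $ j *\<^sub>R axis j 1)"
      by (simp add: basis_expansion flip: scalar_mult_eq_scaleR)
    also have "\<dots> = (\<Sum>j\<in>UNIV. h $ j * partial_deriv j f x)"
      using l partial_deriv_eqI[OF f'] by (simp add: linear_sum linear_cmul)
    finally have "norm (f' x h) \<le> (\<Sum>j\<in>UNIV. \<bar>h $ j\<bar> * \<bar>partial_deriv j f x\<bar>)"
      by (simp add: sum_abs order.trans[OF sum_abs] abs_mult)
    also have "\<dots> \<le> (\<Sum>j\<in>UNIV. norm h * M j)"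
      by (intro sum_mono mult_mono component_le_norm_cart M) auto
    finally show "norm (f' x h) \<le> (\<Sum>j\<in>UNIV. M j) * norm h" by (simp add: sum_distrib_left mult.commute)
  qed
  then have "norm (f x - f y) \<le> (\<Sum>j\<in>UNIV. M j) * norm (x - y)"
    using f' by (intro differentiable_bound[of UNIV f f']) auto
  then show ?thesis by simp
qed

text \<open>All hats are translates and dilates of a single test function, and dilation by r divides
  derivatives by r. A constant that is at least 1 can be inserted as a factor into later bounds
  without a case distinction.\<close>

lemma hat_constant_ex:
  "\<exists>M\<ge>1. \<forall>(r::real)>0. \<forall>z (x::real^'n::finite) j. \<bar>partial_deriv j (hat r z) x\<bar> \<le> M / r"
proof -
  let ?h = "hat 1 (\<lambda>_. 0) :: real^'n \<Rightarrow> real"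
  have t: "?h \<in> test_functions"
  proof (rule test_functionI[OF smooth_hat])
    show "bounded (cball (0::real^'n) (real CARD('n)))" by simp
    fix x assume "?h x \<noteq> 0"
    then have "\<bar>x $ j\<bar> \<le> 1" for j using hat_nonzero[of 1 "\<lambda>_. 0" x j] by simp
    then have "(\<Sum>j\<in>UNIV. \<bar>x $ j\<bar>) \<le> real CARD('n)" using sum_bounded_above[of UNIV "\<lambda>j. \<bar>x $ j\<bar>" 1] by simp
    then show "x \<in> cball 0 (real CARD('n))" using sum_abs_nth_le[of x] by simp
  qed
  have "\<exists>M>0. \<forall>x. \<bar>partial_deriv j ?h x\<bar> \<le> M" for j
    using test_function_bounded[OF test_function_partial_derivs[OF t, of "[j]"]] by simp
  then obtain M where M: "\<And>j. M j > 0" "\<And>j x. \<bar>partial_deriv j ?h x\<bar> \<le> M j" by metis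
  define C where "C = 1 + (\<Sum>j\<in>UNIV. M j)"
  have MC: "M j \<le> C" for j
    using member_le_sum[of j UNIV M] M(1) by (simp add: C_def less_imp_le)
  have "\<bar>partial_deriv j (hat r z) x\<bar> \<le> C / r" if "r > 0" for r :: real and z :: "'n \<Rightarrow> int" and x :: "real^'n" and j
  proof -
    have "hat r z = (\<lambda>x. ?h ((1 / r) *\<^sub>R x + (\<chi> j. - real_of_int (z j))))" by (rule ext) (rule hat_scale)
    then have "partial_deriv j (hat r z) x = (1 / r) * partial_deriv j ?h ((1 / r) *\<^sub>R x + (\<chi> j. - real_of_int (z j)))"
      using differentiable_compose_affine(2)[OF smooth_differentiable[OF smooth_hat], where c = "1 / r"] by simp
    then have "\<bar>partial_deriv j (hat r z) x\<bar> \<le> (1 / r) * M j"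
      using that M(2) by (simp add: abs_mult divide_right_mono)
    also have "\<dots> \<le> C / r" using MC that by (simp add: divide_right_mono)
    finally show ?thesis .
  qed
  moreover have "C \<ge> 1" using M(1) by (simp add: C_def sum_nonneg less_imp_le)
  ultimately show ?thesis by blast
qed

definition hat_constant :: "'n::finite itself \<Rightarrow> real" where
  "hat_constant _ = (SOME M. 1 \<le> M \<and> (\<forall>(r::real)>0. \<forall>z (x::real^'n) j. \<bar>partial_deriv j (hat r z) x\<bar> \<le> M / r))"

lemma hat_constant:
  "1 \<le> hat_constant TYPE('n::finite)"
  "0 < r \<Longrightarrow> \<bar>partial_deriv j (hat r z) (x::real^'n)\<bar> \<le> hat_constant TYPE('n) / r"
  using someI_ex[OF hat_constant_ex[where 'n='n, unfolded Bex_def]] unfolding hat_constant_def by blast+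

subsection \<open>Lattice cells\<close>

text \<open>Half-open cells partition space exactly, which makes \<open>index\<close> a function;
  closed cubes are used where charges are evaluated. Hats and densities use the offset t = 0, while
  a general offset is averaged over when the charge is recovered from its distribution.\<close>

definition cell :: "real \<Rightarrow> real^'n \<Rightarrow> ('n::finite \<Rightarrow> int) \<Rightarrow> (real^'n) set" where
  "cell r t z = {y. \<forall>j. \<lfloor>(y $ j - t $ j) / r\<rfloor> = z j}"

definition index :: "real \<Rightarrow> real^'n \<Rightarrow> real^'n \<Rightarrow> ('n::finite \<Rightarrow> int)" where
  "index r t y = (\<lambda>j. \<lfloor>(y $ j - t $ j) / r\<rfloor>)"

definition corner :: "real \<Rightarrow> real^'n \<Rightarrow> ('n::finite \<Rightarrow> int) \<Rightarrow> real^'n" where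
  "corner r t z = (\<chi> j. t $ j + r * real_of_int (z j))"

lemma corner_nth [simp]: "corner r t z $ j = t $ j + r * real_of_int (z j)" by (simp add: corner_def)

lemma mem_cell_index: "y \<in> cell r t z \<longleftrightarrow> z = index r t y"
  by (auto simp: cell_def index_def fun_eq_iff)

lemma cell_disjoint: "z \<noteq> z' \<Longrightarrow> cell r t z \<inter> cell r t z' = {}"
  by (auto simp: mem_cell_index)

lemma mem_cell_iff:
  assumes "0 < r"
  shows "y \<in> cell r t z \<longleftrightarrow> (\<forall>j. corner r t z $ j \<le> y $ j \<and> y $ j < corner r t z $ j + r)"
proof -
  have "\<lfloor>(y $ j - t $ j) / r\<rfloor> = z j \<longleftrightarrow> corner r t z $ j \<le> y $ j \<and> y $ j < corner r t z $ j + r" for j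
    using assms by (simp add: floor_eq_iff field_simps)
  then show ?thesis by (simp add: cell_def)
qed

lemma corner_in_cell: "0 < r \<Longrightarrow> corner r t z \<in> cell r t z"
  by (simp add: mem_cell_iff)

definition cube :: "real^'n::finite \<Rightarrow> real \<Rightarrow> (real^'n) set" where
  "cube x r = cbox x (x + (\<chi> j. r))"

lemma mem_cube: "y \<in> cube x r \<longleftrightarrow> (\<forall>j. x $ j \<le> y $ j \<and> y $ j \<le> x $ j + r)"
  by (simp add: cube_def mem_box_cart)

lemma negligible_coordinate_hyperplane: "negligible {y::real^'n::finite. y $ j = c}"
  using negligible_hyperplane[of "axis j (1::real)" c] by (simp add: inner_axis' axis_eq_0_iff)

lemma cell_cube:
  fixes t :: "real^'n::finite"
  assumes "0 < r"
  shows "cell r t z \<subseteq> cube (corner r t z) r" "negligible (cube (corner r t z) r - cell r t z)"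
proof -
  show "cell r t z \<subseteq> cube (corner r t z) r" using assms by (auto simp: mem_cell_iff mem_cube less_imp_le)
  have "negligible (\<Union>j. {y. y $ j = corner r t z $ j + r})"
    by (intro negligible_Union) (auto simp: negligible_coordinate_hyperplane)
  then show "negligible (cube (corner r t z) r - cell r t z)"
    by (rule negligible_subset) (use assms in \<open>auto simp: mem_cell_iff mem_cube less_le\<close>)
qed

lemma cube_measure: "0 \<le> r \<Longrightarrow> measure lebesgue (cube (x::real^'n::finite) r) = r ^ CARD('n)"
proof -
  assume r: "0 \<le> r"
  then have ne: "cbox x (x + (\<chi> j. r)) \<noteq> {}" by (auto simp: interval_ne_empty_cart)
  have "measure lebesgue (cube x r) = measure lborel (cbox x (x + (\<chi> j. r)))" by (simp add: cube_def)
  then show ?thesis using content_cbox_cart[OF ne] by simp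
qed

lemma cell_sets_borel: "0 < r \<Longrightarrow> cell r t z \<in> sets borel"
proof -
  assume r: "0 < r"
  have "cell r t z = (\<Inter>j. {y. corner r t z $ j \<le> y $ j} \<inter> {y. y $ j < corner r t z $ j + r})"
    using r by (auto simp: mem_cell_iff)
  also have "\<dots> \<in> sets borel"
    by (intro sets.finite_INT sets.Int borel_closed borel_open closed_Collect_le open_Collect_less continuous_intros) auto
  finally show ?thesis .
qed

lemma cell_lmeasurable: "0 < r \<Longrightarrow> cell r t z \<in> lmeasurable"
  using cell_cube(1)[of r t z] cell_sets_borel[of r t z]
  by (intro bounded_set_imp_lmeasurable) (auto simp: cube_def intro: bounded_subset[OF bounded_cbox])

lemma cell_measure:
  fixes t :: "real^'n::finite"
  assumes "0 < r" shows "measure lebesgue (cell r t z) = r ^ CARD('n)"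
proof -
  have "measure lebesgue (cell r t z) = measure lebesgue (cube (corner r t z) r)"
  proof (rule measure_negligible_symdiff[symmetric, OF cell_lmeasurable[OF assms]])
    show "negligible (sym_diff (cell r t z) (cube (corner r t z) r))"
      by (rule negligible_subset[OF cell_cube(2)[OF assms, of t z]]) (use cell_cube(1)[OF assms, of t z] in auto)
  qed
  then show ?thesis using assms by (simp add: cube_measure)
qed

lemma cell_dist:
  fixes x y :: "real^'n::finite"
  assumes "0 < r" "\<And>j. \<bar>x $ j - y $ j\<bar> \<le> r" shows "norm (x - y) \<le> real CARD('n) * r"
proof -
  have "norm (x - y) \<le> (\<Sum>j\<in>UNIV. \<bar>(x - y) $ j\<bar>)" by (rule norm_le_l1_cart)
  also have "\<dots> \<le> (\<Sum>j\<in>(UNIV::'n set). r)" using assms by (intro sum_mono) auto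
  finally show ?thesis by simp
qed

lemma cube_dist: "0 < r \<Longrightarrow> x \<in> cube a r \<Longrightarrow> y \<in> cube a r \<Longrightarrow> norm (x - y) \<le> real CARD('n) * r"
  for x :: "real^'n::finite"
  by (rule cell_dist) (auto simp: mem_cube abs_le_iff, (smt (verit))+)

lemma finite_cells:
  fixes A :: "(real^'n::finite) set"
  assumes r: "0 < r" and A: "bounded A" shows "finite {z. cell r t z \<inter> A \<noteq> {}}"
proof -
  obtain R where R: "\<And>x. x \<in> A \<Longrightarrow> norm x \<le> R" using A by (auto simp: bounded_iff)
  let ?I = "\<lambda>j. {\<lfloor>(- R - t $ j) / r\<rfloor>..\<lfloor>(R - t $ j) / r\<rfloor>}"
  have "{z. cell r t z \<inter> A \<noteq> {}} \<subseteq> PiE UNIV ?I"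
  proof
    fix z assume "z \<in> {z. cell r t z \<inter> A \<noteq> {}}"
    then obtain x where x: "x \<in> cell r t z" "x \<in> A" by auto
    show "z \<in> PiE UNIV ?I"
    proof (rule PiE_I)
      fix j
      have "- R \<le> x $ j" "x $ j \<le> R" using R[OF x(2)] component_le_norm_cart[of x j] by auto
      then have "(- R - t $ j) / r \<le> (x $ j - t $ j) / r" "(x $ j - t $ j) / r \<le> (R - t $ j) / r"
        using r by (auto intro: divide_right_mono)
      moreover have "z j = \<lfloor>(x $ j - t $ j) / r\<rfloor>" using x(1) by (simp add: cell_def)
      ultimately show "z j \<in> ?I j"
        by (auto intro: floor_mono)
    qed simp
  qed
  then show ?thesis by (rule finite_subset) (intro finite_PiE, auto)
qed

text \<open>Disjointness converts a count of lattice cells into a volume. This is how sums over the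
  cells near a boundary are bounded by the volume of a boundary layer.\<close>

lemma card_cells_le:
  fixes W :: "(real^'n::finite) set"
  assumes r: "0 < r" and Z: "finite Z" and W: "W \<in> lmeasurable" "\<And>z. z \<in> Z \<Longrightarrow> cell r t z \<subseteq> W"
  shows "real (card Z) * r ^ CARD('n) \<le> measure lebesgue W"
proof -
  have "disjoint_family_on (cell r t) Z"
    unfolding disjoint_family_on_def by (simp add: cell_disjoint)
  then have "measure lebesgue (\<Union>z\<in>Z. cell r t z) = (\<Sum>z\<in>Z. measure lebesgue (cell r t z))"
    using Z fmeasurableD[OF cell_lmeasurable[OF r]] fmeasurableD2[OF cell_lmeasurable[OF r]]
    by (intro measure_finite_Union) (auto simp: infinity_ennreal_def)
  also have "\<dots> = real (card Z) * r ^ CARD('n)" by (simp add: cell_measure[OF r])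
  finally have "real (card Z) * r ^ CARD('n) = measure lebesgue (\<Union>z\<in>Z. cell r t z)" ..
  also have "\<dots> \<le> measure lebesgue W"
    using W Z by (intro measure_mono_fmeasurable sets.finite_UN fmeasurableD cell_lmeasurable r) auto
  finally show ?thesis .
qed

text \<open>The support of a hat reaches r to both sides of the corner and the cell reaches r to one
  side, hence 2 r per coordinate; the factor d comes from comparing the Euclidean norm with the sum
  of the coordinates.\<close>

lemma hat_cell_dist:
  fixes x y :: "real^'n::finite"
  assumes r: "0 < r" and "hat r z x \<noteq> 0" "y \<in> cell r 0 z"
  shows "norm (x - y) \<le> 2 * real CARD('n) * r"
proof -
  have "\<bar>x $ j - y $ j\<bar> \<le> 2 * r" for j
  proof -
    have "\<bar>x $ j / r - real_of_int (z j)\<bar> < 1" by (rule hat_nonzero[OF assms(2)])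
    then have "\<bar>x $ j - r * real_of_int (z j)\<bar> < r" using r by (simp add: abs_less_iff field_simps)
    moreover have "r * real_of_int (z j) \<le> y $ j" "y $ j < r * real_of_int (z j) + r"
      using assms(3) r by (auto simp: mem_cell_iff)
    ultimately show ?thesis by linarith
  qed
  then show ?thesis using cell_dist[of "2 * r" x y] r by (simp add: mult.assoc mult.left_commute)
qed

section \<open>Discrete integration by parts\<close>

subsection \<open>Integrals of locally bounded functions\<close>

lemma integral_translate:
  fixes f :: "'a::euclidean_space \<Rightarrow> real"
  assumes "f \<in> borel_measurable borel"
  shows "(LINT x|lborel. f (x + c)) = (LINT x|lborel. f x)"
proof -
  have "(LINT x|lborel. f x) = (LINT x|distr lborel borel ((+) c). f x)" by (simp add: lborel_distr_plus)
  also have "\<dots> = (LINT x|lborel. f (c + x))" using assms by (subst integral_distr) auto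
  finally show ?thesis by (simp add: add.commute)
qed

lemma integrable_supported:
  fixes f :: "'a::euclidean_space \<Rightarrow> real"
  assumes f: "f \<in> borel_measurable borel" and A: "A \<in> sets borel" "emeasure lborel A < \<infinity>"
    and M: "\<And>x. x \<in> A \<Longrightarrow> \<bar>f x\<bar> \<le> M" and z: "\<And>x. x \<notin> A \<Longrightarrow> f x = 0"
  shows "integrable lborel f" "\<bar>LINT x|lborel. f x\<bar> \<le> M * measure lborel A"
proof -
  have i: "integrable lborel (\<lambda>x. M * indicat_real A x)" using A by (intro integrable_mult_right integrable_real_indicator) auto
  have b: "norm (f x) \<le> M * indicat_real A x" for x using M[of x] z[of x] by (auto simp: indicator_def)
  have b': "norm (f x) \<le> norm (M * indicat_real A x)" for x using b[of x] by simp
  show int: "integrable lborel f" using f b' by (intro Bochner_Integration.integrable_bound[OF i]) auto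
  have "\<bar>LINT x|lborel. f x\<bar> \<le> (LINT x|lborel. \<bar>f x\<bar>)" using integral_abs_bound by blast
  also have "\<dots> \<le> (LINT x|lborel. M * indicat_real A x)" using int i b by (intro integral_mono) auto
  also have "\<dots> = M * measure lborel A" using A by simp
  finally show "\<bar>LINT x|lborel. f x\<bar> \<le> M * measure lborel A" .
qed

text \<open>No regularity beyond measurability is available for box values. This class is meant for
  them and \<open>comp_bounded\<close> for the functions they are tested on; both are stable under
  translations and differences, as summation by parts requires.\<close>

definition loc_bounded :: "(real^'n::finite \<Rightarrow> real) \<Rightarrow> bool" where
  "loc_bounded f \<longleftrightarrow> f \<in> borel_measurable borel \<and> (\<forall>R. \<exists>M. \<forall>x. norm x \<le> R \<longrightarrow> \<bar>f x\<bar> \<le> M)"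

definition comp_bounded :: "(real^'n::finite \<Rightarrow> real) \<Rightarrow> bool" where
  "comp_bounded f \<longleftrightarrow> f \<in> borel_measurable borel \<and> (\<exists>M. \<forall>x. \<bar>f x\<bar> \<le> M) \<and> (\<exists>R. \<forall>x. f x \<noteq> 0 \<longrightarrow> norm x \<le> R)"

lemma integrable_loc_comp:
  assumes "loc_bounded u" "comp_bounded \<psi>" shows "integrable lborel (\<lambda>x. u x * \<psi> x)"
proof -
  obtain M R where \<psi>: "\<psi> \<in> borel_measurable borel" "\<And>x. \<bar>\<psi> x\<bar> \<le> M" "\<And>x. \<psi> x \<noteq> 0 \<Longrightarrow> norm x \<le> R"
    using assms(2) by (auto simp: comp_bounded_def)
  obtain L where u: "u \<in> borel_measurable borel" "\<And>x. norm x \<le> R \<Longrightarrow> \<bar>u x\<bar> \<le> L"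
    using assms(1) unfolding loc_bounded_def by blast
  show ?thesis
  proof (rule integrable_supported(1)[where A = "cball 0 R" and M = "L * M"])
    show "\<bar>u x * \<psi> x\<bar> \<le> L * M" if "x \<in> cball 0 R" for x
    proof -
      have "\<bar>u x\<bar> \<le> L" using u(2) that by simp
      then show ?thesis unfolding abs_mult using \<psi>(2)[of x] by (intro mult_mono) auto
    qed
    show "(\<lambda>x. u x * \<psi> x) \<in> borel_measurable borel" using u(1) \<psi>(1) by simp
    show "emeasure lborel (cball (0::real^'a) R) < \<infinity>" by (rule emeasure_bounded_finite[OF bounded_cball])
    show "u x * \<psi> x = 0" if "x \<notin> cball 0 R" for x using \<psi>(3)[of x] that by auto
  qed simp
qed

lemma loc_bounded_translate: assumes "loc_bounded f" shows "loc_bounded (\<lambda>x. f (x + c))"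
  unfolding loc_bounded_def
proof (intro conjI allI)
  have [measurable]: "f \<in> borel_measurable borel" using assms by (simp add: loc_bounded_def)
  show "(\<lambda>x. f (x + c)) \<in> borel_measurable borel" by measurable
  fix R obtain M where M: "\<And>x. norm x \<le> R + norm c \<Longrightarrow> \<bar>f x\<bar> \<le> M" using assms unfolding loc_bounded_def by blast
  have "norm (x + c) \<le> R + norm c" if "norm x \<le> R" for x using norm_triangle_ineq[of x c] that by linarith
  then show "\<exists>M. \<forall>x. norm x \<le> R \<longrightarrow> \<bar>f (x + c)\<bar> \<le> M" using M by blast
qed

lemma loc_bounded_diff: assumes "loc_bounded f" "loc_bounded g" shows "loc_bounded (\<lambda>x. f x - g x)"
  unfolding loc_bounded_def
proof (intro conjI allI)
  show "(\<lambda>x. f x - g x) \<in> borel_measurable borel"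
    using assms unfolding loc_bounded_def by (intro borel_measurable_diff) auto
  fix R obtain M where M: "\<And>x. norm x \<le> R \<Longrightarrow> \<bar>f x\<bar> \<le> M" using assms(1) unfolding loc_bounded_def by blast
  obtain M' where M': "\<And>x. norm x \<le> R \<Longrightarrow> \<bar>g x\<bar> \<le> M'" using assms(2) unfolding loc_bounded_def by blast
  have "\<bar>f x - g x\<bar> \<le> M + M'" if "norm x \<le> R" for x using M[OF that] M'[OF that] by linarith
  then show "\<exists>M. \<forall>x. norm x \<le> R \<longrightarrow> \<bar>f x - g x\<bar> \<le> M" by blast
qed

lemma comp_bounded_translate: assumes "comp_bounded f" shows "comp_bounded (\<lambda>x. f (x + c))"
proof -
  obtain M R where f: "f \<in> borel_measurable borel" "\<And>x. \<bar>f x\<bar> \<le> M" "\<And>x. f x \<noteq> 0 \<Longrightarrow> norm x \<le> R"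
    using assms by (auto simp: comp_bounded_def)
  have "norm x \<le> R + norm c" if "f (x + c) \<noteq> 0" for x
    using f(3)[OF that] norm_triangle_ineq4[of "x + c" c] by simp
  moreover have "(\<lambda>x. f (x + c)) \<in> borel_measurable borel" using f(1) by measurable
  ultimately show ?thesis using f(2) unfolding comp_bounded_def by blast
qed

lemma comp_bounded_diff: assumes "comp_bounded f" "comp_bounded g" shows "comp_bounded (\<lambda>x. f x - g x)"
proof -
  obtain M R where f: "f \<in> borel_measurable borel" "\<And>x. \<bar>f x\<bar> \<le> M" "\<And>x. f x \<noteq> 0 \<Longrightarrow> norm x \<le> R"
    using assms(1) by (auto simp: comp_bounded_def)
  obtain M' R' where g: "g \<in> borel_measurable borel" "\<And>x. \<bar>g x\<bar> \<le> M'" "\<And>x. g x \<noteq> 0 \<Longrightarrow> norm x \<le> R'"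
    using assms(2) by (auto simp: comp_bounded_def)
  have "\<bar>f x - g x\<bar> \<le> M + M'" for x using f(2)[of x] g(2)[of x] by linarith
  moreover have "norm x \<le> max R R'" if "f x - g x \<noteq> 0" for x
    using f(3)[of x] g(3)[of x] that by (cases "f x = 0") auto
  moreover have "(\<lambda>x. f x - g x) \<in> borel_measurable borel" using f(1) g(1) by measurable
  ultimately show ?thesis unfolding comp_bounded_def by blast
qed

lemma test_function_comp_bounded: assumes "\<psi> \<in> test_functions" shows "comp_bounded \<psi>"
proof -
  have "\<psi> \<in> borel_measurable borel"
    by (rule borel_measurable_continuous_onI[OF smooth_continuous[OF test_function_smooth[OF assms]]])
  then show ?thesis
    using test_function_bounded[OF assms] test_function_bounded_support[OF assms]
    unfolding comp_bounded_def bounded_iff by blast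
qed

subsection \<open>Iterated differences\<close>

primrec fdiff :: "real \<Rightarrow> 'n::finite list \<Rightarrow> (real^'n \<Rightarrow> real) \<Rightarrow> real^'n \<Rightarrow> real" where
  "fdiff h [] f = f"
| "fdiff h (i # ks) f = (\<lambda>x. fdiff h ks f (x + h *\<^sub>R axis i 1) - fdiff h ks f x)"

primrec bdiff :: "real \<Rightarrow> 'n::finite list \<Rightarrow> (real^'n \<Rightarrow> real) \<Rightarrow> real^'n \<Rightarrow> real" where
  "bdiff h [] f = f"
| "bdiff h (i # ks) f = (\<lambda>x. bdiff h ks f x - bdiff h ks f (x + (- h) *\<^sub>R axis i 1))"

lemma bdiff_translate: "bdiff h ks (\<lambda>x. f (x + c)) = (\<lambda>x. bdiff h ks f (x + c))"
  by (induction "ks") (auto simp: fun_eq_iff algebra_simps)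

lemma bdiff_diff: "bdiff h ks (\<lambda>x. f x - g x) = (\<lambda>x. bdiff h ks f x - bdiff h ks g x)"
  by (induction "ks") (auto simp: fun_eq_iff)

text \<open>Difference operators commute with translations, so the newest one may act first. The
  induction for summation by parts moves the outermost difference first and needs this
  exchange.\<close>

lemma bdiff_Cons_inner: "bdiff h (i # ks) f = bdiff h ks (\<lambda>x. f x - f (x + (- h) *\<^sub>R axis i 1))"
  unfolding bdiff_diff by (simp only: bdiff.simps bdiff_translate)

lemma loc_bounded_fdiff: "loc_bounded u \<Longrightarrow> loc_bounded (fdiff h ks u)"
proof (induction "ks")
  case (Cons i "ks")
  then show ?case
    unfolding fdiff.simps by (intro loc_bounded_diff loc_bounded_translate) auto
qed simp

text \<open>Translation invariance of Lebesgue measure turns a shift by h of u into a shift by -h of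
  \<psi>; each difference contributes one sign.\<close>

lemma integral_fdiff:
  assumes "loc_bounded u" "comp_bounded \<psi>"
  shows "(LINT x|lborel. fdiff h ks u x * \<psi> x) = (-1) ^ length ks * (LINT x|lborel. u x * bdiff h ks \<psi> x)"
  using assms(2)
proof (induction "ks" arbitrary: \<psi>)
  case (Cons i "ks")
  let ?g = "fdiff h ks u" and ?c = "h *\<^sub>R axis i 1"
  have g: "loc_bounded ?g" by (rule loc_bounded_fdiff[OF assms(1)])
  have t: "comp_bounded (\<lambda>x. \<psi> (x + (- h) *\<^sub>R axis i 1))" by (rule comp_bounded_translate[OF Cons.prems])
  have b: "?g \<in> borel_measurable borel" "(\<lambda>x. \<psi> (x + (- h) *\<^sub>R axis i 1)) \<in> borel_measurable borel"
    using g t by (auto simp: loc_bounded_def comp_bounded_def)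
  have "(LINT x|lborel. fdiff h (i # ks) u x * \<psi> x) = (LINT x|lborel. ?g (x + ?c) * \<psi> x - ?g x * \<psi> x)"
    by (simp add: left_diff_distrib)
  also have "\<dots> = (LINT x|lborel. ?g (x + ?c) * \<psi> x) - (LINT x|lborel. ?g x * \<psi> x)"
    by (intro Bochner_Integration.integral_diff integrable_loc_comp loc_bounded_translate g Cons.prems)
  also have "(LINT x|lborel. ?g (x + ?c) * \<psi> x) = (LINT x|lborel. (\<lambda>x. ?g x * \<psi> (x + (- h) *\<^sub>R axis i 1)) (x + ?c))"
    by (simp add: add.assoc)
  also have "\<dots> = (LINT x|lborel. ?g x * \<psi> (x + (- h) *\<^sub>R axis i 1))"
    by (rule integral_translate) (intro borel_measurable_times b)
  also have "\<dots> - (LINT x|lborel. ?g x * \<psi> x) = - (LINT x|lborel. ?g x * (\<psi> x - \<psi> (x + (- h) *\<^sub>R axis i 1)))"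
    using Bochner_Integration.integral_diff[OF integrable_loc_comp[OF g Cons.prems] integrable_loc_comp[OF g t]]
    unfolding right_diff_distrib by linarith
  also have "\<dots> = - ((-1) ^ length ks * (LINT x|lborel. u x * bdiff h ks (\<lambda>x. \<psi> x - \<psi> (x + (- h) *\<^sub>R axis i 1)) x))"
    by (subst Cons.IH[OF comp_bounded_diff[OF Cons.prems t]]) (rule refl)
  also have "\<dots> = (-1) ^ length (i # ks) * (LINT x|lborel. u x * bdiff h (i # ks) \<psi> x)"
    by (simp only: bdiff_Cons_inner) simp
  finally show ?case .
qed simp

lemma directional_mean_value:
  assumes g: "\<And>x. g differentiable (at x)" and h: "0 < h"
  shows "\<exists>y. norm (y - x) \<le> h \<and> g x - g (x + (- h) *\<^sub>R axis i 1) = h * partial_deriv i g y"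
proof -
  have "\<exists>s. -h < s \<and> s < 0 \<and> g (x + 0 *\<^sub>R axis i 1) - g (x + (- h) *\<^sub>R axis i 1) = (0 - (-h)) * partial_deriv i g (x + s *\<^sub>R axis i 1)"
    using h by (intro MVT2 differentiable_has_partial[OF g]) auto
  then obtain s where s: "-h < s" "s < 0" "g x - g (x + (- h) *\<^sub>R axis i 1) = h * partial_deriv i g (x + s *\<^sub>R axis i 1)"
    by auto
  then show ?thesis by (intro exI[of _ "x + s *\<^sub>R axis i 1"]) auto
qed

lemma partial_deriv_translate_diff:
  assumes "smooth f"
  shows "partial_derivs ks (\<lambda>x. f x - f (x + c)) x = partial_derivs ks f x - partial_derivs ks f (x + c)"
proof (induction "ks" arbitrary: x)
  case (Cons i "ks")
  have d: "partial_derivs ks f differentiable (at x)" for x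
    by (rule smooth_differentiable[OF smooth_partial_derivs[OF assms]])
  obtain f' where f': "\<And>x. (partial_derivs ks f has_derivative f' x) (at x)"
    using d unfolding differentiable_def by metis
  have "((\<lambda>x. x + c) has_derivative (\<lambda>x. x)) (at x)" by (auto intro!: derivative_eq_intros)
  from diff_chain_at[OF this f'[of "x + c"]]
  have "((\<lambda>x. partial_derivs ks f (x + c)) has_derivative f' (x + c)) (at x)" by (simp add: o_def)
  from has_derivative_diff[OF f' this]
  have "(partial_derivs ks (\<lambda>x. f x - f (x + c)) has_derivative (\<lambda>h. f' x h - f' (x + c) h)) (at x)"
  proof -
    have "partial_derivs ks (\<lambda>x. f x - f (x + c)) = (\<lambda>x. partial_derivs ks f x - partial_derivs ks f (x + c))"
      by (rule ext) (rule Cons.IH)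
    then show ?thesis using \<open>((\<lambda>x. partial_derivs ks f x - partial_derivs ks f (x + c)) has_derivative (\<lambda>h. f' x h - f' (x + c) h)) (at x)\<close>
      by simp
  qed
  then show ?case by (simp add: partial_deriv_eqI[OF f'] partial_deriv_eqI)
qed simp

text \<open>One application of the mean value theorem per difference, each moving the evaluation
  point by at most h. It rests on the fact that partial derivatives commute with
  translations.\<close>

lemma bdiff_mean_value:
  assumes "smooth f" "0 < h"
  shows "\<exists>y. norm (y - x) \<le> real (length ks) * h \<and> bdiff h ks f x = h ^ length ks * partial_derivs ks f y"
  using assms(1)
proof (induction "ks" arbitrary: f x)
  case Nil
  then show ?case by (intro exI[of _ x]) simp
next
  case (Cons i "ks")
  let ?c = "(- h) *\<^sub>R axis i 1"
  have "smooth (\<lambda>x. f (1 *\<^sub>R x + ?c))" by (rule smooth_compose_affine[OF Cons.prems])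
  then have "smooth (\<lambda>x. f x - f (x + ?c))" by (intro smooth_diff Cons.prems) simp
  from Cons.IH[OF this, of x] obtain y where y: "norm (y - x) \<le> real (length ks) * h"
    "bdiff h ks (\<lambda>x. f x - f (x + ?c)) x = h ^ length ks * (partial_derivs ks f y - partial_derivs ks f (y + ?c))"
    unfolding partial_deriv_translate_diff[OF Cons.prems] by blast
  obtain z where z: "norm (z - y) \<le> h" "partial_derivs ks f y - partial_derivs ks f (y + ?c) = h * partial_deriv i (partial_derivs ks f) z"
    using directional_mean_value[OF smooth_differentiable[OF smooth_partial_derivs[OF Cons.prems]] assms(2)] by blast
  have "norm (z - x) \<le> norm (z - y) + norm (y - x)" using norm_triangle_ineq[of "z - y" "y - x"] by simp
  then have "norm (z - x) \<le> real (length (i # ks)) * h" using z(1) y(1) by (simp add: algebra_simps)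
  moreover have "bdiff h (i # ks) f x = h ^ length (i # ks) * partial_derivs (i # ks) f z"
    unfolding bdiff_Cons_inner y(2) z(2) by simp
  ultimately show ?case by blast
qed

subsection \<open>Signed boxes\<close>

definition upd :: "real^'n \<Rightarrow> 'n::finite \<Rightarrow> real \<Rightarrow> real^'n" where
  "upd a i p = (\<chi> j. if j = i then p else a $ j)"

lemma upd_nth [simp]: "upd a i p $ j = (if j = i then p else a $ j)" by (simp add: upd_def)

lemma extend_cbox_split:
  fixes a b :: "real^'n::finite"
  assumes B: "simplex_additive B" and pqr: "p \<le> q" "q \<le> r"
  shows "extend B (cbox (upd a i p) (upd b i r)) = extend B (cbox (upd a i p) (upd b i q)) + extend B (cbox (upd a i q) (upd b i r))"
proof -
  let ?P = "\<lambda>k. if k then cbox (upd a i p) (upd b i q) else cbox (upd a i q) (upd b i r)"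
  have "negligible (cbox (upd a i p) (upd b i q) \<inter> cbox (upd a i q) (upd b i r))"
  proof (rule negligible_subset[OF negligible_coordinate_hyperplane[of i q]], clarify)
    fix x assume "x \<in> cbox (upd a i p) (upd b i q)" "x \<in> cbox (upd a i q) (upd b i r)"
    then have "upd a i q $ i \<le> x $ i" "x $ i \<le> upd b i q $ i" unfolding mem_box_cart by blast+
    then show "x $ i = q" by simp
  qed
  then have neg: "negligible (?P k \<inter> ?P l)" if "k \<noteq> l" for k l
    using that by (cases k; cases l) (auto simp: Int_commute)
  have "(\<Union>k\<in>UNIV. ?P k) = cbox (upd a i p) (upd b i r)"
  proof (intro equalityI subsetI)
    fix x assume "x \<in> (\<Union>k\<in>UNIV. ?P k)"
    then have "x \<in> cbox (upd a i p) (upd b i q) \<or> x \<in> cbox (upd a i q) (upd b i r)"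
      by (auto split: if_splits)
    then have dj: "(upd a i p $ j \<le> x $ j \<and> x $ j \<le> upd b i q $ j) \<or> (upd a i q $ j \<le> x $ j \<and> x $ j \<le> upd b i r $ j)" for j
      unfolding mem_box_cart by blast
    have "upd a i p $ j \<le> x $ j \<and> x $ j \<le> upd b i r $ j" for j
      using pqr dj[of j] by (cases "j = i") auto
    then show "x \<in> cbox (upd a i p) (upd b i r)" by (simp add: mem_box_cart del: upd_nth)
  next
    fix x assume "x \<in> cbox (upd a i p) (upd b i r)"
    then have *: "\<And>j. upd a i p $ j \<le> x $ j \<and> x $ j \<le> upd b i r $ j" by (simp add: mem_box_cart del: upd_nth)
    show "x \<in> (\<Union>k\<in>UNIV. ?P k)"
    proof (cases "x $ i \<le> q")
      case True
      then have "upd a i p $ j \<le> x $ j \<and> x $ j \<le> upd b i q $ j" for j using *[of j] by (auto split: if_splits)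
      then have "x \<in> ?P True" by (simp add: mem_box_cart del: upd_nth)
      then show ?thesis by blast
    next
      case False
      then have "upd a i q $ j \<le> x $ j \<and> x $ j \<le> upd b i r $ j" for j using *[of j] by (auto split: if_splits)
      then have "x \<in> ?P False" by (simp add: mem_box_cart del: upd_nth)
      then show ?thesis by blast
    qed
  qed
  moreover have "extend B (\<Union>k\<in>UNIV. ?P k) = (\<Sum>k\<in>UNIV. extend B (?P k))"
    by (rule polyhedral_UN_extend(2)[OF _ _ neg B]) (auto simp: polyhedral_cbox)
  ultimately show ?thesis by (simp add: UNIV_bool)
qed

text \<open>The sign makes the increment in direction i antisymmetric in its two limits, which
  reduces the six possible orders of p, q, r to the sorted one, where a box is split in two.\<close>

lemma signed_box_chasles:
  fixes a b :: "real^'n::finite"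
  assumes B: "simplex_additive B"
  shows "signed_box B (upd a i p) (upd b i q) + signed_box B (upd a i q) (upd b i r) = signed_box B (upd a i p) (upd b i r)"
proof -
  define g where "g p q = extend B (cbox (upd (vmin a b) i (min p q)) (upd (vmax a b) i (max p q)))" for p q
  define c where "c = (\<Prod>j\<in>UNIV - {i}. sgn (b $ j - a $ j))"
  have f: "signed_box B (upd a i p) (upd b i q) = c * (sgn (q - p) * g p q)" for p q
  proof -
    have "(\<Prod>j\<in>UNIV. sgn (upd b i q $ j - upd a i p $ j)) = sgn (q - p) * c"
      unfolding c_def by (subst prod.remove[of UNIV i]) auto
    moreover have "vmin (upd a i p) (upd b i q) = upd (vmin a b) i (min p q)" "vmax (upd a i p) (upd b i q) = upd (vmax a b) i (max p q)"
      by (auto simp: vec_eq_iff)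
    ultimately show ?thesis by (simp add: signed_box_def g_def)
  qed
  define h where "h p q = sgn (q - p) * g p q" for p q
  have anti: "h q p = - h p q" for p q by (simp add: h_def g_def min.commute max.commute sgn_if)
  have sorted: "h p q + h q r = h p r" if "p \<le> q" "q \<le> r" for p q r
  proof (cases "p = q \<or> q = r")
    case True
    then show ?thesis by (auto simp: h_def)
  next
    case False
    then have "p < q" "q < r" using that by auto
    then show ?thesis using extend_cbox_split[OF B that, of "vmin a b" i "vmax a b"]
      by (simp add: h_def g_def min_def max_def)
  qed
  note a = anti[of p q] anti[of q r] anti[of p r]
  consider "p \<le> q" "q \<le> r" | "p \<le> r" "r \<le> q" | "q \<le> p" "p \<le> r"
    | "q \<le> r" "r \<le> p" | "r \<le> p" "p \<le> q" | "r \<le> q" "q \<le> p" by linarith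
  then have "h p q + h q r = h p r"
  proof cases
    case 1 then show ?thesis by (rule sorted)
  next
    case 2 then show ?thesis using sorted[OF 2] a by linarith
  next
    case 3 then show ?thesis using sorted[OF 3] a by linarith
  next
    case 4 then show ?thesis using sorted[OF 4] a by linarith
  next
    case 5 then show ?thesis using sorted[OF 5] a by linarith
  next
    case 6 then show ?thesis using sorted[OF 6] a by linarith
  qed
  then show ?thesis by (simp add: f flip: h_def distrib_left)
qed

text \<open>A difference in a new direction i replaces the limits 0 and x_i by x_i and x_i + h.
  Distinctness guarantees that the limits in direction i are still the original ones.\<close>

lemma fdiff_signed_box:
  fixes ks :: "'n::finite list"
  assumes B: "simplex_additive B" and "distinct ks"
  shows "fdiff h ks (signed_box B 0) x
    = signed_box B (\<chi> j. if j \<in> set ks then x $ j else 0) (\<chi> j. if j \<in> set ks then x $ j + h else x $ j)"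
  using assms(2)
proof (induction "ks" arbitrary: x)
  case Nil
  have "(\<chi> j. 0) = (0 :: real^'n)" by (simp add: vec_eq_iff)
  then show ?case by (simp add: vec_lambda_eta)
next
  case (Cons i "ks")
  let ?a = "\<chi> j. if j \<in> set ks then x $ j else 0" and ?b = "\<chi> j. if j \<in> set ks then x $ j + h else x $ j"
  have IH: "fdiff h ks (signed_box B 0) y
    = signed_box B (\<chi> j. if j \<in> set ks then y $ j else 0) (\<chi> j. if j \<in> set ks then y $ j + h else y $ j)" for y
    using Cons by simp
  have "(\<chi> j. if j \<in> set ks then (x + h *\<^sub>R axis i 1) $ j else 0) = upd ?a i 0"
    "(\<chi> j. if j \<in> set ks then (x + h *\<^sub>R axis i 1) $ j + h else (x + h *\<^sub>R axis i 1) $ j) = upd ?b i (x $ i + h)"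
    using Cons.prems by (auto simp: vec_eq_iff axis_def)
  then have e1: "fdiff h ks (signed_box B 0) (x + h *\<^sub>R axis i 1) = signed_box B (upd ?a i 0) (upd ?b i (x $ i + h))"
    by (simp only: IH)
  have "?a = upd ?a i 0" "?b = upd ?b i (x $ i)"
    using Cons.prems by (auto simp: vec_eq_iff)
  then have e2: "fdiff h ks (signed_box B 0) x = signed_box B (upd ?a i 0) (upd ?b i (x $ i))"
    unfolding IH by (rule arg_cong2)
  have "fdiff h (i # ks) (signed_box B 0) x = signed_box B (upd ?a i 0) (upd ?b i (x $ i + h)) - signed_box B (upd ?a i 0) (upd ?b i (x $ i))"
    unfolding fdiff.simps e1 e2 ..
  also have "\<dots> = signed_box B (upd ?a i (x $ i)) (upd ?b i (x $ i + h))"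
    using signed_box_chasles[OF B, of ?a i 0 ?b "x $ i" "x $ i + h"] by linarith
  also have "upd ?a i (x $ i) = (\<chi> j. if j \<in> set (i # ks) then x $ j else 0)" by (auto simp: vec_eq_iff)
  also have "upd ?b i (x $ i + h) = (\<chi> j. if j \<in> set (i # ks) then x $ j + h else x $ j)" by (auto simp: vec_eq_iff)
  finally show ?case .
qed

text \<open>The signed box function is a d-fold primitive of the charge: differencing it once in
  each direction leaves the charge of a cube.\<close>

lemma fdiff_cube:
  fixes ks :: "'n::finite list"
  assumes B: "simplex_additive B" and "distinct ks" "set ks = UNIV" "0 < h"
  shows "fdiff h ks (signed_box B 0) x = extend B (cube x h)"
proof -
  have "vmin x (\<chi> j. x $ j + h) = x" "vmax x (\<chi> j. x $ j + h) = x + (\<chi> j. h)"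
    using assms(4) by (auto simp: vec_eq_iff)
  then show ?thesis
    using assms(4) unfolding fdiff_signed_box[OF B assms(2)] assms(3)
    by (simp add: signed_box_def cube_def vec_lambda_eta)
qed

section \<open>Averages of a charge over small cubes\<close>

subsection \<open>Charges of Hoelder type\<close>

text \<open>The bound is in terms of the diameter and not the mass, because the simplices tiling a
  cube may be arbitrarily thin. It is implied by finiteness of the norm through
  \<open>mass_le\<close>, and it is also satisfied by the approximating charges built from a
  distribution and by their limit.\<close>

locale holder_charge =
  fixes B :: "(real^'n::finite) set \<Rightarrow> real" and \<alpha> N :: real
  assumes additive: "simplex_additive B" and measurable: "measurable_charge B"
    and \<alpha>: "0 < \<alpha>" "\<alpha> < 1" and N: "0 \<le> N"
    and bound: "\<And>S. S \<in> full_simplices \<Longrightarrow> diameter S \<le> 1 \<Longrightarrow> \<bar>B S\<bar> \<le> N * diameter S ^ CARD('n) * diameter S powr (\<alpha> - 1)"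

text \<open>The number of pieces of a cube times d^d, the latter because a subset of a cube of side
  r has diameter at most d r.\<close>

definition cell_const :: "'n::finite itself \<Rightarrow> real" where
  "cell_const _ = real (box_bound TYPE('n)) * real CARD('n) ^ CARD('n)"

lemma cell_const_nonneg: "0 \<le> cell_const TYPE('n::finite)"
  by (simp add: cell_const_def)

text \<open>Cells of side 1 / d have diameter at most 1, the range in which the hypothesis on the
  charge gives information; the constant counts those meeting the ball.\<close>

definition loc_const :: "real \<Rightarrow> 'n::finite itself \<Rightarrow> real \<Rightarrow> real" where
  "loc_const \<alpha> _ R = real (card {z. cell (1 / real CARD('n)) (0::real^'n) z \<inter> cball 0 R \<noteq> {}})
     * (cell_const TYPE('n) * (1 / real CARD('n)) ^ CARD('n) * (1 / real CARD('n)) powr (\<alpha> - 1))"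

lemma polyhedral_cell: "0 < r \<Longrightarrow> polyhedral (cell r t z)"
  using cell_cube[of r t z] by (intro polyhedral_cong[OF polyhedral_cbox[of "corner r t z" "corner r t z + (\<chi> j. r)"]])
    (auto simp: cube_def elim: negligible_subset)

lemma extend_cells:
  fixes P :: "(real^'n::finite) set"
  assumes B: "simplex_additive B" and r: "0 < r" and P: "polyhedral P" and Z: "finite Z" "\<And>z. cell r t z \<inter> P \<noteq> {} \<Longrightarrow> z \<in> Z"
  shows "extend B P = (\<Sum>z\<in>Z. extend B (P \<inter> cube (corner r t z) r))"
proof -
  have P': "P = (\<Union>z\<in>Z. P \<inter> cell r t z)"
  proof (intro equalityI subsetI)
    fix x assume "x \<in> P"
    moreover have "x \<in> cell r t (index r t x)" by (simp add: mem_cell_index)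
    ultimately show "x \<in> (\<Union>z\<in>Z. P \<inter> cell r t z)" using Z(2) by blast
  qed auto
  have "negligible (P \<inter> cell r t z \<inter> (P \<inter> cell r t z'))" if "z \<noteq> z'" for z z'
    by (rule negligible_subset[OF negligible_empty]) (use cell_disjoint[OF that] in blast)
  then have "extend B (\<Union>z\<in>Z. P \<inter> cell r t z) = (\<Sum>z\<in>Z. extend B (P \<inter> cell r t z))"
    by (intro polyhedral_UN_extend(2) Z(1) B polyhedral_Int P polyhedral_cell r)
  also have "\<dots> = (\<Sum>z\<in>Z. extend B (P \<inter> cube (corner r t z) r))"
  proof (intro sum.cong refl extend_cong B polyhedral_Int P polyhedral_cell r)
    fix z
    have "P \<inter> cell r t z - P \<inter> cube (corner r t z) r = {}" using cell_cube(1)[OF r] by blast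
    then show "negligible (P \<inter> cell r t z - P \<inter> cube (corner r t z) r)" by simp
    show "negligible (P \<inter> cube (corner r t z) r - P \<inter> cell r t z)"
      by (rule negligible_subset[OF cell_cube(2)[OF r, of t z]]) auto
  qed
  finally show ?thesis using P' by simp
qed

context holder_charge
begin

lemma small_simplex_bound:
  assumes T: "T \<in> full_simplices" and r: "0 < r" "real CARD('n) * r \<le> 1"
    and ab: "T \<subseteq> cbox a b" "\<And>j. b $ j - a $ j \<le> r"
  shows "\<bar>B T\<bar> \<le> N * (real CARD('n) ^ CARD('n) * r ^ CARD('n) * r powr (\<alpha> - 1))"
proof -
  let ?d = "real CARD('n)" and ?D = "diameter T"
  have D: "?D \<le> ?d * r"
  proof (rule diameter_le)
    fix x y assume "x \<in> T" "y \<in> T"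
    then have "x \<in> cbox a b" "y \<in> cbox a b" using ab(1) by auto
    then have "\<bar>x $ j - y $ j\<bar> \<le> r" for j using ab(2)[of j] unfolding mem_box_cart by (smt (verit))
    then show "norm (x - y) \<le> ?d * r" by (rule cell_dist[OF r(1)])
  qed (use r in auto)
  have D0: "0 \<le> ?D" by (rule diameter_ge_0[OF full_simplex_bounded[OF T]])
  have "?D ^ CARD('n) * ?D powr (\<alpha> - 1) \<le> ?d ^ CARD('n) * r ^ CARD('n) * r powr (\<alpha> - 1)"
  proof (cases "?D = 0")
    case False
    then have Dp: "0 < ?D" using D0 by simp
    \<comment> \<open>The factor x^(\<alpha> - 1) alone is decreasing. Combined with one factor x it
      becomes the increasing x^\<alpha>, so that the diameter may be replaced by the larger d
      r.\<close>
    have e: "x ^ CARD('n) * x powr (\<alpha> - 1) = x ^ (CARD('n) - 1) * x powr \<alpha>" if "0 < x" for x :: real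
      using that by (simp add: power_CARD powr_mult_base)
    have "?D ^ CARD('n) * ?D powr (\<alpha> - 1) = ?D ^ (CARD('n) - 1) * ?D powr \<alpha>" by (rule e[OF Dp])
    also have "\<dots> \<le> (?d * r) ^ (CARD('n) - 1) * (?d * r) powr \<alpha>"
      using D D0 \<alpha> by (intro mult_mono power_mono powr_mono2) auto
    also have "\<dots> = (?d * r) ^ CARD('n) * (?d * r) powr (\<alpha> - 1)" using e[of "?d * r"] r by simp
    also have "(?d * r) powr (\<alpha> - 1) \<le> r powr (\<alpha> - 1)"
      using r \<alpha> by (intro powr_mono2') (auto simp: mult_le_cancel_right1)
    finally show ?thesis using r by (simp add: power_mult_distrib mult_left_mono)
  qed (use r in auto)
  then have "N * (?D ^ CARD('n) * ?D powr (\<alpha> - 1)) \<le> N * (?d ^ CARD('n) * r ^ CARD('n) * r powr (\<alpha> - 1))"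
    by (rule mult_left_mono[OF _ N])
  then show ?thesis using bound[OF T] D r by (simp add: mult.assoc)
qed

lemma small_cbox_bound:
  assumes r: "0 < r" "real CARD('n) * r \<le> 1" and ab: "\<And>j. b $ j - a $ j \<le> r"
  shows "\<bar>extend B (cbox a b)\<bar> \<le> N * cell_const TYPE('n) * r ^ CARD('n) * r powr (\<alpha> - 1)"
    and "S \<in> full_simplices \<Longrightarrow> \<bar>extend B (S \<inter> cbox a b)\<bar> \<le> N * cell_const TYPE('n) * r ^ CARD('n) * r powr (\<alpha> - 1)"
proof -
  let ?M = "N * (real CARD('n) ^ CARD('n) * r ^ CARD('n) * r powr (\<alpha> - 1))"
  have M: "\<bar>B T\<bar> \<le> ?M" if "T \<in> full_simplices" "T \<subseteq> cbox a b" for T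
    by (rule small_simplex_bound[OF that(1) r that(2) ab])
  have M0: "0 \<le> ?M" using N r by simp
  have e: "real (box_bound TYPE('n)) * ?M = N * cell_const TYPE('n) * r ^ CARD('n) * r powr (\<alpha> - 1)"
    unfolding cell_const_def by (simp only: ac_simps)
  show "\<bar>extend B (cbox a b)\<bar> \<le> N * cell_const TYPE('n) * r ^ CARD('n) * r powr (\<alpha> - 1)"
    using extend_cbox_bound[OF additive M M0] unfolding e .
  show "\<bar>extend B (S \<inter> cbox a b)\<bar> \<le> N * cell_const TYPE('n) * r ^ CARD('n) * r powr (\<alpha> - 1)" if "S \<in> full_simplices"
    using extend_simplex_cbox_bound[OF additive that M M0] unfolding e .
qed

lemma cube_bound:
  assumes r: "0 < r" "real CARD('n) * r \<le> 1"
  shows "\<bar>extend B (cube x r)\<bar> \<le> N * cell_const TYPE('n) * r ^ CARD('n) * r powr (\<alpha> - 1)"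
    and "S \<in> full_simplices \<Longrightarrow> \<bar>extend B (S \<inter> cube x r)\<bar> \<le> N * cell_const TYPE('n) * r ^ CARD('n) * r powr (\<alpha> - 1)"
  unfolding cube_def by (rule small_cbox_bound[OF r]; simp)+

text \<open>Only simplices of diameter at most 1 are controlled, so a large box is first split along
  the grid of side 1 / d.\<close>

lemma loc_cbox_bound:
  assumes "cbox a b \<subseteq> cball 0 R"
  shows "\<bar>extend B (cbox a b)\<bar> \<le> N * loc_const \<alpha> TYPE('n) R"
proof -
  let ?r = "1 / real CARD('n)"
  let ?Z = "{z. cell ?r (0::real^'n) z \<inter> cball 0 R \<noteq> {}}"
  have r: "0 < ?r" by simp
  have fin: "finite ?Z" by (rule finite_cells[OF r bounded_cball])
  have "extend B (cbox a b) = (\<Sum>z\<in>?Z. extend B (cbox a b \<inter> cube (corner ?r 0 z) ?r))"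
    by (rule extend_cells[OF additive r polyhedral_cbox fin]) (use assms in blast)
  also have "\<bar>\<dots>\<bar> \<le> (\<Sum>z\<in>?Z. \<bar>extend B (cbox a b \<inter> cube (corner ?r 0 z) ?r)\<bar>)" by (rule sum_abs)
  also have "\<dots> \<le> (\<Sum>z\<in>?Z. N * cell_const TYPE('n) * ?r ^ CARD('n) * ?r powr (\<alpha> - 1))"
  proof (rule sum_mono)
    fix z
    let ?c = "corner ?r (0::real^'n) z"
    have "cbox a b \<inter> cube ?c ?r = cbox (vmax a ?c) (vmin b (?c + (\<chi> j. ?r)))"
      by (auto simp: cube_def mem_box_cart)
    then show "\<bar>extend B (cbox a b \<inter> cube ?c ?r)\<bar> \<le> N * cell_const TYPE('n) * ?r ^ CARD('n) * ?r powr (\<alpha> - 1)"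
      by (simp only:) (rule small_cbox_bound(1)[OF r], auto)
  qed
  also have "\<dots> = N * loc_const \<alpha> TYPE('n) R" by (simp add: loc_const_def)
  finally show ?thesis .
qed

lemma signed_box_bound:
  assumes "norm v \<le> R" shows "\<bar>signed_box B 0 v\<bar> \<le> N * loc_const \<alpha> TYPE('n) R"
proof -
  have "cbox (vmin 0 v) (vmax 0 v) \<subseteq> cball 0 R"
  proof
    fix x assume x: "x \<in> cbox (vmin 0 v) (vmax 0 v)"
    have "norm (x $ j) \<le> norm (v $ j)" for j
      using x unfolding mem_box_cart by (auto simp: min_def max_def abs_le_iff dest!: spec[of _ j] split: if_splits)
    then have "norm x \<le> norm v" by (rule norm_le_componentwise_cart)
    then show "x \<in> cball 0 R" using assms by simp
  qed
  from loc_cbox_bound[OF this]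
  have b: "\<bar>extend B (cbox (vmin 0 v) (vmax 0 v))\<bar> \<le> N * loc_const \<alpha> TYPE('n) R" .
  have "\<bar>\<Prod>j\<in>UNIV. sgn (v $ j)\<bar> \<le> 1" unfolding abs_prod by (intro prod_le_1) (auto simp: sgn_if)
  then have "\<bar>signed_box B 0 v\<bar> \<le> 1 * \<bar>extend B (cbox (vmin 0 v) (vmax 0 v))\<bar>"
    unfolding signed_box_def abs_mult by (intro mult_right_mono) auto
  then show ?thesis using b by simp
qed

text \<open>Measurability of box values is available for nondegenerate boxes only, that is, off the
  coordinate hyperplanes. On these the sign product vanishes, and extension by 0 keeps the function
  measurable.\<close>

lemma signed_box_measurable: "signed_box B 0 \<in> borel_measurable borel"
proof -
  let ?U = "{v::real^'n. \<forall>j. v $ j \<noteq> 0}"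
  have "?U = (\<Inter>j. {v. v $ j \<noteq> 0})" by auto
  moreover have "\<dots> \<in> sets borel"
    by (intro sets.finite_INT borel_open open_Collect_neq continuous_intros) auto
  ultimately have U: "?U \<in> sets borel" by simp
  have m: "(\<lambda>v. v) \<in> borel_measurable (restrict_space borel ?U)" by (rule measurable_restrict_space1) simp
  have c: "continuous_on UNIV (\<lambda>v::real^'n. vmin 0 v)" "continuous_on UNIV (\<lambda>v::real^'n. vmax 0 v)"
    unfolding vmin_def vmax_def by (intro continuous_intros)+
  have mm: "(\<lambda>v. vmin 0 v) \<in> borel_measurable (restrict_space borel ?U)" "(\<lambda>v. vmax 0 v) \<in> borel_measurable (restrict_space borel ?U)"
    by (intro measurable_restrict_space1 borel_measurable_continuous_onI c)+
  have "(\<lambda>v. extend B (cbox (vmin 0 v) (vmax 0 v))) \<in> borel_measurable (restrict_space borel ?U)"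
    by (rule extend_cbox_measurable[OF additive measurable mm]) (auto simp: space_restrict_space min_def max_def less_le)
  moreover have "(\<lambda>v::real^'n. \<Prod>j\<in>UNIV. sgn (v $ j)) \<in> borel_measurable (restrict_space borel ?U)"
    by (rule measurable_restrict_space1) measurable
  ultimately have "(\<lambda>v. (\<Prod>j\<in>UNIV. sgn (v $ j)) * extend B (cbox (vmin 0 v) (vmax 0 v))) \<in> borel_measurable (restrict_space borel ?U)"
    by (intro borel_measurable_times)
  then have "signed_box B 0 \<in> borel_measurable (restrict_space borel ?U)" by (simp add: signed_box_def[abs_def])
  then have "(\<lambda>v. if v \<in> ?U then signed_box B 0 v else 0) \<in> borel_measurable borel"
    using U by (subst (asm) measurable_restrict_space_iff[of _ _ 0]) auto
  moreover have "(if v \<in> ?U then signed_box B 0 v else 0) = signed_box B 0 v" for v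
    by (auto simp: signed_box_def intro!: disjI1 sgn_0_0[THEN iffD2])
  ultimately show ?thesis by simp
qed

lemma signed_box_loc_bounded: "loc_bounded (signed_box B 0)"
  unfolding loc_bounded_def using signed_box_measurable signed_box_bound by blast

lemma cube_measurable: "0 < h \<Longrightarrow> (\<lambda>x. extend B (cube x h)) \<in> borel_measurable borel"
  unfolding cube_def by (rule extend_cbox_measurable[OF additive measurable]) auto

lemma cube_loc_bounded: assumes "0 < h" shows "loc_bounded (\<lambda>x. extend B (cube x h))"
proof -
  obtain "ks" :: "'n list" where "set ks = UNIV" "distinct ks" using finite_distinct_list[of "UNIV :: 'n set"] by auto
  then have "(\<lambda>x. extend B (cube x h)) = fdiff h ks (signed_box B 0)"
    using fdiff_cube[OF additive _ _ assms] by (simp add: fun_eq_iff)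
  then show ?thesis using loc_bounded_fdiff[OF signed_box_loc_bounded] by simp
qed

definition avg :: "real \<Rightarrow> (real^'n \<Rightarrow> real) \<Rightarrow> real" where
  "avg h \<psi> = (LINT x|lborel. extend B (cube x h) * \<psi> x) / h ^ CARD('n)"

definition pairing :: "(real^'n \<Rightarrow> real) \<Rightarrow> real" where
  "pairing \<psi> = (-1) ^ CARD('n) * (LINT v|lborel. signed_box B 0 v * mixed_deriv \<psi> v)"

text \<open>Summation by parts leaves the difference quotients of \<psi>, which are values of the
  mixed derivative at points within d h. They converge pointwise, and local boundedness of the box
  function provides the domination.\<close>

lemma avg_tendsto_pairing:
  assumes \<psi>: "\<psi> \<in> test_functions" and h: "\<And>k. 0 < h k" "\<And>k. h k \<le> 1" "h \<longlonglongrightarrow> 0"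
  shows "(\<lambda>k. avg (h k) \<psi>) \<longlonglongrightarrow> pairing \<psi>"
proof -
  define "ks" where "ks = (SOME ks::'n list. distinct ks \<and> set ks = UNIV)"
  have "\<exists>ks::'n list. distinct ks \<and> set ks = UNIV" using finite_distinct_list[of "UNIV :: 'n set"] by auto
  then have ks: "distinct ks" "set ks = UNIV" using someI_ex unfolding ks_def by (metis (mono_tags, lifting))+
  then have len: "length ks = CARD('n)" using distinct_card by fastforce
  let ?u = "signed_box B 0" and ?d = "partial_derivs ks \<psi>"
  have sm: "smooth \<psi>" by (rule test_function_smooth[OF \<psi>])
  have dt: "?d \<in> test_functions" by (rule test_function_partial_derivs[OF \<psi>])
  obtain M where M: "\<And>x. \<bar>?d x\<bar> \<le> M" using test_function_bounded[OF dt] by auto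
  obtain R where R: "\<And>x. ?d x \<noteq> 0 \<Longrightarrow> norm x \<le> R" using test_function_bounded_support[OF dt] by (auto simp: bounded_iff)
  let ?R = "R + real CARD('n)"
  obtain L where L: "\<And>x. norm x \<le> ?R \<Longrightarrow> \<bar>?u x\<bar> \<le> L" using signed_box_loc_bounded unfolding loc_bounded_def by blast
  define q where "q k x = bdiff (h k) ks \<psi> x / h k ^ CARD('n)" for k x
  have q: "\<exists>y. norm (y - x) \<le> real CARD('n) * h k \<and> q k x = ?d y" for k x
    using bdiff_mean_value[OF sm h(1)[of k], of x "ks"] h(1)[of k] by (auto simp: q_def len)
  have q_lim: "(\<lambda>k. q k x) \<longlonglongrightarrow> ?d x" for x
  proof -
    obtain y where y: "\<And>k. norm (y k - x) \<le> real CARD('n) * h k" "\<And>k. q k x = ?d (y k)" using q[of x] by metis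
    have "(\<lambda>k. real CARD('n) * h k) \<longlonglongrightarrow> real CARD('n) * 0" by (intro tendsto_intros h)
    then have "(\<lambda>k. y k - x) \<longlonglongrightarrow> 0" using y(1) by (intro Lim_null_comparison[of "\<lambda>k. y k - x" "\<lambda>k. real CARD('n) * h k"]) auto
    then have "y \<longlonglongrightarrow> x" by (simp add: LIM_zero_iff)
    then have "(\<lambda>k. ?d (y k)) \<longlonglongrightarrow> ?d x"
      using smooth_continuous[OF test_function_smooth[OF dt], of UNIV]
      by (metis UNIV_I continuous_on_eq_continuous_at open_UNIV isCont_tendsto_compose)
    then show ?thesis by (simp add: y(2))
  qed
  have q_bd: "\<bar>q k x\<bar> \<le> M" for k x using q[of x k] M by metis
  \<comment> \<open>The restriction h \<le> 1 keeps all supports in one ball, so that a single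
    dominating function serves every k.\<close>
  have q_supp: "norm x \<le> ?R" if "q k x \<noteq> 0" for k x
  proof -
    obtain y where y: "norm (y - x) \<le> real CARD('n) * h k" "q k x = ?d y" using q by blast
    then have "norm y \<le> R" using R that by simp
    moreover have "real CARD('n) * h k \<le> real CARD('n)" using h(2)[of k] by (simp add: mult_left_le)
    moreover have "norm x \<le> norm y + norm (y - x)" using norm_triangle_ineq4[of y "y - x"] by simp
    ultimately show ?thesis using y(1) by linarith
  qed
  have q_meas: "q k \<in> borel_measurable borel" for k
  proof -
    have "bdiff (h k) js \<psi> \<in> borel_measurable borel" for js
    proof (induction js)
      case Nil
      then show ?case using test_function_comp_bounded[OF \<psi>] by (simp add: comp_bounded_def)
    next
      case (Cons i js)
      have "(\<lambda>x. bdiff (h k) js \<psi> (x + (- h k) *\<^sub>R axis i 1)) \<in> borel_measurable borel"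
        using Cons by measurable
      then show ?case using Cons by (simp only: bdiff.simps) (intro borel_measurable_diff)
    qed
    then show ?thesis unfolding q_def by measurable
  qed
  have u_meas: "?u \<in> borel_measurable borel" by (rule signed_box_measurable)
  have d_meas: "?d \<in> borel_measurable borel" using test_function_comp_bounded[OF dt] by (simp add: comp_bounded_def)
  have "(\<lambda>k. LINT x|lborel. ?u x * q k x) \<longlonglongrightarrow> (LINT x|lborel. ?u x * ?d x)"
  proof (rule integral_dominated_convergence[where w = "\<lambda>x. (L * M) * indicat_real (cball 0 ?R) x"])
    show "(\<lambda>x. ?u x * ?d x) \<in> borel_measurable lborel" using u_meas d_meas by simp
    show "\<And>k. (\<lambda>x. ?u x * q k x) \<in> borel_measurable lborel" using u_meas q_meas by simp
    show "integrable lborel (\<lambda>x. (L * M) * indicat_real (cball (0::real^'n) ?R) x)"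
      by (intro integrable_mult_right integrable_real_indicator) (use emeasure_bounded_finite[OF bounded_cball[of "0::real^'n" ?R]] in auto)
    show "AE x in lborel. (\<lambda>k. ?u x * q k x) \<longlonglongrightarrow> ?u x * ?d x"
      by (intro AE_I2 tendsto_intros q_lim)
    show "AE x in lborel. norm (?u x * q k x) \<le> (L * M) * indicat_real (cball 0 ?R) x" for k
    proof (intro AE_I2)
      fix x show "norm (?u x * q k x) \<le> (L * M) * indicat_real (cball 0 ?R) x"
      proof (cases "q k x = 0")
        case True
        have "0 \<le> L * M" if "x \<in> cball 0 ?R" using L[of x] M[of x] that by (intro mult_nonneg_nonneg) auto
        then show ?thesis using True by (auto simp: indicator_def)
      next
        case False
        then have x: "norm x \<le> ?R" by (rule q_supp)
        have "\<bar>?u x\<bar> * \<bar>q k x\<bar> \<le> L * M" using L[OF x] q_bd[of k x] by (intro mult_mono) auto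
        then show ?thesis using x by (simp add: abs_mult)
      qed
    qed
  qed
  then have "(\<lambda>k. (-1) ^ CARD('n) * (LINT x|lborel. ?u x * q k x)) \<longlonglongrightarrow> pairing \<psi>"
    unfolding pairing_def mixed_deriv_def ks_def[symmetric] by (intro tendsto_mult tendsto_const)
  moreover have "avg (h k) \<psi> = (-1) ^ CARD('n) * (LINT x|lborel. ?u x * q k x)" for k
  proof -
    have "(LINT x|lborel. extend B (cube x (h k)) * \<psi> x) = (LINT x|lborel. fdiff (h k) ks ?u x * \<psi> x)"
      using fdiff_cube[OF additive ks h(1)] by simp
    also have "\<dots> = (-1) ^ CARD('n) * (LINT x|lborel. ?u x * bdiff (h k) ks \<psi> x)"
      using integral_fdiff[OF signed_box_loc_bounded test_function_comp_bounded[OF \<psi>], of "h k" "ks"] by (simp add: len)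
    finally show ?thesis by (simp add: avg_def q_def)
  qed
  ultimately show ?thesis by simp
qed

lemma pairing_bound_smooth:
  assumes \<psi>: "\<psi> \<in> test_functions" and R: "\<And>x. \<psi> x \<noteq> 0 \<Longrightarrow> norm x \<le> R" and M: "\<And>x. \<bar>mixed_deriv \<psi> x\<bar> \<le> M"
  shows "\<bar>pairing \<psi>\<bar> \<le> N * loc_const \<alpha> TYPE('n) R * M * measure lborel (cball (0::real^'n) R)"
proof -
  have c: "closure {x. \<psi> x \<noteq> 0} \<subseteq> cball 0 R" using R by (intro closure_minimal) auto
  have m: "mixed_deriv \<psi> \<in> borel_measurable borel"
    unfolding mixed_deriv_def using test_function_comp_bounded[OF test_function_partial_derivs[OF \<psi>]] by (simp add: comp_bounded_def)
  have "\<bar>LINT v|lborel. signed_box B 0 v * mixed_deriv \<psi> v\<bar> \<le> (N * loc_const \<alpha> TYPE('n) R * M) * measure lborel (cball (0::real^'n) R)"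
  proof (rule integrable_supported(2))
    show "(\<lambda>v. signed_box B 0 v * mixed_deriv \<psi> v) \<in> borel_measurable borel" using signed_box_measurable m by simp
    show "\<bar>signed_box B 0 x * mixed_deriv \<psi> x\<bar> \<le> N * loc_const \<alpha> TYPE('n) R * M" if "x \<in> cball 0 R" for x
    proof -
      have "\<bar>signed_box B 0 x\<bar> \<le> N * loc_const \<alpha> TYPE('n) R" using that by (intro signed_box_bound) simp
      then show ?thesis unfolding abs_mult using M[of x] by (intro mult_mono) auto
    qed
    show "signed_box B 0 x * mixed_deriv \<psi> x = 0" if "x \<notin> cball 0 R" for x
      using that c support_partial_derivs[of "SOME ks. distinct ks \<and> set ks = UNIV" \<psi>] unfolding mixed_deriv_def by auto
  qed (use emeasure_bounded_finite[OF bounded_cball[of "0::real^'n" R]] in auto)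
  then show ?thesis by (simp add: pairing_def abs_mult)
qed

lemma avg_bound:
  assumes h: "0 < h" "real CARD('n) * h \<le> 1" and \<psi>: "\<psi> \<in> borel_measurable borel"
    and A: "A \<in> sets borel" "emeasure lborel A < \<infinity>" and M: "\<And>x. \<bar>\<psi> x\<bar> \<le> M" "\<And>x. x \<notin> A \<Longrightarrow> \<psi> x = 0"
  shows "\<bar>LINT x|lborel. extend B (cube x h) * \<psi> x\<bar> \<le> N * cell_const TYPE('n) * h ^ CARD('n) * h powr (\<alpha> - 1) * M * measure lborel A"
proof (rule integrable_supported(2)[OF _ A])
  show "(\<lambda>x. extend B (cube x h) * \<psi> x) \<in> borel_measurable borel" using cube_measurable[OF h(1)] \<psi> by simp
  show "\<bar>extend B (cube x h) * \<psi> x\<bar> \<le> N * cell_const TYPE('n) * h ^ CARD('n) * h powr (\<alpha> - 1) * M" for x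
    unfolding abs_mult using cube_bound(1)[OF h, of x] M(1)[of x] by (intro mult_mono) auto
qed (use M in auto)

text \<open>Closed cubes overlap along faces, half-open cells split exactly into their dyadic
  children. Passing from cubes to cells and back changes only null sets.\<close>

lemma cube_halves:
  assumes h: "0 < h"
  shows "extend B (cube x h) = (\<Sum>z\<in>PiE UNIV (\<lambda>_. {0, 1}). extend B (cube (x + (h / 2) *\<^sub>R (\<chi> j. real_of_int (z j))) (h / 2)))"
proof -
  let ?Z = "PiE (UNIV::'n set) (\<lambda>_. {0, 1::int})"
  have fin: "finite ?Z" by (intro finite_PiE) auto
  have c0: "corner h x (\<lambda>_. 0) = x" by (simp add: vec_eq_iff)
  have cz: "corner (h / 2) x z = x + (h / 2) *\<^sub>R (\<chi> j. real_of_int (z j))" for z by (simp add: vec_eq_iff)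
  have ecell: "extend B (cube (corner r t z) r) = extend B (cell r t z)" if "0 < r" for r t z
  proof (rule extend_cong[OF additive])
    show "polyhedral (cube (corner r t z) r)" by (simp add: cube_def polyhedral_cbox)
    show "negligible (cube (corner r t z) r - cell r t z)" by (rule cell_cube(2)[OF that])
    have "cell r t z - cube (corner r t z) r = {}" using cell_cube(1)[OF that] by blast
    then show "negligible (cell r t z - cube (corner r t z) r)" by simp
  qed
  have "extend B (cube x h) = extend B (cell h x (\<lambda>_. 0))" using ecell[OF h, of x "\<lambda>_. 0"] by (simp add: c0)
  also have "cell h x (\<lambda>_. 0) = (\<Union>z\<in>?Z. cell (h / 2) x z)"
  proof (intro equalityI subsetI)
    fix y assume y: "y \<in> cell h x (\<lambda>_. 0)"
    have "\<lfloor>(y $ j - x $ j) / (h / 2)\<rfloor> \<in> {0, 1}" for j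
    proof -
      have "x $ j \<le> y $ j" "y $ j < x $ j + h" using y h by (auto simp: mem_cell_iff)
      then have "0 \<le> (y $ j - x $ j) / (h / 2)" "(y $ j - x $ j) / (h / 2) < 2" using h by (auto simp: field_simps)
      then have "\<lfloor>(y $ j - x $ j) / (h / 2)\<rfloor> = 0 \<or> \<lfloor>(y $ j - x $ j) / (h / 2)\<rfloor> = 1" by linarith
      then show ?thesis by blast
    qed
    then have "index (h / 2) x y \<in> ?Z" by (auto simp: index_def PiE_iff extensional_def)
    then show "y \<in> (\<Union>z\<in>?Z. cell (h / 2) x z)" by (auto simp: mem_cell_index)
  next
    fix y assume "y \<in> (\<Union>z\<in>?Z. cell (h / 2) x z)"
    then obtain z where z: "z \<in> ?Z" "y \<in> cell (h / 2) x z" by auto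
    have "x $ j \<le> y $ j \<and> y $ j < x $ j + h" for j
    proof -
      have "x $ j + h / 2 * real_of_int (z j) \<le> y $ j" "y $ j < x $ j + h / 2 * real_of_int (z j) + h / 2"
        using z(2) h by (auto simp: mem_cell_iff)
      moreover have "z j = 0 \<or> z j = 1" using z(1) by (auto simp: PiE_iff)
      ultimately show ?thesis using h by (elim disjE) auto
    qed
    then show "y \<in> cell h x (\<lambda>_. 0)" using h by (simp add: mem_cell_iff)
  qed
  also have "extend B \<dots> = (\<Sum>z\<in>?Z. extend B (cell (h / 2) x z))"
  proof (rule polyhedral_UN_extend(2)[OF fin _ _ additive])
    show "polyhedral (cell (h / 2) x z)" for z using h by (intro polyhedral_cell) simp
    show "negligible (cell (h / 2) x z \<inter> cell (h / 2) x z')" if "z \<noteq> z'" for z z'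
      using cell_disjoint[OF that, of "h / 2" x] by simp
  qed
  also have "\<dots> = (\<Sum>z\<in>?Z. extend B (cube (x + (h / 2) *\<^sub>R (\<chi> j. real_of_int (z j))) (h / 2)))"
    using ecell[of "h / 2" x] h by (simp add: cz)
  finally show ?thesis .
qed

text \<open>The set W localises the error: off it \<psi> is unchanged by shifts up to d h, so the
  volume of W enters and not that of the support. For smoothed indicator functions W is a thin
  collar, whose small volume compensates a Lipschitz constant of order 1 / h.\<close>

lemma avg_halve:
  assumes h: "0 < h" "real CARD('n) * h \<le> 1" and \<psi>: "comp_bounded \<psi>"
    and K: "\<And>x y. \<bar>\<psi> x - \<psi> y\<bar> \<le> K * norm (x - y)" "0 \<le> K"
    and W: "W \<in> sets borel" "emeasure lborel W < \<infinity>" "\<And>x y. x \<notin> W \<Longrightarrow> norm y \<le> real CARD('n) * h \<Longrightarrow> \<psi> (x + y) = \<psi> x"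
  shows "\<bar>avg h \<psi> - avg (h / 2) \<psi>\<bar> \<le> N * cell_const TYPE('n) * real CARD('n) * K * measure lborel W * (h / 2) powr \<alpha>"
proof -
  let ?Z = "PiE (UNIV::'n set) (\<lambda>_. {0, 1::int})"
  let ?c = "\<lambda>z::'n \<Rightarrow> int. (h / 2) *\<^sub>R (\<chi> j. real_of_int (z j)) :: real^'n"
  let ?e = "\<lambda>x. extend B (cube x (h / 2))"
  have h2: "0 < h / 2" "real CARD('n) * (h / 2) \<le> 1" using h by auto
  have fin: "finite ?Z" by (intro finite_PiE) auto
  have cZ: "card ?Z = 2 ^ CARD('n)" by (simp add: card_PiE numeral_2_eq_2)
  have lb: "loc_bounded ?e" by (rule cube_loc_bounded[OF h2(1)])
  have em: "?e \<in> borel_measurable borel" and pm: "\<psi> \<in> borel_measurable borel"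
    using lb \<psi> by (auto simp: loc_bounded_def comp_bounded_def)
  have cz: "norm (- ?c z) \<le> real CARD('n) * (h / 2)" if "z \<in> ?Z" for z
  proof -
    have "\<bar>(- ?c z) $ j - 0 $ j\<bar> \<le> h / 2" for j
    proof -
      have "z j = 0 \<or> z j = 1" using that by (auto simp: PiE_iff)
      then show ?thesis using h by auto
    qed
    from cell_dist[OF h2(1) this] show ?thesis by simp
  qed
  have 1: "(LINT x|lborel. extend B (cube x h) * \<psi> x) = (\<Sum>z\<in>?Z. LINT x|lborel. ?e x * \<psi> (x + - ?c z))"
  proof -
    have "(LINT x|lborel. extend B (cube x h) * \<psi> x) = (LINT x|lborel. (\<Sum>z\<in>?Z. ?e (x + ?c z) * \<psi> x))"
      by (simp only: cube_halves[OF h(1)] sum_distrib_right)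
    also have "\<dots> = (\<Sum>z\<in>?Z. LINT x|lborel. ?e (x + ?c z) * \<psi> x)"
      by (rule Bochner_Integration.integral_sum) (rule integrable_loc_comp[OF loc_bounded_translate[OF lb] \<psi>])
    also have "\<dots> = (\<Sum>z\<in>?Z. LINT x|lborel. ?e x * \<psi> (x + - ?c z))"
    proof (rule sum.cong[OF refl])
      fix z
      have "(LINT x|lborel. (\<lambda>x. ?e x * \<psi> (x + - ?c z)) (x + ?c z)) = (LINT x|lborel. ?e x * \<psi> (x + - ?c z))"
      proof (rule integral_translate)
        have "(\<lambda>x. \<psi> (x + - ?c z)) \<in> borel_measurable borel" using pm by measurable
        then show "(\<lambda>x. ?e x * \<psi> (x + - ?c z)) \<in> borel_measurable borel" using em by simp
      qed
      then show "(LINT x|lborel. ?e (x + ?c z) * \<psi> x) = (LINT x|lborel. ?e x * \<psi> (x + - ?c z))" by simp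
    qed
    finally show ?thesis .
  qed
  have 2: "2 ^ CARD('n) * (LINT x|lborel. ?e x * \<psi> x) = (\<Sum>z\<in>?Z. LINT x|lborel. ?e x * \<psi> x)" by (simp add: cZ)
  have "avg h \<psi> - avg (h / 2) \<psi> = ((LINT x|lborel. extend B (cube x h) * \<psi> x) - 2 ^ CARD('n) * (LINT x|lborel. ?e x * \<psi> x)) / h ^ CARD('n)"
    using h by (simp add: avg_def power_divide diff_divide_distrib)
  also have "\<dots> = (\<Sum>z\<in>?Z. LINT x|lborel. ?e x * (\<psi> (x + - ?c z) - \<psi> x)) / h ^ CARD('n)"
    unfolding 1 2 sum_subtractf[symmetric] right_diff_distrib
    by (subst Bochner_Integration.integral_diff) (intro integrable_loc_comp lb \<psi> comp_bounded_translate, simp)+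
  finally have 3: "avg h \<psi> - avg (h / 2) \<psi> = (\<Sum>z\<in>?Z. LINT x|lborel. ?e x * (\<psi> (x + - ?c z) - \<psi> x)) / h ^ CARD('n)" .
  let ?b = "N * cell_const TYPE('n) * (h / 2) ^ CARD('n) * (h / 2) powr (\<alpha> - 1) * (K * (real CARD('n) * (h / 2))) * measure lborel W"
  have "\<bar>\<Sum>z\<in>?Z. LINT x|lborel. ?e x * (\<psi> (x + - ?c z) - \<psi> x)\<bar> \<le> (\<Sum>z\<in>?Z. ?b)"
  proof (rule order.trans[OF sum_abs], rule sum_mono)
    fix z assume z: "z \<in> ?Z"
    show "\<bar>LINT x|lborel. ?e x * (\<psi> (x + - ?c z) - \<psi> x)\<bar> \<le> ?b"
    proof (rule avg_bound[OF h2 _ W(1,2)])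
      have "(\<lambda>x. \<psi> (x + - ?c z)) \<in> borel_measurable borel" using pm by measurable
      then show "(\<lambda>x. \<psi> (x + - ?c z) - \<psi> x) \<in> borel_measurable borel" using pm by (intro borel_measurable_diff)
      show "\<bar>\<psi> (x + - ?c z) - \<psi> x\<bar> \<le> K * (real CARD('n) * (h / 2))" for x
        using K(1)[of "x + - ?c z" x] mult_left_mono[OF cz[OF z] K(2)] by simp
      have "0 \<le> real CARD('n) * h" using h by simp
      then have n: "norm (- ?c z) \<le> real CARD('n) * h" using cz[OF z] by linarith
      show "\<psi> (x + - ?c z) - \<psi> x = 0" if "x \<notin> W" for x by (simp only: W(3)[OF that n] diff_self)
    qed
  qed
  \<comment> \<open>The 2^d subcubes restore (h / 2)^d to h^d, and the factor h / 2 from the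
    Lipschitz bound raises the exponent \<alpha> - 1 to \<alpha>.\<close>
  also have "\<dots> = h ^ CARD('n) * (N * cell_const TYPE('n) * real CARD('n) * K * measure lborel W * ((h / 2) * (h / 2) powr (\<alpha> - 1)))"
    by (simp add: cZ power_divide)
  also have "(h / 2) * (h / 2) powr (\<alpha> - 1) = (h / 2) powr \<alpha>" by (subst powr_mult_base) (use h in auto)
  finally have "\<bar>\<Sum>z\<in>?Z. LINT x|lborel. ?e x * (\<psi> (x + - ?c z) - \<psi> x)\<bar> \<le> h ^ CARD('n) * (N * cell_const TYPE('n) * real CARD('n) * K * measure lborel W * (h / 2) powr \<alpha>)" .
  then show ?thesis unfolding 3 using h by (simp add: abs_divide pos_divide_le_eq mult.commute)
qed

end

lemma telescoping_limit:
  fixes a :: "nat \<Rightarrow> real"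
  assumes a: "a \<longlonglongrightarrow> L" and q: "0 \<le> q" "q < 1" and c: "\<And>k. \<bar>a k - a (Suc k)\<bar> \<le> c * q ^ k"
  shows "\<bar>L - a 0\<bar> \<le> c / (1 - q)"
proof -
  have c0: "0 \<le> c" using c[of 0] by simp
  have b: "\<bar>a k - a 0\<bar> \<le> c / (1 - q)" for k
  proof -
    have "\<bar>a k - a 0\<bar> \<le> (\<Sum>i<k. c * q ^ i)"
    proof (induction k)
      case (Suc k)
      then show ?case using c[of k] by simp
    qed simp
    also have "\<dots> = c * ((1 - q ^ k) / (1 - q))" using q by (simp add: sum_distrib_left[symmetric] sum_gp_strict)
    also have "\<dots> \<le> c * (1 / (1 - q))" using q c0 by (intro mult_left_mono divide_right_mono) auto
    finally show ?thesis by simp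
  qed
  have "(\<lambda>k. \<bar>a k - a 0\<bar>) \<longlonglongrightarrow> \<bar>L - a 0\<bar>" by (intro tendsto_intros a)
  then show ?thesis by (rule LIMSEQ_le_const2) (use b in auto)
qed

text \<open>The denominator is that of the geometric series of ratio 2^(-\<alpha>) over dyadic
  scales.\<close>

definition sewing_const :: "real \<Rightarrow> 'n::finite itself \<Rightarrow> real" where
  "sewing_const \<alpha> _ = cell_const TYPE('n) * real CARD('n) / (1 - 2 powr (- \<alpha>))"

lemma two_powr_neg: "0 < \<alpha> \<Longrightarrow> (2::real) powr (- \<alpha>) < 1"
  by (simp add: powr_less_one)

lemma sewing_const_nonneg: "0 < \<alpha> \<Longrightarrow> 0 \<le> sewing_const \<alpha> TYPE('n::finite)"
  using two_powr_neg[of \<alpha>] cell_const_nonneg[where 'n='n] by (simp add: sewing_const_def)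

context holder_charge
begin

text \<open>Telescoping over the scales h / 2^k down to the limit, the halving errors form a
  geometric series. The same W serves all finer scales, because the shifts only get shorter.\<close>

lemma pairing_avg:
  assumes \<psi>: "\<psi> \<in> test_functions" and h: "0 < h" "real CARD('n) * h \<le> 1"
    and K: "\<And>x y. \<bar>\<psi> x - \<psi> y\<bar> \<le> K * norm (x - y)" "0 \<le> K"
    and W: "W \<in> sets borel" "emeasure lborel W < \<infinity>" "\<And>x y. x \<notin> W \<Longrightarrow> norm y \<le> real CARD('n) * h \<Longrightarrow> \<psi> (x + y) = \<psi> x"
  shows "\<bar>pairing \<psi> - avg h \<psi>\<bar> \<le> N * sewing_const \<alpha> TYPE('n) * K * measure lborel W * h powr \<alpha>"
proof -
  let ?q = "2 powr (- \<alpha>) :: real"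
  let ?A = "N * cell_const TYPE('n) * real CARD('n) * K * measure lborel W"
  have A0: "0 \<le> ?A" using N K(2) cell_const_nonneg[where 'n='n] by simp
  have hk: "0 < h / 2 ^ k" "h / 2 ^ k \<le> h" for k
    using h(1) by (auto simp: divide_le_eq mult_le_cancel_left1)
  have d1: "1 \<le> real CARD('n)" by (simp add: Suc_leI)
  have h1: "h \<le> 1" using mult_right_mono[OF d1, of h] h by linarith
  have "(\<lambda>k. h / 2 ^ k) \<longlonglongrightarrow> 0" by (rule LIMSEQ_divide_realpow_zero) simp
  then have lim: "(\<lambda>k. avg (h / 2 ^ k) \<psi>) \<longlonglongrightarrow> pairing \<psi>"
    by (intro avg_tendsto_pairing[OF \<psi> hk(1)]) (use hk(2) h1 order.trans in blast)
  have "\<bar>avg (h / 2 ^ k) \<psi> - avg (h / 2 ^ Suc k) \<psi>\<bar> \<le> (?A * h powr \<alpha>) * ?q ^ k" for k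
  proof -
    have hk1: "real CARD('n) * (h / 2 ^ k) \<le> real CARD('n) * h" by (rule mult_left_mono[OF hk(2)]) simp
    have "\<bar>avg (h / 2 ^ k) \<psi> - avg (h / 2 ^ k / 2) \<psi>\<bar> \<le> ?A * (h / 2 ^ k / 2) powr \<alpha>"
      by (rule avg_halve[OF hk(1) order.trans[OF hk1 h(2)] test_function_comp_bounded[OF \<psi>] K W(1,2)])
        (rule W(3)[OF _ order.trans[OF _ hk1]])
    also have "\<dots> \<le> ?A * (h powr \<alpha> * ?q ^ k)"
    proof (rule mult_left_mono[OF _ A0])
      have "(h / 2 ^ k / 2) powr \<alpha> \<le> (h / 2 ^ k) powr \<alpha>"
        using h(1) \<alpha> by (intro powr_mono2) (auto simp: field_simps)
      also have "\<dots> = h powr \<alpha> / (2 ^ k) powr \<alpha>" by (rule powr_divide)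
      also have "(2 ^ k) powr \<alpha> = (2 powr \<alpha>) ^ k" by (simp add: powr_powr powr_realpow[symmetric] mult.commute)
      also have "h powr \<alpha> / (2 powr \<alpha>) ^ k = h powr \<alpha> * ?q ^ k"
        by (simp only: powr_minus power_inverse divide_inverse)
      finally show "(h / 2 ^ k / 2) powr \<alpha> \<le> h powr \<alpha> * ?q ^ k" .
    qed
    finally show ?thesis by (simp add: mult.assoc divide_divide_eq_left mult.commute[of "2 ^ k" 2])
  qed
  from telescoping_limit[OF lim _ two_powr_neg[OF \<alpha>(1)] this]
  have "\<bar>pairing \<psi> - avg (h / 2 ^ 0) \<psi>\<bar> \<le> ?A * h powr \<alpha> / (1 - ?q)" by simp
  then show ?thesis by (simp add: sewing_const_def)
qed

end

section \<open>Estimates for distributions, boundary layers and smoothed indicators\<close>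

subsection \<open>Testing distributions of negative Hoelder regularity\<close>

lemma Ck_norm_1:
  fixes f :: "real^'n::finite \<Rightarrow> real"
  shows "Ck_norm 1 f = (SUP x. \<bar>f x\<bar>) + (\<Sum>j\<in>UNIV. SUP x. \<bar>partial_deriv j f x\<bar>)"
proof -
  have "{ks::'n list. length ks \<le> 1} = insert [] (range (\<lambda>j. [j]))"
  proof (intro equalityI subsetI)
    fix ks :: "'n list" assume "ks \<in> {ks. length ks \<le> 1}"
    then show "ks \<in> insert [] (range (\<lambda>j. [j]))" by (cases ks) auto
  qed auto
  then show ?thesis
    unfolding Ck_norm_def by (simp only:) (subst sum.insert; simp add: sum.reindex inj_on_def image_iff)
qed

definition hnorm :: "real \<Rightarrow> ((real^'n::finite \<Rightarrow> real) \<Rightarrow> real) \<Rightarrow> real" where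
  "hnorm \<alpha> F = enn2real (holder_norm (\<alpha> - 1) F)"

lemma hnorm_nonneg: "0 \<le> hnorm \<alpha> F" by (simp add: hnorm_def)

lemma holder_norm_test:
  assumes F: "F \<in> holder_space (\<alpha> - 1)" and r: "0 < \<rho>" "\<rho> \<le> 1" and \<phi>: "\<phi> \<in> unit_test_functions"
  shows "\<rho> powr (1 - \<alpha>) * \<bar>F (rescale \<rho> x \<phi>)\<bar> \<le> hnorm \<alpha> F"
proof -
  have fin: "holder_norm (\<alpha> - 1) F < \<infinity>" using F by (simp add: holder_space_def)
  have "ennreal (\<rho> powr (1 - \<alpha>) * \<bar>F (rescale \<rho> x \<phi>)\<bar>) \<le> holder_norm (\<alpha> - 1) F"
    unfolding holder_norm_def by (rule SUP_upper2[of "(x, \<rho>, \<phi>)"]) (use r \<phi> in auto)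
  also have "\<dots> = ennreal (hnorm \<alpha> F)" using fin by (simp add: hnorm_def)
  finally show ?thesis by (simp add: ennreal_le_iff hnorm_nonneg)
qed

lemma holder_test:
  fixes g :: "real^'n::finite \<Rightarrow> real"
  assumes F: "F \<in> holder_space (\<alpha> - 1)" and g: "smooth g" and \<rho>: "0 < \<rho>" "\<rho> \<le> 1" and M: "0 < M"
    and supp: "\<And>y. g y \<noteq> 0 \<Longrightarrow> norm (y - x) \<le> \<rho>" and b0: "\<And>y. \<bar>g y\<bar> \<le> M" and b1: "\<And>j y. \<bar>partial_deriv j g y\<bar> \<le> M / \<rho>"
  shows "\<bar>F g\<bar> \<le> (real CARD('n) + 1) * M * \<rho> ^ CARD('n) * \<rho> powr (\<alpha> - 1) * hnorm \<alpha> F"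
proof -
  \<comment> \<open>The first order norm is a sum of d + 1 suprema, each of which is at most M after
    rescaling to the unit ball.\<close>
  let ?c = "1 / ((real CARD('n) + 1) * M)"
  have c: "0 < ?c" using M by simp
  define \<phi> where "\<phi> y = ?c * g (\<rho> *\<^sub>R y + x)" for y
  have gd: "g differentiable (at y)" for y by (rule smooth_differentiable[OF g])
  have sm: "smooth (\<lambda>y. g (\<rho> *\<^sub>R y + x))" by (rule smooth_compose_affine[OF g])
  have p: "partial_deriv j \<phi> y = ?c * (\<rho> * partial_deriv j g (\<rho> *\<^sub>R y + x))" for j y
    unfolding \<phi>_def[abs_def]
    using partial_deriv_mult[of "\<lambda>_. ?c" y "\<lambda>y. g (\<rho> *\<^sub>R y + x)" j] smooth_differentiable[OF sm, of y]
      differentiable_compose_affine(2)[OF gd, where c = \<rho> and b = x and i = j and x = y]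
    by (simp add: partial_deriv_const)
  have "\<phi> \<in> unit_test_functions"
    unfolding unit_test_functions_def
  proof (intro CollectI conjI)
    show "smooth \<phi>" unfolding \<phi>_def[abs_def] by (intro smooth_mult smooth_const sm)
    show "closure {y. \<phi> y \<noteq> 0} \<subseteq> cball 0 1"
    proof (rule closure_minimal)
      show "{y. \<phi> y \<noteq> 0} \<subseteq> cball 0 1"
      proof
        fix y assume "y \<in> {y. \<phi> y \<noteq> 0}"
        then have "norm (\<rho> *\<^sub>R y + x - x) \<le> \<rho>" by (intro supp) (auto simp: \<phi>_def)
        then have "\<rho> * norm y \<le> \<rho> * 1" using \<rho> by simp
        then show "y \<in> cball 0 1" using \<rho>(1) by (simp only: mult_le_cancel_left_pos) simp
      qed
    qed simp
    have "(SUP y. \<bar>\<phi> y\<bar>) \<le> ?c * M"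
    proof (intro cSUP_least)
      show "\<bar>\<phi> y\<bar> \<le> ?c * M" for y unfolding \<phi>_def abs_mult using b0 c by (intro mult_mono) auto
    qed simp
    moreover have "(SUP y. \<bar>partial_deriv j \<phi> y\<bar>) \<le> ?c * M" for j
    proof (intro cSUP_least)
      fix y
      have "\<rho> * \<bar>partial_deriv j g (\<rho> *\<^sub>R y + x)\<bar> \<le> \<rho> * (M / \<rho>)" using \<rho> b1 by (intro mult_left_mono) auto
      then have "?c * (\<rho> * \<bar>partial_deriv j g (\<rho> *\<^sub>R y + x)\<bar>) \<le> ?c * M" using c \<rho> by (intro mult_left_mono) auto
      then show "\<bar>partial_deriv j \<phi> y\<bar> \<le> ?c * M" unfolding p using c \<rho> M by (simp add: abs_mult)
    qed simp
    ultimately have "Ck_norm 1 \<phi> \<le> ?c * M + (\<Sum>j\<in>(UNIV::'n set). ?c * M)"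
      unfolding Ck_norm_1 by (intro add_mono sum_mono)
    also have "\<dots> = (real CARD('n) + 1) * (?c * M)"
      by (simp only: sum_constant distrib_right mult_1_left add.commute)
    also have "\<dots> = 1"
    proof -
      have *: "x * (1 / (x * M) * M) = 1" if "0 < x" for x :: real using that M by simp
      show ?thesis by (rule *) (simp add: add_nonneg_pos)
    qed
    finally show "Ck_norm 1 \<phi> \<le> 1" .
  qed
  from holder_norm_test[OF F \<rho> this, of x]
  have 1: "\<rho> powr (1 - \<alpha>) * \<bar>F (rescale \<rho> x \<phi>)\<bar> \<le> hnorm \<alpha> F" .
  \<comment> \<open>Linearity of distributions is stated for combinations of two functions, hence
    the zero second term.\<close>
  have r: "rescale \<rho> x \<phi> = (\<lambda>y. (?c / \<rho> ^ CARD('n)) * g y + 0 * g y)"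
    using \<rho> by (auto simp: rescale_def \<phi>_def fun_eq_iff)
  have tf: "g \<in> test_functions"
    by (rule test_functionI[OF g bounded_cball[of x \<rho>]]) (use supp in \<open>auto simp: dist_norm norm_minus_commute\<close>)
  have "F \<in> distributions" using F by (simp add: holder_space_def)
  from distribution_lincomb[OF this tf tf, of "?c / \<rho> ^ CARD('n)" 0]
  have "F (rescale \<rho> x \<phi>) = (?c / \<rho> ^ CARD('n)) * F g" unfolding r by simp
  then have "\<bar>F (rescale \<rho> x \<phi>)\<bar> = (?c / \<rho> ^ CARD('n)) * \<bar>F g\<bar>"
    using c \<rho> M by (simp add: abs_mult)
  then have 2: "\<rho> powr (1 - \<alpha>) * (?c / \<rho> ^ CARD('n)) * \<bar>F g\<bar> \<le> hnorm \<alpha> F" using 1 by (simp add: mult.assoc)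
  define X where "X = \<rho> powr (1 - \<alpha>) * (?c / \<rho> ^ CARD('n))"
  define Y where "Y = (real CARD('n) + 1) * M * \<rho> ^ CARD('n) * \<rho> powr (\<alpha> - 1)"
  have "\<rho> powr (1 - \<alpha>) * \<rho> powr (\<alpha> - 1) = 1" using \<rho> by (simp flip: powr_add)
  moreover have "?c * ((real CARD('n) + 1) * M) = 1" using M by simp
  moreover have "X * Y = (\<rho> powr (1 - \<alpha>) * \<rho> powr (\<alpha> - 1)) * (?c * ((real CARD('n) + 1) * M))"
    unfolding X_def Y_def using \<rho> by simp
  ultimately have XY: "Y * X = 1" by (simp add: mult.commute)
  have "Y * (X * \<bar>F g\<bar>) \<le> Y * hnorm \<alpha> F"
    using 2 M \<rho> unfolding X_def Y_def by (intro mult_left_mono) auto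
  then have "\<bar>F g\<bar> \<le> Y * hnorm \<alpha> F" using XY by (simp add: mult.assoc[symmetric])
  then show ?thesis by (simp add: Y_def)
qed

text \<open>A closed condition, so that it contains the closure of the support of a hat and
  therefore controls its derivatives as well.\<close>

definition near :: "real \<Rightarrow> ('n::finite \<Rightarrow> int) \<Rightarrow> real^'n \<Rightarrow> bool" where
  "near r z x \<longleftrightarrow> (\<forall>j. \<bar>x $ j / r - real_of_int (z j)\<bar> \<le> 1)"

lemma hat_near: "hat r z x \<noteq> 0 \<Longrightarrow> near r z x"
  unfolding near_def using hat_nonzero less_imp_le by blast

lemma partial_hat_near:
  fixes x :: "real^'n::finite"
  assumes "partial_deriv j (hat r z) x \<noteq> 0" shows "near r z x"
proof -
  have "x \<in> closure {x. hat r z x \<noteq> 0}"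
    using support_partial_derivs[of "[j]" "hat r z"] assms by auto
  also have "\<dots> \<subseteq> {x. near r z x}"
  proof (rule closure_minimal)
    show "{x. hat r z x \<noteq> 0} \<subseteq> {x. near r z x}" using hat_near by auto
    have "{x::real^'n. near r z x} = (\<Inter>j. {x. \<bar>x $ j / r - real_of_int (z j)\<bar> \<le> 1})" by (auto simp: near_def)
    moreover have "closed \<dots>"
      unfolding divide_inverse by (intro closed_INT ballI closed_Collect_le continuous_intros)
    ultimately show "closed {x::real^'n. near r z x}" by simp
  qed
  finally show ?thesis by simp
qed

lemma near_cell_dist:
  fixes x y :: "real^'n::finite"
  assumes r: "0 < r" and "near r z x" "y \<in> cell r 0 z"
  shows "norm (x - y) \<le> 2 * real CARD('n) * r"
proof -
  have "\<bar>x $ j - y $ j\<bar> \<le> 2 * r" for j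
  proof -
    have "\<bar>x $ j / r - real_of_int (z j)\<bar> \<le> 1" using assms(2) by (simp add: near_def)
    then have "\<bar>x $ j - r * real_of_int (z j)\<bar> \<le> r" using r by (simp add: abs_le_iff field_simps)
    moreover have "r * real_of_int (z j) \<le> y $ j" "y $ j < r * real_of_int (z j) + r"
      using assms(3) r by (auto simp: mem_cell_iff)
    ultimately show ?thesis by linarith
  qed
  then show ?thesis using cell_dist[of "2 * r" x y] r by (simp add: mult.assoc mult.left_commute)
qed

text \<open>Bounds the number of hats near a point: the corresponding disjoint cells lie in a ball
  of radius 2 d r, whose volume is at most (4 d r)^d.\<close>

definition overlap :: "'n::finite itself \<Rightarrow> real" where
  "overlap _ = (4 * real CARD('n)) ^ CARD('n)"

lemma overlap_ge_1: "1 \<le> overlap TYPE('n::finite)"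
proof -
  have "1 \<le> real CARD('n)" by (simp add: Suc_leI)
  then have "1 \<le> 4 * real CARD('n)" by linarith
  then show ?thesis unfolding overlap_def by (rule one_le_power)
qed

lemma finite_near:
  fixes x :: "real^'n::finite"
  assumes r: "0 < r" shows "finite {z. near r z x}"
proof (rule finite_subset[OF _ finite_cells[OF r bounded_cball, of 0 x "2 * real CARD('n) * r"]], clarify)
  fix z assume "near r z x" "cell r 0 z \<inter> cball x (2 * real CARD('n) * r) = {}"
  have "corner r 0 z \<in> cball x (2 * real CARD('n) * r)"
    using near_cell_dist[OF r \<open>near r z x\<close> corner_in_cell[OF r]] by (simp add: dist_norm)
  then show False using \<open>cell r 0 z \<inter> cball x (2 * real CARD('n) * r) = {}\<close> corner_in_cell[OF r, of 0 z] by blast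
qed

lemma card_near:
  fixes x :: "real^'n::finite"
  assumes r: "0 < r" shows "real (card {z. near r z x}) \<le> overlap TYPE('n)"
proof -
  let ?R = "2 * real CARD('n) * r"
  have R: "0 \<le> ?R" using r by simp
  have "real (card {z. near r z x}) * r ^ CARD('n) \<le> measure lebesgue (cball x ?R)"
  proof (rule card_cells_le[OF r finite_near[OF r]])
    show "cell r 0 z \<subseteq> cball x ?R" if "z \<in> {z. near r z x}" for z
      using near_cell_dist[OF r] that by (auto simp: dist_norm)
  qed simp
  also have "\<dots> \<le> (2 * ?R) ^ CARD('n)" by (rule measure_cball_le[OF R])
  also have "2 * ?R = 4 * real CARD('n) * r" by simp
  also have "\<dots> ^ CARD('n) = overlap TYPE('n) * r ^ CARD('n)" by (simp only: overlap_def power_mult_distrib)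
  finally show ?thesis using r by simp
qed

definition hat_sum :: "real \<Rightarrow> ('n::finite \<Rightarrow> int) set \<Rightarrow> (('n \<Rightarrow> int) \<Rightarrow> real) \<Rightarrow> real^'n \<Rightarrow> real" where
  "hat_sum r Z c x = (\<Sum>z\<in>Z. c z * hat r z x)"

lemma hat_test_function:
  fixes z :: "'n::finite \<Rightarrow> int"
  assumes r: "0 < r" shows "hat r z \<in> test_functions"
proof (rule test_functionI[OF smooth_hat bounded_cball[of "corner r 0 z" "2 * real CARD('n) * r"]])
  fix x assume "hat r z x \<noteq> 0"
  then show "x \<in> cball (corner r 0 z) (2 * real CARD('n) * r)"
    using hat_cell_dist[OF r \<open>hat r z x \<noteq> 0\<close> corner_in_cell[OF r]] by (simp add: dist_norm norm_minus_commute)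
qed

lemma hat_sum_test_function: "0 < r \<Longrightarrow> finite Z \<Longrightarrow> hat_sum r Z c \<in> test_functions"
  unfolding hat_sum_def[abs_def] by (intro test_function_sum hat_test_function)

lemma partial_deriv_sum:
  assumes "finite Z" "\<And>z. z \<in> Z \<Longrightarrow> smooth (f z)"
  shows "partial_deriv j (\<lambda>x. \<Sum>z\<in>Z. c z * f z x) x = (\<Sum>z\<in>Z. c z * partial_deriv j (f z) x)"
  using assms
proof (induction Z rule: finite_induct)
  case empty
  then show ?case by (simp add: partial_deriv_const)
next
  case (insert z Z)
  have d: "(\<lambda>x. c z * f z x) differentiable (at x)" "f z differentiable (at x)"
    using insert by (auto intro!: smooth_differentiable smooth_mult smooth_const)
  have ds: "(\<lambda>x. \<Sum>z\<in>Z. c z * f z x) differentiable (at x)"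
    using insert by (intro smooth_differentiable smooth_sum smooth_mult smooth_const) auto
  have "partial_deriv j (\<lambda>x. c z * f z x) x = c z * partial_deriv j (f z) x"
    using partial_deriv_mult[of "\<lambda>_. c z", OF _ d(2)] by (simp add: partial_deriv_const)
  then show ?case using insert partial_deriv_add[OF d(1) ds, of j] by simp
qed

lemma sum_near_bound:
  fixes x :: "real^'n::finite"
  assumes r: "0 < r" and Z: "finite Z" and near: "\<And>z. z \<in> Z \<Longrightarrow> f z \<noteq> 0 \<Longrightarrow> near r z x"
    and M: "\<And>z. z \<in> Z \<Longrightarrow> near r z x \<Longrightarrow> \<bar>f z\<bar> \<le> M" "0 \<le> M"
  shows "\<bar>\<Sum>z\<in>Z. f z\<bar> \<le> overlap TYPE('n) * M"
proof -
  have "(\<Sum>z\<in>Z. f z) = (\<Sum>z\<in>Z \<inter> {z. near r z x}. f z)"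
    using Z near by (intro sum.mono_neutral_right) auto
  also have "\<bar>\<dots>\<bar> \<le> real (card (Z \<inter> {z. near r z x})) * M"
    using M by (intro order.trans[OF sum_abs] sum_bounded_above) auto
  also have "\<dots> \<le> real (card {z. near r z x}) * M"
    using M(2) finite_near[OF r] by (intro mult_right_mono) (auto intro: card_mono)
  also have "\<dots> \<le> overlap TYPE('n) * M" using card_near[OF r] M(2) by (intro mult_right_mono)
  finally show ?thesis .
qed

lemma hat_sum_bounds:
  fixes Z :: "('n::finite \<Rightarrow> int) set"
  assumes r: "0 < r" and Z: "finite Z" and c: "\<And>z. z \<in> Z \<Longrightarrow> \<bar>c z\<bar> \<le> M" "0 \<le> M"
  shows "\<bar>hat_sum r Z c x\<bar> \<le> overlap TYPE('n) * M"
    "\<bar>partial_deriv j (hat_sum r Z c) x\<bar> \<le> overlap TYPE('n) * (M * (hat_constant TYPE('n) / r))"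
proof -
  show "\<bar>hat_sum r Z c x\<bar> \<le> overlap TYPE('n) * M"
    unfolding hat_sum_def
  proof (rule sum_near_bound[OF r Z _ _ c(2)])
    show "\<bar>c z * hat r z x\<bar> \<le> M" if "z \<in> Z" for z
      using mult_mono[OF c(1)[OF that] abs_hat_le[of r z x] c(2)] by (simp add: abs_mult)
  qed (use hat_near in auto)
  show "\<bar>partial_deriv j (hat_sum r Z c) x\<bar> \<le> overlap TYPE('n) * (M * (hat_constant TYPE('n) / r))"
    unfolding hat_sum_def[abs_def] partial_deriv_sum[OF Z smooth_hat]
  proof (rule sum_near_bound[OF r Z])
    show "\<bar>c z * partial_deriv j (hat r z) x\<bar> \<le> M * (hat_constant TYPE('n) / r)" if "z \<in> Z" for z
      unfolding abs_mult using c hat_constant(2)[OF r] that by (intro mult_mono) auto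
    show "0 \<le> M * (hat_constant TYPE('n) / r)" using c(2) hat_constant(1)[where 'n='n] r by simp
  qed (use partial_hat_near in auto)
qed

text \<open>The factor d + 1 normalises the first order norm. The piece of g under a hat has
  derivatives up to (1 + H) M / r, H being the hat constant, but it is tested at scale 2 d r, which
  costs the second factor; (2 d)^d is the volume of that scale relative to r^d.\<close>

definition test_const :: "'n::finite itself \<Rightarrow> real" where
  "test_const _ = (real CARD('n) + 1) * ((1 + hat_constant TYPE('n)) * (2 * real CARD('n))) * (2 * real CARD('n)) ^ CARD('n)"

lemma test_const_nonneg: "0 \<le> test_const TYPE('n::finite)"
  using hat_constant(1)[where 'n='n] by (simp add: test_const_def)

lemma holder_test_local:
  fixes g :: "real^'n::finite \<Rightarrow> real"
  assumes F: "F \<in> holder_space (\<alpha> - 1)" and \<alpha>: "\<alpha> < 1" and g: "smooth g" and r: "0 < r" "2 * real CARD('n) * r \<le> 1" and M: "0 < M"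
    and b: "\<And>y. \<bar>g y\<bar> \<le> M" "\<And>j y. \<bar>partial_deriv j g y\<bar> \<le> (1 + hat_constant TYPE('n)) * M / r"
    and supp: "\<And>y. g y \<noteq> 0 \<Longrightarrow> norm (y - x) \<le> 2 * real CARD('n) * r"
  shows "\<bar>F g\<bar> \<le> test_const TYPE('n) * M * (r ^ CARD('n) * r powr (\<alpha> - 1)) * hnorm \<alpha> F"
proof -
  let ?d = "real CARD('n)" and ?H = "hat_constant TYPE('n)"
  let ?M = "(1 + ?H) * (2 * ?d) * M"
  have d1: "1 \<le> ?d" by (simp add: Suc_leI)
  have H: "1 \<le> ?H" by (rule hat_constant)
  have "1 * 1 \<le> (1 + ?H) * (2 * ?d)" by (intro mult_mono; use H d1 in linarith)
  then have MM: "M \<le> ?M" using M by simp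
  have "\<bar>F g\<bar> \<le> (?d + 1) * ?M * (2 * ?d * r) ^ CARD('n) * (2 * ?d * r) powr (\<alpha> - 1) * hnorm \<alpha> F"
  proof (rule holder_test[OF F g _ r(2) _ supp])
    show "0 < 2 * ?d * r" "0 < ?M" using r M H by auto
    show "\<bar>g y\<bar> \<le> ?M" for y using b(1)[of y] MM by linarith
    show "\<bar>partial_deriv j g y\<bar> \<le> ?M / (2 * ?d * r)" for j y
      using b(2)[of j y] r by simp
  qed
  also have "\<dots> \<le> (?d + 1) * ?M * (2 * ?d * r) ^ CARD('n) * r powr (\<alpha> - 1) * hnorm \<alpha> F"
  proof -
    have "1 \<le> 2 * ?d" using d1 by linarith
    then have "1 * r \<le> 2 * ?d * r" using r(1) by (intro mult_right_mono) auto
    then have "(2 * ?d * r) powr (\<alpha> - 1) \<le> r powr (\<alpha> - 1)"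
      using r \<alpha> by (intro powr_mono2') auto
    then show ?thesis using r M H by (intro mult_right_mono mult_left_mono hnorm_nonneg) auto
  qed
  also have "\<dots> = test_const TYPE('n) * M * (r ^ CARD('n) * r powr (\<alpha> - 1)) * hnorm \<alpha> F"
    by (simp add: test_const_def power_mult_distrib)
  finally show ?thesis .
qed

text \<open>The partition of unity splits g into pieces living at scale r, and their number times
  r^d is at most the volume of a neighbourhood of the support. The bound is thus proportional to
  that volume, which is decisive when g lives in a thin layer.\<close>

lemma holder_test_global:
  fixes g :: "real^'n::finite \<Rightarrow> real"
  assumes F: "F \<in> holder_space (\<alpha> - 1)" and \<alpha>: "\<alpha> < 1" and g: "g \<in> test_functions" and r: "0 < r" "2 * real CARD('n) * r \<le> 1" and M: "0 < M"
    and b: "\<And>y. \<bar>g y\<bar> \<le> M" "\<And>j y. \<bar>partial_deriv j g y\<bar> \<le> M / r"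
    and W: "W \<in> lmeasurable" "\<And>x y. g x \<noteq> 0 \<Longrightarrow> norm (x - y) \<le> 2 * real CARD('n) * r \<Longrightarrow> y \<in> W"
  shows "\<bar>F g\<bar> \<le> test_const TYPE('n) * M * r powr (\<alpha> - 1) * hnorm \<alpha> F * measure lebesgue W"
proof -
  let ?R = "2 * real CARD('n) * r"
  have H: "1 \<le> hat_constant TYPE('n)" by (rule hat_constant)
  have sg: "smooth g" by (rule test_function_smooth[OF g])
  have FD: "F \<in> distributions" using F by (simp add: holder_space_def)
  obtain A where A: "\<And>x. g x \<noteq> 0 \<Longrightarrow> norm x \<le> A" using test_function_bounded_support[OF g] by (auto simp: bounded_iff)
  define Z where "Z = {z. \<exists>x. hat r z x \<noteq> 0 \<and> g x \<noteq> 0}"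
  have cellZ: "norm (x - y) \<le> ?R" if "hat r z x \<noteq> 0" "y \<in> cell r 0 z" for x y :: "real^'n" and z
    by (rule hat_cell_dist[OF r(1) that])
  have "Z \<subseteq> {z. cell r 0 z \<inter> cball 0 (A + ?R) \<noteq> {}}"
  proof
    fix z assume "z \<in> Z"
    then obtain x where x: "hat r z x \<noteq> 0" "g x \<noteq> 0" by (auto simp: Z_def)
    have "norm (corner r 0 z) \<le> norm x + norm (x - corner r 0 z)" using norm_triangle_ineq4[of x "x - corner r 0 z"] by simp
    then have "corner r 0 z \<in> cball 0 (A + ?R)" using A[OF x(2)] cellZ[OF x(1) corner_in_cell[OF r(1)]] by simp
    then show "z \<in> {z. cell r 0 z \<inter> cball 0 (A + ?R) \<noteq> {}}" using corner_in_cell[OF r(1), of 0 z] by blast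
  qed
  then have fin: "finite Z" by (rule finite_subset[OF _ finite_cells[OF r(1) bounded_cball]])
  have geq: "g = (\<lambda>x. \<Sum>z\<in>Z. 1 * (hat r z x * g x))"
  proof
    fix x show "g x = (\<Sum>z\<in>Z. 1 * (hat r z x * g x))"
    proof (cases "g x = 0")
      case False
      have "(\<Sum>z\<in>Z. hat r z x) = 1" by (rule sum_hat[OF fin]) (use False in \<open>auto simp: Z_def\<close>)
      then show ?thesis by (simp flip: sum_distrib_right)
    qed simp
  qed
  have t: "(\<lambda>x. hat r z x * g x) \<in> test_functions" for z by (rule test_function_mult[OF smooth_hat g])
  have piece: "\<bar>F (\<lambda>x. hat r z x * g x)\<bar> \<le> test_const TYPE('n) * M * (r ^ CARD('n) * r powr (\<alpha> - 1)) * hnorm \<alpha> F" for z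
  proof (rule holder_test_local[OF F \<alpha> test_function_smooth[OF t] r M])
    show "\<bar>hat r z y * g y\<bar> \<le> M" for y
      using mult_mono[OF abs_hat_le[of r z y] b(1)[of y]] by (simp add: abs_mult)
    show "\<bar>partial_deriv j (\<lambda>x. hat r z x * g x) y\<bar> \<le> (1 + hat_constant TYPE('n)) * M / r" for j y
    proof -
      have "\<bar>partial_deriv j (\<lambda>x. hat r z x * g x) y\<bar> \<le> \<bar>hat r z y\<bar> * \<bar>partial_deriv j g y\<bar> + \<bar>partial_deriv j (hat r z) y\<bar> * \<bar>g y\<bar>"
        unfolding partial_deriv_mult[OF smooth_differentiable[OF smooth_hat] smooth_differentiable[OF sg]]
        by (simp add: abs_mult[symmetric] abs_triangle_ineq)
      also have "\<dots> \<le> 1 * (M / r) + (hat_constant TYPE('n) / r) * M"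
        using b(1)[of y] b(2)[of j y] abs_hat_le[of r z y] hat_constant(2)[OF r(1), of j z y] H r M
        by (intro add_mono mult_mono) auto
      also have "\<dots> = (1 + hat_constant TYPE('n)) * M / r" by (simp add: add_divide_distrib distrib_right)
      finally show ?thesis .
    qed
    show "norm (y - corner r 0 z) \<le> ?R" if "hat r z y * g y \<noteq> 0" for y
      using that by (intro cellZ[OF _ corner_in_cell[OF r(1)]]) auto
  qed
  have "F g = (\<Sum>z\<in>Z. 1 * F (\<lambda>x. hat r z x * g x))"
    by (subst geq) (rule distribution_sum[OF FD fin t])
  then have "\<bar>F g\<bar> \<le> (\<Sum>z\<in>Z. \<bar>F (\<lambda>x. hat r z x * g x)\<bar>)" by (simp add: sum_abs)
  also have "\<dots> \<le> real (card Z) * (test_const TYPE('n) * M * (r ^ CARD('n) * r powr (\<alpha> - 1)) * hnorm \<alpha> F)"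
    using piece by (intro sum_bounded_above)
  also have "\<dots> = (test_const TYPE('n) * M * r powr (\<alpha> - 1) * hnorm \<alpha> F) * (real (card Z) * r ^ CARD('n))"
    by simp
  also have "\<dots> \<le> (test_const TYPE('n) * M * r powr (\<alpha> - 1) * hnorm \<alpha> F) * measure lebesgue W"
  proof (rule mult_left_mono)
    show "real (card Z) * r ^ CARD('n) \<le> measure lebesgue W"
    proof (rule card_cells_le[OF r(1) fin W(1)])
      fix z assume "z \<in> Z"
      then obtain x where "hat r z x \<noteq> 0" "g x \<noteq> 0" by (auto simp: Z_def)
      then show "cell r 0 z \<subseteq> W" using W(2) cellZ by blast
    qed
    show "0 \<le> test_const TYPE('n) * M * r powr (\<alpha> - 1) * hnorm \<alpha> F"
      using M test_const_nonneg[where 'n='n] hnorm_nonneg[of \<alpha> F] by simp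
  qed
  finally show ?thesis .
qed

lemma holder_test_hat:
  fixes z :: "'n::finite \<Rightarrow> int"
  assumes F: "F \<in> holder_space (\<alpha> - 1)" and \<alpha>: "\<alpha> < 1" and r: "0 < r" "2 * real CARD('n) * r \<le> 1"
  shows "\<bar>F (hat r z)\<bar> \<le> test_const TYPE('n) * (r ^ CARD('n) * r powr (\<alpha> - 1)) * hnorm \<alpha> F"
proof -
  have "\<bar>F (hat r z)\<bar> \<le> test_const TYPE('n) * 1 * (r ^ CARD('n) * r powr (\<alpha> - 1)) * hnorm \<alpha> F"
  proof (rule holder_test_local[OF F \<alpha> smooth_hat r])
    show "\<bar>partial_deriv j (hat r z) y\<bar> \<le> (1 + hat_constant TYPE('n)) * 1 / r" for j y
      using hat_constant(2)[OF r(1), of j z y] r by (simp add: add_divide_distrib add_increasing)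
    show "norm (y - corner r 0 z) \<le> 2 * real CARD('n) * r" if "hat r z y \<noteq> 0" for y
      by (rule hat_cell_dist[OF r(1) that corner_in_cell[OF r(1)]])
  qed (auto simp: abs_hat_le)
  then show ?thesis by simp
qed

subsection \<open>Boundary layers of simplices\<close>

text \<open>A shrunken copy of the simplex for s > 0 and an enlarged one for s < 0.\<close>

definition inset :: "'n::finite vertex_tuple \<Rightarrow> real \<Rightarrow> (real^'n) set" where
  "inset v s = {x. \<forall>i. s \<le> bary v x $ i}"

lemma closed_inset: "closed (inset v s)"
proof -
  have "inset v s = (\<Inter>i. {x. s \<le> bary v x $ i})" by (auto simp: inset_def)
  then show ?thesis by (simp only:) (intro closed_INT ballI closed_Collect_le continuous_intros bary_continuous)
qed

text \<open>The centroid has all coordinates equal to 1 / (d + 1), so the homothety about it with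
  ratio 1 - (d + 1) s maps the condition of being at least 0 to that of being at least s.\<close>

lemma inset_scale:
  fixes v :: "'n::finite vertex_tuple"
  assumes ai: "aff_indep_tuple v" and k: "0 < 1 - (real CARD('n) + 1) * s"
  shows "inset v s \<in> lmeasurable"
    "measure lebesgue (inset v s) = (1 - (real CARD('n) + 1) * s) ^ CARD('n) * measure lebesgue (convex hull (range (($) v)))"
proof -
  let ?S = "convex hull (range (($) v))" and ?b = "1 / (real CARD('n) + 1)"
  define \<kappa> where "\<kappa> = 1 - (real CARD('n) + 1) * s"
  have \<kappa>: "0 < \<kappa>" using k by (simp add: \<kappa>_def)
  have "x * s * (1 / x) = s" if "0 < x" for x :: real using that by simp
  from this[of "real CARD('n) + 1"] have sb: "(1 - \<kappa>) * ?b = s" by (simp add: \<kappa>_def)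
  define c where "c = (\<Sum>i\<in>UNIV. ?b *\<^sub>R v $ i)"
  have bc: "bary v c = (\<chi> i. ?b)"
    by (rule bary_unique[OF ai]) (auto simp: c_def card_option)
  let ?T = "\<lambda>x. \<kappa> *\<^sub>R x + (1 - \<kappa>) *\<^sub>R c"
  have bT: "bary v (?T x) $ i = \<kappa> * bary v x $ i + s" for x i
  proof -
    have "bary v (?T x) = \<kappa> *\<^sub>R bary v x + (1 - \<kappa>) *\<^sub>R bary v c" by (rule bary_affine[OF ai]) simp
    then have "bary v (?T x) $ i = \<kappa> * bary v x $ i + (1 - \<kappa>) * ?b" unfolding bc by simp
    then show ?thesis unfolding sb .
  qed
  have eq: "inset v s = ?T ` ?S"
  proof (intro equalityI subsetI)
    fix y assume y: "y \<in> inset v s"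
    let ?x = "(1 / \<kappa>) *\<^sub>R y + (1 - 1 / \<kappa>) *\<^sub>R c"
    have "\<kappa> * (1 - 1 / \<kappa>) + (1 - \<kappa>) = 0" using \<kappa> by (simp add: right_diff_distrib)
    moreover have "?T ?x = (\<kappa> * (1 / \<kappa>)) *\<^sub>R y + (\<kappa> * (1 - 1 / \<kappa>) + (1 - \<kappa>)) *\<^sub>R c"
      by (simp only: scaleR_add_right scaleR_scaleR scaleR_add_left add.assoc)
    ultimately have T: "?T ?x = y" using \<kappa> by simp
    have "0 \<le> bary v ?x $ i" for i
    proof -
      have "s \<le> bary v y $ i" using y by (simp add: inset_def)
      then have "0 \<le> \<kappa> * bary v ?x $ i" using bT[of ?x i] unfolding T by linarith
      then show ?thesis using \<kappa> by (simp only: zero_le_mult_iff) linarith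
    qed
    then have "?x \<in> ?S" using mem_simplex_iff[OF ai] by blast
    then show "y \<in> ?T ` ?S" by (rule image_eqI[where x = ?x and f = ?T, OF T[symmetric]])
  next
    fix y assume "y \<in> ?T ` ?S"
    then obtain x where x: "y = ?T x" "x \<in> ?S" by blast
    have "s \<le> bary v y $ i" for i
    proof -
      have "0 \<le> \<kappa> * bary v x $ i" using \<kappa> x(2) mem_simplex_iff[OF ai, of x] by (intro mult_nonneg_nonneg) auto
      then show ?thesis unfolding x(1) bT by linarith
    qed
    then show "y \<in> inset v s" by (simp add: inset_def)
  qed
  have S: "compact ?S" by (intro full_simplex_compact full_simplicesI ai)
  have "compact (?T ` ?S)" by (intro compact_continuous_image continuous_intros S)
  then show "inset v s \<in> lmeasurable" unfolding eq by (rule lmeasurable_compact)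
  have "measure lebesgue (?T ` ?S) = \<bar>\<kappa>\<bar> ^ DIM(real^'n) * measure lebesgue ?S" by (rule measure_lebesgue_affine)
  then show "measure lebesgue (inset v s) = (1 - (real CARD('n) + 1) * s) ^ CARD('n) * measure lebesgue ?S"
    unfolding eq \<kappa>_def[symmetric] using \<kappa> by simp
qed

text \<open>An upper counterpart of Bernoulli's inequality, linear in p as long as p stays below
  P.\<close>

lemma power_growth:
  fixes p P :: real
  assumes "0 \<le> p" "p \<le> P" shows "(1 + p) ^ k \<le> 1 + p * (2 + P) ^ k"
proof (induction k)
  case (Suc k)
  let ?A = "(2 + P) ^ k"
  have A: "1 \<le> ?A" using assms by (intro one_le_power) auto
  have "(1 + p) ^ Suc k \<le> (1 + p) * (1 + p * ?A)" using Suc assms by simp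
  also have "\<dots> = 1 + p * (1 + ?A + p * ?A)" by (simp add: algebra_simps)
  also have "\<dots> \<le> 1 + p * (?A + ?A + P * ?A)"
    using A assms by (intro add_left_mono mult_left_mono add_mono mult_right_mono) auto
  also have "\<dots> = 1 + p * (2 + P) ^ Suc k" by (simp add: algebra_simps)
  finally show ?case .
qed (use assms in auto)

definition layer :: "'n::finite vertex_tuple \<Rightarrow> real \<Rightarrow> (real^'n) set" where
  "layer v s = inset v (- s) - inset v (2 * s)"

definition layer_const :: "real \<Rightarrow> 'n::finite itself \<Rightarrow> real" where
  "layer_const s0 _ = (real CARD('n) + 1) * (2 * (2 + (real CARD('n) + 1) * s0) ^ CARD('n) + 2 * real CARD('n))"

text \<open>The volumes of the outer and inner homothets are compared, with
  \<open>power_growth\<close> from above and Bernoulli from below. When 2 (d + 1) s \<ge> 1 the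
  inner homothet may degenerate, but then s is bounded below and the outer volume alone is at most a
  multiple of s.\<close>

lemma layer_measure:
  fixes v :: "'n::finite vertex_tuple"
  assumes ai: "aff_indep_tuple v" and s: "0 < s" "s \<le> s0"
  shows "layer v s \<in> lmeasurable"
    "measure lebesgue (layer v s) \<le> layer_const s0 TYPE('n) * s * measure lebesgue (convex hull (range (($) v)))"
proof -
  let ?p = "(real CARD('n) + 1) * s" and ?P = "(real CARD('n) + 1) * s0" and ?V = "measure lebesgue (convex hull (range (($) v)))"
  let ?A = "(2 + ?P) ^ CARD('n)"
  have p: "0 < ?p" "?p \<le> ?P" using s by (auto intro: mult_left_mono)
  have lc: "?p * (2 * ?A + 2 * real CARD('n)) = layer_const s0 TYPE('n) * s" by (simp add: layer_const_def)
  have A: "1 \<le> ?A" by (rule one_le_power) (use p in linarith)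
  have o: "inset v (- s) \<in> lmeasurable" "measure lebesgue (inset v (- s)) = (1 + ?p) ^ CARD('n) * ?V"
    using inset_scale[OF ai, of "- s"] p by (auto simp: algebra_simps)
  show "layer v s \<in> lmeasurable"
    unfolding layer_def by (rule fmeasurable_Diff[OF o(1)]) (simp add: closed_inset borel_closed lebesgue_closedin)
  have "measure lebesgue (layer v s) \<le> ((1 + ?p) ^ CARD('n) - (1 - 2 * real CARD('n) * ?p)) * ?V \<or> 1 \<le> 2 * ?p"
  proof (cases "1 \<le> 2 * ?p")
    case False
    then have k: "0 < 1 - (real CARD('n) + 1) * (2 * s)" by (simp add: mult.assoc mult.left_commute)
    note i = inset_scale[OF ai k]
    have "inset v (2 * s) \<subseteq> inset v (- s)"
      unfolding inset_def using s(1) by (auto intro: order.trans[of "- s" "2 * s"])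
    then have "measure lebesgue (layer v s) = (1 + ?p) ^ CARD('n) * ?V - (1 - 2 * ?p) ^ CARD('n) * ?V"
      unfolding layer_def using measurable_measure_Diff[OF o(1) fmeasurableD[OF i(1)]] o(2) i(2)
      by (simp add: mult.left_commute)
    also have "\<dots> \<le> (1 + ?p) ^ CARD('n) * ?V - (1 - 2 * real CARD('n) * ?p) * ?V"
    proof -
      have "1 + real CARD('n) * (- (2 * ?p)) \<le> (1 + (- (2 * ?p))) ^ CARD('n)"
        using False by (intro Bernoulli_inequality) simp
      then have "1 - 2 * real CARD('n) * ?p \<le> (1 - 2 * ?p) ^ CARD('n)" by (simp add: mult.assoc mult.left_commute)
      then show ?thesis by (intro diff_left_mono mult_right_mono) auto
    qed
    finally show ?thesis by (simp add: left_diff_distrib)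
  qed simp
  then show "measure lebesgue (layer v s) \<le> layer_const s0 TYPE('n) * s * ?V"
  proof
    assume *: "measure lebesgue (layer v s) \<le> ((1 + ?p) ^ CARD('n) - (1 - 2 * real CARD('n) * ?p)) * ?V"
    have "(1 + ?p) ^ CARD('n) - (1 - 2 * real CARD('n) * ?p) \<le> ?p * ?A + 2 * real CARD('n) * ?p"
      using power_growth[OF less_imp_le[OF p(1)] p(2), of "CARD('n)"] by linarith
    also have "\<dots> \<le> ?p * (2 * ?A + 2 * real CARD('n))"
    proof -
      have "0 \<le> ?p * ?A" using p A by simp
      then show ?thesis by (simp add: algebra_simps)
    qed
    also have "\<dots> = layer_const s0 TYPE('n) * s" by (rule lc)
    finally show ?thesis using * by (meson mult_right_mono measure_nonneg order.trans)
  next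
    assume p2: "1 \<le> 2 * ?p"
    have "measure lebesgue (layer v s) \<le> measure lebesgue (inset v (- s))"
      unfolding layer_def using o(1)
      by (intro measure_mono_fmeasurable) (auto simp: closed_inset borel_closed fmeasurableD)
    also have "\<dots> \<le> ?A * ?V" unfolding o(2)
    proof (intro mult_right_mono power_mono)
      show "1 + ?p \<le> 2 + ?P" "0 \<le> 1 + ?p" using p by linarith+
    qed simp
    also have "\<dots> \<le> (2 * ?p * ?A) * ?V" using p2 A by (intro mult_right_mono) auto
    also have "\<dots> \<le> layer_const s0 TYPE('n) * s * ?V"
    proof (rule mult_right_mono)
      have "0 \<le> ?p * (2 * real CARD('n))" using p by simp
      then have "2 * ?p * ?A \<le> ?p * (2 * ?A + 2 * real CARD('n))" by (simp add: algebra_simps)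
      then show "2 * ?p * ?A \<le> layer_const s0 TYPE('n) * s" by (simp only: lc)
    qed simp
    finally show ?thesis .
  qed
qed

text \<open>Proximity to a point of the simplex keeps every coordinate of y above -\<rho> / h,
  proximity to a point outside pushes one of them below \<rho> / h. The layer reaches inward to
  twice that value, which leaves room to spare.\<close>

lemma mem_layer:
  fixes v :: "'n::finite vertex_tuple"
  assumes ai: "aff_indep_tuple v" and \<rho>: "0 < \<rho>"
    and x: "x \<in> convex hull (range (($) v))" "norm (x - y) \<le> \<rho>"
    and z: "z \<notin> convex hull (range (($) v))" "norm (z - y) \<le> \<rho>"
  shows "y \<in> layer v (\<rho> / height (osimplex_of v))"
proof -
  let ?h = "height (osimplex_of v)"
  have h: "0 < ?h" by (rule height_pos[OF ai])
  have L: "\<bar>bary v w $ i - bary v y $ i\<bar> \<le> \<rho> / ?h" if "norm (w - y) \<le> \<rho>" for w i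
    using bary_Lipschitz[OF ai, of w i y] divide_right_mono[OF that less_imp_le[OF h]] by linarith
  have "- (\<rho> / ?h) \<le> bary v y $ i" for i
    using L[OF x(2), of i] x(1) mem_simplex_iff[OF ai, of x] by (smt (verit))
  moreover obtain i where "bary v z $ i < 0" using z(1) mem_simplex_iff[OF ai, of z] by (auto simp: not_le)
  then have "bary v y $ i < \<rho> / ?h" using L[OF z(2), of i] by linarith
  moreover have "0 < \<rho> / ?h" using \<rho> h by simp
  ultimately show ?thesis unfolding layer_def inset_def by (auto simp: not_le intro!: exI[of _ i])
qed

subsection \<open>Approximate indicator functions\<close>

definition meets :: "real \<Rightarrow> (real^'n::finite) set \<Rightarrow> ('n \<Rightarrow> int) set" where
  "meets r S = {z. cell r 0 z \<inter> S \<noteq> {}}"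

definition cell_frac :: "real \<Rightarrow> (real^'n::finite) set \<Rightarrow> ('n \<Rightarrow> int) \<Rightarrow> real" where
  "cell_frac r S z = measure lebesgue (S \<inter> cell r 0 z) / r ^ CARD('n)"

text \<open>The weights are cell averages of the indicator function. Spreading them by the hats is
  adjoint to replacing a distribution by its cellwise density; see
  \<open>mass_of_soft\<close>.\<close>

definition soft :: "real \<Rightarrow> (real^'n::finite) set \<Rightarrow> real^'n \<Rightarrow> real" where
  "soft r S = hat_sum r (meets r S) (cell_frac r S)"

lemma finite_meets: "0 < r \<Longrightarrow> bounded S \<Longrightarrow> finite (meets r S)"
  unfolding meets_def by (rule finite_cells)

lemma cell_frac_bounds:
  fixes S :: "(real^'n::finite) set"
  assumes r: "0 < r" and S: "S \<in> sets borel"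
  shows "0 \<le> cell_frac r S z" "cell_frac r S z \<le> 1"
proof -
  have "measure lebesgue (S \<inter> cell r 0 z) \<le> measure lebesgue (cell r 0 z)"
  proof (intro measure_mono_fmeasurable cell_lmeasurable r)
    have "S \<inter> cell r 0 z \<in> sets borel" by (intro sets.Int S cell_sets_borel r)
    then show "S \<inter> cell r 0 z \<in> sets lebesgue" by simp
  qed auto
  then have "measure lebesgue (S \<inter> cell r 0 z) \<le> r ^ CARD('n)" by (simp add: cell_measure[OF r])
  then show "0 \<le> cell_frac r S z" "cell_frac r S z \<le> 1" using r by (auto simp: cell_frac_def)
qed

lemma soft_test_function: "0 < r \<Longrightarrow> bounded S \<Longrightarrow> soft r S \<in> test_functions"
  unfolding soft_def by (intro hat_sum_test_function finite_meets)

lemma soft_bounds: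
  fixes S :: "(real^'n::finite) set"
  assumes r: "0 < r" and S: "S \<in> sets borel" "bounded S"
  shows "\<bar>soft r S x\<bar> \<le> overlap TYPE('n)"
    "\<bar>partial_deriv j (soft r S) x\<bar> \<le> overlap TYPE('n) * (hat_constant TYPE('n) / r)"
proof -
  have c: "\<bar>cell_frac r S z\<bar> \<le> 1" for z using cell_frac_bounds[OF r S(1), of z] by simp
  show "\<bar>soft r S x\<bar> \<le> overlap TYPE('n)"
    using hat_sum_bounds(1)[OF r finite_meets[OF r S(2)] c] by (simp add: soft_def)
  show "\<bar>partial_deriv j (soft r S) x\<bar> \<le> overlap TYPE('n) * (hat_constant TYPE('n) / r)"
    using hat_sum_bounds(2)[OF r finite_meets[OF r S(2)] c] by (simp add: soft_def)
qed

lemma soft_eq_1: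
  fixes S :: "(real^'n::finite) set"
  assumes r: "0 < r" and S: "bounded S" and x: "cball x (2 * real CARD('n) * r) \<subseteq> S"
  shows "soft r S x = 1"
proof -
  have sub: "cell r 0 z \<subseteq> S" if "hat r z x \<noteq> 0" for z
    using hat_cell_dist[OF r that] x by (auto simp: dist_norm)
  have "cell_frac r S z * hat r z x = hat r z x" for z
  proof (cases "hat r z x = 0")
    case False
    then have "S \<inter> cell r 0 z = cell r 0 z" using sub by blast
    then have "cell_frac r S z = 1" using r by (simp add: cell_frac_def cell_measure[OF r])
    then show ?thesis by simp
  qed simp
  then have "soft r S x = (\<Sum>z\<in>meets r S. hat r z x)" unfolding soft_def hat_sum_def by (intro sum.cong refl)
  also have "\<dots> = 1"
  proof (rule sum_hat[OF finite_meets[OF r S]])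
    fix z assume "hat r z x \<noteq> 0"
    then show "z \<in> meets r S" using sub corner_in_cell[OF r, of 0 z] unfolding meets_def by blast
  qed
  finally show ?thesis .
qed

lemma soft_eq_0:
  fixes S :: "(real^'n::finite) set"
  assumes r: "0 < r" and x: "cball x (2 * real CARD('n) * r) \<inter> S = {}"
  shows "soft r S x = 0"
  unfolding soft_def hat_sum_def
proof (intro sum.neutral ballI)
  fix z assume "z \<in> meets r S"
  then obtain y where y: "y \<in> cell r 0 z" "y \<in> S" by (auto simp: meets_def)
  have "hat r z x = 0"
  proof (rule ccontr)
    assume "hat r z x \<noteq> 0"
    from hat_cell_dist[OF r this y(1)] have "y \<in> cball x (2 * real CARD('n) * r)" by (simp add: dist_norm)
    then show False using x y(2) by blast
  qed
  then show "cell_frac r S z * hat r z x = 0" by simp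
qed

text \<open>Where the ball of radius 2 d r lies inside the set, all active hats have weight 1; where
  it misses the set, all have weight 0. Elsewhere the ball contains points of both kinds.\<close>

lemma soft_intermediate:
  fixes S :: "(real^'n::finite) set"
  assumes r: "0 < r" and S: "bounded S" and x: "soft r S x \<noteq> indicat_real S x"
  obtains p q where "p \<in> S" "q \<notin> S" "norm (p - x) \<le> 2 * real CARD('n) * r" "norm (q - x) \<le> 2 * real CARD('n) * r"
proof -
  let ?R = "2 * real CARD('n) * r"
  have xx: "x \<in> cball x ?R" using r by simp
  have "\<not> cball x ?R \<subseteq> S"
  proof
    assume *: "cball x ?R \<subseteq> S"
    then have "x \<in> S" using xx by blast
    then show False using soft_eq_1[OF r S *] x by simp
  qed
  moreover have "cball x ?R \<inter> S \<noteq> {}"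
  proof
    assume *: "cball x ?R \<inter> S = {}"
    then have "x \<notin> S" using xx by blast
    then show False using soft_eq_0[OF r *] x by simp
  qed
  ultimately obtain p q where "p \<in> cball x ?R" "p \<in> S" "q \<in> cball x ?R" "q \<notin> S" by blast
  then show ?thesis by (intro that[of p q]) (auto simp: dist_norm norm_minus_commute)
qed

text \<open>Dyadic scales starting at 1 / (2 d), the largest r with 2 d r \<le> 1, as the estimates
  for test functions at scale r demand.\<close>

definition scale_seq :: "'n::finite itself \<Rightarrow> nat \<Rightarrow> real" where
  "scale_seq _ k = 1 / (2 * real CARD('n)) / 2 ^ k"

lemma scale_seq:
  "0 < scale_seq TYPE('n::finite) k" "2 * real CARD('n) * scale_seq TYPE('n) k \<le> 1"
  "scale_seq TYPE('n) (Suc k) = scale_seq TYPE('n) k / 2"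
  "scale_seq TYPE('n) \<longlonglongrightarrow> 0"
proof -
  have d: "(0::real) < 2 * real CARD('n)" by simp
  show "0 < scale_seq TYPE('n) k" "scale_seq TYPE('n) (Suc k) = scale_seq TYPE('n) k / 2" by (simp_all add: scale_seq_def)
  have "2 * real CARD('n) * scale_seq TYPE('n) k = 1 / 2 ^ k" by (simp add: scale_seq_def)
  then show "2 * real CARD('n) * scale_seq TYPE('n) k \<le> 1" by (simp add: divide_le_eq)
  show "scale_seq TYPE('n) \<longlonglongrightarrow> 0"
    unfolding scale_seq_def[abs_def] by (rule LIMSEQ_divide_realpow_zero) simp
qed

lemma scale_seq_add: "scale_seq TYPE('n::finite) (m + k) = scale_seq TYPE('n) m / 2 ^ k"
  by (simp add: scale_seq_def power_add)

text \<open>In contrast to \<open>telescoping_limit\<close>, convergence is a conclusion here: the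
  limit is what defines the new charge.\<close>

lemma telescoping_bound:
  fixes a :: "nat \<Rightarrow> real"
  assumes q: "0 \<le> q" "q < 1" and c: "\<And>k. \<bar>a k - a (Suc k)\<bar> \<le> c * q ^ k"
  shows "convergent a" "\<bar>a k - a 0\<bar> \<le> c / (1 - q)"
proof -
  have c0: "0 \<le> c" using c[of 0] by simp
  have "\<bar>a k - a 0\<bar> \<le> (\<Sum>i<k. c * q ^ i)"
  proof (induction k)
    case (Suc k)
    then show ?case using c[of k] by simp
  qed simp
  also have "\<dots> = c * ((1 - q ^ k) / (1 - q))" using q by (simp add: sum_distrib_left[symmetric] sum_gp_strict)
  also have "\<dots> \<le> c * (1 / (1 - q))" using q c0 by (intro mult_left_mono divide_right_mono) auto
  finally show "\<bar>a k - a 0\<bar> \<le> c / (1 - q)" by simp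
  have "summable (\<lambda>k. c * q ^ k)" using q by (intro summable_mult summable_geometric) auto
  then have "summable (\<lambda>k. a (Suc k) - a k)"
    by (rule summable_comparison_test'[of _ 0]) (use c in \<open>simp add: abs_minus_commute\<close>)
  then have "(\<lambda>n. \<Sum>i<n. a (Suc i) - a i) \<longlonglongrightarrow> (\<Sum>k. a (Suc k) - a k)" by (rule summable_LIMSEQ)
  then have "(\<lambda>n. a n - a 0) \<longlonglongrightarrow> (\<Sum>k. a (Suc k) - a k)" by (simp add: sum_lessThan_telescope)
  then have "(\<lambda>n. a n - a 0 + a 0) \<longlonglongrightarrow> (\<Sum>k. a (Suc k) - a k) + a 0" by (intro tendsto_intros)
  then show "convergent a" by (auto simp: convergent_def)
qed

section \<open>From a distribution to a charge\<close>

subsection \<open>Piecewise constant approximation of a distribution\<close>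

lemma AE_negligible: "negligible N \<Longrightarrow> AE x in lborel. x \<notin> N"
  using AE_not_in[of N lebesgue] by (simp add: negligible_iff_null_sets AE_completion_iff)

text \<open>Measurability in the vertices of an integral over their hull requires the indicator
  function to be jointly measurable. The graph is the projection of a closed set along the compact
  simplex of weights, hence closed.\<close>

lemma closed_hull_graph: "closed {(v :: 'n::finite vertex_tuple, x). x \<in> convex hull (range (($) v))}"
proof -
  let ?K = "{u::real^('n option). (\<forall>i. 0 \<le> u $ i) \<and> (\<Sum>i\<in>UNIV. u $ i) = 1}"
  let ?T = "{(u::real^('n option), w :: 'n vertex_tuple \<times> (real^'n)). snd w = (\<Sum>i\<in>UNIV. u $ i *\<^sub>R fst w $ i)}"
  have "?K = (\<Inter>i. {u. 0 \<le> u $ i}) \<inter> {u. (\<Sum>i\<in>UNIV. u $ i) = 1}" by auto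
  moreover have "closed \<dots>"
    by (intro closed_Int closed_INT ballI closed_Collect_le closed_Collect_eq continuous_intros)
  moreover have "?K \<subseteq> cball 0 1"
  proof
    fix u assume u: "u \<in> ?K"
    have "norm u \<le> (\<Sum>i\<in>UNIV. \<bar>u $ i\<bar>)" by (rule norm_le_l1_cart)
    then show "u \<in> cball 0 1" using u by simp
  qed
  then have "bounded ?K" using bounded_cball bounded_subset by blast
  ultimately have K: "compact ?K" by (simp add: compact_eq_bounded_closed)
  have "closed ?T"
    unfolding case_prod_beta by (intro closed_Collect_eq continuous_intros)
  from closed_compact_projection[OF K this]
  have "closed {y. \<exists>x. x \<in> ?K \<and> (x, y) \<in> ?T}" .
  also have "{y. \<exists>x. x \<in> ?K \<and> (x, y) \<in> ?T} = {(v, x). x \<in> convex hull (range (($) v))}"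
  proof (intro equalityI subsetI)
    fix y assume "y \<in> {y. \<exists>x. x \<in> ?K \<and> (x, y) \<in> ?T}"
    then obtain u where "u \<in> ?K" "(u, y) \<in> ?T" by blast
    then show "y \<in> {(v, x). x \<in> convex hull (range (($) v))}"
      unfolding convex_hull_range by (auto intro!: exI[of _ "\<lambda>i. u $ i"])
  next
    fix y assume "y \<in> {(v :: 'n vertex_tuple, x). x \<in> convex hull (range (($) v))}"
    then obtain u where "snd y = (\<Sum>i\<in>UNIV. u i *\<^sub>R fst y $ i)" "\<forall>i. 0 \<le> u i" "sum u UNIV = 1"
      unfolding convex_hull_range by (auto simp: case_prod_beta)
    then have "(\<chi> i. u i) \<in> ?K \<and> ((\<chi> i. u i), y) \<in> ?T" by simp
    then show "y \<in> {y. \<exists>x. x \<in> ?K \<and> (x, y) \<in> ?T}" by blast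
  qed
  finally show ?thesis .
qed

lemma full_simplex_borel: "S \<in> full_simplices \<Longrightarrow> S \<in> sets borel"
  by (simp add: full_simplex_closed borel_closed)

locale holder_distribution =
  fixes F :: "(real^'n::finite \<Rightarrow> real) \<Rightarrow> real" and \<alpha> :: real
  assumes F: "F \<in> holder_space (\<alpha> - 1)" and \<alpha>: "0 < \<alpha>" "\<alpha> < 1"
begin

lemma FD: "F \<in> distributions" using F by (simp add: holder_space_def)

definition dens :: "real \<Rightarrow> real^'n \<Rightarrow> real" where
  "dens r x = F (hat r (index r 0 x)) / r ^ CARD('n)"

definition dens_bd :: "real \<Rightarrow> real" where
  "dens_bd r = test_const TYPE('n) * r powr (\<alpha> - 1) * hnorm \<alpha> F"

lemma dens_bound: "0 < r \<Longrightarrow> 2 * real CARD('n) * r \<le> 1 \<Longrightarrow> \<bar>dens r x\<bar> \<le> dens_bd r"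
  using holder_test_hat[OF F \<alpha>(2), of r "index r 0 x"] by (simp add: dens_def dens_bd_def abs_divide divide_le_eq ac_simps)

lemma dens_measurable:
  assumes r: "0 < r" shows "dens r \<in> borel_measurable borel"
proof -
  have "index r 0 \<in> measurable borel (count_space (UNIV :: ('n \<Rightarrow> int) set))"
  proof -
    have "countable (UNIV :: ('n \<Rightarrow> int) set)" by simp
    moreover have "index r 0 -` {z} \<inter> space borel \<in> sets borel" for z :: "'n \<Rightarrow> int"
    proof -
      have "index r 0 -` {z} = cell r 0 z" by (auto simp: mem_cell_index)
      then show ?thesis by (simp add: cell_sets_borel[OF r])
    qed
    ultimately show ?thesis by (simp add: measurable_count_space_eq2_countable)
  qed
  from measurable_compose[OF this, of "\<lambda>z. F (hat r z) / r ^ CARD('n)" borel]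
  show ?thesis by (simp add: dens_def[abs_def])
qed

definition mass_of :: "real \<Rightarrow> (real^'n) set \<Rightarrow> real" where
  "mass_of r S = (LINT x|lborel. indicat_real S x * dens r x)"

lemma mass_of:
  assumes r: "0 < r" "2 * real CARD('n) * r \<le> 1" and S: "S \<in> sets borel" "bounded S"
  shows "integrable lborel (\<lambda>x. indicat_real S x * dens r x)" "\<bar>mass_of r S\<bar> \<le> dens_bd r * measure lebesgue S"
proof -
  have m: "(\<lambda>x. indicat_real S x * dens r x) \<in> borel_measurable borel" using dens_measurable[OF r(1)] S by simp
  have b: "\<bar>indicat_real S x * dens r x\<bar> \<le> dens_bd r" if "x \<in> S" for x using dens_bound[OF r] that by simp
  show "integrable lborel (\<lambda>x. indicat_real S x * dens r x)"
    by (rule integrable_supported(1)[OF m S(1) emeasure_bounded_finite[OF S(2)] b]) (simp_all add: indicator_def)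
  show "\<bar>mass_of r S\<bar> \<le> dens_bd r * measure lebesgue S"
    unfolding mass_of_def using integrable_supported(2)[OF m S(1) emeasure_bounded_finite[OF S(2)] b] S by simp
qed

lemma sum_cells_eq:
  assumes "finite Z" "\<And>z. x \<in> cell r 0 z \<Longrightarrow> G x \<noteq> 0 \<Longrightarrow> z \<in> Z"
  shows "dens r x * G x = (\<Sum>z\<in>Z. (F (hat r z) / r ^ CARD('n)) * (indicat_real (cell r 0 z) x * G x))"
proof (cases "G x = 0")
  case False
  let ?z = "index r 0 x"
  have z: "?z \<in> Z" using assms(2)[of ?z] False by (simp add: mem_cell_index)
  have "(\<Sum>z\<in>Z. (F (hat r z) / r ^ CARD('n)) * (indicat_real (cell r 0 z) x * G x))
     = (\<Sum>z\<in>{?z}. (F (hat r z) / r ^ CARD('n)) * (indicat_real (cell r 0 z) x * G x))"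
    using assms(1) z by (intro sum.mono_neutral_right) (auto simp: mem_cell_index indicator_def)
  also have "\<dots> = dens r x * G x" by (simp add: dens_def mem_cell_index)
  finally show ?thesis by simp
qed simp

text \<open>Where G does not vanish, the density is a finite sum over cells, so the integral is a
  finite combination of values of F on hats, from which linearity pulls F out. It is applied both to
  indicator functions and to test functions.\<close>

lemma integral_dens:
  assumes r: "0 < r" and Z: "finite Z" "\<And>x z. x \<in> cell r 0 z \<Longrightarrow> G x \<noteq> 0 \<Longrightarrow> z \<in> Z" and G: "integrable lborel G"
  shows "(LINT x|lborel. dens r x * G x) = F (hat_sum r Z (\<lambda>z. (LINT x|lborel. indicat_real (cell r 0 z) x * G x) / r ^ CARD('n)))"
proof -
  have i: "integrable lborel (\<lambda>x. indicat_real (cell r 0 z) x * G x)" for z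
  proof -
    have "cell r 0 z \<in> sets lborel" by (simp add: cell_sets_borel[OF r])
    from integrable_real_mult_indicator[OF this G] show ?thesis by (simp add: mult.commute)
  qed
  have "(LINT x|lborel. dens r x * G x) = (LINT x|lborel. (\<Sum>z\<in>Z. (F (hat r z) / r ^ CARD('n)) * (indicat_real (cell r 0 z) x * G x)))"
    by (intro Bochner_Integration.integral_cong refl sum_cells_eq Z(1)) (rule Z(2))
  also have "\<dots> = (\<Sum>z\<in>Z. (F (hat r z) / r ^ CARD('n)) * (LINT x|lborel. indicat_real (cell r 0 z) x * G x))"
    by (subst Bochner_Integration.integral_sum) (auto intro!: integrable_mult_right i)
  also have "\<dots> = (\<Sum>z\<in>Z. ((LINT x|lborel. indicat_real (cell r 0 z) x * G x) / r ^ CARD('n)) * F (hat r z))"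
    by (intro sum.cong) auto
  also have "\<dots> = F (hat_sum r Z (\<lambda>z. (LINT x|lborel. indicat_real (cell r 0 z) x * G x) / r ^ CARD('n)))"
    unfolding hat_sum_def[abs_def] by (rule distribution_sum[OF FD Z(1) hat_test_function[OF r], symmetric])
  finally show ?thesis .
qed

lemma mass_of_soft:
  assumes r: "0 < r" and S: "S \<in> sets borel" "bounded S"
  shows "mass_of r S = F (soft r S)"
proof -
  have "integrable lborel (indicat_real S)"
    using S emeasure_bounded_finite[OF S(2)] by (intro integrable_real_indicator) auto
  from integral_dens[OF r finite_meets[OF r S(2)] _ this]
  have "(LINT x|lborel. dens r x * indicat_real S x) = F (hat_sum r (meets r S) (\<lambda>z. (LINT x|lborel. indicat_real (cell r 0 z) x * indicat_real S x) / r ^ CARD('n)))"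
    by (auto simp: meets_def indicator_def)
  moreover have "(LINT x|lborel. indicat_real (cell r 0 z) x * indicat_real S x) / r ^ CARD('n) = cell_frac r S z" for z
  proof -
    have "(LINT x|lborel. indicat_real (cell r 0 z) x * indicat_real S x) = (LINT x|lborel. indicat_real (S \<inter> cell r 0 z) x)"
      by (intro Bochner_Integration.integral_cong) (auto simp: indicator_def)
    also have "\<dots> = measure lebesgue (S \<inter> cell r 0 z)"
    proof -
      have "S \<inter> cell r 0 z \<in> sets borel" by (intro sets.Int S cell_sets_borel r)
      then show ?thesis by simp
    qed
    finally show ?thesis by (simp add: cell_frac_def)
  qed
  ultimately show ?thesis by (simp add: mass_of_def soft_def mult.commute)
qed

lemma mass_of_tiles:
  assumes r: "0 < r" "2 * real CARD('n) * r \<le> 1" and t: "tiles \<T> P" and P: "P \<in> sets borel" "bounded P"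
  shows "mass_of r P = sum (mass_of r) \<T>"
proof -
  let ?N = "(\<Union>\<T> - P) \<union> (P - \<Union>\<T>) \<union> (\<Union>(S, T)\<in>{(S, T). S \<in> \<T> \<and> T \<in> \<T> \<and> S \<noteq> T}. S \<inter> T)"
  have fin: "finite \<T>" by (rule tiles_finite[OF t])
  have "finite {(S, T). S \<in> \<T> \<and> T \<in> \<T> \<and> S \<noteq> T}" by (rule finite_subset[of _ "\<T> \<times> \<T>"]) (use fin in auto)
  then have "negligible ?N"
    using tiles_negligible[OF t] tiles_disjoint[OF t] by (intro negligible_Un negligible_Union) auto
  then have AE: "AE x in lborel. x \<notin> ?N" by (rule AE_negligible)
  have T: "T \<in> sets borel" "bounded T" if "T \<in> \<T>" for T
    using full_simplex_borel full_simplex_bounded tiles_full[OF t that] by auto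
  have i: "integrable lborel (\<lambda>x. indicat_real T x * dens r x)" if "T \<in> \<T>" for T by (rule mass_of(1)[OF r T[OF that]])
  have "mass_of r P = (LINT x|lborel. (\<Sum>T\<in>\<T>. indicat_real T x * dens r x))"
    unfolding mass_of_def
  proof (rule integral_cong_AE)
    show "(\<lambda>x. indicat_real P x * dens r x) \<in> borel_measurable lborel" using dens_measurable[OF r(1)] P by simp
    show "(\<lambda>x. \<Sum>T\<in>\<T>. indicat_real T x * dens r x) \<in> borel_measurable lborel"
      using dens_measurable[OF r(1)] T by (intro borel_measurable_sum borel_measurable_times) auto
    show "AE x in lborel. indicat_real P x * dens r x = (\<Sum>T\<in>\<T>. indicat_real T x * dens r x)"
      using AE
    proof eventually_elim
      fix x assume x: "x \<notin> ?N"
      have "indicat_real P x = (\<Sum>T\<in>\<T>. indicat_real T x)"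
      proof (cases "x \<in> P")
        case True
        then obtain T where T: "T \<in> \<T>" "x \<in> T" using x by blast
        have "x \<notin> T'" if "T' \<in> \<T>" "T' \<noteq> T" for T' using x T that by blast
        then have "(\<Sum>T'\<in>\<T>. indicat_real T' x) = (\<Sum>T'\<in>{T}. indicat_real T' x)"
          using fin T by (intro sum.mono_neutral_right) auto
        then show ?thesis using T True by simp
      next
        case False
        then have "\<forall>T\<in>\<T>. x \<notin> T" using x by blast
        then show ?thesis using False by simp
      qed
      then show "indicat_real P x * dens r x = (\<Sum>T\<in>\<T>. indicat_real T x * dens r x)" by (simp add: sum_distrib_right)
    qed
  qed
  also have "\<dots> = sum (mass_of r) \<T>" unfolding mass_of_def by (rule Bochner_Integration.integral_sum) (rule i)
  finally show ?thesis .
qed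

lemma mass_of_additive:
  assumes r: "0 < r" "2 * real CARD('n) * r \<le> 1" shows "simplex_additive (mass_of r)"
  unfolding simplex_additive_def
  using mass_of_tiles[OF r] full_simplex_borel full_simplex_bounded by blast

lemma mass_of_measurable:
  assumes r: "0 < r" shows "measurable_charge (mass_of r)"
proof -
  have d: "dens r \<in> borel_measurable borel" by (rule dens_measurable[OF r])
  let ?H = "{(v :: 'n vertex_tuple, x). x \<in> convex hull (range (($) v))}"
  have "?H \<in> sets (borel \<Otimes>\<^sub>M borel)" unfolding borel_prod by (rule borel_closed[OF closed_hull_graph])
  moreover have "(\<lambda>p :: 'n vertex_tuple \<times> (real^'n). dens r (snd p)) \<in> borel_measurable (borel \<Otimes>\<^sub>M borel)"
    by (rule measurable_compose[OF measurable_snd d])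
  ultimately have "(\<lambda>p. indicat_real ?H p * dens r (snd p)) \<in> borel_measurable (borel \<Otimes>\<^sub>M borel)"
    by (intro borel_measurable_times borel_measurable_indicator)
  moreover have "sets (borel \<Otimes>\<^sub>M borel) = sets (borel \<Otimes>\<^sub>M (lborel :: (real^'n) measure))" by (intro sets_pair_measure_cong) auto
  ultimately have "(\<lambda>p. indicat_real ?H p * dens r (snd p)) \<in> borel_measurable (borel \<Otimes>\<^sub>M (lborel :: (real^'n) measure))"
    using measurable_cong_sets by blast
  then have "(\<lambda>(v :: 'n vertex_tuple, x). indicat_real (convex hull (range (($) v))) x * dens r x) \<in> borel_measurable (borel \<Otimes>\<^sub>M (lborel :: (real^'n) measure))"
    by (simp add: case_prod_beta' indicator_def)
  from lborel.borel_measurable_lebesgue_integral[OF this]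
  have "(\<lambda>v :: 'n vertex_tuple. mass_of r (convex hull (range (($) v)))) \<in> borel_measurable borel" by (simp add: mass_of_def)
  then show ?thesis unfolding measurable_charge_def by (rule measurable_restrict_space1)
qed

text \<open>The factor 2 O H, with O the overlap and H the hat constant, bounds the difference of
  two smoothed indicators and, per r / 2, its derivatives. The next 2 comes from (r / 2)^(\<alpha> -
  1) \<le> 2 r^(\<alpha> - 1), and the rest is the volume of a layer of relative width 3 d r /
  h.\<close>

definition step_const :: real where
  "step_const = test_const TYPE('n) * (2 * overlap TYPE('n) * hat_constant TYPE('n)) * 2
     * (layer_const (3 * real CARD('n)) TYPE('n) * (3 * real CARD('n)))"

lemma layer_const_nonneg: "0 \<le> s0 \<Longrightarrow> 0 \<le> layer_const s0 TYPE('n)"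
  by (simp add: layer_const_def)

lemma step_const_nonneg: "0 \<le> step_const"
  using layer_const_nonneg[of "3 * real CARD('n)"] test_const_nonneg[where 'n='n] hat_constant(1)[where 'n='n] overlap_ge_1[where 'n='n]
  by (simp add: step_const_def)

text \<open>The difference of two smoothed indicators is not small in size; the whole gain lies in
  its support, a boundary layer. The condition r \<le> h keeps the relative width of the layer below
  3 d, where its volume is controlled linearly.\<close>

lemma mass_of_step:
  fixes v :: "'n vertex_tuple"
  assumes ai: "aff_indep_tuple v" and r: "0 < r" "2 * real CARD('n) * r \<le> 1" "r \<le> height (osimplex_of v)"
  defines "S \<equiv> convex hull (range (($) v))" and "h \<equiv> height (osimplex_of v)"
  shows "\<bar>mass_of r S - mass_of (r / 2) S\<bar> \<le> step_const * hnorm \<alpha> F * (measure lebesgue S / h) * r powr \<alpha>"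
proof -
  let ?d = "real CARD('n)" and ?H = "hat_constant TYPE('n)" and ?O = "overlap TYPE('n)" and ?V = "measure lebesgue S"
  have h: "0 < h" unfolding h_def by (rule height_pos[OF ai])
  have H: "1 \<le> ?H" by (rule hat_constant)
  have O: "1 \<le> ?O" by (rule overlap_ge_1)
  have Sf: "S \<in> full_simplices" unfolding S_def by (rule full_simplicesI[OF ai])
  have S: "S \<in> sets borel" "bounded S" using full_simplex_borel[OF Sf] full_simplex_bounded[OF Sf] by auto
  have r2: "0 < r / 2" "2 * ?d * (r / 2) \<le> 1" using r by auto
  define g where "g x = 1 * soft r S x + (-1) * soft (r / 2) S x" for x
  have t: "soft r S \<in> test_functions" "soft (r / 2) S \<in> test_functions"
    by (intro soft_test_function r r2 S)+
  have gt: "g \<in> test_functions" unfolding g_def[abs_def] by (rule test_function_lincomb[OF t])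
  have Fg: "F g = mass_of r S - mass_of (r / 2) S"
    unfolding g_def[abs_def] distribution_lincomb[OF FD t] mass_of_soft[OF r(1) S] mass_of_soft[OF r2(1) S] by simp
  let ?M = "2 * ?O * ?H"
  \<comment> \<open>The coarser smoothing reaches 2 d r, and the neighbourhood of the support
    required for testing at scale r / 2 adds d r.\<close>
  let ?s = "3 * ?d * r / h"
  have s: "0 < ?s" "?s \<le> 3 * ?d"
  proof -
    show "0 < ?s" using r h by simp
    have "3 * ?d * r \<le> 3 * ?d * h" using r(3) by (intro mult_left_mono) (auto simp: h_def)
    then show "?s \<le> 3 * ?d" using h by (simp add: divide_le_eq)
  qed
  note lay = layer_measure[OF ai s, folded S_def]
  have near: "y \<in> layer v ?s" if gx: "g x \<noteq> 0" and xy: "norm (x - y) \<le> 2 * ?d * (r / 2)" for x y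
  proof -
    have "soft r S x \<noteq> indicat_real S x \<or> soft (r / 2) S x \<noteq> indicat_real S x" using gx by (auto simp: g_def)
    then obtain p q where pq: "p \<in> S" "q \<notin> S" "norm (p - x) \<le> 2 * ?d * r" "norm (q - x) \<le> 2 * ?d * r"
    proof
      assume "soft r S x \<noteq> indicat_real S x"
      then show ?thesis using soft_intermediate[OF r(1) S(2), of x thesis] that by blast
    next
      assume "soft (r / 2) S x \<noteq> indicat_real S x"
      then obtain p q where "p \<in> S" "q \<notin> S" "norm (p - x) \<le> 2 * ?d * (r / 2)" "norm (q - x) \<le> 2 * ?d * (r / 2)"
        by (rule soft_intermediate[OF r2(1) S(2)])
      moreover have "2 * ?d * (r / 2) \<le> 2 * ?d * r" using r by simp
      ultimately show ?thesis using that by (meson order.trans)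
    qed
    have "norm (p - y) \<le> norm (p - x) + norm (x - y)" "norm (q - y) \<le> norm (q - x) + norm (x - y)"
      using norm_triangle_ineq[of "p - x" "x - y"] norm_triangle_ineq[of "q - x" "x - y"] by auto
    moreover have "2 * ?d * r + 2 * ?d * (r / 2) = 3 * ?d * r" by simp
    ultimately have n: "norm (p - y) \<le> 3 * ?d * r" "norm (q - y) \<le> 3 * ?d * r" using pq(3,4) xy by linarith+
    have "0 < 3 * ?d * r" using r(1) by simp
    then show ?thesis
      unfolding h_def by (rule mem_layer[OF ai _ pq(1)[unfolded S_def] n(1) pq(2)[unfolded S_def] n(2)])
  qed
  have "\<bar>F g\<bar> \<le> test_const TYPE('n) * ?M * (r / 2) powr (\<alpha> - 1) * hnorm \<alpha> F * measure lebesgue (layer v ?s)"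
  proof (rule holder_test_global[OF F \<alpha>(2) gt r2 _ _ _ lay(1) near])
    show "0 < ?M" using H O by simp
    have "2 * ?O * 1 \<le> 2 * ?O * ?H" using H O by (intro mult_left_mono) auto
    then have M2: "?O + ?O \<le> ?M" by simp
    show "\<bar>g y\<bar> \<le> ?M" for y
    proof -
      have "\<bar>g y\<bar> \<le> \<bar>soft r S y\<bar> + \<bar>soft (r / 2) S y\<bar>" by (simp add: g_def)
      then show ?thesis using soft_bounds(1)[OF r(1) S, of y] soft_bounds(1)[OF r2(1) S, of y] M2 by linarith
    qed
    show "\<bar>partial_deriv j g y\<bar> \<le> ?M / (r / 2)" for j y
    proof -
      have "partial_derivs [j] g y = 1 * partial_derivs [j] (soft r S) y + (-1) * partial_derivs [j] (soft (r / 2) S) y"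
        unfolding g_def[abs_def] partial_derivs_lincomb[OF test_function_smooth[OF t(1)] test_function_smooth[OF t(2)]] ..
      then have "\<bar>partial_deriv j g y\<bar> \<le> \<bar>partial_deriv j (soft r S) y\<bar> + \<bar>partial_deriv j (soft (r / 2) S) y\<bar>" by simp
      also have "\<dots> \<le> ?O * (?H / r) + ?O * (?H / (r / 2))"
        by (intro add_mono soft_bounds(2) r r2 S)
      also have "\<dots> \<le> ?O * (?H / (r / 2)) + ?O * (?H / (r / 2))"
      proof (intro add_mono mult_left_mono order.refl divide_left_mono)
      qed (use r H O in auto)
      also have "\<dots> = ?M / (r / 2)" by simp
      finally show ?thesis .
    qed
  qed auto
  also have "\<dots> \<le> test_const TYPE('n) * ?M * (r powr (\<alpha> - 1) * 2) * hnorm \<alpha> F * (layer_const (3 * ?d) TYPE('n) * ?s * ?V)"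
  proof (intro mult_mono lay(2) mult_nonneg_nonneg hnorm_nonneg test_const_nonneg order.refl)
    have "1 / (2::real) powr (\<alpha> - 1) = 2 powr (1 - \<alpha>)" using powr_minus_divide[of "2::real" "\<alpha> - 1"] by simp
    also have "\<dots> \<le> 2 powr 1" using \<alpha> by (intro powr_mono) auto
    finally have "1 / (2::real) powr (\<alpha> - 1) \<le> 2" by simp
    from mult_left_mono[OF this powr_ge_zero[of r "\<alpha> - 1"]]
    show "(r / 2) powr (\<alpha> - 1) \<le> r powr (\<alpha> - 1) * 2" by (simp add: powr_divide)
  qed (use H O in auto)
  also have "\<dots> = step_const * hnorm \<alpha> F * (?V / h) * (r * r powr (\<alpha> - 1))"
    by (simp add: step_const_def)
  also have "r * r powr (\<alpha> - 1) = r powr \<alpha>" by (subst powr_mult_base) (use r in auto)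
  finally show ?thesis unfolding Fg .
qed

text \<open>The first term accounts for the scales down to the height, where the density is bounded
  without cancellation; 2 d appears because the first scale below h is at least h / (2 d). The
  second is the geometric tail.\<close>

definition total_const :: real where
  "total_const = test_const TYPE('n) * (2 * real CARD('n)) + step_const / (1 - 2 powr (- \<alpha>))"

text \<open>The starting scale lies below the height, so every further halving is covered by
  \<open>mass_of_step\<close>. Bounding its power by h^\<alpha> turns vol S / h into vol S times
  h^(\<alpha> - 1).\<close>

lemma mass_of_tail:
  fixes v :: "'n vertex_tuple"
  assumes ai: "aff_indep_tuple v" and m: "scale_seq TYPE('n) m \<le> height (osimplex_of v)"
  defines "S \<equiv> convex hull (range (($) v))" and "h \<equiv> height (osimplex_of v)"
  shows "convergent (\<lambda>k. mass_of (scale_seq TYPE('n) k) S)"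
    "\<bar>mass_of (scale_seq TYPE('n) (m + k)) S - mass_of (scale_seq TYPE('n) m) S\<bar>
       \<le> step_const * hnorm \<alpha> F * (measure lebesgue S * h powr (\<alpha> - 1)) / (1 - 2 powr (- \<alpha>))"
proof -
  let ?r = "scale_seq TYPE('n)" and ?q = "2 powr (- \<alpha>) :: real"
  let ?a = "\<lambda>k. mass_of (?r (m + k)) S" and ?c = "step_const * hnorm \<alpha> F * (measure lebesgue S / h)"
  have h: "0 < h" unfolding h_def by (rule height_pos[OF ai])
  have c0: "0 \<le> ?c" using step_const_nonneg hnorm_nonneg[of \<alpha> F] h by simp
  have st: "\<bar>?a k - ?a (Suc k)\<bar> \<le> (?c * (?r m) powr \<alpha>) * ?q ^ k" for k
  proof -
    have "?r (m + k) \<le> ?r m" using scale_seq(1)[where 'n='n and k=m] by (simp add: scale_seq_add divide_le_eq mult_le_cancel_left1)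
    then have rh: "?r (m + k) \<le> height (osimplex_of v)" using m by simp
    have "\<bar>?a k - ?a (Suc k)\<bar> \<le> ?c * (?r (m + k)) powr \<alpha>"
      using mass_of_step[OF ai scale_seq(1,2) rh] unfolding S_def h_def by (simp add: scale_seq(3))
    also have "(?r (m + k)) powr \<alpha> = (?r m) powr \<alpha> / (2 ^ k) powr \<alpha>"
      unfolding scale_seq_add by (rule powr_divide)
    also have "((2::real) ^ k) powr \<alpha> = (2 powr \<alpha>) ^ k" by (simp add: powr_powr powr_realpow[symmetric] mult.commute)
    also have "(?r m) powr \<alpha> / (2 powr \<alpha>) ^ k = (?r m) powr \<alpha> * ?q ^ k" by (simp only: powr_minus power_inverse divide_inverse)
    finally show ?thesis by (simp add: mult.assoc)
  qed
  have q: "0 \<le> ?q" "?q < 1" using two_powr_neg[OF \<alpha>(1)] by auto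
  note tb = telescoping_bound[OF q st]
  have "convergent (\<lambda>k. mass_of (?r (k + m)) S)" using tb(1) by (simp add: add.commute)
  then show "convergent (\<lambda>k. mass_of (?r k) S)" by (rule convergent_ignore_initial_segment[THEN iffD1])
  have "\<bar>?a k - ?a 0\<bar> \<le> ?c * (?r m) powr \<alpha> / (1 - ?q)" by (rule tb(2))
  also have "\<dots> \<le> ?c * h powr \<alpha> / (1 - ?q)"
    using m q c0 \<alpha> scale_seq(1)[where 'n='n and k=m] unfolding h_def
    by (intro divide_right_mono mult_left_mono powr_mono2) auto
  also have "?c * h powr \<alpha> = step_const * hnorm \<alpha> F * (measure lebesgue S * h powr (\<alpha> - 1))"
  proof -
    have "h powr \<alpha> = h * h powr (\<alpha> - 1)" by (subst powr_mult_base) (use h in auto)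
    then show ?thesis using h by simp
  qed
  finally show "\<bar>mass_of (?r (m + k)) S - mass_of (?r m) S\<bar> \<le> step_const * hnorm \<alpha> F * (measure lebesgue S * h powr (\<alpha> - 1)) / (1 - ?q)"
    by simp
qed

lemma ex_scale: assumes "0 < h" shows "\<exists>m. scale_seq TYPE('n) m \<le> h"
proof -
  have "\<forall>\<^sub>F m in sequentially. scale_seq TYPE('n) m < h" by (rule order_tendstoD(2)[OF scale_seq(4) assms])
  then show ?thesis by (auto simp: eventually_sequentially intro: less_imp_le)
qed

text \<open>Up to and including the first scale below the height, the crude density bound suffices:
  r \<ge> h / (2 d), and r^(\<alpha> - 1) is decreasing in r. All later scales differ from that one
  by the tail.\<close>

lemma mass_of_uniform:
  fixes v :: "'n vertex_tuple"
  assumes ai: "aff_indep_tuple v" and D: "diameter (convex hull (range (($) v))) \<le> 1"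
  defines "S \<equiv> convex hull (range (($) v))" and "h \<equiv> height (osimplex_of v)"
  shows "\<bar>mass_of (scale_seq TYPE('n) k) S\<bar> \<le> total_const * hnorm \<alpha> F * (measure lebesgue S * h powr (\<alpha> - 1))"
proof -
  let ?r = "scale_seq TYPE('n)" and ?q = "2 powr (- \<alpha>) :: real" and ?d = "real CARD('n)"
  let ?X = "hnorm \<alpha> F * (measure lebesgue S * h powr (\<alpha> - 1))"
  have d1: "1 \<le> ?d" by (simp add: Suc_leI)
  have h: "0 < h" "h \<le> 1" using height_pos[OF ai] height_le_diameter[OF ai] D unfolding h_def by auto
  have X0: "0 \<le> ?X" using hnorm_nonneg[of \<alpha> F] by simp
  have q: "?q < 1" by (rule two_powr_neg[OF \<alpha>(1)])
  define m where "m = (LEAST m. ?r m \<le> h)"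
  have m: "?r m \<le> h" unfolding m_def by (rule LeastI_ex[OF ex_scale[OF h(1)]])
  have anti: "?r l \<le> ?r j" if "j \<le> l" for j l
  proof -
    have "?r l = ?r j / 2 ^ (l - j)" using scale_seq_add[where 'n='n, of j "l - j"] that by simp
    then show ?thesis using scale_seq(1)[where 'n='n and k=j] by (simp add: divide_le_eq mult_le_cancel_left1)
  qed
  \<comment> \<open>If already the initial scale 1 / (2 d) is below h, the bound follows from h
    \<le> 1. Otherwise the preceding scale exceeds h, so this one exceeds h / 2.\<close>
  have m2: "h / (2 * ?d) \<le> ?r m"
  proof (cases m)
    case 0
    then show ?thesis using h d1 by (simp add: scale_seq_def divide_right_mono)
  next
    case (Suc l)
    then have "\<not> ?r l \<le> h" using not_less_Least[of l "\<lambda>m. ?r m \<le> h"] unfolding m_def[symmetric] by simp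
    then have "h / 2 \<le> ?r m" using Suc by (simp add: scale_seq(3))
    moreover have "h / (2 * ?d) \<le> h / 2" using h d1 by (intro divide_left_mono) auto
    ultimately show ?thesis by linarith
  qed
  have Sf: "S \<in> full_simplices" unfolding S_def by (rule full_simplicesI[OF ai])
  have S: "S \<in> sets borel" "bounded S" using full_simplex_borel[OF Sf] full_simplex_bounded[OF Sf] by auto
  have early: "\<bar>mass_of (?r k) S\<bar> \<le> test_const TYPE('n) * (2 * ?d) * ?X" if "k \<le> m" for k
  proof -
    have "h / (2 * ?d) \<le> ?r k" using m2 anti[OF that] by linarith
    then have "(?r k) powr (\<alpha> - 1) \<le> (h / (2 * ?d)) powr (\<alpha> - 1)"
      using h d1 \<alpha> by (intro powr_mono2') auto
    also have "\<dots> = h powr (\<alpha> - 1) / (2 * ?d) powr (\<alpha> - 1)" by (rule powr_divide)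
    also have "\<dots> = h powr (\<alpha> - 1) * (2 * ?d) powr (1 - \<alpha>)"
      by (simp only: powr_minus_divide[of _ "\<alpha> - 1"] minus_diff_eq[of \<alpha> 1, symmetric]) (simp add: divide_inverse)
    also have "\<dots> \<le> h powr (\<alpha> - 1) * (2 * ?d) powr 1"
    proof (intro mult_left_mono powr_mono)
      show "1 \<le> 2 * ?d" using d1 by linarith
    qed (use \<alpha> in auto)
    finally have p: "(?r k) powr (\<alpha> - 1) \<le> h powr (\<alpha> - 1) * (2 * ?d)" using d1 by simp
    have "\<bar>mass_of (?r k) S\<bar> \<le> dens_bd (?r k) * measure lebesgue S" by (rule mass_of(2)[OF scale_seq(1,2) S])
    also have "\<dots> \<le> (test_const TYPE('n) * (h powr (\<alpha> - 1) * (2 * ?d)) * hnorm \<alpha> F) * measure lebesgue S"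
      unfolding dens_bd_def using p by (intro mult_right_mono mult_left_mono hnorm_nonneg test_const_nonneg) auto
    also have "\<dots> = test_const TYPE('n) * (2 * ?d) * ?X" by simp
    finally show ?thesis .
  qed
  have Y0: "0 \<le> step_const / (1 - ?q) * ?X" using X0 q step_const_nonneg by simp
  have eq: "total_const * hnorm \<alpha> F * (measure lebesgue S * h powr (\<alpha> - 1)) = test_const TYPE('n) * (2 * ?d) * ?X + step_const / (1 - ?q) * ?X"
    by (simp add: total_const_def distrib_right mult.assoc)
  show ?thesis
  proof (cases "k \<le> m")
    case True
    then show ?thesis unfolding eq using early[of k] Y0 by linarith
  next
    case False
    then obtain l where l: "k = m + l" by (metis le_iff_add nat_le_linear)
    have "\<bar>mass_of (?r k) S - mass_of (?r m) S\<bar> \<le> step_const / (1 - ?q) * ?X"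
      using mass_of_tail(2)[OF ai m[unfolded h_def], of l] unfolding l S_def h_def by (simp add: mult.assoc)
    then show ?thesis unfolding eq using early[of m] by linarith
  qed
qed

definition limit_charge :: "(real^'n) set \<Rightarrow> real" where
  "limit_charge S = lim (\<lambda>k. mass_of (scale_seq TYPE('n) k) S)"

lemma limit_charge:
  assumes "S \<in> full_simplices" shows "(\<lambda>k. mass_of (scale_seq TYPE('n) k) S) \<longlonglongrightarrow> limit_charge S"
proof -
  obtain v where v: "aff_indep_tuple v" "S = convex hull (range (($) v))" using assms by (auto simp: full_simplices_def)
  obtain m where "scale_seq TYPE('n) m \<le> height (osimplex_of v)" using ex_scale[OF height_pos[OF v(1)]] by blast
  from mass_of_tail(1)[OF v(1) this] show ?thesis unfolding v(2) limit_charge_def by (simp add: convergent_LIMSEQ_iff)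
qed

lemma limit_charge_bound:
  fixes v :: "'n vertex_tuple"
  assumes ai: "aff_indep_tuple v" and D: "diameter (convex hull (range (($) v))) \<le> 1"
  shows "\<bar>limit_charge (convex hull (range (($) v)))\<bar>
    \<le> total_const * hnorm \<alpha> F * (measure lebesgue (convex hull (range (($) v))) * height (osimplex_of v) powr (\<alpha> - 1))"
proof (rule LIMSEQ_le_const2)
  show "(\<lambda>k. \<bar>mass_of (scale_seq TYPE('n) k) (convex hull (range (($) v)))\<bar>) \<longlonglongrightarrow> \<bar>limit_charge (convex hull (range (($) v)))\<bar>"
    by (intro tendsto_intros limit_charge full_simplicesI ai)
qed (use mass_of_uniform[OF assms] in blast)

lemma total_const_nonneg: "0 \<le> total_const"
  using step_const_nonneg two_powr_neg[OF \<alpha>(1)] test_const_nonneg[where 'n='n] by (simp add: total_const_def)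

definition charge_const :: real where
  "charge_const = total_const * prism_constant TYPE('n) * facet_constant TYPE('n)"

lemma charge_const_nonneg: "0 \<le> charge_const"
  using total_const_nonneg prism_constant_pos[where 'n='n] facet_constant_pos[where 'n='n] by (simp add: charge_const_def)

text \<open>Formulated for an arbitrary number \<open>b\<close>, so as to serve the approximating
  charges and their limit alike. The bound by the mass gives the norm of the inverse, the one by the
  diameter the hypothesis of \<open>holder_charge\<close>.\<close>

lemma mass_to_diameter:
  fixes v :: "'n vertex_tuple"
  assumes ai: "aff_indep_tuple v" and B: "\<bar>b\<bar> \<le> total_const * hnorm \<alpha> F * (measure lebesgue (convex hull (range (($) v))) * height (osimplex_of v) powr (\<alpha> - 1))"
  shows "\<bar>b\<bar> \<le> total_const * hnorm \<alpha> F * (prism_constant TYPE('n) * mass \<alpha> (osimplex_of v))"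
    "\<bar>b\<bar> \<le> (charge_const * hnorm \<alpha> F) * diameter (convex hull (range (($) v))) ^ CARD('n) * diameter (convex hull (range (($) v))) powr (\<alpha> - 1)"
proof -
  let ?D = "diameter (convex hull (range (($) v)))"
  have tL: "0 \<le> total_const * hnorm \<alpha> F" using total_const_nonneg hnorm_nonneg[of \<alpha> F] by simp
  show 1: "\<bar>b\<bar> \<le> total_const * hnorm \<alpha> F * (prism_constant TYPE('n) * mass \<alpha> (osimplex_of v))"
    using B mult_left_mono[OF mass_ge[OF ai, of \<alpha>] tL] by linarith
  have "prism_constant TYPE('n) * mass \<alpha> (osimplex_of v) \<le> prism_constant TYPE('n) * (facet_constant TYPE('n) * ?D ^ CARD('n) * ?D powr (\<alpha> - 1))"
    using prism_constant_pos[where 'n='n] by (intro mult_left_mono mass_le[OF ai \<alpha>(1)]) auto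
  from mult_left_mono[OF this tL] 1
  have "\<bar>b\<bar> \<le> total_const * hnorm \<alpha> F * (prism_constant TYPE('n) * (facet_constant TYPE('n) * ?D ^ CARD('n) * ?D powr (\<alpha> - 1)))" by linarith
  also have "\<dots> = (charge_const * hnorm \<alpha> F) * ?D ^ CARD('n) * ?D powr (\<alpha> - 1)" by (simp add: charge_const_def)
  finally show "\<bar>b\<bar> \<le> (charge_const * hnorm \<alpha> F) * ?D ^ CARD('n) * ?D powr (\<alpha> - 1)" .
qed

text \<open>The constant does not depend on k. This uniformity is what dominates the box values when
  the scale tends to 0.\<close>

lemma holder_charge_mass_of: "holder_charge (mass_of (scale_seq TYPE('n) k)) \<alpha> (charge_const * hnorm \<alpha> F)"
proof
  show "simplex_additive (mass_of (scale_seq TYPE('n) k))" by (intro mass_of_additive scale_seq)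
  show "measurable_charge (mass_of (scale_seq TYPE('n) k))" by (intro mass_of_measurable scale_seq)
  show "0 \<le> charge_const * hnorm \<alpha> F" using charge_const_nonneg hnorm_nonneg[of \<alpha> F] by simp
  fix S :: "(real^'n) set" assume "S \<in> full_simplices" and D: "diameter S \<le> 1"
  then obtain v where v: "aff_indep_tuple v" "S = convex hull (range (($) v))" by (auto simp: full_simplices_def)
  show "\<bar>mass_of (scale_seq TYPE('n) k) S\<bar> \<le> charge_const * hnorm \<alpha> F * diameter S ^ CARD('n) * diameter S powr (\<alpha> - 1)"
    using mass_to_diameter(2)[OF v(1) mass_of_uniform[OF v(1)]] D unfolding v(2) by blast
qed (use \<alpha> in auto)

lemma holder_charge_limit: "holder_charge limit_charge \<alpha> (charge_const * hnorm \<alpha> F)"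
proof
  show "simplex_additive limit_charge"
    unfolding simplex_additive_def
  proof (intro ballI allI impI)
    fix S :: "(real^'n) set" and \<T> assume S: "S \<in> full_simplices" and T: "tiles \<T> S"
    have "(\<lambda>k. \<Sum>T\<in>\<T>. mass_of (scale_seq TYPE('n) k) T) \<longlonglongrightarrow> (\<Sum>T\<in>\<T>. limit_charge T)"
      using limit_charge[OF tiles_full[OF T]] by (intro tendsto_sum)
    moreover have "sum (mass_of (scale_seq TYPE('n) k)) \<T> = mass_of (scale_seq TYPE('n) k) S" for k
      using holder_charge.additive[OF holder_charge_mass_of] S T by (simp add: simplex_additive_def)
    ultimately have "(\<lambda>k. mass_of (scale_seq TYPE('n) k) S) \<longlonglongrightarrow> (\<Sum>T\<in>\<T>. limit_charge T)" by simp
    then show "limit_charge S = sum limit_charge \<T>" using limit_charge[OF S] LIMSEQ_unique by blast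
  qed
  show "measurable_charge limit_charge"
    unfolding measurable_charge_def
  proof (rule borel_measurable_LIMSEQ_real)
    fix v :: "'n vertex_tuple" assume "v \<in> space (restrict_space borel {v. aff_indep_tuple v})"
    then have "aff_indep_tuple v" by (simp add: space_restrict_space)
    then show "(\<lambda>k. mass_of (scale_seq TYPE('n) k) (convex hull (range (($) v)))) \<longlonglongrightarrow> limit_charge (convex hull (range (($) v)))"
      by (intro limit_charge full_simplicesI)
  next
    fix k show "(\<lambda>v. mass_of (scale_seq TYPE('n) k) (convex hull (range (($) v)))) \<in> borel_measurable (restrict_space borel {v. aff_indep_tuple v})"
      using holder_charge.measurable[OF holder_charge_mass_of, of k] by (simp add: measurable_charge_def)
  qed
  show "0 \<le> charge_const * hnorm \<alpha> F" using charge_const_nonneg hnorm_nonneg[of \<alpha> F] by simp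
  fix S :: "(real^'n) set" assume "S \<in> full_simplices" and D: "diameter S \<le> 1"
  then obtain v where v: "aff_indep_tuple v" "S = convex hull (range (($) v))" by (auto simp: full_simplices_def)
  show "\<bar>limit_charge S\<bar> \<le> charge_const * hnorm \<alpha> F * diameter S ^ CARD('n) * diameter S powr (\<alpha> - 1)"
    using mass_to_diameter(2)[OF v(1) limit_charge_bound[OF v(1)]] D unfolding v(2) by blast
qed (use \<alpha> in auto)

end

subsection \<open>Convergence of the approximations\<close>

lemma test_function_integrable: assumes "\<psi> \<in> test_functions" shows "integrable lborel \<psi>"
proof -
  have "loc_bounded (\<lambda>_::real^'a. 1)" by (auto simp: loc_bounded_def)
  from integrable_loc_comp[OF this test_function_comp_bounded[OF assms]] show ?thesis by simp
qed

lemma test_function_Lipschitz: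
  fixes \<psi> :: "real^'n::finite \<Rightarrow> real"
  assumes "\<psi> \<in> test_functions"
  obtains K where "0 < K" "\<And>x y. \<bar>\<psi> x - \<psi> y\<bar> \<le> K * norm (x - y)" "\<And>j x. \<bar>partial_deriv j \<psi> x\<bar> \<le> K"
proof -
  have "\<exists>M>0. \<forall>x. \<bar>partial_deriv j \<psi> x\<bar> \<le> M" for j
    using test_function_bounded[OF test_function_partial_derivs[OF assms, of "[j]"]] by simp
  then obtain M where M: "\<And>j. 0 < M j" "\<And>j x. \<bar>partial_deriv j \<psi> x\<bar> \<le> M j" by metis
  have "M j \<le> sum M UNIV" for j using M(1) by (intro member_le_sum) (auto intro: less_imp_le)
  then have "\<bar>partial_deriv j \<psi> x\<bar> \<le> sum M UNIV" for j x using M(2) order_trans by blast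
  moreover have "0 < sum M UNIV" using M(1) by (intro sum_pos) auto
  ultimately show ?thesis using that smooth_Lipschitz[OF test_function_smooth[OF assms] M(2)] by blast
qed

text \<open>Since a sum is differentiated, it has to equal 1 in a neighbourhood of x and not only at
  x; hence the radius is enlarged by 1 when the active hats are collected.\<close>

lemma sum_partial_deriv_hat:
  fixes x :: "real^'n::finite"
  assumes r: "0 < r" and Z: "finite Z" "meets r (cball x (2 * real CARD('n) * r + 1)) \<subseteq> Z"
  shows "(\<Sum>z\<in>Z. partial_deriv j (hat r z) x) = 0"
proof -
  let ?f = "\<lambda>y. \<Sum>z\<in>Z. 1 * hat r z y"
  have one: "?f y = 1" if y: "y \<in> ball x 1" for y
  proof -
    have "z \<in> Z" if "hat r z y \<noteq> 0" for z
    proof -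
      have c: "corner r 0 z \<in> cell r 0 z" by (rule corner_in_cell[OF r])
      have "norm (y - corner r 0 z) \<le> 2 * real CARD('n) * r" by (rule hat_cell_dist[OF r that c])
      moreover have "dist x (corner r 0 z) \<le> dist x y + dist y (corner r 0 z)" by (rule dist_triangle)
      ultimately have "corner r 0 z \<in> cball x (2 * real CARD('n) * r + 1)" using y by (simp add: dist_norm)
      then have "z \<in> meets r (cball x (2 * real CARD('n) * r + 1))" using c unfolding meets_def by blast
      then show ?thesis using Z(2) by blast
    qed
    from sum_hat[OF Z(1) this] show ?thesis by simp
  qed
  have sm: "smooth (\<lambda>y. hat r z y)" for z :: "'n \<Rightarrow> int" by (rule smooth_hat)
  have "partial_derivs [j] (\<lambda>y. ?f y + (-1)) x = 0"
    by (rule partial_deriv_zero_outside[of "ball x 1"]) (use one in auto)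
  then have "0 = partial_deriv j (\<lambda>y. ?f y + (-1)) x" by simp
  also have "\<dots> = partial_deriv j ?f x + partial_deriv j (\<lambda>_. -1) x"
    by (rule partial_deriv_add) (intro smooth_differentiable smooth_sum smooth_mult smooth_const sm)+
  also have "\<dots> = (\<Sum>z\<in>Z. 1 * partial_deriv j (hat r z) x)"
    unfolding partial_deriv_const partial_deriv_sum[OF Z(1) sm] by simp
  finally show ?thesis by simp
qed

text \<open>The counterpart of \<open>soft\<close> for test functions: F applied to it is the
  integral of \<psi> against the cellwise density.\<close>

definition smoothing :: "real \<Rightarrow> (real^'n::finite \<Rightarrow> real) \<Rightarrow> real^'n \<Rightarrow> real" where
  "smoothing r \<psi> = hat_sum r (meets r {x. \<psi> x \<noteq> 0}) (\<lambda>z. (LINT x|lborel. indicat_real (cell r 0 z) x * \<psi> x) / r ^ CARD('n))"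

text \<open>The hats sum to 1, so \<psi> x may be subtracted from every cell average, leaving
  coefficients of order r. Their derivatives sum to 0, so the same subtraction applies there, and
  the factor r cancels the 1 / r of a hat derivative: the first derivatives of the error are bounded
  but not small.\<close>

lemma smoothing_error:
  fixes \<psi> :: "real^'n::finite \<Rightarrow> real"
  assumes r: "0 < r" "2 * real CARD('n) * r \<le> 1" and \<psi>: "\<psi> \<in> test_functions"
    and K: "0 < K" "\<And>x y. \<bar>\<psi> x - \<psi> y\<bar> \<le> K * norm (x - y)" "\<And>j x. \<bar>partial_deriv j \<psi> x\<bar> \<le> K"
  shows "smoothing r \<psi> \<in> test_functions"
    "\<bar>smoothing r \<psi> x - \<psi> x\<bar> \<le> overlap TYPE('n) * (K * (2 * real CARD('n) * r))"
    "\<bar>partial_deriv j (smoothing r \<psi>) x - partial_deriv j \<psi> x\<bar> \<le> overlap TYPE('n) * (K * (2 * real CARD('n)) * hat_constant TYPE('n)) + K"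
    "(\<And>y. \<psi> y \<noteq> 0 \<Longrightarrow> norm y \<le> R) \<Longrightarrow> smoothing r \<psi> x \<noteq> 0 \<Longrightarrow> norm x \<le> R + 1"
proof -
  let ?d = "real CARD('n)" and ?H = "hat_constant TYPE('n)" and ?O = "overlap TYPE('n)"
  define Z where "Z = meets r {x. \<psi> x \<noteq> 0}"
  define c where "c z = (LINT x|lborel. indicat_real (cell r 0 z) x * \<psi> x) / r ^ CARD('n)" for z
  have sm: "smoothing r \<psi> = hat_sum r Z c" by (simp add: smoothing_def Z_def c_def[abs_def])
  have Z: "finite Z" unfolding Z_def by (rule finite_meets[OF r(1) test_function_bounded_support[OF \<psi>]])
  show "smoothing r \<psi> \<in> test_functions" unfolding sm by (rule hat_sum_test_function[OF r(1) Z])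
  have c0: "c z = 0" if "z \<notin> Z" for z
  proof -
    have "indicat_real (cell r 0 z) y * \<psi> y = 0" for y using that by (auto simp: Z_def meets_def indicator_def)
    then show ?thesis by (simp only: c_def Bochner_Integration.integral_zero div_0)
  qed
  have cb: "\<bar>c z - \<psi> x\<bar> \<le> K * (2 * ?d * r)" if n: "near r z x" for z
  proof -
    have cs: "cell r 0 z \<in> sets lborel" by (simp add: cell_sets_borel[OF r(1)])
    have i1: "integrable lborel (\<lambda>y. indicat_real (cell r 0 z) y * \<psi> y)"
      using integrable_real_mult_indicator[OF cs test_function_integrable[OF \<psi>]] by (simp add: mult.commute)
    have em: "emeasure lborel (cell r 0 z) < \<infinity>" "measure lborel (cell r 0 z) = r ^ CARD('n)"
      using fmeasurableD2[OF cell_lmeasurable[OF r(1), of 0 z]] cell_measure[OF r(1), of 0 z] cs by (simp_all add: less_top)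
    have i2: "integrable lborel (\<lambda>y. indicat_real (cell r 0 z) y * \<psi> x)"
      by (intro integrable_mult_left integrable_real_indicator cs em)
    have bm: "(\<lambda>y. indicat_real (cell r 0 z) y * (\<psi> y - \<psi> x)) \<in> borel_measurable borel"
      using borel_measurable_integrable[OF test_function_integrable[OF \<psi>]] cs by simp
    have bd: "\<bar>indicat_real (cell r 0 z) y * (\<psi> y - \<psi> x)\<bar> \<le> K * (2 * ?d * r)" if y: "y \<in> cell r 0 z" for y
    proof -
      have "\<bar>\<psi> y - \<psi> x\<bar> \<le> K * norm (y - x)" by (rule K(2))
      also have "\<dots> \<le> K * (2 * ?d * r)"
        using near_cell_dist[OF r(1) n y] K(1) by (intro mult_left_mono) (auto simp: norm_minus_commute)
      finally show ?thesis using y by simp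
    qed
    have "(LINT y|lborel. indicat_real (cell r 0 z) y * (\<psi> y - \<psi> x)) = c z * r ^ CARD('n) - r ^ CARD('n) * \<psi> x"
      using i1 i2 em(2) r(1) cs by (simp add: right_diff_distrib c_def)
    moreover have "\<bar>LINT y|lborel. indicat_real (cell r 0 z) y * (\<psi> y - \<psi> x)\<bar> \<le> K * (2 * ?d * r) * measure lborel (cell r 0 z)"
      by (rule integrable_supported(2)[OF bm _ em(1) bd]) (use cs in auto)
    ultimately have "\<bar>(c z - \<psi> x) * r ^ CARD('n)\<bar> \<le> K * (2 * ?d * r) * r ^ CARD('n)" by (simp add: em(2) algebra_simps)
    then show ?thesis using r(1) by (simp add: abs_mult)
  qed
  \<comment> \<open>The enlarged index set contains every hat active near x. The added indices carry
    zero cell averages and so do not change the smoothing.\<close>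
  define Z' where "Z' = Z \<union> meets r (cball x (2 * ?d * r + 1))"
  have Z': "finite Z'" unfolding Z'_def using Z finite_meets[OF r(1) bounded_cball] by blast
  have hz: "z \<in> Z'" if "hat r z x \<noteq> 0" for z
  proof -
    have cc: "corner r 0 z \<in> cell r 0 z" by (rule corner_in_cell[OF r(1)])
    have "norm (x - corner r 0 z) \<le> 2 * ?d * r" by (rule hat_cell_dist[OF r(1) that cc])
    then have "corner r 0 z \<in> cball x (2 * ?d * r + 1)" by (simp add: dist_norm)
    then have "z \<in> meets r (cball x (2 * ?d * r + 1))" using cc unfolding meets_def by blast
    then show ?thesis by (simp add: Z'_def)
  qed
  have K0: "0 \<le> K * (2 * ?d * r)" using K(1) r(1) by simp
  have "smoothing r \<psi> x = (\<Sum>z\<in>Z'. c z * hat r z x)"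
    unfolding sm hat_sum_def using Z' c0 by (intro sum.mono_neutral_left) (auto simp: Z'_def)
  moreover have "\<psi> x = (\<Sum>z\<in>Z'. \<psi> x * hat r z x)"
    using sum_hat[OF Z' hz] by (simp add: sum_distrib_left[symmetric])
  ultimately have "smoothing r \<psi> x - \<psi> x = (\<Sum>z\<in>Z'. (c z - \<psi> x) * hat r z x)"
    by (simp add: left_diff_distrib sum_subtractf)
  also have "\<bar>\<dots>\<bar> \<le> ?O * (K * (2 * ?d * r))"
  proof (rule sum_near_bound[OF r(1) Z' _ _ K0])
    show "near r z x" if "(c z - \<psi> x) * hat r z x \<noteq> 0" for z using that by (intro hat_near) auto
    show "\<bar>(c z - \<psi> x) * hat r z x\<bar> \<le> K * (2 * ?d * r)" if "near r z x" for z
      using mult_mono[OF cb[OF that] abs_hat_le[of r z x] K0] by (simp add: abs_mult)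
  qed
  finally show "\<bar>smoothing r \<psi> x - \<psi> x\<bar> \<le> ?O * (K * (2 * ?d * r))" .
  have "partial_deriv j (smoothing r \<psi>) x = (\<Sum>z\<in>Z. c z * partial_deriv j (hat r z) x)"
    unfolding sm hat_sum_def[abs_def] by (rule partial_deriv_sum[OF Z smooth_hat])
  also have "\<dots> = (\<Sum>z\<in>Z'. c z * partial_deriv j (hat r z) x)"
    using Z' c0 by (intro sum.mono_neutral_left) (auto simp: Z'_def)
  also have "\<dots> = (\<Sum>z\<in>Z'. (c z - \<psi> x) * partial_deriv j (hat r z) x)"
    using sum_partial_deriv_hat[OF r(1) Z', of x j] by (simp add: Z'_def left_diff_distrib sum_subtractf sum_distrib_left[symmetric])
  finally have e: "partial_deriv j (smoothing r \<psi>) x = (\<Sum>z\<in>Z'. (c z - \<psi> x) * partial_deriv j (hat r z) x)" .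
  have H: "1 \<le> ?H" by (rule hat_constant)
  have KH: "0 \<le> K * (2 * ?d) * ?H" using K(1) H by simp
  have "\<bar>\<Sum>z\<in>Z'. (c z - \<psi> x) * partial_deriv j (hat r z) x\<bar> \<le> ?O * (K * (2 * ?d) * ?H)"
  proof (rule sum_near_bound[OF r(1) Z' _ _ KH])
    show "near r z x" if "(c z - \<psi> x) * partial_deriv j (hat r z) x \<noteq> 0" for z using that by (intro partial_hat_near) auto
    show "\<bar>(c z - \<psi> x) * partial_deriv j (hat r z) x\<bar> \<le> K * (2 * ?d) * ?H" if "near r z x" for z
      using mult_mono[OF cb[OF that] hat_constant(2)[OF r(1), of j z x] K0] r(1) by (simp add: abs_mult)
  qed
  then show "\<bar>partial_deriv j (smoothing r \<psi>) x - partial_deriv j \<psi> x\<bar> \<le> ?O * (K * (2 * ?d) * ?H) + K"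
    unfolding e using K(3)[of j x] by linarith
  assume R: "\<And>y. \<psi> y \<noteq> 0 \<Longrightarrow> norm y \<le> R" and "smoothing r \<psi> x \<noteq> 0"
  then obtain z where z: "z \<in> Z" "hat r z x \<noteq> 0" unfolding sm hat_sum_def by (metis (no_types, lifting) mult_zero_right sum.neutral)
  then obtain y where y: "y \<in> cell r 0 z" "\<psi> y \<noteq> 0" by (auto simp: Z_def meets_def)
  show "norm x \<le> R + 1"
    using hat_cell_dist[OF r(1) z(2) y(1)] R[OF y(2)] r(2) norm_triangle_ineq[of "x - y" y] by simp
qed

context holder_distribution
begin

text \<open>The error has size C r and derivatives at most C = (C r) / r, exactly the shape of a
  test function of amplitude C r at scale r. Testing therefore costs a multiple of r r^(\<alpha> -
  1) = r^\<alpha>, which tends to 0.\<close>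

lemma smoothing_tendsto:
  assumes \<psi>: "\<psi> \<in> test_functions"
  shows "(\<lambda>k. F (smoothing (scale_seq TYPE('n) k) \<psi>)) \<longlonglongrightarrow> F \<psi>"
proof -
  let ?r = "scale_seq TYPE('n)" and ?d = "real CARD('n)" and ?H = "hat_constant TYPE('n)" and ?O = "overlap TYPE('n)"
  obtain K where K: "0 < K" "\<And>x y. \<bar>\<psi> x - \<psi> y\<bar> \<le> K * norm (x - y)" "\<And>j x. \<bar>partial_deriv j \<psi> x\<bar> \<le> K"
    using test_function_Lipschitz[OF \<psi>] by blast
  obtain R where "\<And>y. \<psi> y \<noteq> 0 \<Longrightarrow> norm y \<le> R" using test_function_bounded_support[OF \<psi>] by (auto simp: bounded_iff)
  note e = smoothing_error[OF scale_seq(1,2) \<psi> K]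
  have e4: "norm x \<le> R + 1" if "smoothing (?r k) \<psi> x \<noteq> 0" for k x
    using e(4) \<open>\<And>y. \<psi> y \<noteq> 0 \<Longrightarrow> norm y \<le> R\<close> that by blast
  have H: "1 \<le> ?H" by (rule hat_constant)
  have O: "1 \<le> ?O" by (rule overlap_ge_1)
  let ?C = "?O * (K * (2 * ?d) * ?H) + K"
  have C: "0 < ?C" using K(1) H O by (intro add_nonneg_pos) auto
  \<comment> \<open>The smoothing enlarges the support by at most 1, and the neighbourhood of width
    2 d r needed for testing by at most 1 again.\<close>
  let ?W = "cball (0::real^'n) (R + 2)"
  have b: "\<bar>F (smoothing (?r k) \<psi>) - F \<psi>\<bar> \<le> test_const TYPE('n) * ?C * hnorm \<alpha> F * measure lebesgue ?W * (?r k) powr \<alpha>" for k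
  proof -
    have r: "0 < ?r k" "2 * ?d * ?r k \<le> 1" by (rule scale_seq)+
    define g where "g x = 1 * smoothing (?r k) \<psi> x + (-1) * \<psi> x" for x
    have gt: "g \<in> test_functions" unfolding g_def[abs_def] by (rule test_function_lincomb[OF e(1) \<psi>])
    have Fg: "F g = F (smoothing (?r k) \<psi>) - F \<psi>"
      unfolding g_def[abs_def] distribution_lincomb[OF FD e(1) \<psi>] by simp
    have pd: "partial_deriv j g y = partial_deriv j (smoothing (?r k) \<psi>) y - partial_deriv j \<psi> y" for j y
    proof -
      have "partial_derivs [j] g y = 1 * partial_derivs [j] (smoothing (?r k) \<psi>) y + (-1) * partial_derivs [j] \<psi> y"
        unfolding g_def[abs_def] partial_derivs_lincomb[OF test_function_smooth[OF e(1)] test_function_smooth[OF \<psi>]] ..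
      then show ?thesis by simp
    qed
    have "\<bar>F g\<bar> \<le> test_const TYPE('n) * (?C * ?r k) * (?r k) powr (\<alpha> - 1) * hnorm \<alpha> F * measure lebesgue ?W"
    proof (rule holder_test_global[OF F \<alpha>(2) gt r])
      show "0 < ?C * ?r k" using C r by simp
      show "\<bar>g y\<bar> \<le> ?C * ?r k" for y
      proof -
        have "\<bar>g y\<bar> \<le> ?O * (K * (2 * ?d * ?r k))" using e(2)[of k y] by (simp add: g_def)
        also have "\<dots> = (?O * (K * (2 * ?d) * 1)) * ?r k" by simp
        also have "\<dots> \<le> ?C * ?r k"
        proof (intro mult_right_mono)
          have "?O * (K * (2 * ?d) * 1) \<le> ?O * (K * (2 * ?d) * ?H)" using K(1) H O by (intro mult_left_mono) auto
          then show "?O * (K * (2 * ?d) * 1) \<le> ?C" using K(1) by linarith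
        qed (use r in simp)
        finally show ?thesis .
      qed
      show "\<bar>partial_deriv j g y\<bar> \<le> ?C * ?r k / ?r k" for j y unfolding pd using e(3)[of j k y] r(1) by simp
      show "y \<in> ?W" if "g x \<noteq> 0" "norm (x - y) \<le> 2 * ?d * ?r k" for x y
      proof -
        have "norm x \<le> R + 1"
        proof (cases "\<psi> x = 0")
          case True then show ?thesis using that e4[of k x] by (simp add: g_def)
        next
          case False then show ?thesis using \<open>\<And>y. \<psi> y \<noteq> 0 \<Longrightarrow> norm y \<le> R\<close>[of x] by simp
        qed
        then show ?thesis using norm_triangle_ineq4[of x "x - y"] that(2) r(2) by simp
      qed
    qed simp
    also have "\<dots> = test_const TYPE('n) * ?C * hnorm \<alpha> F * measure lebesgue ?W * (?r k * (?r k) powr (\<alpha> - 1))" by simp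
    also have "?r k * (?r k) powr (\<alpha> - 1) = (?r k) powr \<alpha>" by (subst powr_mult_base) (use r in auto)
    finally show ?thesis unfolding Fg .
  qed
  have "(\<lambda>k. (?r k) powr \<alpha>) \<longlonglongrightarrow> 0"
    by (rule tendsto_zero_powrI[OF scale_seq(4) tendsto_const]) (use \<alpha> scale_seq(1)[where 'n='n] in \<open>auto intro!: always_eventually less_imp_le\<close>)
  then have "(\<lambda>k. test_const TYPE('n) * ?C * hnorm \<alpha> F * measure lebesgue ?W * (?r k) powr \<alpha>) \<longlonglongrightarrow> 0"
    using tendsto_mult_right_zero by blast
  then have "(\<lambda>k. F (smoothing (?r k) \<psi>) - F \<psi>) \<longlonglongrightarrow> 0"
    by (rule Lim_null_comparison[rotated]) (use b in simp)
  then show ?thesis by (simp add: LIM_zero_iff)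
qed

lemma extend_mass_of:
  assumes r: "0 < r" "2 * real CARD('n) * r \<le> 1" and P: "polyhedral P" "P \<in> sets borel" "bounded P"
  shows "extend (mass_of r) P = mass_of r P"
proof -
  obtain \<T> where t: "tiles \<T> P" using P(1) by (auto simp: polyhedral_def)
  show ?thesis by (simp add: extend_eq[OF mass_of_additive[OF r] t] mass_of_tiles[OF r t P(2,3)])
qed

lemma cube_facts: "polyhedral (cube x h)" "cube x h \<in> sets borel" "bounded (cube x h)"
  by (auto simp: cube_def polyhedral_cbox)

text \<open>Cells are closed at their lower and open at their upper faces, and cubes grow from x in
  positive directions. The inclusion therefore holds for every x, also on the walls between
  cells.\<close>

lemma cube_in_cell:
  fixes x :: "real^'n"
  assumes r: "0 < r" and h: "h \<longlonglongrightarrow> 0"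
  shows "\<forall>\<^sub>F k in sequentially. cube x (h k) \<subseteq> cell r 0 (index r 0 x)"
proof -
  let ?z = "index r 0 x"
  have x: "corner r 0 ?z $ j \<le> x $ j" "x $ j < corner r 0 ?z $ j + r" for j
    using mem_cell_iff[OF r, of x 0 ?z] by (simp_all add: mem_cell_index)
  have "\<forall>\<^sub>F k in sequentially. \<forall>j\<in>UNIV. h k < corner r 0 ?z $ j + r - x $ j"
    using x(2) by (intro eventually_ball_finite ballI order_tendstoD(2)[OF h]) auto
  then show ?thesis
  proof eventually_elim
    case (elim k)
    show ?case
    proof
      fix y assume y: "y \<in> cube x (h k)"
      show "y \<in> cell r 0 ?z" unfolding mem_cell_iff[OF r]
      proof
        fix j show "corner r 0 ?z $ j \<le> y $ j \<and> y $ j < corner r 0 ?z $ j + r"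
          using y elim x(1)[of j] unfolding mem_cube by (smt (verit) UNIV_I)
      qed
    qed
  qed
qed

text \<open>A sufficiently small cube at x stays in one cell, where the density is constant, so the
  normalised charge of the cube is eventually equal to the density at x. Uniqueness of the limit of
  the averages identifies the pairing with the integral against the density.\<close>

lemma pairing_mass_of:
  assumes \<psi>: "\<psi> \<in> test_functions"
  shows "holder_charge.pairing (mass_of (scale_seq TYPE('n) k)) \<psi> = F (smoothing (scale_seq TYPE('n) k) \<psi>)"
proof -
  let ?r = "scale_seq TYPE('n) k"
  have r: "0 < ?r" "2 * real CARD('n) * ?r \<le> 1" by (rule scale_seq)+
  interpret M: holder_charge "mass_of ?r" \<alpha> "charge_const * hnorm \<alpha> F" by (rule holder_charge_mass_of)
  define h :: "nat \<Rightarrow> real" where "h i = 1 / 2 ^ i" for i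
  have h: "0 < h i" "h i \<le> 1" "h \<longlonglongrightarrow> 0" for i
    using LIMSEQ_divide_realpow_zero[of 2 1] by (auto simp: h_def[abs_def] divide_le_eq)
  have i\<psi>: "integrable lborel \<psi>" by (rule test_function_integrable[OF \<psi>])
  have m: "extend (mass_of ?r) (cube x (h i)) = mass_of ?r (cube x (h i))" for x i
    by (rule extend_mass_of[OF r cube_facts])
  have "(\<lambda>i. LINT x|lborel. extend (mass_of ?r) (cube x (h i)) / h i ^ CARD('n) * \<psi> x) \<longlonglongrightarrow> (LINT x|lborel. dens ?r x * \<psi> x)"
  proof (rule integral_dominated_convergence)
    show "(\<lambda>x. dens ?r x * \<psi> x) \<in> borel_measurable lborel"
      using dens_measurable[OF r(1)] borel_measurable_integrable[OF i\<psi>] by simp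
    show "(\<lambda>x. extend (mass_of ?r) (cube x (h i)) / h i ^ CARD('n) * \<psi> x) \<in> borel_measurable lborel" for i
      using M.cube_measurable[OF h(1)] borel_measurable_integrable[OF i\<psi>] by simp
    show "integrable lborel (\<lambda>x. dens_bd ?r * \<bar>\<psi> x\<bar>)" using i\<psi> by simp
    show "AE x in lborel. norm (extend (mass_of ?r) (cube x (h i)) / h i ^ CARD('n) * \<psi> x) \<le> dens_bd ?r * \<bar>\<psi> x\<bar>" for i
    proof (rule AE_I2)
      fix x
      have "\<bar>extend (mass_of ?r) (cube x (h i))\<bar> \<le> dens_bd ?r * h i ^ CARD('n)"
        using mass_of(2)[OF r cube_facts(2,3), of x "h i"] cube_measure[OF less_imp_le[OF h(1)], of x i] by (simp add: m)
      then have "\<bar>extend (mass_of ?r) (cube x (h i)) / h i ^ CARD('n)\<bar> \<le> dens_bd ?r"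
        using h(1)[of i] by (simp add: abs_divide divide_le_eq)
      then show "norm (extend (mass_of ?r) (cube x (h i)) / h i ^ CARD('n) * \<psi> x) \<le> dens_bd ?r * \<bar>\<psi> x\<bar>"
        by (simp only: real_norm_def abs_mult mult_right_mono abs_ge_zero)
    qed
    show "AE x in lborel. (\<lambda>i. extend (mass_of ?r) (cube x (h i)) / h i ^ CARD('n) * \<psi> x) \<longlonglongrightarrow> dens ?r x * \<psi> x"
    proof (rule AE_I2)
      fix x
      have "\<forall>\<^sub>F i in sequentially. extend (mass_of ?r) (cube x (h i)) / h i ^ CARD('n) * \<psi> x = dens ?r x * \<psi> x"
        using cube_in_cell[OF r(1) h(3), of x]
      proof eventually_elim
        case (elim i)
        have "mass_of ?r (cube x (h i)) = (LINT y|lborel. indicat_real (cube x (h i)) y * dens ?r x)"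
          unfolding mass_of_def
        proof (intro Bochner_Integration.integral_cong refl)
          fix y
          have "index ?r 0 y = index ?r 0 x" if "y \<in> cube x (h i)" using elim that by (auto simp: mem_cell_index)
          then show "indicat_real (cube x (h i)) y * dens ?r y = indicat_real (cube x (h i)) y * dens ?r x"
            by (auto simp: dens_def indicator_def)
        qed
        also have "\<dots> = h i ^ CARD('n) * dens ?r x"
          using cube_measure[OF less_imp_le[OF h(1)], of x i] cube_facts(2)[of x "h i"] by simp
        finally show ?case using h(1)[of i] by (simp add: m)
      qed
      then show "(\<lambda>i. extend (mass_of ?r) (cube x (h i)) / h i ^ CARD('n) * \<psi> x) \<longlonglongrightarrow> dens ?r x * \<psi> x"
        by (rule tendsto_eventually)
    qed
  qed
  then have "(\<lambda>i. M.avg (h i) \<psi>) \<longlonglongrightarrow> (LINT x|lborel. dens ?r x * \<psi> x)"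
    by (simp add: M.avg_def)
  then have "M.pairing \<psi> = (LINT x|lborel. dens ?r x * \<psi> x)"
    using M.avg_tendsto_pairing[OF \<psi> h] LIMSEQ_unique by blast
  also have "\<dots> = F (smoothing ?r \<psi>)"
    unfolding smoothing_def
    by (rule integral_dens[OF r(1) finite_meets[OF r(1) test_function_bounded_support[OF \<psi>]] _ i\<psi>]) (auto simp: meets_def)
  finally show ?thesis .
qed

text \<open>The tiling chosen by \<open>extend\<close> depends on the box and not on the charge, so
  convergence on simplices passes through a fixed finite sum.\<close>

lemma signed_box_tendsto:
  "(\<lambda>k. signed_box (mass_of (scale_seq TYPE('n) k)) 0 v) \<longlonglongrightarrow> signed_box limit_charge 0 v"
proof -
  have t: "tiles (SOME \<T>. tiles \<T> (cbox a b)) (cbox a b)" for a b :: "real^'n"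
    using polyhedral_cbox[of a b] unfolding polyhedral_def by (rule someI_ex)
  show ?thesis
    unfolding signed_box_def extend_def by (intro tendsto_intros limit_charge tiles_full[OF t])
qed

text \<open>Both sides of \<open>pairing_mass_of\<close> pass to the limit: the pairings by
  dominated convergence of the box values, which are bounded uniformly in k, and the values of F by
  \<open>smoothing_tendsto\<close>.\<close>

lemma pairing_limit_charge:
  assumes \<psi>: "\<psi> \<in> test_functions"
  shows "holder_charge.pairing limit_charge \<psi> = F \<psi>"
proof -
  interpret L: holder_charge limit_charge \<alpha> "charge_const * hnorm \<alpha> F" by (rule holder_charge_limit)
  interpret M: holder_charge "mass_of (scale_seq TYPE('n) k)" \<alpha> "charge_const * hnorm \<alpha> F" for k by (rule holder_charge_mass_of)
  have mt: "mixed_deriv \<psi> \<in> test_functions" unfolding mixed_deriv_def by (rule test_function_partial_derivs[OF \<psi>])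
  obtain R where R: "\<And>y. mixed_deriv \<psi> y \<noteq> 0 \<Longrightarrow> norm y \<le> R" using test_function_bounded_support[OF mt] by (auto simp: bounded_iff)
  let ?c = "charge_const * hnorm \<alpha> F * loc_const \<alpha> TYPE('n) R"
  have "(\<lambda>k. LINT v|lborel. signed_box (mass_of (scale_seq TYPE('n) k)) 0 v * mixed_deriv \<psi> v)
      \<longlonglongrightarrow> (LINT v|lborel. signed_box limit_charge 0 v * mixed_deriv \<psi> v)"
  proof (rule integral_dominated_convergence)
    show "(\<lambda>v. signed_box limit_charge 0 v * mixed_deriv \<psi> v) \<in> borel_measurable lborel"
      using L.signed_box_measurable borel_measurable_integrable[OF test_function_integrable[OF mt]] by simp
    show "(\<lambda>v. signed_box (mass_of (scale_seq TYPE('n) k)) 0 v * mixed_deriv \<psi> v) \<in> borel_measurable lborel" for k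
      using M.signed_box_measurable borel_measurable_integrable[OF test_function_integrable[OF mt]] by simp
    show "integrable lborel (\<lambda>v. ?c * \<bar>mixed_deriv \<psi> v\<bar>)" using test_function_integrable[OF mt] by simp
    show "AE v in lborel. norm (signed_box (mass_of (scale_seq TYPE('n) k)) 0 v * mixed_deriv \<psi> v) \<le> ?c * \<bar>mixed_deriv \<psi> v\<bar>" for k
    proof (rule AE_I2)
      fix v :: "real^'n"
      show "norm (signed_box (mass_of (scale_seq TYPE('n) k)) 0 v * mixed_deriv \<psi> v) \<le> ?c * \<bar>mixed_deriv \<psi> v\<bar>"
      proof (cases "mixed_deriv \<psi> v = 0")
        case False
        show ?thesis unfolding real_norm_def abs_mult
          by (intro mult_right_mono M.signed_box_bound R[OF False] abs_ge_zero)
      qed simp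
    qed
    show "AE v in lborel. (\<lambda>k. signed_box (mass_of (scale_seq TYPE('n) k)) 0 v * mixed_deriv \<psi> v) \<longlonglongrightarrow> signed_box limit_charge 0 v * mixed_deriv \<psi> v"
      by (intro AE_I2 tendsto_intros signed_box_tendsto)
  qed
  then have "(\<lambda>k. M.pairing k \<psi>) \<longlonglongrightarrow> L.pairing \<psi>"
    unfolding M.pairing_def L.pairing_def by (intro tendsto_intros)
  then have "(\<lambda>k. F (smoothing (scale_seq TYPE('n) k) \<psi>)) \<longlonglongrightarrow> L.pairing \<psi>" by (simp add: pairing_mass_of[OF \<psi>])
  then show ?thesis using smoothing_tendsto[OF \<psi>] LIMSEQ_unique by blast
qed

end

section \<open>From a charge to a distribution\<close>

subsection \<open>Boundedness of the map\<close>

lemma test_function_bdd_above: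
  assumes "\<psi> \<in> test_functions" shows "bdd_above (range (\<lambda>x. \<bar>partial_derivs ks \<psi> x\<bar>))"
  using test_function_bounded[OF test_function_partial_derivs[OF assms, of ks]] by (auto simp: bdd_above_def)

lemma partial_derivs_le_Ck_norm:
  fixes \<psi> :: "real^'n::finite \<Rightarrow> real"
  assumes \<psi>: "\<psi> \<in> test_functions" and k: "length ks \<le> m"
  shows "\<bar>partial_derivs ks \<psi> x\<bar> \<le> Ck_norm m \<psi>"
proof -
  let ?S = "\<lambda>ks. SUP x. \<bar>partial_derivs ks \<psi> x\<bar>"
  have le: "\<bar>partial_derivs ks \<psi> y\<bar> \<le> ?S ks" for ks y
    by (rule cSUP_upper[OF UNIV_I test_function_bdd_above[OF \<psi>]])
  have "finite {ks :: 'n list. set ks \<subseteq> UNIV \<and> length ks \<le> m}" by (rule finite_lists_length_le) simp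
  then have fin: "finite {ks :: 'n list. length ks \<le> m}" by simp
  have "?S ks \<le> (\<Sum>ks\<in>{ks. length ks \<le> m}. ?S ks)"
    by (rule member_le_sum) (use k fin order.trans[OF abs_ge_zero le] in auto)
  then show ?thesis using le[of ks x] unfolding Ck_norm_def by linarith
qed

text \<open>The first order norm adds the suprema of all first partial derivatives, so even their
  sum is at most 1, and this sum is a Lipschitz constant.\<close>

lemma unit_test_functions:
  fixes \<phi> :: "real^'n::finite \<Rightarrow> real"
  assumes \<phi>: "\<phi> \<in> unit_test_functions"
  shows "\<phi> \<in> test_functions" "\<bar>\<phi> x\<bar> \<le> 1" "\<bar>\<phi> x - \<phi> y\<bar> \<le> norm (x - y)" "\<phi> x \<noteq> 0 \<Longrightarrow> norm x \<le> 1"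
proof -
  have c: "smooth \<phi>" "closure {x. \<phi> x \<noteq> 0} \<subseteq> cball 0 1" "Ck_norm 1 \<phi> \<le> 1"
    using \<phi> by (auto simp: unit_test_functions_def)
  have sub: "{x. \<phi> x \<noteq> 0} \<subseteq> cball 0 1" by (rule order.trans[OF closure_subset c(2)])
  then show "\<phi> x \<noteq> 0 \<Longrightarrow> norm x \<le> 1" by auto
  show t: "\<phi> \<in> test_functions" by (rule test_functionI[OF c(1) bounded_cball]) (use sub in blast)
  show "\<bar>\<phi> x\<bar> \<le> 1" using partial_derivs_le_Ck_norm[OF t, of "[]" 1 x] c(3) by simp
  let ?M = "\<lambda>j. SUP x. \<bar>partial_deriv j \<phi> x\<bar>"
  have "\<bar>partial_deriv j \<phi> x\<bar> \<le> ?M j" for j x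
    using test_function_bdd_above[OF t, of "[j]"] by (intro cSUP_upper) simp_all
  from smooth_Lipschitz[OF c(1) this]
  have L: "\<bar>\<phi> x - \<phi> y\<bar> \<le> sum ?M UNIV * norm (x - y)" .
  have "0 \<le> (SUP x. \<bar>\<phi> x\<bar>)"
  proof (rule order.trans[OF abs_ge_zero])
    show "\<bar>\<phi> 0\<bar> \<le> (SUP x. \<bar>\<phi> x\<bar>)"
      using test_function_bdd_above[OF t, of "[]"] by (intro cSUP_upper) simp_all
  qed
  then have "sum ?M UNIV \<le> 1" using c(3) unfolding Ck_norm_1 by linarith
  from mult_right_mono[OF this norm_ge_zero[of "x - y"]] L show "\<bar>\<phi> x - \<phi> y\<bar> \<le> norm (x - y)" by simp
qed

lemma rescale_test_function:
  fixes \<phi> :: "real^'n::finite \<Rightarrow> real"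
  assumes \<phi>: "\<phi> \<in> unit_test_functions" and \<rho>: "0 < \<rho>"
  shows "rescale \<rho> x \<phi> \<in> test_functions" "\<bar>rescale \<rho> x \<phi> y\<bar> \<le> 1 / \<rho> ^ CARD('n)"
    "\<bar>rescale \<rho> x \<phi> y - rescale \<rho> x \<phi> z\<bar> \<le> 1 / (\<rho> * \<rho> ^ CARD('n)) * norm (y - z)"
    "\<rho> < norm (y - x) \<Longrightarrow> rescale \<rho> x \<phi> y = 0"
proof -
  note u = unit_test_functions[OF \<phi>]
  have e: "(y - x) /\<^sub>R \<rho> = (1 / \<rho>) *\<^sub>R y + (- (1 / \<rho>) *\<^sub>R x)" for y
    by (simp add: algebra_simps divide_inverse)
  show 0: "\<rho> < norm (y - x) \<Longrightarrow> rescale \<rho> x \<phi> y = 0" for y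
    using u(4)[of "(y - x) /\<^sub>R \<rho>"] \<rho> by (auto simp: rescale_def divide_simps)
  have "smooth (\<lambda>y. (1 / \<rho> ^ CARD('n)) * \<phi> ((1 / \<rho>) *\<^sub>R y + (- (1 / \<rho>) *\<^sub>R x)))"
    by (intro smooth_mult smooth_const smooth_compose_affine test_function_smooth u(1))
  then have "smooth (rescale \<rho> x \<phi>)" unfolding rescale_def e by simp
  then show "rescale \<rho> x \<phi> \<in> test_functions"
    by (rule test_functionI[OF _ bounded_cball[of x \<rho>]]) (use 0 in \<open>force simp: dist_norm norm_minus_commute\<close>)
  show "\<bar>rescale \<rho> x \<phi> y\<bar> \<le> 1 / \<rho> ^ CARD('n)"
    using u(2) \<rho> by (simp add: rescale_def abs_divide divide_right_mono)
  have "(y - x) /\<^sub>R \<rho> - (z - x) /\<^sub>R \<rho> = (y - z) /\<^sub>R \<rho>" by (simp add: algebra_simps)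
  then have "\<bar>\<phi> ((y - x) /\<^sub>R \<rho>) - \<phi> ((z - x) /\<^sub>R \<rho>)\<bar> \<le> norm ((y - z) /\<^sub>R \<rho>)" using u(3) by metis
  also have "\<dots> = norm (y - z) / \<rho>" using \<rho> by (simp add: divide_inverse)
  finally have "\<bar>\<phi> ((y - x) /\<^sub>R \<rho>) - \<phi> ((z - x) /\<^sub>R \<rho>)\<bar> / \<rho> ^ CARD('n) \<le> (norm (y - z) / \<rho>) / \<rho> ^ CARD('n)"
    using \<rho> by (intro divide_right_mono) auto
  moreover have "\<bar>rescale \<rho> x \<phi> y - rescale \<rho> x \<phi> z\<bar> = \<bar>\<phi> ((y - x) /\<^sub>R \<rho>) - \<phi> ((z - x) /\<^sub>R \<rho>)\<bar> / \<rho> ^ CARD('n)"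
    using \<rho> by (simp add: rescale_def abs_divide diff_divide_distrib[symmetric])
  ultimately show "\<bar>rescale \<rho> x \<phi> y - rescale \<rho> x \<phi> z\<bar> \<le> 1 / (\<rho> * \<rho> ^ CARD('n)) * norm (y - z)" by simp
qed

text \<open>The power 4^d is the volume of the ball of radius 2 \<rho> relative to \<rho>^d. The
  first summand is the distance to the average at scale \<rho> / d, the second that average itself,
  d arising from (1 / d)^(\<alpha> - 1) \<le> d.\<close>

definition pairing_const :: "real \<Rightarrow> 'n::finite itself \<Rightarrow> real" where
  "pairing_const \<alpha> _ = 4 ^ CARD('n) * (sewing_const \<alpha> TYPE('n) + cell_const TYPE('n) * real CARD('n))"

context holder_charge
begin

lemma pairing_lincomb:
  assumes "\<psi> \<in> test_functions" "\<phi> \<in> test_functions"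
  shows "pairing (\<lambda>x. a * \<psi> x + b * \<phi> x) = a * pairing \<psi> + b * pairing \<phi>"
proof -
  have i: "integrable lborel (\<lambda>v. signed_box B 0 v * mixed_deriv f v)" if "f \<in> test_functions" for f
    unfolding mixed_deriv_def
    by (intro integrable_loc_comp signed_box_loc_bounded test_function_comp_bounded test_function_partial_derivs that)
  have "mixed_deriv (\<lambda>x. a * \<psi> x + b * \<phi> x) = (\<lambda>x. a * mixed_deriv \<psi> x + b * mixed_deriv \<phi> x)"
    unfolding mixed_deriv_def by (intro partial_derivs_lincomb test_function_smooth assms)
  then have "(LINT v|lborel. signed_box B 0 v * mixed_deriv (\<lambda>x. a * \<psi> x + b * \<phi> x) v)
      = (LINT v|lborel. a * (signed_box B 0 v * mixed_deriv \<psi> v) + b * (signed_box B 0 v * mixed_deriv \<phi> v))"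
    by (simp add: algebra_simps)
  also have "\<dots> = a * (LINT v|lborel. signed_box B 0 v * mixed_deriv \<psi> v) + b * (LINT v|lborel. signed_box B 0 v * mixed_deriv \<phi> v)"
    using i[OF assms(1)] i[OF assms(2)] by simp
  finally show ?thesis by (simp add: pairing_def algebra_simps)
qed

text \<open>Only the mixed derivative enters, so the order d suffices, and the box function is
  bounded on bounded sets.\<close>

lemma pairing_continuous:
  assumes K: "compact K"
  shows "\<exists>C N. \<forall>\<psi>\<in>test_functions. {x. \<psi> x \<noteq> 0} \<subseteq> K \<longrightarrow> \<bar>pairing \<psi>\<bar> \<le> C * Ck_norm N \<psi>"
proof -
  obtain R where R: "\<And>x. x \<in> K \<Longrightarrow> norm x \<le> R" using compact_imp_bounded[OF K] by (auto simp: bounded_iff)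
  obtain ls :: "'n list" where ls: "set ls = UNIV" "distinct ls" using finite_distinct_list[of "UNIV :: 'n set"] by auto
  define ks :: "'n list" where "ks = (SOME ks. distinct ks \<and> set ks = UNIV)"
  have "distinct ks \<and> set ks = UNIV" unfolding ks_def by (rule someI[of _ ls]) (use ls in simp)
  then have len: "length ks \<le> CARD('n)" using distinct_card[of ks] by simp
  have "\<bar>pairing \<psi>\<bar> \<le> (N * loc_const \<alpha> TYPE('n) R * measure lborel (cball (0::real^'n) R)) * Ck_norm CARD('n) \<psi>"
    if \<psi>: "\<psi> \<in> test_functions" and sub: "{x. \<psi> x \<noteq> 0} \<subseteq> K" for \<psi>
  proof -
    have "\<bar>mixed_deriv \<psi> x\<bar> \<le> Ck_norm CARD('n) \<psi>" for x
      unfolding mixed_deriv_def ks_def[symmetric] by (rule partial_derivs_le_Ck_norm[OF \<psi> len])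
    from pairing_bound_smooth[OF \<psi> _ this, of R] show ?thesis using R sub by (auto simp: mult_ac)
  qed
  then show ?thesis by blast
qed

lemma pairing_rescale_bound:
  assumes \<phi>: "\<phi> \<in> unit_test_functions" and \<rho>: "0 < \<rho>" "\<rho> \<le> 1"
  shows "\<bar>pairing (rescale \<rho> x \<phi>)\<bar> \<le> N * pairing_const \<alpha> TYPE('n) * \<rho> powr (\<alpha> - 1)"
proof -
  let ?d = "real CARD('n)" and ?\<psi> = "rescale \<rho> x \<phi>"
  \<comment> \<open>With d h = \<rho> the shifts allowed in \<open>pairing_avg\<close> have length
    at most \<rho>, so the rescaled function and its shifts vanish off the ball of radius 2 \<rho>;
    moreover d h \<le> 1, as the cube bounds require.\<close>
  define h where "h = \<rho> / ?d"
  define W where "W = cball x (2 * \<rho>)"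
  note t = rescale_test_function[OF \<phi> \<rho>(1)]
  have d1: "1 \<le> ?d" by (simp add: Suc_leI)
  have h: "0 < h" "?d * h = \<rho>" "h \<le> \<rho>" using \<rho> d1 by (auto simp: h_def divide_le_eq)
  have h1: "?d * h \<le> 1" using h \<rho> by simp
  have Wb: "W \<in> sets borel" "emeasure lborel W < \<infinity>"
    using emeasure_bounded_finite[OF bounded_cball[of x "2 * \<rho>"]] by (auto simp: W_def)
  have "(2 * (2 * \<rho>)) ^ CARD('n) = (4 * \<rho>) ^ CARD('n)" by simp
  also have "\<dots> = 4 ^ CARD('n) * \<rho> ^ CARD('n)" by (rule power_mult_distrib)
  finally have Wm: "measure lborel W \<le> 4 ^ CARD('n) * \<rho> ^ CARD('n)"
    using measure_cball_le[of "2 * \<rho>" x] \<rho> Wb(1) by (simp add: W_def)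
  have sc: "0 \<le> N * sewing_const \<alpha> TYPE('n)" "0 \<le> N * cell_const TYPE('n)"
    using N sewing_const_nonneg[OF \<alpha>(1), where 'n='n] cell_const_nonneg[where 'n='n] by auto
  have "?\<psi> (y + u) = ?\<psi> y" if y: "y \<notin> W" and u: "norm u \<le> ?d * h" for y u
  proof -
    have "2 * \<rho> < norm (y - x)" using y by (simp add: W_def dist_norm norm_minus_commute)
    moreover have "norm (y - x) \<le> norm (y + u - x) + norm u" using norm_triangle_ineq4[of "y + u - x" u] by simp
    ultimately have "\<rho> < norm (y - x)" "\<rho> < norm (y + u - x)" using u h(2) \<rho>(1) by linarith+
    then show ?thesis using t(4) by metis
  qed
  then have "\<bar>pairing ?\<psi> - avg h ?\<psi>\<bar> \<le> N * sewing_const \<alpha> TYPE('n) * (1 / (\<rho> * \<rho> ^ CARD('n))) * measure lborel W * h powr \<alpha>"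
    using \<rho> by (intro pairing_avg t(1) h(1) h1 t(3) Wb) auto
  also have "\<dots> \<le> N * sewing_const \<alpha> TYPE('n) * (1 / (\<rho> * \<rho> ^ CARD('n))) * (4 ^ CARD('n) * \<rho> ^ CARD('n)) * \<rho> powr \<alpha>"
  proof (intro mult_mono mult_left_mono powr_mono2 mult_nonneg_nonneg)
  qed (use N sewing_const_nonneg[OF \<alpha>(1), where 'n='n] \<rho> h \<alpha> Wm in auto)
  also have "\<dots> = N * sewing_const \<alpha> TYPE('n) * 4 ^ CARD('n) * (\<rho> powr \<alpha> / \<rho>)" using \<rho> by simp
  also have "\<rho> powr \<alpha> / \<rho> = \<rho> powr (\<alpha> - 1)" using \<rho> by (simp add: powr_diff)
  finally have 1: "\<bar>pairing ?\<psi> - avg h ?\<psi>\<bar> \<le> N * sewing_const \<alpha> TYPE('n) * 4 ^ CARD('n) * \<rho> powr (\<alpha> - 1)" .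
  have "\<bar>LINT y|lborel. extend B (cube y h) * ?\<psi> y\<bar>
      \<le> N * cell_const TYPE('n) * h ^ CARD('n) * h powr (\<alpha> - 1) * (1 / \<rho> ^ CARD('n)) * measure lborel W"
  proof (rule avg_bound[OF h(1) h1 _ Wb t(2)])
    show "?\<psi> \<in> borel_measurable borel" using test_function_comp_bounded[OF t(1)] by (simp add: comp_bounded_def)
    show "?\<psi> y = 0" if "y \<notin> W" for y
      using that \<rho> by (intro t(4)) (simp add: W_def dist_norm norm_minus_commute)
  qed
  also have "\<dots> \<le> N * cell_const TYPE('n) * h ^ CARD('n) * (\<rho> powr (\<alpha> - 1) * ?d) * (1 / \<rho> ^ CARD('n)) * (4 ^ CARD('n) * \<rho> ^ CARD('n))"
  proof (intro mult_mono mult_left_mono mult_right_mono)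
    have "h powr (\<alpha> - 1) = \<rho> powr (\<alpha> - 1) * (1 / ?d powr (\<alpha> - 1))" by (simp add: h_def powr_divide)
    also have "1 / ?d powr (\<alpha> - 1) = ?d powr (1 - \<alpha>)" using powr_minus_divide[of ?d "\<alpha> - 1"] by simp
    also have "\<rho> powr (\<alpha> - 1) * ?d powr (1 - \<alpha>) \<le> \<rho> powr (\<alpha> - 1) * ?d powr 1"
      using d1 \<alpha> by (intro mult_left_mono powr_mono) auto
    finally show "h powr (\<alpha> - 1) \<le> \<rho> powr (\<alpha> - 1) * ?d" by simp
  qed (use N cell_const_nonneg[where 'n='n] h \<rho> Wm in auto)
  also have "\<dots> = h ^ CARD('n) * (N * cell_const TYPE('n) * ?d * 4 ^ CARD('n) * \<rho> powr (\<alpha> - 1))" using \<rho> by simp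
  finally have "\<bar>avg h ?\<psi>\<bar> \<le> N * cell_const TYPE('n) * ?d * 4 ^ CARD('n) * \<rho> powr (\<alpha> - 1)"
    using h(1) by (simp add: avg_def abs_divide divide_le_eq mult.commute)
  with 1 have "\<bar>pairing ?\<psi>\<bar> \<le> N * sewing_const \<alpha> TYPE('n) * 4 ^ CARD('n) * \<rho> powr (\<alpha> - 1) + N * cell_const TYPE('n) * ?d * 4 ^ CARD('n) * \<rho> powr (\<alpha> - 1)"
    by linarith
  also have "\<dots> = N * pairing_const \<alpha> TYPE('n) * \<rho> powr (\<alpha> - 1)" by (simp add: pairing_const_def algebra_simps)
  finally show ?thesis .
qed

end

lemma Omega_norm_test:
  fixes A :: "'n::finite osimplex \<Rightarrow> real"
  assumes A: "A \<in> Omega_alpha \<alpha>" and \<sigma>: "\<sigma> \<in> small_osimplices"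
  shows "\<bar>A \<sigma>\<bar> \<le> enn2real (Omega_norm \<alpha> A) * mass \<alpha> \<sigma>"
proof -
  obtain v where v: "aff_indep_tuple v" "\<sigma> = osimplex_of v" using \<sigma> by (auto simp: small_osimplices_def elim: osimplicesE)
  have m: "0 < mass \<alpha> \<sigma>" unfolding v(2) by (rule mass_pos[OF v(1)])
  have fin: "Omega_norm \<alpha> A < \<infinity>" using A by (simp add: Omega_alpha_def)
  have "ennreal (\<bar>A \<sigma>\<bar> / mass \<alpha> \<sigma>) \<le> Omega_norm \<alpha> A" unfolding Omega_norm_def by (rule SUP_upper[OF \<sigma>])
  then have "\<bar>A \<sigma>\<bar> / mass \<alpha> \<sigma> \<le> enn2real (Omega_norm \<alpha> A)"
    using m fin enn2real_mono[of "ennreal (\<bar>A \<sigma>\<bar> / mass \<alpha> \<sigma>)" "Omega_norm \<alpha> A"] by simp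
  then show ?thesis using m by (simp add: divide_le_eq)
qed

lemma Omega_alpha_charge:
  fixes A :: "'n::finite osimplex \<Rightarrow> real"
  assumes A: "A \<in> Omega_alpha \<alpha>" and \<alpha>: "0 < \<alpha>" "\<alpha> < 1"
  shows "holder_charge (charge A) \<alpha> (enn2real (Omega_norm \<alpha> A) * facet_constant TYPE('n))"
proof
  have O: "A \<in> Omega" using A by (simp add: Omega_alpha_def)
  show "simplex_additive (charge A)" "measurable_charge (charge A)" by (rule charge_additive[OF O], rule charge_measurable[OF O])
  show "0 \<le> enn2real (Omega_norm \<alpha> A) * facet_constant TYPE('n)" using facet_constant_pos[where 'n='n] by simp
  fix S :: "(real^'n) set" assume S: "S \<in> full_simplices" "diameter S \<le> 1"
  note o = oriented[OF S(1), of 1, simplified]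
  obtain v where v: "aff_indep_tuple v" "oriented 1 S = osimplex_of v" using o(1) by (rule osimplicesE)
  have Sv: "convex hull (range (($) v)) = S" using o(2) unfolding v(2) body_osimplex_of .
  have "\<bar>charge A S\<bar> \<le> enn2real (Omega_norm \<alpha> A) * mass \<alpha> (oriented 1 S)"
    unfolding charge_def using o S(2) by (intro Omega_norm_test[OF A]) (simp add: small_osimplices_def)
  also have "\<dots> \<le> enn2real (Omega_norm \<alpha> A) * (facet_constant TYPE('n) * diameter S ^ CARD('n) * diameter S powr (\<alpha> - 1))"
    using mass_le[OF v(1) \<alpha>(1)] unfolding v(2) Sv by (intro mult_left_mono) auto
  finally show "\<bar>charge A S\<bar> \<le> enn2real (Omega_norm \<alpha> A) * facet_constant TYPE('n) * diameter S ^ CARD('n) * diameter S powr (\<alpha> - 1)"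
    by (simp add: mult.assoc)
qed (rule \<alpha>)+

lemma pi_map_pairing:
  assumes "A \<in> Omega" "\<psi> \<in> test_functions" "holder_charge (charge A) \<alpha> N"
  shows "pi_map A \<psi> = holder_charge.pairing (charge A) \<psi>"
  unfolding pi_map_def holder_charge.pairing_def[OF assms(3)] box_value_eq[OF assms(1)] using assms(2) by simp

lemma pi_map_bounded:
  fixes A :: "'n::finite osimplex \<Rightarrow> real"
  assumes A: "A \<in> Omega_alpha \<alpha>" and \<alpha>: "0 < \<alpha>" "\<alpha> < 1"
  shows "pi_map A \<in> holder_space (\<alpha> - 1)"
    "holder_norm (\<alpha> - 1) (pi_map A) \<le> ennreal (facet_constant TYPE('n) * pairing_const \<alpha> TYPE('n)) * Omega_norm \<alpha> A"
proof -
  let ?N = "enn2real (Omega_norm \<alpha> A)" and ?C = "facet_constant TYPE('n) * pairing_const \<alpha> TYPE('n)"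
  have O: "A \<in> Omega" and fin: "Omega_norm \<alpha> A < \<infinity>" using A by (simp_all add: Omega_alpha_def)
  interpret holder_charge "charge A" \<alpha> "?N * facet_constant TYPE('n)" by (rule Omega_alpha_charge[OF assms])
  have pi: "pi_map A \<psi> = pairing \<psi>" if "\<psi> \<in> test_functions" for \<psi>
    by (rule pi_map_pairing[OF O that Omega_alpha_charge[OF assms]])
  have "pi_map A \<in> distributions"
    unfolding distributions_def
  proof (intro CollectI conjI allI ballI impI)
    show "pi_map A \<psi> = 0" if "\<psi> \<notin> test_functions" for \<psi> using that by (simp add: pi_map_def)
    show "pi_map A (\<lambda>x. a * \<psi> x + b * \<phi> x) = a * pi_map A \<psi> + b * pi_map A \<phi>"
      if "\<psi> \<in> test_functions" "\<phi> \<in> test_functions" for \<psi> \<phi> a b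
      using that by (simp add: pi test_function_lincomb pairing_lincomb)
    fix K :: "(real^'n) set" assume "compact K"
    from pairing_continuous[OF this] show "\<exists>C N. \<forall>\<psi>\<in>test_functions. {x. \<psi> x \<noteq> 0} \<subseteq> K \<longrightarrow> \<bar>pi_map A \<psi>\<bar> \<le> C * Ck_norm N \<psi>"
      by (simp add: pi)
  qed
  moreover show b: "holder_norm (\<alpha> - 1) (pi_map A) \<le> ennreal ?C * Omega_norm \<alpha> A"
    unfolding holder_norm_def
  proof (rule SUP_least, clarify)
    fix x :: "real^'n" and \<rho> :: real and \<phi> :: "real^'n \<Rightarrow> real"
    assume \<rho>: "\<rho> \<in> {0<..1}" and \<phi>: "\<phi> \<in> unit_test_functions"
    have C: "0 \<le> ?C"
      using facet_constant_pos[where 'n='n] sewing_const_nonneg[OF \<alpha>(1), where 'n='n] cell_const_nonneg[where 'n='n] by (simp add: pairing_const_def)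
    have p: "\<rho> powr (- (\<alpha> - 1)) * \<rho> powr (\<alpha> - 1) = 1" using \<rho> by (simp add: powr_add[symmetric])
    have "\<rho> powr (- (\<alpha> - 1)) * \<bar>pi_map A (rescale \<rho> x \<phi>)\<bar>
        \<le> \<rho> powr (- (\<alpha> - 1)) * (?N * facet_constant TYPE('n) * pairing_const \<alpha> TYPE('n) * \<rho> powr (\<alpha> - 1))"
      using \<rho> rescale_test_function(1)[OF \<phi>, of \<rho> x] by (intro mult_left_mono) (simp_all add: pi pairing_rescale_bound[OF \<phi>])
    also have "\<dots> = ?C * ?N * (\<rho> powr (- (\<alpha> - 1)) * \<rho> powr (\<alpha> - 1))" by (simp only: mult_ac)
    finally have "ennreal (\<rho> powr (- (\<alpha> - 1)) * \<bar>pi_map A (rescale \<rho> x \<phi>)\<bar>) \<le> ennreal (?C * ?N)"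
      unfolding p by (simp add: ennreal_leI)
    also have "\<dots> = ennreal ?C * ennreal ?N" using C by (simp add: ennreal_mult)
    also have "ennreal ?N = Omega_norm \<alpha> A" using fin by simp
    finally show "ennreal (\<rho> powr (- (\<alpha> - 1)) * \<bar>pi_map A (rescale \<rho> x \<phi>)\<bar>) \<le> ennreal ?C * Omega_norm \<alpha> A" .
  qed
  ultimately show "pi_map A \<in> holder_space (\<alpha> - 1)"
    using fin by (auto simp: holder_space_def ennreal_mult_less_top intro: le_less_trans)
qed

text \<open>The subdivision selected in \<open>box_value\<close> depends on the box alone, so box
  values are linear in the function term by term. The finite norms are needed for integrability,
  without which the integral would not split.\<close>

lemma pi_map_lincomb:
  fixes A B :: "'n::finite osimplex \<Rightarrow> real"
  assumes A: "A \<in> Omega_alpha \<alpha>" and B: "B \<in> Omega_alpha \<alpha>" and \<alpha>: "0 < \<alpha>" "\<alpha> < 1"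
  shows "pi_map (\<lambda>\<sigma>. a * A \<sigma> + b * B \<sigma>) = (\<lambda>\<psi>. a * pi_map A \<psi> + b * pi_map B \<psi>)"
proof
  fix \<psi> :: "real^'n \<Rightarrow> real"
  show "pi_map (\<lambda>\<sigma>. a * A \<sigma> + b * B \<sigma>) \<psi> = a * pi_map A \<psi> + b * pi_map B \<psi>"
  proof (cases "\<psi> \<in> test_functions")
    case True
    have i: "integrable lborel (\<lambda>v. box_value D v * mixed_deriv \<psi> v)" if D: "D \<in> Omega_alpha \<alpha>" for D
    proof -
      interpret holder_charge "charge D" \<alpha> "enn2real (Omega_norm \<alpha> D) * facet_constant TYPE('n)" by (rule Omega_alpha_charge[OF D \<alpha>])
      have "box_value D = signed_box (charge D) 0" using D by (intro ext box_value_eq) (simp add: Omega_alpha_def)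
      then show ?thesis unfolding mixed_deriv_def
        using integrable_loc_comp[OF signed_box_loc_bounded test_function_comp_bounded[OF test_function_partial_derivs[OF True]]] by simp
    qed
    have "box_value (\<lambda>\<sigma>. a * A \<sigma> + b * B \<sigma>) v = a * box_value A v + b * box_value B v" for v :: "real^'n"
      by (simp add: box_value_def sum.distrib sum_distrib_left distrib_left mult_ac)
    then have "(LINT v|lborel. box_value (\<lambda>\<sigma>. a * A \<sigma> + b * B \<sigma>) v * mixed_deriv \<psi> v)
        = (LINT v|lborel. a * (box_value A v * mixed_deriv \<psi> v) + b * (box_value B v * mixed_deriv \<psi> v))"
      by (simp add: algebra_simps)
    also have "\<dots> = a * (LINT v|lborel. box_value A v * mixed_deriv \<psi> v) + b * (LINT v|lborel. box_value B v * mixed_deriv \<psi> v)"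
      using i[OF A] i[OF B] by simp
    finally show ?thesis using True by (simp add: pi_map_def algebra_simps)
  qed (simp add: pi_map_def)
qed

section \<open>Injectivity by testing with smoothed indicators\<close>

subsection \<open>Recovering a charge from its distribution\<close>

text \<open>The smoothing reaches 2 d r and the shifts allowed in the averaging estimate add d r;
  the width 4 d r leaves some slack.\<close>

definition collar :: "'n::finite vertex_tuple \<Rightarrow> real \<Rightarrow> (real^'n) set" where
  "collar v r = layer v (4 * real CARD('n) * r / height (osimplex_of v))"

definition collar_const :: "'n::finite vertex_tuple \<Rightarrow> real" where
  "collar_const v = layer_const (4 * real CARD('n)) TYPE('n) * (4 * real CARD('n) / height (osimplex_of v))
     * measure lebesgue (convex hull (range (($) v)))"

lemma collar_measure:
  fixes v :: "'n::finite vertex_tuple"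
  assumes ai: "aff_indep_tuple v" and r: "0 < r" "r \<le> height (osimplex_of v)"
  shows "collar v r \<in> sets borel" "emeasure lborel (collar v r) < \<infinity>" "collar v r \<in> lmeasurable"
    "measure lebesgue (collar v r) \<le> collar_const v * r"
proof -
  let ?d = "real CARD('n)" and ?h = "height (osimplex_of v)"
  have h: "0 < ?h" by (rule height_pos[OF ai])
  have s: "0 < 4 * ?d * r / ?h" using r h by simp
  have "4 * ?d * r \<le> 4 * ?d * ?h" using r by (intro mult_left_mono) auto
  then have s4: "4 * ?d * r / ?h \<le> 4 * ?d" using h by (simp add: divide_le_eq)
  show b: "collar v r \<in> sets borel"
    unfolding collar_def layer_def by (intro sets.Diff borel_closed closed_inset)
  show l: "collar v r \<in> lmeasurable" unfolding collar_def by (rule layer_measure(1)[OF ai s s4])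
  show "emeasure lborel (collar v r) < \<infinity>" using fmeasurableD2[OF l] b by (simp add: less_top)
  show "measure lebesgue (collar v r) \<le> collar_const v * r"
    using layer_measure(2)[OF ai s s4] by (simp add: collar_def collar_const_def mult_ac)
qed

lemma mem_collar:
  fixes v :: "'n::finite vertex_tuple"
  assumes ai: "aff_indep_tuple v" and r: "0 < r"
    and p: "p \<in> convex hull (range (($) v))" "norm (p - x) \<le> 4 * real CARD('n) * r"
    and q: "q \<notin> convex hull (range (($) v))" "norm (q - x) \<le> 4 * real CARD('n) * r"
  shows "x \<in> collar v r"
proof -
  have "0 < 4 * real CARD('n) * r" using r by simp
  then show ?thesis unfolding collar_def by (rule mem_layer[OF ai _ p q])
qed

lemma soft_outside_collar:
  fixes v :: "'n::finite vertex_tuple"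
  assumes ai: "aff_indep_tuple v" and r: "0 < r" and x: "x \<notin> collar v r" and y: "norm y \<le> real CARD('n) * r"
  defines "S \<equiv> convex hull (range (($) v))"
  shows "soft r S (x + y) = indicat_real S x"
proof -
  let ?d = "real CARD('n)"
  have S: "bounded S" unfolding S_def by (rule full_simplex_bounded[OF full_simplicesI[OF ai]])
  have dr: "0 < ?d * r" using r by simp
  have eq1: "soft r S (x + y) = indicat_real S (x + y)"
  proof (rule ccontr)
    assume "soft r S (x + y) \<noteq> indicat_real S (x + y)"
    then obtain p q where p: "p \<in> S" "q \<notin> S" "norm (p - (x + y)) \<le> 2 * ?d * r" "norm (q - (x + y)) \<le> 2 * ?d * r"
      by (rule soft_intermediate[OF r S])
    have "norm (p - x) \<le> norm (p - (x + y)) + norm y" "norm (q - x) \<le> norm (q - (x + y)) + norm y"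
      using norm_triangle_ineq[of "p - (x + y)" y] norm_triangle_ineq[of "q - (x + y)" y] by (auto simp: algebra_simps)
    then have "norm (p - x) \<le> 4 * ?d * r" "norm (q - x) \<le> 4 * ?d * r" using p(3,4) y dr by linarith+
    then have "x \<in> collar v r" by (rule mem_collar[OF ai r p(1)[unfolded S_def] _ p(2)[unfolded S_def]])
    then show False using x by simp
  qed
  have n0: "norm (x - x) \<le> 4 * ?d * r" using r by simp
  have ny: "norm (x + y - x) \<le> 4 * ?d * r" using y dr by simp
  have "x \<in> S \<longleftrightarrow> x + y \<in> S"
  proof (rule ccontr)
    assume "\<not> ?thesis"
    then consider "x \<in> S" "x + y \<notin> S" | "x + y \<in> S" "x \<notin> S" by blast
    then have "x \<in> collar v r"
    proof cases
      case 1
      then show ?thesis unfolding S_def by (intro mem_collar[OF ai r _ n0 _ ny])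
    next
      case 2
      then show ?thesis unfolding S_def by (intro mem_collar[OF ai r _ ny _ n0])
    qed
    then show False using x by simp
  qed
  then show ?thesis unfolding eq1 by (simp add: indicator_def)
qed

text \<open>Unfolding over the lattice: the integral over space becomes an integral over the offset
  t in one fundamental cell of sums over the translated lattice. An average over positions of a cube
  is thereby exchanged for an average over grids, each of which tiles space.\<close>

lemma integral_cells:
  fixes f :: "real^'n::finite \<Rightarrow> real"
  assumes r: "0 < r" and f: "integrable lborel f" and Z: "finite Z" "\<And>x z. x \<in> cell r 0 z \<Longrightarrow> f x \<noteq> 0 \<Longrightarrow> z \<in> Z"
  shows "integrable lborel (\<lambda>t. indicat_real (cell r 0 (\<lambda>_. 0)) t * (\<Sum>z\<in>Z. f (corner r t z)))"
    "(LINT x|lborel. f x) = (LINT t|lborel. indicat_real (cell r 0 (\<lambda>_. 0)) t * (\<Sum>z\<in>Z. f (corner r t z)))"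
proof -
  have cs: "cell r 0 z \<in> sets lborel" for z :: "'n \<Rightarrow> int" by (simp add: cell_sets_borel[OF r])
  have i: "integrable lborel (\<lambda>x. indicat_real (cell r 0 z) x * f x)" for z
    using integrable_real_mult_indicator[OF cs f, of z] by (simp add: mult.commute)
  have tr: "corner r t z = t + corner r 0 z" for t z by (simp add: vec_eq_iff)
  have ind: "indicat_real (cell r 0 z) (t + corner r 0 z) = indicat_real (cell r 0 (\<lambda>_. 0)) t" for t z
    by (simp add: indicator_def mem_cell_iff[OF r])
  have sh: "integrable lborel (\<lambda>t. indicat_real (cell r 0 (\<lambda>_. 0)) t * f (corner r t z))"
    "(LINT x|lborel. indicat_real (cell r 0 z) x * f x) = (LINT t|lborel. indicat_real (cell r 0 (\<lambda>_. 0)) t * f (corner r t z))" for z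
  proof -
    have "(\<lambda>x. indicat_real (cell r 0 z) x * f x) \<in> borel_measurable borel"
      using borel_measurable_integrable[OF i[of z]] by simp
    from integral_translate[OF this, of "corner r 0 z"]
    show "(LINT x|lborel. indicat_real (cell r 0 z) x * f x) = (LINT t|lborel. indicat_real (cell r 0 (\<lambda>_. 0)) t * f (corner r t z))"
      unfolding tr[symmetric] ind[folded tr] by simp
    have "integrable (distr lborel borel ((+) (corner r 0 z))) (\<lambda>x. indicat_real (cell r 0 z) x * f x)"
      using i[of z] by (simp add: lborel_distr_plus)
    then have "integrable lborel (\<lambda>x. indicat_real (cell r 0 z) (corner r 0 z + x) * f (corner r 0 z + x))"
      by (subst (asm) integrable_distr_eq) (use borel_measurable_integrable[OF i[of z]] in simp_all)
    then show "integrable lborel (\<lambda>t. indicat_real (cell r 0 (\<lambda>_. 0)) t * f (corner r t z))"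
      unfolding add.commute[of "corner r 0 z"] tr[symmetric] ind[folded tr] .
  qed
  show "integrable lborel (\<lambda>t. indicat_real (cell r 0 (\<lambda>_. 0)) t * (\<Sum>z\<in>Z. f (corner r t z)))"
    unfolding sum_distrib_left by (intro Bochner_Integration.integrable_sum sh)
  have "f x = (\<Sum>z\<in>Z. indicat_real (cell r 0 z) x * f x)" for x
  proof (cases "f x = 0")
    case False
    have m: "x \<in> cell r 0 (index r 0 x)" by (simp add: mem_cell_index)
    have "(\<Sum>z\<in>Z. indicat_real (cell r 0 z) x * f x) = (\<Sum>z\<in>{index r 0 x}. indicat_real (cell r 0 z) x * f x)"
      using Z(1) Z(2)[OF m False] by (intro sum.mono_neutral_right) (auto simp: mem_cell_index indicator_def)
    then show ?thesis using m by simp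
  qed simp
  then have "(LINT x|lborel. f x) = (LINT x|lborel. (\<Sum>z\<in>Z. indicat_real (cell r 0 z) x * f x))" by presburger
  also have "\<dots> = (\<Sum>z\<in>Z. LINT x|lborel. indicat_real (cell r 0 z) x * f x)" by (rule Bochner_Integration.integral_sum) (rule i)
  also have "\<dots> = (LINT t|lborel. (\<Sum>z\<in>Z. indicat_real (cell r 0 (\<lambda>_. 0)) t * f (corner r t z)))"
    unfolding sh(2) by (rule Bochner_Integration.integral_sum[symmetric]) (rule sh(1))
  finally show "(LINT x|lborel. f x) = (LINT t|lborel. indicat_real (cell r 0 (\<lambda>_. 0)) t * (\<Sum>z\<in>Z. f (corner r t z)))"
    by (simp add: sum_distrib_left)
qed

context holder_charge
begin

text \<open>Averaging over all translates of the grid of width \<open>r\<close>: for each translate, the cubes inside the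
  simplex contribute their exact charge, so that only the cubes near the boundary produce an error.\<close>

lemma avg_indicator:
  fixes v :: "'n vertex_tuple"
  assumes ai: "aff_indep_tuple v" and r: "0 < r" "real CARD('n) * r \<le> 1" "r \<le> height (osimplex_of v)"
  defines "S \<equiv> convex hull (range (($) v))"
  shows "\<bar>avg r (indicat_real S) - B S\<bar> \<le> 2 * (N * cell_const TYPE('n)) * collar_const v * r powr \<alpha>"
proof -
  let ?d = "real CARD('n)" and ?c = "N * cell_const TYPE('n) * r ^ CARD('n) * r powr (\<alpha> - 1)" and ?Q = "cell r 0 (\<lambda>_::'n. 0)"
  have Sf: "S \<in> full_simplices" unfolding S_def by (rule full_simplicesI[OF ai])
  have Sb: "S \<in> sets borel" "bounded S" using full_simplex_borel[OF Sf] full_simplex_bounded[OF Sf] by auto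
  obtain R where R: "\<And>x. x \<in> S \<Longrightarrow> norm x \<le> R" using Sb(2) by (auto simp: bounded_iff)
  define Z where "Z = meets r (cball (0::real^'n) (R + 1))"
  have Z: "finite Z" unfolding Z_def by (rule finite_meets[OF r(1) bounded_cball])
  have c0: "0 \<le> ?c" using N cell_const_nonneg[where 'n='n] r(1) by simp
  note cb = cube_bound[OF r(1,2)]
  define f where "f x = indicat_real S x * extend B (cube x r)" for x
  have fm: "f \<in> borel_measurable borel" unfolding f_def[abs_def] using cube_measurable[OF r(1)] Sb by simp
  have fi: "integrable lborel f"
    by (rule integrable_supported(1)[OF fm Sb(1) emeasure_bounded_finite[OF Sb(2)], of ?c]) (use cb(1) in \<open>simp_all add: f_def\<close>)
  have in0: "corner r t z \<in> cell r 0 z" if "t \<in> ?Q" for t z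
    using that unfolding mem_cell_iff[OF r(1)] by simp
  have fZ: "z \<in> Z" if "x \<in> cell r 0 z" "f x \<noteq> 0" for x z
  proof -
    have "x \<in> S" using that(2) by (simp add: f_def indicator_def split: if_splits)
    then have "x \<in> cball 0 (R + 1)" using R by fastforce
    then show ?thesis using that(1) unfolding Z_def meets_def by blast
  qed
  have cellZ: "z \<in> Z" if t: "t \<in> ?Q" and y: "y \<in> cell r t z" "y \<in> S" for t z y
  proof -
    have "norm (corner r t z - y) \<le> ?d * r"
      using cell_cube(1)[OF r(1), of t z] y(1) r(1) by (intro cube_dist[of r _ "corner r t z"]) (auto simp: mem_cube)
    then have "norm (corner r t z) \<le> R + 1"
      using R[OF y(2)] norm_triangle_ineq[of "corner r t z - y" y] r(2) by simp
    then show ?thesis using in0[OF t, of z] unfolding Z_def meets_def by fastforce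
  qed
  have pt: "\<bar>(\<Sum>z\<in>Z. f (corner r t z)) - B S\<bar> \<le> 2 * (N * cell_const TYPE('n)) * collar_const v * r powr \<alpha>" if t: "t \<in> ?Q" for t
  proof -
    \<comment> \<open>The whole cube counts when its lower corner lies in S, against the exact
      charge of the part inside S. The two agree for cubes contained in S and for cubes missing
      S.\<close>
    define E where "E z = f (corner r t z) - extend B (S \<inter> cube (corner r t z) r)" for z
    define Y where "Y = {z\<in>Z. E z \<noteq> 0}"
    have "B S = extend B S" by (rule extend_simplex[OF additive Sf, symmetric])
    also have "\<dots> = (\<Sum>z\<in>Z. extend B (S \<inter> cube (corner r t z) r))"
      by (rule extend_cells[OF additive r(1) polyhedral_full_simplex[OF Sf] Z]) (use cellZ[OF t] in blast)
    finally have "(\<Sum>z\<in>Z. f (corner r t z)) - B S = sum E Z" by (simp add: E_def sum_subtractf)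
    moreover have "sum E Z = sum E Y" using Z by (intro sum.mono_neutral_right) (auto simp: Y_def)
    ultimately have "\<bar>(\<Sum>z\<in>Z. f (corner r t z)) - B S\<bar> \<le> (\<Sum>z\<in>Y. \<bar>E z\<bar>)" by simp
    also have "\<dots> \<le> real (card Y) * (2 * ?c)"
    proof (rule sum_bounded_above)
      fix z
      have "\<bar>f (corner r t z)\<bar> \<le> ?c" using cb(1)[of "corner r t z"] c0 by (simp add: f_def indicator_def)
      then show "\<bar>E z\<bar> \<le> 2 * ?c" using cb(2)[OF Sf, of "corner r t z"] unfolding E_def by linarith
    qed
    also have "\<dots> = (real (card Y) * r ^ CARD('n)) * (2 * (N * cell_const TYPE('n)) * r powr (\<alpha> - 1))" by simp
    also have "\<dots> \<le> (collar_const v * r) * (2 * (N * cell_const TYPE('n)) * r powr (\<alpha> - 1))"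
    proof (rule mult_right_mono)
      have "real (card Y) * r ^ CARD('n) \<le> measure lebesgue (collar v r)"
      proof (rule card_cells_le[OF r(1) _ collar_measure(3)[OF ai r(1,3)]])
        show "finite Y" using Z by (simp add: Y_def)
        fix z assume z: "z \<in> Y"
        let ?K = "cube (corner r t z) r"
        have ck: "corner r t z \<in> ?K" using r(1) by (simp add: mem_cube)
        have "\<not> ?K \<subseteq> S"
        proof
          assume K: "?K \<subseteq> S"
          then have "S \<inter> ?K = ?K" by blast
          moreover have "corner r t z \<in> S" using K ck by blast
          ultimately have "E z = 0" by (simp add: E_def f_def)
          then show False using z by (simp add: Y_def)
        qed
        moreover have "?K \<inter> S \<noteq> {}"
        proof
          assume K: "?K \<inter> S = {}"
          then have "S \<inter> ?K = {}" "corner r t z \<notin> S" using ck by blast+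
          then have "E z = 0" using extend_negligible[OF additive negligible_empty] by (simp add: E_def f_def)
          then show False using z by (simp add: Y_def)
        qed
        ultimately obtain p q where pq: "p \<in> ?K" "p \<in> S" "q \<in> ?K" "q \<notin> S" by blast
        show "cell r t z \<subseteq> collar v r"
        proof
          fix y assume "y \<in> cell r t z"
          then have y: "y \<in> ?K" using cell_cube(1)[OF r(1)] by blast
          have "?d * r \<le> 4 * ?d * r" using r(1) by simp
          then have "norm (p - y) \<le> 4 * ?d * r" "norm (q - y) \<le> 4 * ?d * r"
            using cube_dist[OF r(1) pq(1) y] cube_dist[OF r(1) pq(3) y] by linarith+
          then show "y \<in> collar v r" by (rule mem_collar[OF ai r(1) pq(2)[unfolded S_def] _ pq(4)[unfolded S_def]])
        qed
      qed
      then show "real (card Y) * r ^ CARD('n) \<le> collar_const v * r" using collar_measure(4)[OF ai r(1,3)] by linarith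
    qed (use N cell_const_nonneg[where 'n='n] in simp)
    also have "\<dots> = 2 * (N * cell_const TYPE('n)) * collar_const v * (r * r powr (\<alpha> - 1))" by simp
    also have "r * r powr (\<alpha> - 1) = r powr \<alpha>" by (subst powr_mult_base) (use r in auto)
    finally show ?thesis .
  qed
  have Qs: "?Q \<in> sets borel" by (rule cell_sets_borel[OF r(1)])
  have Qm: "emeasure lborel ?Q < \<infinity>" "measure lborel ?Q = r ^ CARD('n)"
    using fmeasurableD2[OF cell_lmeasurable[OF r(1), of 0 "\<lambda>_::'n. 0"]] cell_measure[OF r(1), of 0 "\<lambda>_::'n. 0"] Qs by (simp_all add: less_top)
  have i2: "integrable lborel (\<lambda>t. indicat_real ?Q t * B S)"
    using Qs Qm by (intro integrable_mult_left integrable_real_indicator) auto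
  note ic = integral_cells[OF r(1) fi Z fZ]
  define g where "g t = indicat_real ?Q t * (\<Sum>z\<in>Z. f (corner r t z)) - indicat_real ?Q t * B S" for t
  have gi: "integrable lborel g" unfolding g_def[abs_def] by (intro Bochner_Integration.integrable_diff ic(1) i2)
  have "(LINT x|lborel. f x) - r ^ CARD('n) * B S = (LINT t|lborel. g t)"
    unfolding g_def[abs_def] using ic i2 Qm Qs by simp
  moreover have "\<bar>LINT t|lborel. g t\<bar> \<le> 2 * (N * cell_const TYPE('n)) * collar_const v * r powr \<alpha> * measure lborel ?Q"
  proof (rule integrable_supported(2)[OF _ Qs Qm(1)])
    show "g \<in> borel_measurable borel" using borel_measurable_integrable[OF gi] by simp
  qed (use pt in \<open>simp_all add: g_def\<close>)
  moreover have "avg r (indicat_real S) * r ^ CARD('n) = (LINT x|lborel. f x)"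
    using r(1) by (simp add: avg_def f_def[abs_def] mult.commute)
  ultimately have "\<bar>(avg r (indicat_real S) - B S) * r ^ CARD('n)\<bar> \<le> 2 * (N * cell_const TYPE('n)) * collar_const v * r powr \<alpha> * r ^ CARD('n)"
    by (simp add: Qm(2) algebra_simps)
  then show ?thesis using r(1) by (simp add: abs_mult)
qed

text \<open>Three comparisons are added: the pairing with the average of the smoothed indicator,
  that average with the one of the true indicator, and the latter with the charge. In each the
  collar has volume of order r, which compensates the Lipschitz constant of order 1 / r in the first
  and raises r^(\<alpha> - 1) to r^\<alpha> in the other two. The constant may depend on the
  simplex, as only convergence for a fixed simplex is wanted.\<close>

lemma pairing_soft:
  fixes v :: "'n vertex_tuple"
  assumes ai: "aff_indep_tuple v"
  defines "S \<equiv> convex hull (range (($) v))"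
  shows "\<exists>C. \<forall>r. 0 < r \<longrightarrow> real CARD('n) * r \<le> 1 \<longrightarrow> r \<le> height (osimplex_of v) \<longrightarrow> \<bar>pairing (soft r S) - B S\<bar> \<le> C * r powr \<alpha>"
proof -
  let ?d = "real CARD('n)" and ?O = "overlap TYPE('n)" and ?H = "hat_constant TYPE('n)" and ?c = "N * cell_const TYPE('n)"
  have Sf: "S \<in> full_simplices" unfolding S_def by (rule full_simplicesI[OF ai])
  have Sb: "S \<in> sets borel" "bounded S" using full_simplex_borel[OF Sf] full_simplex_bounded[OF Sf] by auto
  have O: "1 \<le> ?O" and H: "1 \<le> ?H" by (rule overlap_ge_1, rule hat_constant)
  have sc: "0 \<le> N * sewing_const \<alpha> TYPE('n)" "0 \<le> ?c"
    using N sewing_const_nonneg[OF \<alpha>(1), where 'n='n] cell_const_nonneg[where 'n='n] by auto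
  let ?C1 = "N * sewing_const \<alpha> TYPE('n) * (?d * (?O * ?H)) * collar_const v"
  let ?C2 = "?c * (?O + 1) * collar_const v"
  let ?C3 = "2 * ?c * collar_const v"
  have "\<bar>pairing (soft r S) - B S\<bar> \<le> (?C1 + ?C2 + ?C3) * r powr \<alpha>"
    if r: "0 < r" "?d * r \<le> 1" "r \<le> height (osimplex_of v)" for r
  proof -
    note cm = collar_measure[OF ai r(1,3)]
    have out: "soft r S (x + y) = indicat_real S x" if "x \<notin> collar v r" "norm y \<le> ?d * r" for x y
      unfolding S_def by (rule soft_outside_collar[OF ai r(1) that])
    have out0: "soft r S x = indicat_real S x" if "x \<notin> collar v r" for x using out[OF that, of 0] r(1) by simp
    have cml: "measure lborel (collar v r) \<le> collar_const v * r" using cm(1,4) by simp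
    have pw: "r * r powr (\<alpha> - 1) = r powr \<alpha>" by (subst powr_mult_base) (use r in auto)
    have st: "soft r S \<in> test_functions" by (rule soft_test_function[OF r(1) Sb(2)])
    have sm: "soft r S \<in> borel_measurable borel" using test_function_comp_bounded[OF st] by (simp add: comp_bounded_def)
    have im: "indicat_real S \<in> borel_measurable borel" using Sb by simp
    note smooth_Lipschitz[OF test_function_smooth[OF st] soft_bounds(2)[OF r(1) Sb]]
    then have lip: "\<bar>soft r S x - soft r S y\<bar> \<le> (?d * (?O * ?H) / r) * norm (x - y)" for x y by simp
    have "\<bar>pairing (soft r S) - avg r (soft r S)\<bar> \<le> N * sewing_const \<alpha> TYPE('n) * (?d * (?O * ?H) / r) * measure lborel (collar v r) * r powr \<alpha>"
    proof (rule pairing_avg[OF st r(1,2) lip _ cm(1,2)])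
      show "0 \<le> ?d * (?O * ?H) / r" using O H r(1) by simp
      show "soft r S (x + y) = soft r S x" if "x \<notin> collar v r" "norm y \<le> ?d * r" for x y
        using out[OF that] out0[OF that(1)] by simp
    qed
    also have "\<dots> \<le> N * sewing_const \<alpha> TYPE('n) * (?d * (?O * ?H) / r) * (collar_const v * r) * r powr \<alpha>"
      using sc O H r(1) by (intro mult_right_mono mult_left_mono cml) auto
    also have "\<dots> = ?C1 * r powr \<alpha>" using r(1) by simp
    finally have 1: "\<bar>pairing (soft r S) - avg r (soft r S)\<bar> \<le> ?C1 * r powr \<alpha>" .
    have i1: "integrable lborel (\<lambda>x. extend B (cube x r) * soft r S x)"
      by (rule integrable_loc_comp[OF cube_loc_bounded[OF r(1)] test_function_comp_bounded[OF st]])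
    have "comp_bounded (indicat_real S)"
      unfolding comp_bounded_def
    proof (intro conjI im)
      show "\<exists>M. \<forall>x. \<bar>indicat_real S x\<bar> \<le> M" by (auto intro!: exI[of _ 1] simp: indicator_def)
      show "\<exists>R. \<forall>x. indicat_real S x \<noteq> 0 \<longrightarrow> norm x \<le> R" using Sb(2) by (auto simp: bounded_iff indicator_def)
    qed
    then have i2: "integrable lborel (\<lambda>x. extend B (cube x r) * indicat_real S x)"
      by (rule integrable_loc_comp[OF cube_loc_bounded[OF r(1)]])
    define g where "g x = soft r S x - indicat_real S x" for x
    have "(LINT x|lborel. extend B (cube x r) * soft r S x) - (LINT x|lborel. extend B (cube x r) * indicat_real S x)
        = (LINT x|lborel. extend B (cube x r) * g x)"
      unfolding g_def right_diff_distrib by (rule Bochner_Integration.integral_diff[OF i1 i2, symmetric])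
    moreover have "\<bar>LINT x|lborel. extend B (cube x r) * g x\<bar> \<le> ?c * r ^ CARD('n) * r powr (\<alpha> - 1) * (?O + 1) * measure lborel (collar v r)"
    proof (rule avg_bound[OF r(1,2) _ cm(1,2)])
      show "g \<in> borel_measurable borel" unfolding g_def[abs_def] using sm im by simp
      show "\<bar>g x\<bar> \<le> ?O + 1" for x
      proof -
        have "\<bar>indicat_real S x\<bar> \<le> 1" by (simp add: indicator_def)
        then show ?thesis using soft_bounds(1)[OF r(1) Sb, of x] abs_triangle_ineq4[of "soft r S x" "indicat_real S x"] unfolding g_def by linarith
      qed
      show "g x = 0" if "x \<notin> collar v r" for x using out0[OF that] by (simp add: g_def)
    qed
    moreover have "?c * r ^ CARD('n) * r powr (\<alpha> - 1) * (?O + 1) * measure lborel (collar v r) \<le> ?c * r ^ CARD('n) * r powr (\<alpha> - 1) * (?O + 1) * (collar_const v * r)"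
      using sc O r(1) by (intro mult_left_mono cml) auto
    moreover have "?c * r ^ CARD('n) * r powr (\<alpha> - 1) * (?O + 1) * (collar_const v * r) = (?C2 * (r * r powr (\<alpha> - 1))) * r ^ CARD('n)" by simp
    ultimately have "\<bar>(avg r (soft r S) - avg r (indicat_real S)) * r ^ CARD('n)\<bar> \<le> (?C2 * r powr \<alpha>) * r ^ CARD('n)"
      unfolding pw using r(1) by (simp add: avg_def left_diff_distrib)
    then have 2: "\<bar>avg r (soft r S) - avg r (indicat_real S)\<bar> \<le> ?C2 * r powr \<alpha>" using r(1) by (simp add: abs_mult)
    have 3: "\<bar>avg r (indicat_real S) - B S\<bar> \<le> ?C3 * r powr \<alpha>" unfolding S_def by (rule avg_indicator[OF ai r])
    have "\<bar>pairing (soft r S) - B S\<bar> \<le> ?C1 * r powr \<alpha> + ?C2 * r powr \<alpha> + ?C3 * r powr \<alpha>" using 1 2 3 by linarith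
    then show ?thesis by (simp only: distrib_right)
  qed
  then show ?thesis by blast
qed

lemma pairing_soft_tendsto:
  assumes S: "S \<in> full_simplices"
  shows "(\<lambda>k. pairing (soft (scale_seq TYPE('n) k) S)) \<longlonglongrightarrow> B S"
proof -
  let ?r = "scale_seq TYPE('n)"
  obtain v where v: "aff_indep_tuple v" "S = convex hull (range (($) v))" using S by (auto simp: full_simplices_def)
  obtain C where C: "\<And>r. 0 < r \<Longrightarrow> real CARD('n) * r \<le> 1 \<Longrightarrow> r \<le> height (osimplex_of v) \<Longrightarrow> \<bar>pairing (soft r S) - B S\<bar> \<le> C * r powr \<alpha>"
    using pairing_soft[OF v(1)] unfolding v(2) by blast
  have "\<forall>\<^sub>F k in sequentially. ?r k < height (osimplex_of v)" by (rule order_tendstoD(2)[OF scale_seq(4) height_pos[OF v(1)]])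
  then have ev: "\<forall>\<^sub>F k in sequentially. norm (pairing (soft (?r k) S) - B S) \<le> C * (?r k) powr \<alpha>"
  proof eventually_elim
    case (elim k)
    have "real CARD('n) * ?r k \<le> 1" using scale_seq(2)[where 'n='n and k=k] scale_seq(1)[where 'n='n and k=k] by simp
    then show ?case using C[OF scale_seq(1)[where 'n='n and k=k]] elim by simp
  qed
  have "(\<lambda>k. (?r k) powr \<alpha>) \<longlonglongrightarrow> 0"
    by (rule tendsto_zero_powrI[OF scale_seq(4) tendsto_const]) (use \<alpha> scale_seq(1)[where 'n='n] in \<open>auto intro!: always_eventually less_imp_le\<close>)
  then have "(\<lambda>k. C * (?r k) powr \<alpha>) \<longlonglongrightarrow> 0" using tendsto_mult_right_zero by blast
  from Lim_null_comparison[OF ev this] show ?thesis by (simp add: LIM_zero_iff)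
qed

end

lemma pi_map_inj:
  fixes A B :: "'n::finite osimplex \<Rightarrow> real"
  assumes A: "A \<in> Omega_alpha \<alpha>" and B: "B \<in> Omega_alpha \<alpha>" and \<alpha>: "0 < \<alpha>" "\<alpha> < 1" and eq: "pi_map A = pi_map B"
  shows "A = B"
proof
  fix \<sigma>
  have O: "A \<in> Omega" "B \<in> Omega" using A B by (simp_all add: Omega_alpha_def)
  interpret A: holder_charge "charge A" \<alpha> "enn2real (Omega_norm \<alpha> A) * facet_constant TYPE('n)" by (rule Omega_alpha_charge[OF A \<alpha>])
  interpret B: holder_charge "charge B" \<alpha> "enn2real (Omega_norm \<alpha> B) * facet_constant TYPE('n)" by (rule Omega_alpha_charge[OF B \<alpha>])
  show "A \<sigma> = B \<sigma>"
  proof (cases "\<sigma> \<in> osimplices")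
    case True
    have S: "body \<sigma> \<in> full_simplices" by (rule body_full_simplex[OF True])
    have t: "soft (scale_seq TYPE('n) k) (body \<sigma>) \<in> test_functions" for k
      by (rule soft_test_function[OF scale_seq(1) full_simplex_bounded[OF S]])
    have "A.pairing (soft (scale_seq TYPE('n) k) (body \<sigma>)) = B.pairing (soft (scale_seq TYPE('n) k) (body \<sigma>))" for k
      unfolding pi_map_pairing[OF O(1) t A.holder_charge_axioms, symmetric] pi_map_pairing[OF O(2) t B.holder_charge_axioms, symmetric] eq ..
    then have "charge A (body \<sigma>) = charge B (body \<sigma>)"
      using A.pairing_soft_tendsto[OF S] B.pairing_soft_tendsto[OF S] LIMSEQ_unique by simp
    then show ?thesis using charge_body[OF O(1) True] charge_body[OF O(2) True] by simp
  qed (use O in \<open>simp add: Omega_def\<close>)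
qed

section \<open>The inverse map and its norm\<close>

lemma ennreal_hnorm:
  assumes "F \<in> holder_space (\<alpha> - 1)" shows "ennreal (hnorm \<alpha> F) = holder_norm (\<alpha> - 1) F"
  using assms by (simp add: hnorm_def holder_space_def)

context holder_distribution
begin

text \<open>The norm bound uses the estimate by the mass directly. The diameter bound recorded in
  \<open>holder_charge\<close> would be too weak, since thin simplices have a mass far below that
  bound.\<close>

lemma of_charge_limit:
  defines "A \<equiv> of_charge limit_charge"
  shows "Omega_norm \<alpha> A \<le> ennreal (total_const * prism_constant TYPE('n)) * holder_norm (\<alpha> - 1) F"
    "A \<in> Omega_alpha \<alpha>" "pi_map A = F"
proof -
  interpret holder_charge limit_charge \<alpha> "charge_const * hnorm \<alpha> F" by (rule holder_charge_limit)
  have C: "0 \<le> total_const * prism_constant TYPE('n)"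
    using total_const_nonneg prism_constant_pos[where 'n='n] by simp
  show b: "Omega_norm \<alpha> A \<le> ennreal (total_const * prism_constant TYPE('n)) * holder_norm (\<alpha> - 1) F"
    unfolding Omega_norm_def
  proof (rule SUP_least)
    fix \<sigma> :: "'n osimplex" assume \<sigma>: "\<sigma> \<in> small_osimplices"
    then have o: "\<sigma> \<in> osimplices" by (simp add: small_osimplices_def)
    then obtain v where v: "aff_indep_tuple v" "\<sigma> = osimplex_of v" by (rule osimplicesE)
    have D: "diameter (convex hull (range (($) v))) \<le> 1" using \<sigma> by (simp add: small_osimplices_def v(2) body_osimplex_of)
    have m: "0 < mass \<alpha> \<sigma>" unfolding v(2) by (rule mass_pos[OF v(1)])
    have "\<bar>A \<sigma>\<bar> = \<bar>limit_charge (body \<sigma>)\<bar>"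
      using o orientation_sign_cases[OF o] by (auto simp: A_def of_charge_def abs_mult)
    also have "\<dots> \<le> total_const * hnorm \<alpha> F * (prism_constant TYPE('n) * mass \<alpha> \<sigma>)"
      unfolding v(2) body_osimplex_of by (rule mass_to_diameter(1)[OF v(1) limit_charge_bound[OF v(1) D]])
    finally have "\<bar>A \<sigma>\<bar> / mass \<alpha> \<sigma> \<le> (total_const * prism_constant TYPE('n)) * hnorm \<alpha> F"
      using m by (simp add: divide_le_eq mult_ac)
    then have "ennreal (\<bar>A \<sigma>\<bar> / mass \<alpha> \<sigma>) \<le> ennreal ((total_const * prism_constant TYPE('n)) * hnorm \<alpha> F)"
      by (rule ennreal_leI)
    also have "\<dots> = ennreal (total_const * prism_constant TYPE('n)) * holder_norm (\<alpha> - 1) F"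
      unfolding ennreal_mult[OF C hnorm_nonneg] ennreal_hnorm[OF F] ..
    finally show "ennreal (\<bar>A \<sigma>\<bar> / mass \<alpha> \<sigma>) \<le> ennreal (total_const * prism_constant TYPE('n)) * holder_norm (\<alpha> - 1) F" .
  qed
  have O: "A \<in> Omega" unfolding A_def by (rule of_charge_Omega[OF additive measurable])
  have "holder_norm (\<alpha> - 1) F < \<infinity>" using F by (simp add: holder_space_def)
  then show A: "A \<in> Omega_alpha \<alpha>"
    using O le_less_trans[OF b] by (simp add: Omega_alpha_def ennreal_mult_less_top)
  show "pi_map A = F"
  proof
    fix \<psi> :: "real^'n \<Rightarrow> real"
    show "pi_map A \<psi> = F \<psi>"
    proof (cases "\<psi> \<in> test_functions")
      case True
      have t: "tiles (SOME \<T>. tiles \<T> (cbox a b)) (cbox a b)" for a b :: "real^'n"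
        using polyhedral_cbox[of a b] unfolding polyhedral_def by (rule someI_ex)
      \<comment> \<open>Off the full simplices the two set functions may differ, but
        \<open>extend\<close> evaluates them only on the simplices of its chosen tiling, which is
        the same for both.\<close>
      have "charge A T = limit_charge T" if "T \<in> full_simplices" for T
        unfolding A_def by (rule charge_of_charge[OF that])
      then have "extend (charge A) (cbox a b) = extend limit_charge (cbox a b)" for a b :: "real^'n"
        unfolding extend_def by (intro sum.cong refl) (blast intro: tiles_full[OF t])
      then have "box_value A v = signed_box limit_charge 0 v" for v :: "real^'n"
        unfolding box_value_eq[OF O] signed_box_def by simp
      then have "pi_map A \<psi> = pairing \<psi>" using True by (simp add: pi_map_def pairing_def)
      then show ?thesis using pairing_limit_charge[OF True] by simp
    next
      case False
      then show ?thesis using FD by (simp add: pi_map_def distributions_def)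
    qed
  qed
qed

end

theorem proposition6p3:
  fixes \<alpha> :: real
    and X :: "('n::finite osimplex \<Rightarrow> real) set"
    and Y :: "((real^'n \<Rightarrow> real) \<Rightarrow> real) set"
  assumes "0 < \<alpha>" and "\<alpha> < 1"
    and X: "X = Omega_alpha \<alpha>"
    and Y: "Y = holder_space (\<alpha> - 1)"
  shows "(\<forall>A\<in>X. pi_map A \<in> Y)
    \<and> (\<forall>A\<in>X. \<forall>B\<in>X. \<forall>a b.
          pi_map (\<lambda>\<sigma>. a * A \<sigma> + b * B \<sigma>) = (\<lambda>\<psi>. a * pi_map A \<psi> + b * pi_map B \<psi>))
    \<and> (\<exists>C::real. \<forall>A\<in>X. holder_norm (\<alpha> - 1) (pi_map A) \<le> ennreal C * Omega_norm \<alpha> A)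
    \<and> inj_on pi_map X
    \<and> pi_map ` X = Y
    \<and> (\<exists>C::real. \<forall>F\<in>Y. Omega_norm \<alpha> (inv_into X pi_map F) \<le> ennreal C * holder_norm (\<alpha> - 1) F)"
proof -
  note \<alpha> = assms(1,2)
  have into: "\<forall>A\<in>X. pi_map A \<in> Y" unfolding X Y using pi_map_bounded(1)[OF _ \<alpha>] by blast
  have lin: "\<forall>A\<in>X. \<forall>B\<in>X. \<forall>a b. pi_map (\<lambda>\<sigma>. a * A \<sigma> + b * B \<sigma>) = (\<lambda>\<psi>. a * pi_map A \<psi> + b * pi_map B \<psi>)"
    unfolding X using pi_map_lincomb[OF _ _ \<alpha>] by blast
  have bdd: "\<exists>C::real. \<forall>A\<in>X. holder_norm (\<alpha> - 1) (pi_map A) \<le> ennreal C * Omega_norm \<alpha> A"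
    unfolding X using pi_map_bounded(2)[OF _ \<alpha>] by blast
  have inj: "inj_on pi_map X" unfolding X using pi_map_inj[OF _ _ \<alpha>] by (intro inj_onI)
  have hd: "holder_distribution F \<alpha>" if "F \<in> Y" for F :: "(real^'n \<Rightarrow> real) \<Rightarrow> real"
    using that \<alpha> unfolding Y by unfold_locales
  define G where "G F = of_charge (holder_distribution.limit_charge F)" for F :: "(real^'n \<Rightarrow> real) \<Rightarrow> real"
  have G: "G F \<in> X" "pi_map (G F) = F" if "F \<in> Y" for F
    using holder_distribution.of_charge_limit(2,3)[OF hd[OF that]] unfolding G_def X by auto
  have surj: "pi_map ` X = Y" using into G by (metis (no_types, lifting) image_eqI image_subsetI subsetI subset_antisym)
  \<comment> \<open>By injectivity the abstract inverse coincides with the explicit preimage, so the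
    bound for the constructed charge is a bound for the inverse.\<close>
  have inv: "inv_into X pi_map F = G F" if "F \<in> Y" for F
    using inv_into_f_f[OF inj G(1)[OF that]] G(2)[OF that] by simp
  \<comment> \<open>The constant depends on the dimension and \<alpha> only, hence is the same for
    all F.\<close>
  have Fs: "Omega_norm \<alpha> (inv_into X pi_map F) \<le> ennreal (holder_distribution.total_const TYPE('n) \<alpha> * prism_constant TYPE('n)) * holder_norm (\<alpha> - 1) F"
    if "F \<in> Y" for F
    using holder_distribution.of_charge_limit(1)[OF hd[OF that]] unfolding inv[OF that] G_def .
  show ?thesis using into lin bdd inj surj Fs by blast
qed

end
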